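(* Let $q=2^r$, let $D=DC_i^{\epsilon}(n,q)$ be one of the double cosets ($n$ in its range of definition), $N=|D|$, $\{C_{i,j}^\epsilon(n,q)\}_{j=0}^{N}$ the weight distribution of the binary code $C(D)$, and assume $q\ge4$ when $i\in\{2,4\}$. Identify $\epsilon\in\{+,-\}$ with $\epsilon1\in\{1,-1\}$ and write $A=A_i^\epsilon(n,q)$, $B=B_i^\epsilon(n,q)$. In each formula the sum is over all families of nonnegative integers $\{\nu_\beta\}_{\beta\in\mathbb{F}_q}$ with $\sum_\beta\nu_\beta=j$ and $\sum_\beta\nu_\beta\beta=0$. (a) For $i=1,3$ and $0\le j\le N$: $$C_{i,j}^\epsilon(n,q)=\sum\binom{q^{-1}A(B+\epsilon1)}{\nu_0}\prod_{\beta\neq0,\ tr(\beta^{-1})=0}\binom{q^{-1}A(B+\epsilon(q+1))}{\nu_\beta}\prod_{\beta\ne0,\ tr(\beta^{-1})=1}\binom{q^{-1}A(B+\epsilon(-q+1))}{\nu_\beta}.$$ (b) For $i=2$ and $0\le j\le N$: $$C_{2,j}^\epsilon(n,q)=\sum\binom{q^{-1}A(B+\epsilon(q+1-q^2))}{\nu_0}\prod_{\substack{\tau\in\mathbb{Z},\ |\tau|<2\sqrt q\\ \tau\equiv-1\,(\mathrm{mod}\,4)}}\prod_{\beta\in\mathbb{F}_q^*:\ K(\lambda;\beta^{-1})=\tau}\binom{q^{-1}A(B+\epsilon(q+1-q\tau))}{\nu_\beta}.$$ (c) For $i=4$ and $0\le j\le N$: $$C_{4,j}^\epsilon(n,q)=\sum\binom{q^{-1}A(B+\epsilon(q^2+1-q^3))}{\nu_0}\prod_{\substack{\tau\in\mathbb{Z},\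 |\tau|<2\sqrt q\\ \tau\equiv-1\,(\mathrm{mod}\,4)}}\prod_{\beta\in\mathbb{F}_q^*:\ K(\lambda;\beta^{-1})=\tau}\binom{q^{-1}A(B+\epsilon(q^2+1-q\tau))}{\nu_\beta}.$$
   Context: $q=2^r$, $tr(x)=x+x^2+\cdots+x^{2^{r-1}}$, $\lambda(x)=(-1)^{tr(x)}$, $K(\lambda;a)=\sum_{\alpha\in\mathbb{F}_q^*}\lambda(\alpha+a\alpha^{-1})$. $\binom ba=0$ if $a>b$ or $a<0$. $\mathrm{Tr}$ matrix trace, ${}^tX$ transpose, alternating = symmetric with zero diagonal, $\left[\substack{m\\ s}\right]_q=\prod_{j=0}^{s-1}(q^{m-j}-1)/(q^{s-j}-1)$, empty products 1. Fix $\kappa\in\mathbb{F}_q$ with $z^2+z+\kappa$ irreducible. For $n\ge1$, $O^-(2n,q)$ is the group of $g\in GL(2n,q)$ preserving $\theta^-(x)=\sum_{i=1}^{n-1}x_ix_{n-1+i}+x_{2n-1}^2+x_{2n-1}x_{2n}+\kappa x_{2n}^2$. $\delta=\begin{pmatrix}1&1\\0&\kappa\end{pmatrix}$, $\eta=\begin{pmatrix}0&1\\1&0\end{pmatrix}$, $SO^-(2,q)=\{\begin{pmatrix}d_1&\kappa d_2\\ d_2&d_1+d_2\end{pmatrix}:d_1^2+d_1d_2+\kappa d_2^2=1\}$. $Q=Q^-(2n,q)$ is the group of all products (blocks $n-1,n-1,2$) $\begin{pmatrix}A&0&0\\0&{}^tA^{-1}&0\\0&0&i\end{pmatrix}\begin{pmatrix}1_{n-1}&B&{}^th\,{}^ti\,\eta\,i\\0&1_{n-1}&0\\0&h&1_2\end{pmatrix}$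 with $A\in GL(n-1,q)$, $i\in SO^-(2,q)$, ${}^tB+{}^th\delta h$ alternating. $\rho=\mathrm{diag}(1_{2n-2},\begin{pmatrix}1&1\\0&1\end{pmatrix})$. $\sigma_s$ interchanges $e^j,e^{n-1+j}$ for $1\le j\le s$. $DC_1^+=Q\sigma_{n-1}Q$, $DC_2^+=Q\sigma_{n-2}Q$, $DC_3^+=\rho Q\sigma_{n-2}Q$ ($n=2,4,\dots$); $DC_4^+=\rho Q\sigma_{n-3}Q$ ($n=4,6,\dots$); $DC_1^-=Q\sigma_{n-1}Q$ ($n=1,3,\dots$); $DC_2^-=Q\sigma_{n-2}Q$, $DC_3^-=\rho Q\sigma_{n-2}Q$, $DC_4^-=\rho Q\sigma_{n-3}Q$ ($n=3,5,\dots$). Constants (arguments $(n,q)$): $A_1^+=q^{(5n^2-2n-4)/4}(q^{n-1}-1)\prod_{j=1}^{(n-2)/2}(q^{2j-1}-1)$, $B_1^+=(q+1)q^{n^2/4}\prod_{j=1}^{(n-2)/2}(q^{2j}-1)$; $A_2^+=q^{(5n^2-2n-8)/4}\left[\substack{n-1\\1}\right]_q\prod_{j=1}^{(n-2)/2}(q^{2j-1}-1)$, $B_2^+=(q+1)q^{(n-2)^2/4}(q^{n-1}-1)\prod_{j=1}^{(n-2)/2}(q^{2j}-1)$; $A_3^+=(q+1)A_2^+$, $B_3^+=q^{(n-2)^2/4}(q^{n-1}-1)\prod_{j=1}^{(n-2)/2}(q^{2j}-1)$; $A_4^+=(q+1)q^{(5n^2-6n-4)/4}\left[\substack{n-1\\2}\right]_q\prod_{j=1}^{(n-2)/2}(q^{2j-1}-1)$,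 $B_4^+=B_3^+$; $A_1^-=q^{5(n^2-1)/4}\prod_{j=1}^{(n-1)/2}(q^{2j-1}-1)$, $B_1^-=(q+1)q^{(n-1)^2/4}\prod_{j=1}^{(n-1)/2}(q^{2j}-1)$; $A_2^-=q^{(5n^2-4n-5)/4}\left[\substack{n-1\\1}\right]_q\prod_{j=1}^{(n-1)/2}(q^{2j-1}-1)$, $B_2^-=B_1^-$; $A_3^-=(q+1)A_2^-$, $B_3^-=q^{(n-1)^2/4}\prod_{j=1}^{(n-1)/2}(q^{2j}-1)$; $A_4^-=(q+1)q^{(5n^2-4n-9)/4}\left[\substack{n-1\\2}\right]_q\prod_{j=1}^{(n-3)/2}(q^{2j-1}-1)$, $B_4^-=q^{(n-3)^2/4}(q^{n-2}-1)(q^{n-1}-1)\prod_{j=1}^{(n-3)/2}(q^{2j}-1)$. Code: with $D$ ordered as $g_1,\dots,g_N$, $C(D)=\{u\in\mathbb{F}_2^N:\sum_k u_k\mathrm{Tr}(g_k)=0\text{ in }\mathbb{F}_q\}$; $C_{i,j}^\epsilon(n,q)$ is the number of codewords of Hamming weight $j$. *)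

theory Defs
  imports
    Complex_Main
    "HOL-Library.Z2"
    "HOL-Library.Cardinality"
    "HOL-Number_Theory.Cong"
    "HOL-Computational_Algebra.Polynomial_Factorial"
    "Jordan_Normal_Form.Matrix"
begin

text \<open>Throughout, the field with \<open>q = 2 ^ r\<close> elements is a type \<open>'a :: {field, finite}\<close>
  with \<open>CARD('a) = 2 ^ r\<close>.\<close>

definition field_tr :: "nat \<Rightarrow> 'a::field \<Rightarrow> 'a" where
  "field_tr r x = (\<Sum>i<r. x ^ (2 ^ i))"

text \<open>\<open>field_tr r x\<close> lies in the prime field \<open>{0, 1}\<close>, so this is \<open>(-1)\<close> to the power of the
  trace.\<close>

definition add_char :: "nat \<Rightarrow> 'a::field \<Rightarrow> int" where
  "add_char r x = (if field_tr r x = 0 then 1 else -1)"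

definition kloosterman :: "nat \<Rightarrow> 'a::{field,finite} \<Rightarrow> int" where
  "kloosterman r a = (\<Sum>\<alpha>\<in>UNIV - {0}. add_char r (\<alpha> + a * inverse \<alpha>))"

text \<open>The upper argument is a real number because it is given by a quotient; it is a
  nonnegative integer wherever it is used.\<close>

definition binom :: "real \<Rightarrow> nat \<Rightarrow> real" where
  "binom b a = (if real a > b then 0 else b gchoose a)"

definition q_binomial :: "real \<Rightarrow> nat \<Rightarrow> nat \<Rightarrow> real" where
  "q_binomial q m s = (\<Prod>j<s. (q ^ (m - j) - 1) / (q ^ (s - j) - 1))"

definition mat_trace :: "'a::comm_monoid_add mat \<Rightarrow> 'a" where
  "mat_trace X = (\<Sum>k<dim_row X. X $$ (k, k))"

definition alternating_mat :: "'a::zero mat \<Rightarrow> bool" where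
  "alternating_mat X \<longleftrightarrow>
     square_mat X \<and> transpose_mat X = X \<and> (\<forall>k<dim_row X. X $$ (k, k) = 0)"

definition append_cols :: "'a::zero mat \<Rightarrow> 'a mat \<Rightarrow> 'a mat" where
  "append_cols X Y = four_block_mat X Y (0\<^sub>m 0 (dim_col X)) (0\<^sub>m 0 (dim_col Y))"

definition delta_mat :: "'a::field \<Rightarrow> 'a mat" where
  "delta_mat \<kappa> = mat_of_rows_list 2 [[1, 1], [0, \<kappa>]]"

definition eta_mat :: "'a::field mat" where
  "eta_mat = mat_of_rows_list 2 [[0, 1], [1, 0]]"

definition SO2_minus :: "'a::field \<Rightarrow> 'a mat set" where
  "SO2_minus \<kappa> = {mat_of_rows_list 2 [[d1, \<kappa> * d2], [d2, d1 + d2]] | d1 d2.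
     d1\<^sup>2 + d1 * d2 + \<kappa> * d2\<^sup>2 = 1}"

definition Q_unipotent :: "nat \<Rightarrow> 'a::field mat \<Rightarrow> 'a mat \<Rightarrow> 'a mat \<Rightarrow> 'a mat" where
  "Q_unipotent n w B h =
     four_block_mat
       (four_block_mat (1\<^sub>m (n - 1)) B (0\<^sub>m (n - 1) (n - 1)) (1\<^sub>m (n - 1)))
       ((transpose_mat h * transpose_mat w * eta_mat * w) @\<^sub>r 0\<^sub>m (n - 1) 2)
       (append_cols (0\<^sub>m 2 (n - 1)) h)
       (1\<^sub>m 2)"

text \<open>\<open>A'\<close> is the inverse of \<open>A\<close>, and \<open>w\<close> is the element of \<open>SO\<^sup>-(2, q)\<close>.\<close>

definition Q_minus :: "'a::field \<Rightarrow> nat \<Rightarrow> 'a mat set" where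
  "Q_minus \<kappa> n =
     {diag_block_mat [A, transpose_mat A', w] * Q_unipotent n w B h | A A' w B h.
        A \<in> carrier_mat (n - 1) (n - 1) \<and> A' \<in> carrier_mat (n - 1) (n - 1) \<and>
        inverts_mat A A' \<and> inverts_mat A' A \<and>
        w \<in> SO2_minus \<kappa> \<and>
        B \<in> carrier_mat (n - 1) (n - 1) \<and> h \<in> carrier_mat 2 (n - 1) \<and>
        alternating_mat (transpose_mat B + transpose_mat h * delta_mat \<kappa> * h)}"

definition rho_mat :: "nat \<Rightarrow> 'a::field mat" where
  "rho_mat n = diag_block_mat [1\<^sub>m (2 * n - 2), mat_of_rows_list 2 [[1, 1], [0, 1]]]"

definition sigma_mat :: "nat \<Rightarrow> nat \<Rightarrow> 'a::field mat" where
  "sigma_mat n s = mat (2 * n) (2 * n) (\<lambda>(i, j).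
     if i = (if j < s then n - 1 + j
             else if n - 1 \<le> j \<and> j < n - 1 + s then j - (n - 1)
             else j)
     then 1 else 0)"

definition double_coset :: "'a::field \<Rightarrow> nat \<Rightarrow> nat \<Rightarrow> 'a mat set" where
  "double_coset \<kappa> n s = {x * sigma_mat n s * y | x y. x \<in> Q_minus \<kappa> n \<and> y \<in> Q_minus \<kappa> n}"

text \<open>The sign \<open>\<epsilon>\<close> of \<open>DC\<^sub>i\<^sup>\<epsilon>(n, q)\<close> only records the parity of \<open>n\<close>; the set itself is given by the
  same expression for both signs.\<close>

definition DC :: "nat \<Rightarrow> 'a::field \<Rightarrow> nat \<Rightarrow> 'a mat set" where
  "DC i \<kappa> n =
     (if i = 1 then double_coset \<kappa> n (n - 1)
      else if i = 2 then double_coset \<kappa> n (n - 2)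
      else if i = 3 then (\<lambda>x. rho_mat n * x) ` double_coset \<kappa> n (n - 2)
      else (\<lambda>x. rho_mat n * x) ` double_coset \<kappa> n (n - 3))"

definition DC_range :: "int \<Rightarrow> nat \<Rightarrow> nat \<Rightarrow> bool" where
  "DC_range \<epsilon> i n \<longleftrightarrow> i \<in> {1, 2, 3, 4} \<and>
     (\<epsilon> = 1 \<and> even n \<and> n \<ge> (if i = 4 then 4 else 2) \<or>
      \<epsilon> = -1 \<and> odd n \<and> n \<ge> (if i = 1 then 1 else 3))"

text \<open>For \<open>i\<close>, \<open>n\<close> satisfying \<open>DC_range\<close>, no subtraction in the exponents and bounds of the
  selected branch truncates, and every division there is exact.\<close>

definition A_plus :: "nat \<Rightarrow> nat \<Rightarrow> real \<Rightarrow> real" where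
  "A_plus i n q =
     (let P = (\<Prod>j=1..(n - 2) div 2. q ^ (2 * j - 1) - 1);
          A2 = q ^ ((5 * n\<^sup>2 - 2 * n - 8) div 4) * q_binomial q (n - 1) 1 * P
      in if i = 1 then q ^ ((5 * n\<^sup>2 - 2 * n - 4) div 4) * (q ^ (n - 1) - 1) * P
         else if i = 2 then A2
         else if i = 3 then (q + 1) * A2
         else (q + 1) * q ^ ((5 * n\<^sup>2 - 6 * n - 4) div 4) * q_binomial q (n - 1) 2 * P)"

definition B_plus :: "nat \<Rightarrow> nat \<Rightarrow> real \<Rightarrow> real" where
  "B_plus i n q =
     (let P = (\<Prod>j=1..(n - 2) div 2. q ^ (2 * j) - 1)
      in if i = 1 then (q + 1) * q ^ (n\<^sup>2 div 4) * P
         else if i = 2 then (q + 1) * q ^ ((n - 2)\<^sup>2 div 4) * (q ^ (n - 1) - 1) * P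
         else q ^ ((n - 2)\<^sup>2 div 4) * (q ^ (n - 1) - 1) * P)"

definition A_minus :: "nat \<Rightarrow> nat \<Rightarrow> real \<Rightarrow> real" where
  "A_minus i n q =
     (let P = (\<Prod>j=1..(n - 1) div 2. q ^ (2 * j - 1) - 1);
          A2 = q ^ ((5 * n\<^sup>2 - 4 * n - 5) div 4) * q_binomial q (n - 1) 1 * P
      in if i = 1 then q ^ (5 * (n\<^sup>2 - 1) div 4) * P
         else if i = 2 then A2
         else if i = 3 then (q + 1) * A2
         else (q + 1) * q ^ ((5 * n\<^sup>2 - 4 * n - 9) div 4) * q_binomial q (n - 1) 2 *
           (\<Prod>j=1..(n - 3) div 2. q ^ (2 * j - 1) - 1))"

definition B_minus :: "nat \<Rightarrow> nat \<Rightarrow> real \<Rightarrow> real" where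
  "B_minus i n q =
     (let P = (\<Prod>j=1..(n - 1) div 2. q ^ (2 * j) - 1)
      in if i = 1 \<or> i = 2 then (q + 1) * q ^ ((n - 1)\<^sup>2 div 4) * P
         else if i = 3 then q ^ ((n - 1)\<^sup>2 div 4) * P
         else q ^ ((n - 3)\<^sup>2 div 4) * (q ^ (n - 2) - 1) * (q ^ (n - 1) - 1) *
           (\<Prod>j=1..(n - 3) div 2. q ^ (2 * j) - 1))"

definition coef_A :: "int \<Rightarrow> nat \<Rightarrow> nat \<Rightarrow> real \<Rightarrow> real" where
  "coef_A \<epsilon> i n q = (if \<epsilon> = 1 then A_plus i n q else A_minus i n q)"

definition coef_B :: "int \<Rightarrow> nat \<Rightarrow> nat \<Rightarrow> real \<Rightarrow> real" where
  "coef_B \<epsilon> i n q = (if \<epsilon> = 1 then B_plus i n q else B_minus i n q)"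

definition trace_code :: "'a::field mat list \<Rightarrow> bit vec set" where
  "trace_code gs = {u \<in> carrier_vec (length gs).
     (\<Sum>k<length gs. if u $ k = 1 then mat_trace (gs ! k) else 0) = 0}"

definition hamming_weight :: "bit vec \<Rightarrow> nat" where
  "hamming_weight u = card {k. k < dim_vec u \<and> u $ k \<noteq> 0}"

definition weight_count :: "'a::field mat list \<Rightarrow> nat \<Rightarrow> nat" where
  "weight_count gs j = card {u \<in> trace_code gs. hamming_weight u = j}"

definition families :: "nat \<Rightarrow> ('a::{field,finite} \<Rightarrow> nat) set" where
  "families j = {\<nu>. (\<Sum>\<beta>\<in>UNIV. \<nu> \<beta>) = j \<and> (\<Sum>\<beta>\<in>UNIV. of_nat (\<nu> \<beta>) * \<beta>) = 0}"

definition tau_range :: "nat \<Rightarrow> int set" where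
  "tau_range q = {\<tau>. \<bar>real_of_int \<tau>\<bar> < 2 * sqrt (real q) \<and> [\<tau> = -1] (mod 4)}"

end

theory Submission
  imports Defs "Jordan_Normal_Form.Determinant"
begin

text \<open>A codeword of weight \<open>j\<close> selects \<open>\<nu>\<^sub>\<beta>\<close> of the matrices of trace \<open>\<beta>\<close>, so the weight distribution is
  governed by the numbers \<open>n\<^sub>\<beta>\<close> of elements of trace \<open>\<beta>\<close>. All fibres of \<open>(x, y) \<mapsto> x \<sigma> y\<close> on \<open>Q \<times> Q\<close>
  have size \<open>|Q \<inter> \<sigma> Q \<sigma>|\<close> and \<open>Tr (x \<sigma> y) = Tr (y x \<sigma>)\<close>, so \<open>n\<^sub>\<beta>\<close> is determined by the sums of
  \<open>\<lambda> (c Tr (w \<sigma>))\<close> over \<open>w \<in> Q\<close> (with \<open>\<rho> w \<sigma>\<close> in place of \<open>w \<sigma>\<close> for \<open>i = 3, 4\<close>). For \<open>c \<noteq> 0\<close>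
  the sum over \<open>B\<close> vanishes unless \<open>A\<close> is block triangular with a symmetric leading \<open>s \<times> s\<close> block;
  the sum over \<open>h\<close> then contributes the sign \<open>(-1)\<^sup>s\<close>, the remaining block a Kloosterman sum over
  \<open>GL(m, q)\<close> with \<open>m = n - 1 - s \<le> 2\<close>, and \<open>SO\<^sup>-(2, q)\<close> a factor \<open>- K(c)\<close>, or \<open>q + 1\<close> in the
  presence of \<open>\<rho>\<close>. Fourier inversion turns products of \<open>K(c)\<close> into \<open>\<lambda> (\<beta>\<inverse>)\<close> and \<open>K(\<beta>\<inverse>)\<close>.

  That all values of \<open>K\<close> lie in the range of \<open>\<tau>\<close> is the Weil bound. It is obtained by Manin's
  argument: on \<open>y\<^sup>2 + x y = x\<^sup>3 + b\<^sup>2\<close> over the rational function field, the heights of the abscissae of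
  the Frobenius image of the generic point plus its multiples by \<open>k\<close> are \<open>k\<^sup>2 - K k + q\<close>, and heights
  are nonnegative.\<close>

section \<open>Characters and Kloosterman sums in characteristic two\<close>

text \<open>The constants \<open>A\<close> and \<open>B\<close> have one origin. Let a be the
  product of all factors of the character sum that do not depend on \<beta>, and v(\<beta>) the
  Fourier coefficient that is left, both stripped of signs. The count then reads q * n_\<beta> *
  |stabilizer| = |Q| * (|Q| + \<epsilon> * a * v(\<beta>)), so B = |Q| / a and A = |Q| * a /
  |stabilizer|; it remains to compare powers of q and products of factors q^j - 1. The sign
  \<epsilon> is (-1)^s times the sign of the low-dimensional factors. The obstacle is the strict
  range of \<tau>. The curve is dictated by K: with z = (y + b) / x it becomes z^2 + z = x + b / x,
  which has solutions over a unit x exactly if tr (x + b / x) = 0. Points and the group law are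
  never formed. Only abscissae occur, as coprime pairs of polynomials, and adding or subtracting the
  generic point is encoded in one quadratic equation whose roots are the two possible abscissae;
  comparing degrees in it yields the parallelogram law for heights.\<close>

locale binary_field =
  fixes r q :: nat and field_type :: "'a::{field,finite} itself"
  assumes card_field [simp]: "CARD('a) = q" and q_def: "q = 2 ^ r"
begin

abbreviation lam :: "'a \<Rightarrow> int" where "lam \<equiv> add_char r"
abbreviation tr :: "'a \<Rightarrow> 'a" where "tr \<equiv> field_tr r"
abbreviation K :: "'a \<Rightarrow> int" where "K \<equiv> kloosterman r"

text \<open>Translation by 1 permutes the field, so the sum of all elements equals itself plus q *
  1; hence q, a power of 2, is zero in the field.\<close>

lemma two_eq_zero: "(2::'a) = 0"
proof -
  have "(\<Sum>x\<in>(UNIV::'a set). x) = (\<Sum>x\<in>UNIV. x + 1)"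
    by (rule sum.reindex_bij_witness[of _ "\<lambda>x. x + 1" "\<lambda>x. x - 1"]) auto
  then have "of_nat q = (0::'a)" by (simp add: sum.distrib)
  then have "(2::'a) ^ r = 0" by (simp add: q_def)
  then show ?thesis by simp
qed

lemma add_self [simp]: "x + x = (0::'a)"
  using two_eq_zero by (metis mult_2 mult_zero_left)

lemma add_self_left [simp]: "x + (x + y) = (y::'a)"
  by (simp add: add.assoc[symmetric])

lemma uminus_char2: "- x = (x::'a)"
  by (rule minus_unique) simp

lemma minus_char2: "x - y = x + (y::'a)"
  using uminus_char2[of y] by (simp only: diff_conv_add_uminus)

lemma add_eq_zero_char2: "x + y = 0 \<longleftrightarrow> x = (y::'a)"
  using minus_char2[of x y] by (metis eq_iff_diff_eq_0)

lemma of_nat_char2: "(of_nat n :: 'a) = (if even n then 0 else 1)"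
  by (induction n) auto

lemma r_pos: "r > 0"
proof (rule ccontr)
  assume "\<not> r > 0"
  then have "CARD('a) = 1" using q_def by simp
  then obtain z where z: "(UNIV::'a set) = {z}" using card_1_singletonE by blast
  have "(0::'a) \<in> {z}" "(1::'a) \<in> {z}" using z by blast+
  then show False by simp
qed

lemma q_ge_2: "int q \<ge> 2"
  using r_pos self_le_power[of 2 r] by (simp add: q_def)

lemma card_units: "card (UNIV - {0::'a}) = q - 1"
  by (simp add: card_Diff_subset)

lemma power_units: "x \<noteq> 0 \<Longrightarrow> x ^ (q - 1) = (1::'a)"
proof -
  assume x: "x \<noteq> 0"
  have "(\<Prod>y\<in>UNIV - {0}. x * y) = (\<Prod>y\<in>UNIV - {0::'a}. y)"
    using x by (intro prod.reindex_bij_witness[of _ "\<lambda>y. y / x" "\<lambda>y. x * y"]) auto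
  then have "x ^ (q - 1) * \<Prod>(UNIV - {0::'a}) = \<Prod>(UNIV - {0::'a})"
    by (simp add: prod.distrib card_units)
  moreover have "\<Prod>(UNIV - {0::'a}) \<noteq> 0" by simp
  ultimately show ?thesis by simp
qed

lemma power_q [simp]: "x ^ q = (x::'a)"
proof (cases "x = 0")
  case False
  have "q = Suc (q - 1)" using q_ge_2 by simp
  then have "x ^ q = x * x ^ (q - 1)" by (metis power_Suc)
  then show ?thesis using power_units[OF False] by simp
qed (use q_ge_2 in simp)

lemma power_two_r: "x ^ (2 ^ r) = (x::'a)"
  using power_q q_def by simp

lemma square_add: "(x + y)\<^sup>2 = x\<^sup>2 + (y::'a)\<^sup>2"
  by (simp add: power2_sum two_eq_zero)

lemma frobenius_add: "(x + y) ^ (2 ^ i) = x ^ (2 ^ i) + (y::'a) ^ (2 ^ i)"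
proof (induction i)
  case (Suc i)
  have *: "z ^ (2 ^ Suc i) = (z ^ (2 ^ i))\<^sup>2" for z :: 'a
    by (simp add: power_mult[symmetric] mult.commute)
  show ?case by (simp only: * Suc square_add)
qed simp

lemma inj_square: "inj (\<lambda>x::'a. x\<^sup>2)"
proof
  fix x y :: 'a assume "x\<^sup>2 = y\<^sup>2"
  then have "(x + y)\<^sup>2 = 0" by (simp add: square_add)
  then show "x = y" by (simp add: add_eq_zero_char2)
qed

lemma bij_square: "bij (\<lambda>x::'a. x\<^sup>2)"
  using inj_square finite_UNIV_inj_surj[OF _ inj_square] by (auto simp: bij_def)

lemma ex_sqrt: "\<exists>y. y\<^sup>2 = (x::'a)"
  using bij_square by (metis bij_pointE)

lemma square_eq_iff: "x\<^sup>2 = y\<^sup>2 \<longleftrightarrow> x = (y::'a)"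
  using inj_square by (auto dest: injD)

lemma sum_square: "(\<Sum>x\<in>(UNIV::'a set). f (x\<^sup>2)) = sum f UNIV"
  by (rule sum.reindex_bij_betw[OF bij_square])

lemma bij_square_units: "bij_betw (\<lambda>x::'a. x\<^sup>2) (UNIV - {0}) (UNIV - {0})"
  using bij_betw_DiffI[OF bij_square, of "{0}" "{0}"] by (simp add: bij_betw_def)

lemma sum_square_units: "(\<Sum>x\<in>UNIV - {0::'a}. f (x\<^sup>2)) = sum f (UNIV - {0})"
  by (rule sum.reindex_bij_betw[OF bij_square_units])

lemma sum_inverse_units: "(\<Sum>x\<in>UNIV - {0::'a}. f (inverse x)) = sum f (UNIV - {0})"
  by (rule sum.reindex_bij_witness[of _ inverse inverse]) auto

lemma sum_scale_units:
  "c \<noteq> 0 \<Longrightarrow> (\<Sum>x\<in>UNIV - {0::'a}. f (c * x)) = sum f (UNIV - {0})"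
  by (rule sum.reindex_bij_witness[of _ "\<lambda>x. x / c" "\<lambda>x. c * x"]) auto

lemma sum_shift: "(\<Sum>x\<in>(UNIV::'a set). f (x + c)) = sum f UNIV"
  by (rule sum.reindex_bij_witness[of _ "\<lambda>x. x - c" "\<lambda>x. x + c"]) auto

lemma tr_0 [simp]: "tr 0 = 0"
  by (simp add: field_tr_def power_0_left)

lemma tr_add: "tr (x + y) = tr x + tr y"
  by (simp add: field_tr_def frobenius_add sum.distrib)

lemma tr_square: "tr (x\<^sup>2) = tr x"
proof -
  have "tr (x\<^sup>2) = (\<Sum>i<r. x ^ (2 ^ Suc i))"
    by (simp add: field_tr_def power_mult[symmetric])
  also have "\<dots> + x ^ (2 ^ 0) = (\<Sum>i<Suc r. x ^ (2 ^ i))"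
    by (simp only: sum.lessThan_Suc_shift add.commute)
  also have "\<dots> = tr x + x ^ (2 ^ 0)" by (simp add: field_tr_def power_two_r)
  finally show ?thesis by simp
qed

lemma tr_cases: "tr x = 0 \<or> tr x = 1"
proof -
  have "(tr x)\<^sup>2 = tr (x\<^sup>2)"
  proof -
    have "finite A \<Longrightarrow> (sum f A)\<^sup>2 = (\<Sum>i\<in>A. (f i)\<^sup>2)" for f :: "nat \<Rightarrow> 'a" and A
      by (induction A rule: finite_induct) (auto simp: square_add)
    then show ?thesis by (simp add: field_tr_def power_mult[symmetric] mult.commute)
  qed
  then have "tr x * tr x = tr x" unfolding tr_square by (simp only: power2_eq_square)
  then show ?thesis by auto
qed

text \<open>The trace is a polynomial of degree at most q / 2 with linear coefficient 1, so it
  cannot vanish at all q elements.\<close>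

lemma ex_tr_nonzero: "\<exists>x. tr x \<noteq> 0"
proof (rule ccontr)
  assume "\<not> (\<exists>x. tr x \<noteq> 0)"
  then have z: "tr x = 0" for x by simp
  define p :: "'a poly" where "p = (\<Sum>i<r. monom 1 (2 ^ i))"
  have ev: "poly p x = tr x" for x by (simp add: p_def field_tr_def poly_sum poly_monom)
  have "coeff p 1 = (\<Sum>i<r. if i = 0 then 1 else 0)"
    unfolding p_def coeff_sum by (intro sum.cong) auto
  also have "\<dots> = 1" using r_pos by simp
  finally have p0: "p \<noteq> 0" by auto
  have deg: "degree p \<le> 2 ^ (r - 1)"
    unfolding p_def
    by (intro degree_sum_le) (auto intro!: order.trans[OF degree_monom_le] power_increasing)
  have "{x. poly p x = 0} = UNIV" using z ev by auto
  then have "q \<le> degree p" using card_poly_roots_bound[OF p0] by simp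
  then have "(2::nat) ^ r \<le> 2 ^ (r - 1)" using deg q_def by linarith
  then show False using r_pos by (simp add: power_increasing_iff)
qed

lemma lam_0 [simp]: "lam 0 = 1"
  by (simp add: add_char_def)

lemma lam_add: "lam (x + y) = lam x * lam y"
  using tr_cases[of x] tr_cases[of y] by (auto simp: add_char_def tr_add)

lemma lam_cases: "lam x = 1 \<or> lam x = -1"
  by (simp add: add_char_def)

lemma lam_square_arg: "lam (x\<^sup>2) = lam x"
  by (simp add: add_char_def tr_square)

lemma lam_tr: "lam x = 1 \<longleftrightarrow> tr x = 0" "lam x = -1 \<longleftrightarrow> tr x = 1"
  using tr_cases[of x] by (auto simp: add_char_def)

lemma ex_lam_neg: "\<exists>x. lam x = -1"
  using ex_tr_nonzero by (auto simp: add_char_def)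

lemma sum_lam: "(\<Sum>x\<in>UNIV. lam x) = 0"
proof -
  obtain z where z: "lam z = -1" using ex_lam_neg by blast
  have "(\<Sum>x\<in>UNIV. lam x) = (\<Sum>x\<in>UNIV. lam (x + z))" by (rule sum_shift[symmetric])
  also have "\<dots> = - (\<Sum>x\<in>UNIV. lam x)" by (simp add: lam_add z sum_negf)
  finally show ?thesis by simp
qed

lemma sum_lam_mult: "(\<Sum>c\<in>UNIV. lam (c * x)) = (if x = 0 then int q else 0)"
proof (cases "x = 0")
  case False
  have "(\<Sum>c\<in>UNIV. lam (c * x)) = (\<Sum>c\<in>UNIV. lam c)"
    using False by (intro sum.reindex_bij_witness[of _ "\<lambda>c. c / x" "\<lambda>c. c * x"]) auto
  then show ?thesis using False sum_lam by simp
qed simp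

lemma sum_units: "(\<Sum>x\<in>UNIV - {0::'a}. f x) = sum f UNIV - (f 0 :: int)"
  by (simp add: sum_diff)

lemma sum_units_lam_mult: "(\<Sum>c\<in>UNIV - {0}. lam (c * x)) = (if x = 0 then int q else 0) - 1"
  by (simp add: sum_units sum_lam_mult)

text \<open>Orthogonality of the additive characters x -> lam (c x). Both the point counts behind
  \<open>K\<close> and the trace counts on Q pass through this identity.\<close>

lemma q_card_eq:
  assumes "finite S"
  shows "int q * int (card {x\<in>S. f x = b}) = (\<Sum>c\<in>UNIV. lam (c * b) * (\<Sum>x\<in>S. lam (c * f x)))"
proof -
  have "(\<Sum>c\<in>UNIV. lam (c * b) * (\<Sum>x\<in>S. lam (c * f x)))
      = (\<Sum>x\<in>S. \<Sum>c\<in>UNIV. lam (c * (f x + b)))"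
    by (subst sum.swap) (simp add: sum_distrib_left lam_add distrib_left mult.commute)
  also have "\<dots> = (\<Sum>x\<in>S. if f x = b then int q else 0)"
    by (simp add: sum_lam_mult add_eq_zero_char2)
  also have "\<dots> = int q * int (card {x\<in>S. f x = b})"
    using assms by (simp add: sum.If_cases Int_def)
  finally show ?thesis by simp
qed

text \<open>Orthogonality is used with c^2 in place of c: \<open>lam\<close> is invariant under
  squaring, so lam (c^2 (z^2 + z)) = lam (z (c^2 + c)), and the sum over z survives only for c = 0
  and c = 1. These two indices give the terms 1 and lam t.\<close>

lemma card_artin_schreier: "int (card {z. z\<^sup>2 + z = t}) = 1 + lam t"
proof -
  have "int q * int (card {z\<in>UNIV. z\<^sup>2 + z = t})
      = (\<Sum>c\<in>UNIV. lam (c\<^sup>2 * t) * (\<Sum>z\<in>UNIV. lam (c\<^sup>2 * (z\<^sup>2 + z))))"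
    by (subst q_card_eq, simp, rule sum_square[symmetric])
  also have "\<dots> = (\<Sum>c\<in>UNIV. lam (c\<^sup>2 * t) * (\<Sum>z\<in>UNIV. lam (z * (c\<^sup>2 + c))))"
  proof -
    have "lam (c\<^sup>2 * (z\<^sup>2 + z)) = lam (z * (c\<^sup>2 + c))" for c z
      using lam_square_arg[of "c * z"] by (simp add: distrib_left lam_add power_mult_distrib mult.commute)
    then show ?thesis by simp
  qed
  also have "\<dots> = (\<Sum>c\<in>UNIV. if c \<in> {0, 1} then lam (c\<^sup>2 * t) * int q else 0)"
  proof -
    have "c\<^sup>2 + c = 0 \<longleftrightarrow> c = 0 \<or> c = 1" for c :: 'a
      by (simp add: power2_eq_square add_eq_zero_char2)
    then show ?thesis by (intro sum.cong) (auto simp: sum_lam_mult)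
  qed
  also have "\<dots> = int q * (1 + lam t)"
  proof -
    have "UNIV \<inter> {c::'a. c = 0 \<or> c = 1} = {0, 1}" by auto
    then show ?thesis by (simp add: sum.If_cases algebra_simps)
  qed
  finally show ?thesis using q_ge_2 by simp
qed

lemma card_quadratic:
  assumes "d \<noteq> 0"
  shows "int (card {x. x\<^sup>2 + d * x = t}) = 1 + lam (t / d\<^sup>2)"
proof -
  have "bij_betw (\<lambda>z. d * z) {z. z\<^sup>2 + z = t / d\<^sup>2} {x. x\<^sup>2 + d * x = t}"
    using assms
    by (intro bij_betw_byWitness[of _ "\<lambda>x. x / d"])
       (auto simp: field_simps power2_eq_square)
  then show ?thesis using card_artin_schreier[of "t / d\<^sup>2"] by (simp add: bij_betw_same_card)
qed

text \<open>Squaring permutes the units and leaves \<open>lam\<close> unchanged.\<close>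

lemma K_square: "K (a\<^sup>2) = K a"
proof -
  have "K (a\<^sup>2) = (\<Sum>x\<in>UNIV - {0}. lam (x\<^sup>2 + a\<^sup>2 * inverse (x\<^sup>2)))"
    unfolding kloosterman_def by (rule sum_square_units[symmetric])
  also have "\<dots> = K a"
    unfolding kloosterman_def
  proof (intro sum.cong refl)
    fix x :: 'a
    have "x\<^sup>2 + a\<^sup>2 * inverse (x\<^sup>2) = (x + a * inverse x)\<^sup>2"
      by (simp add: square_add power_mult_distrib power_inverse)
    then show "lam (x\<^sup>2 + a\<^sup>2 * inverse (x\<^sup>2)) = lam (x + a * inverse x)"
      by (simp only: lam_square_arg)
  qed
  finally show ?thesis .
qed

lemma K_scaled:
  assumes "c \<noteq> 0"
  shows "(\<Sum>x\<in>UNIV - {0}. lam (c * x + d * inverse x)) = K (c * d)"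
proof -
  have "K (c * d) = (\<Sum>x\<in>UNIV - {0}. lam (c * x + c * d * inverse (c * x)))"
    unfolding kloosterman_def by (rule sum_scale_units[OF assms, symmetric])
  also have "\<dots> = (\<Sum>x\<in>UNIV - {0}. lam (c * x + d * inverse x))"
    using assms by (intro sum.cong) (auto simp: field_simps)
  finally show ?thesis by simp
qed

text \<open>Scaling x by c turns the sum into K (c^2), and invariance under squaring removes the
  square. In this form \<open>K c\<close> is the character sum of the single map x -> x + 1 / x, so
  its Fourier transform is a count of solutions.\<close>

lemma K_eq_units_sum:
  assumes "c \<noteq> 0"
  shows "(\<Sum>x\<in>UNIV - {0}. lam (c * (x + inverse x))) = K c"
  using K_scaled[OF assms, of c] K_square[of c]
  by (simp add: distrib_left power2_eq_square)

text \<open>Both the congruence modulo 4 and the degree of a denominator in the Weil bound are read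
  off from the number of units at which the character is -1.\<close>

lemma K_eq_card: "K a = int q - 1 - 2 * int (card {x. x \<noteq> 0 \<and> lam (x + a * inverse x) = -1})"
proof -
  have "K a = (\<Sum>x\<in>UNIV - {0}. 1 - 2 * (if lam (x + a * inverse x) = -1 then 1 else 0))"
    unfolding kloosterman_def using lam_cases by (intro sum.cong) auto
  also have "\<dots> = int (card (UNIV - {0::'a}))
      - 2 * (\<Sum>x\<in>UNIV - {0}. if lam (x + a * inverse x) = -1 then 1 else 0)"
    by (simp add: sum_subtractf sum_distrib_left)
  also have "(\<Sum>x\<in>UNIV - {0}. if lam (x + a * inverse x) = -1 then 1 else (0::int))
      = int (card {x. x \<noteq> 0 \<and> lam (x + a * inverse x) = -1})"
    by (simp add: sum.If_cases) (intro arg_cong[where f = card], auto)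
  finally show ?thesis using q_ge_2 by (simp add: card_units of_nat_diff)
qed

lemma even_card_involution:
  assumes "finite S" and "\<And>x. x \<in> S \<Longrightarrow> f x \<in> S \<and> f (f x) = x \<and> f x \<noteq> x"
  shows "even (card S)"
  using assms
proof (induction "card S" arbitrary: S rule: less_induct)
  case less
  show ?case
  proof (cases "S = {}")
    case False
    then obtain x where x: "x \<in> S" by blast
    let ?S = "S - {x, f x}"
    have c: "card S = Suc (Suc (card ?S))"
    proof -
      have "card {x, f x} = 2" "{x, f x} \<subseteq> S" using less.prems(2)[OF x] x by auto
      moreover have "card {x, f x} \<le> card S"
        using calculation(2) less.prems(1) by (intro card_mono)
      ultimately show ?thesis using less.prems(1) by (simp add: card_Diff_subset)
    qed
    have "even (card ?S)"
    proof (rule less.hyps)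
      show "f y \<in> ?S \<and> f (f y) = y \<and> f y \<noteq> y" if "y \<in> ?S" for y
        using that less.prems(2)[of y] less.prems(2)[OF x] by auto
    qed (use c less.prems in auto)
    then show ?thesis using c by simp
  qed simp
qed

text \<open>The involution x -> a / x preserves x + a / x. At a fixed point this value is 0, where
  the character is 1, so the units with character -1 come in pairs and K a = q - 1 - 4 k. The lower
  bound on q makes 4 divide q.\<close>

lemma K_mod_4:
  assumes "int q \<ge> 4" and "a \<noteq> 0"
  shows "[K a = -1] (mod 4)"
proof -
  let ?S = "{x. x \<noteq> 0 \<and> lam (x + a * inverse x) = -1}"
  have "even (card ?S)"
  proof (rule even_card_involution[where f = "\<lambda>x. a * inverse x"])
    fix x assume x: "x \<in> ?S"
    have "a * inverse x \<noteq> x"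
    proof
      assume "a * inverse x = x"
      then have "lam (x + a * inverse x) = 1" by simp
      then show False using x by simp
    qed
    then show "a * inverse x \<in> ?S \<and> a * inverse (a * inverse x) = x \<and> a * inverse x \<noteq> x"
      using x assms(2) by (auto simp: field_simps)
  qed simp
  then obtain k where k: "card ?S = 2 * k" by blast
  have "4 dvd q"
  proof -
    have "r \<ge> 2"
    proof (rule ccontr)
      assume "\<not> r \<ge> 2"
      then have "r = 1" using r_pos by simp
      then show False using assms(1) q_def by simp
    qed
    then have "2 ^ 2 dvd q" unfolding q_def by (rule le_imp_power_dvd)
    then show ?thesis by simp
  qed
  then obtain l where "q = 4 * l" by blast
  then have "K a + 1 = 4 * (int l - int k)" using K_eq_card[of a] k by simp
  then show ?thesis by (metis cong_iff_dvd_diff diff_minus_eq_add dvd_triv_left)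
qed

text \<open>The Fourier transform of \<open>K\<close>: orthogonality reduces it to the number of
  units with x + 1 / x = b. For nonzero b this is the quadratic x^2 + b x = 1 with 1 + lam (1 / b^2)
  = 1 + lam (1 / b) roots. The index c = 0, where the unit sum is q - 1 instead of
  \<open>K 0\<close>, is split off.\<close>

lemma sum_lam_kloosterman:
  "(\<Sum>c\<in>UNIV - {0}. lam (c * b) * K c) = (if b = 0 then 1 else 1 + int q * lam (inverse b))"
proof -
  let ?f = "\<lambda>x::'a. x + inverse x"
  have "int q * int (card {x\<in>UNIV - {0}. ?f x = b})
      = (\<Sum>c\<in>UNIV. lam (c * b) * (\<Sum>x\<in>UNIV - {0}. lam (c * ?f x)))"
    by (rule q_card_eq) simp
  also have "\<dots> = (\<Sum>c\<in>UNIV - {0}. lam (c * b) * K c) + (int q - 1)"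
  proof -
    have "(\<Sum>c\<in>UNIV - {0}. lam (c * b) * (\<Sum>x\<in>UNIV - {0}. lam (c * ?f x)))
       = (\<Sum>c\<in>UNIV - {0}. lam (c * b) * K c)"
      by (intro sum.cong) (auto simp: K_eq_units_sum)
    then show ?thesis using q_ge_2 by (simp add: sum_units card_units of_nat_diff)
  qed
  finally have 1: "(\<Sum>c\<in>UNIV - {0}. lam (c * b) * K c)
      = int q * int (card {x\<in>UNIV - {0}. ?f x = b}) - (int q - 1)" by simp
  show ?thesis
  proof (cases "b = 0")
    case True
    have "x \<noteq> 0 \<and> x + inverse x = 0 \<longleftrightarrow> x = 1" for x :: 'a
    proof -
      have "x = inverse x \<longleftrightarrow> x\<^sup>2 = 1\<^sup>2" if "x \<noteq> 0"
        using that by (simp add: field_simps power2_eq_square)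
      moreover have "x\<^sup>2 = 1\<^sup>2 \<longleftrightarrow> x = 1" by (rule square_eq_iff)
      ultimately show ?thesis by (auto simp: add_eq_zero_char2)
    qed
    then have "{x\<in>UNIV - {0}. ?f x = b} = {1}" using True by auto
    then show ?thesis using 1 True by simp
  next
    case False
    have "{x\<in>UNIV - {0}. ?f x = b} = {x. x\<^sup>2 + b * x = 1}"
    proof -
      have "x \<noteq> 0 \<and> x + inverse x = b \<longleftrightarrow> x\<^sup>2 + b * x = 1" for x
      proof (cases "x = 0")
        case False
        have "x + inverse x = b \<longleftrightarrow> x * (x + inverse x) = x * b" using False by simp
        also have "\<dots> \<longleftrightarrow> x\<^sup>2 + 1 + b * x = 0"
          using False by (simp add: distrib_left power2_eq_square mult.commute add_eq_zero_char2)
        also have "\<dots> \<longleftrightarrow> x\<^sup>2 + b * x = 1"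
          by (metis add.commute add.left_commute add_eq_zero_char2)
        finally show ?thesis using False by simp
      qed simp
      then show ?thesis by auto
    qed
    then have "int (card {x\<in>UNIV - {0}. ?f x = b}) = 1 + lam (inverse b)"
      using card_quadratic[OF False, of 1] lam_square_arg[of "inverse b"]
      by (simp add: power_divide inverse_eq_divide)
    then show ?thesis using 1 False by (simp add: algebra_simps)
  qed
qed

lemma card_pairs_sum_prod:
  assumes "s \<noteq> 0"
  shows "int (card {(x, y). x + y = s \<and> x * y = p}) = 1 + lam (p / s\<^sup>2)"
proof -
  have "{(x, y). x + y = s \<and> x * y = p} = (\<lambda>x. (x, x + s)) ` {x. x\<^sup>2 + s * x = p}"
  proof -
    have "x + y = s \<longleftrightarrow> y = x + s" for x y :: 'a by auto
    then show ?thesis by (auto simp: image_iff algebra_simps power2_eq_square)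
  qed
  moreover have "inj_on (\<lambda>x. (x, x + s)) {x. x\<^sup>2 + s * x = p}" by (auto intro: inj_onI)
  ultimately show ?thesis using card_quadratic[OF assms, of p] by (simp add: card_image)
qed

text \<open>The expression equals (x + y)(x y + 1) / (x y). For b = 0 this leaves y = x or y = 1 /
  x, two families meeting only in x = y = 1. For nonzero b the pairs are sorted by their product p,
  which is neither 0 nor 1: the sum x + y = b p / (p + 1) is forced, there are 1 + lam ((p + 1 / p)
  / b^2) such pairs, and summing over p gives a Kloosterman sum again.\<close>

lemma card_double_kloosterman_eq:
  "int (card {(x, y). x \<noteq> 0 \<and> y \<noteq> 0 \<and> x + inverse x + (y + inverse y) = b})
    = (if b = 0 then 2 * int q - 3 else int q - 3 + K (inverse b))"
proof (cases "b = 0")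
  case True
  have "x \<noteq> 0 \<and> y \<noteq> 0 \<and> x + inverse x + (y + inverse y) = 0
      \<longleftrightarrow> x \<noteq> 0 \<and> (y = x \<or> y = inverse x)" for x y :: 'a
  proof (cases "x = 0 \<or> y = 0")
    case False
    then have "x + inverse x + (y + inverse y) = (x + y) * (x * y + 1) / (x * y)"
      by (simp add: field_simps)
    then have "x + inverse x + (y + inverse y) = 0 \<longleftrightarrow> x = y \<or> x * y = 1"
      using False by (simp add: add_eq_zero_char2)
    moreover have "x * y = 1 \<longleftrightarrow> y = inverse x" using False by (auto simp: field_simps)
    ultimately show ?thesis using False by auto
  qed auto
  then have eq: "{(x, y). x \<noteq> 0 \<and> y \<noteq> 0 \<and> x + inverse x + (y + inverse y) = b}
      = (\<lambda>x. (x, x)) ` (UNIV - {0}) \<union> (\<lambda>x. (x, inverse x)) ` (UNIV - {0, 1})"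
    using True by (auto simp: image_iff)
  have "card ((\<lambda>x. (x, x)) ` (UNIV - {0::'a}) \<union> (\<lambda>x. (x, inverse x)) ` (UNIV - {0, 1::'a}))
      = (q - 1) + (q - 2)"
  proof (subst card_Un_disjoint)
    show "(\<lambda>x. (x, x)) ` (UNIV - {0::'a}) \<inter> (\<lambda>x. (x, inverse x)) ` (UNIV - {0, 1::'a}) = {}"
    proof -
      have "x = 1" if "x \<noteq> 0" "inverse x = x" for x :: 'a
      proof -
        have "x\<^sup>2 = 1\<^sup>2" using that by (simp add: field_simps power2_eq_square)
        then show ?thesis by (simp only: square_eq_iff)
      qed
      then show ?thesis by (auto simp: image_iff)
    qed
    show "card ((\<lambda>x. (x, x)) ` (UNIV - {0::'a})) + card ((\<lambda>x. (x, inverse x)) ` (UNIV - {0, 1::'a}))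
        = q - 1 + (q - 2)"
      by (subst card_image, simp add: inj_on_def, subst card_image, simp add: inj_on_def,
          simp add: card_Diff_subset)
  qed auto
  then show ?thesis using True eq q_ge_2 by (simp add: of_nat_diff)
next
  case False
  let ?P = "UNIV - {0, 1::'a}"
  let ?S = "\<lambda>p. {(x, y). x + y = b * p / (p + 1) \<and> x * y = p}"
  have eq: "{(x, y). x \<noteq> 0 \<and> y \<noteq> 0 \<and> x + inverse x + (y + inverse y) = b} = (\<Union>p\<in>?P. ?S p)"
  proof -
    have "x \<noteq> 0 \<and> y \<noteq> 0 \<and> x + inverse x + (y + inverse y) = b \<longleftrightarrow>
        x * y \<noteq> 0 \<and> x * y \<noteq> 1 \<and> x + y = b * (x * y) / (x * y + 1)" for x y
    proof (cases "x = 0 \<or> y = 0")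
      case nz: False
      then have e: "x + inverse x + (y + inverse y) = (x + y) * (x * y + 1) / (x * y)"
        by (simp add: field_simps)
      show ?thesis
      proof (cases "x * y = 1")
        case True
        then show ?thesis using e False nz by simp
      next
        case F1: False
        then have "x * y + 1 \<noteq> 0" by (simp add: add_eq_zero_char2)
        then show ?thesis unfolding e using nz F1 by (auto simp: field_simps)
      qed
    qed auto
    then show ?thesis by (auto simp del: mult_eq_0_iff)
  qed
  have "int (card (\<Union>p\<in>?P. ?S p)) = (\<Sum>p\<in>?P. int (card (?S p)))"
    by (subst card_UN_disjoint) (auto intro: finite_subset[OF subset_UNIV])
  also have "\<dots> = (\<Sum>p\<in>?P. 1 + lam (inverse b ^ 2 * p + inverse b ^ 2 * inverse p))"
  proof (intro sum.cong refl)
    fix p assume p: "p \<in> ?P"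
    then have p1: "p \<noteq> 0" "p + 1 \<noteq> 0" by (auto simp: add_eq_zero_char2)
    then have ne: "b * p / (p + 1) \<noteq> 0" using False by simp
    have eq: "p / (b * p / (p + 1))\<^sup>2 = inverse b ^ 2 * p + inverse b ^ 2 * inverse p"
    proof -
      have "p / (b * p / (p + 1))\<^sup>2 = p * (p + 1)\<^sup>2 / (b\<^sup>2 * p\<^sup>2)"
        using p1 False by (simp add: field_simps power2_eq_square)
      also have "\<dots> = (p\<^sup>2 + 1) / (b\<^sup>2 * p)"
        using p1 False by (simp add: square_add field_simps power2_eq_square)
      also have "\<dots> = inverse b ^ 2 * p + inverse b ^ 2 * inverse p"
        using p1 False by (simp add: field_simps power2_eq_square)
      finally show ?thesis .
    qed
    show "int (card (?S p)) = 1 + lam (inverse b ^ 2 * p + inverse b ^ 2 * inverse p)"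
      unfolding card_pairs_sum_prod[OF ne] eq ..
  qed
  also have "\<dots> = int (card ?P)
      + (\<Sum>p\<in>?P. lam (inverse b ^ 2 * p + inverse b ^ 2 * inverse p))"
    by (simp add: sum.distrib)
  \<comment> \<open>The missing index p = 1 would contribute 1, because p + 1 / p vanishes
    there.\<close>
  also have "(\<Sum>p\<in>?P. lam (inverse b ^ 2 * p + inverse b ^ 2 * inverse p))
      = (\<Sum>p\<in>UNIV - {0}. lam (inverse b ^ 2 * p + inverse b ^ 2 * inverse p)) - 1"
  proof -
    have "?P = (UNIV - {0}) - {1}" by auto
    then show ?thesis by (simp add: sum_diff)
  qed
  also have "(\<Sum>p\<in>UNIV - {0}. lam (inverse b ^ 2 * p + inverse b ^ 2 * inverse p)) = K (inverse b)"
    using K_scaled[of "inverse b ^ 2" "inverse b ^ 2"] False K_square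
    by (simp add: power2_eq_square)
  also have "int (card ?P) = int q - 2" using q_ge_2 by (simp add: card_Diff_subset of_nat_diff)
  finally show ?thesis using eq False by simp
qed

text \<open>The square of the unit sum is the character sum of x + 1 / x + y + 1 / y over pairs of
  units; the index c = 0 accounts for (q - 1)^2.\<close>

lemma sum_lam_kloosterman_square:
  "(\<Sum>c\<in>UNIV - {0}. lam (c * b) * (K c)\<^sup>2)
    = (if b = 0 then (int q)\<^sup>2 - int q - 1 else int q * K (inverse b) - int q - 1)"
proof -
  let ?f = "\<lambda>x::'a. x + inverse x" and ?U = "UNIV - {0::'a}"
  let ?g = "\<lambda>(x, y). ?f x + ?f y"
  have dbl: "(\<Sum>z\<in>?U \<times> ?U. lam (c * ?g z)) = (\<Sum>x\<in>?U. lam (c * ?f x))\<^sup>2" for c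
  proof -
    have "(\<Sum>x\<in>?U. lam (c * ?f x))\<^sup>2 = (\<Sum>x\<in>?U. \<Sum>y\<in>?U. lam (c * (?f x + ?f y)))"
      by (simp add: power2_eq_square sum_product distrib_left lam_add mult_ac)
    then show ?thesis by (simp add: sum.cartesian_product split_def)
  qed
  have "int q * int (card {z\<in>?U \<times> ?U. ?g z = b})
      = (\<Sum>c\<in>UNIV. lam (c * b) * (\<Sum>z\<in>?U \<times> ?U. lam (c * ?g z)))"
    by (rule q_card_eq) simp
  also have "\<dots> = (\<Sum>c\<in>UNIV - {0}. lam (c * b) * (K c)\<^sup>2) + (int q - 1)\<^sup>2"
  proof -
    have "(\<Sum>c\<in>UNIV - {0}. lam (c * b) * (\<Sum>x\<in>?U. lam (c * ?f x))\<^sup>2)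
       = (\<Sum>c\<in>UNIV - {0}. lam (c * b) * (K c)\<^sup>2)"
      by (intro sum.cong) (auto simp: K_eq_units_sum)
    then show ?thesis unfolding dbl using q_ge_2 by (simp add: sum_units card_units of_nat_diff)
  qed
  also have "{z\<in>?U \<times> ?U. ?g z = b} = {(x, y). x \<noteq> 0 \<and> y \<noteq> 0 \<and> ?f x + ?f y = b}"
    by auto
  finally show ?thesis
    unfolding card_double_kloosterman_eq by (auto simp: algebra_simps power2_eq_square)
qed

end

section \<open>The Weil bound for Kloosterman sums\<close>

text \<open>With Bezout coefficients instead of a gcd, coprimality of numerator and denominator
  passes to powers, products and elementary changes by plain algebra.\<close>

definition unimodular :: "'a::comm_ring_1 \<Rightarrow> 'a \<Rightarrow> bool" where
  "unimodular a b \<longleftrightarrow> (\<exists>u v. u * a + v * b = 1)"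

lemma unimodular_sym: "unimodular a b \<Longrightarrow> unimodular b a"
  unfolding unimodular_def by (metis add.commute)

lemma unimodular_mult:
  assumes "unimodular a b" "unimodular a c" shows "unimodular a (b * c)"
proof -
  obtain u v where 1: "u * a + v * b = 1" using assms(1) unimodular_def by blast
  obtain x y where 2: "x * a + y * c = 1" using assms(2) unimodular_def by blast
  have "(u * x * a + u * y * c + v * b * x) * a + (v * y) * (b * c)
      = (u * a + v * b) * (x * a + y * c)" by (simp add: algebra_simps)
  then show ?thesis unfolding unimodular_def 1 2 by (metis mult_1)
qed

lemma unimodular_power: "unimodular a b \<Longrightarrow> unimodular a (b ^ n)"
proof (induction n)
  case 0
  have "0 * a + 1 * b ^ 0 = 1" by simp
  then show ?case unfolding unimodular_def by blast
qed (simp add: unimodular_mult)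

lemma unimodular_powers: "unimodular a b \<Longrightarrow> unimodular (a ^ m) (b ^ n)"
  by (rule unimodular_power[OF unimodular_sym[OF unimodular_power[OF unimodular_sym]]])

lemma unimodular_dvd_mult:
  assumes "unimodular a b" "a dvd b * c" shows "a dvd c"
proof -
  obtain u v where "u * a + v * b = 1" using assms(1) unimodular_def by blast
  then have "c = u * a * c + v * (b * c)" by (metis (no_types) distrib_right mult.assoc mult_1)
  then show ?thesis using assms(2) by (metis dvd_add dvd_mult dvd_mult2 dvd_triv_right)
qed

lemma unimodular_add_mult:
  assumes "unimodular a b" shows "unimodular (a + c * b) b"
proof -
  obtain u v where "u * a + v * b = 1" using assms(1) unimodular_def by blast
  then have "u * (a + c * b) + (v - u * c) * b = 1" by (simp add: algebra_simps)
  then show ?thesis unfolding unimodular_def by blast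
qed

text \<open>Modulo X - c the polynomial p is the constant p(c), a unit.\<close>

lemma unimodular_linear:
  fixes p :: "'a::field poly"
  assumes "poly p c \<noteq> 0" shows "unimodular p [:- c, 1:]"
proof -
  have "[:- c, 1:] dvd p - [:poly p c:]" by (simp add: poly_eq_0_iff_dvd[symmetric])
  then obtain s where s: "p - [:poly p c:] = [:- c, 1:] * s" by (rule dvdE)
  have "[:1 / poly p c:] * p + (- ([:1 / poly p c:] * s)) * [:- c, 1:]
      = [:1 / poly p c:] * (p - [:- c, 1:] * s)"
    by (simp add: algebra_simps del: mult_pCons_left mult_pCons_right)
  also have "p - [:- c, 1:] * s = [:poly p c:]" using s by (simp add: algebra_simps)
  also have "[:1 / poly p c:] * [:poly p c:] = 1" using assms by simp
  finally show ?thesis unfolding unimodular_def by blast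
qed

lemma unimodular_prod_linear:
  fixes p :: "'a::field poly"
  assumes "finite S" "\<And>c. c \<in> S \<Longrightarrow> poly p c \<noteq> 0"
  shows "unimodular p (\<Prod>c\<in>S. [:- c, 1:])"
  using assms
proof (induction S rule: finite_induct)
  case empty
  have "0 * p + 1 * 1 = 1" by simp
  then show ?case unfolding unimodular_def by (metis prod.empty)
next
  case (insert x S)
  then show ?case by (simp add: unimodular_mult unimodular_linear del: mult_pCons_left)
qed

lemma prod_linear_dvd:
  fixes p :: "'a::field poly"
  assumes "finite S" "\<And>c. c \<in> S \<Longrightarrow> poly p c = 0"
  shows "(\<Prod>c\<in>S. [:- c, 1:]) dvd p"
  using assms
proof (induction S rule: finite_induct)
  case (insert x S)
  then obtain s where s: "p = (\<Prod>c\<in>S. [:- c, 1:]) * s" by (auto elim: dvdE)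
  have "poly (\<Prod>c\<in>S. [:- c, 1:]) x \<noteq> 0" using insert.hyps by (auto simp: poly_prod)
  moreover have "poly p x = 0" using insert.prems by simp
  ultimately have "poly s x = 0" using s by (simp add: poly_mult)
  then have "[:- x, 1:] dvd s" by (simp add: poly_eq_0_iff_dvd)
  then show ?case using insert.hyps s by (simp add: mult.commute mult_dvd_mono del: mult_pCons_left mult_pCons_right)
qed simp

lemma degree_prod_linear: "degree (\<Prod>c\<in>S. [:- c, 1::'a::field:]) = card S"
  by (cases "finite S") (simp_all add: degree_prod_eq_sum_degree)

text \<open>For coprime A and B this is the degree of the rational function A / B.\<close>

definition height :: "'a::field poly \<Rightarrow> 'a poly \<Rightarrow> nat" where
  "height A B = max (degree A) (degree B)"

lemma height_coeff:
  assumes "A \<noteq> 0 \<or> B \<noteq> 0"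
  shows "coeff A (height A B) \<noteq> 0 \<or> coeff B (height A B) \<noteq> 0"
proof (rule ccontr)
  assume "\<not> ?thesis"
  then have z: "coeff A (height A B) = 0" "coeff B (height A B) = 0" by auto
  show False
  proof (cases "degree A \<ge> degree B")
    case True
    then have h: "height A B = degree A" by (simp add: height_def)
    then have "A = 0" using z by simp
    then have "degree B = 0" "height A B = 0" using True h by simp_all
    then have "B = 0" using z(2) by (metis leading_coeff_0_iff)
    then show False using \<open>A = 0\<close> assms by simp
  next
    case False
    then have h: "height A B = degree B" by (simp add: height_def)
    then have "B = 0" using z by simp
    then show False using False by simp
  qed
qed

lemma coeff_mult_bound:
  assumes "degree p \<le> m" "degree s \<le> n"
  shows "coeff (p * s) (m + n) = coeff p m * coeff s n"
proof -
  have "coeff (p * s) (m + n) = (\<Sum>i\<le>m + n. coeff p i * coeff s (m + n - i))"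
    by (rule coeff_mult)
  also have "\<dots> = (\<Sum>i\<in>{m}. coeff p i * coeff s (m + n - i))"
  proof (rule sum.mono_neutral_right)
    show "\<forall>i\<in>{..m + n} - {m}. coeff p i * coeff s (m + n - i) = 0"
    proof
      fix i assume "i \<in> {..m + n} - {m}"
      then have "i > m \<or> m + n - i > n" by auto
      then show "coeff p i * coeff s (m + n - i) = 0"
        using assms coeff_eq_0[of p i] coeff_eq_0[of s "m + n - i"] by auto
    qed
  qed auto
  finally show ?thesis by simp
qed

text \<open>The degree of a quadratic form with these three coefficients, measured at the place at
  infinity. It is determined by the triple, so two expressions for the same form must agree on
  it.\<close>

definition triple_degree :: "'a::field poly \<Rightarrow> 'a poly \<Rightarrow> 'a poly \<Rightarrow> nat \<Rightarrow> bool" where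
  "triple_degree X Y Z d \<longleftrightarrow> degree X \<le> d \<and> degree Y \<le> d \<and> degree Z \<le> d \<and>
     (coeff X d \<noteq> 0 \<or> coeff Y d \<noteq> 0 \<or> coeff Z d \<noteq> 0)"

lemma triple_degree_unique: "triple_degree X Y Z d \<Longrightarrow> triple_degree X Y Z e \<Longrightarrow> d = e"
  unfolding triple_degree_def by (auto dest: le_degree intro: le_antisym order_trans)

text \<open>The triple consists of the coefficients of (D T + C)(F T + E). Its coefficients at the
  sum of the heights are those of a product of two nonzero polynomials in T over the field, hence
  not all zero: the Gauss lemma at infinity.\<close>

lemma triple_degree_product:
  assumes "C \<noteq> 0 \<or> D \<noteq> 0" "E \<noteq> 0 \<or> F \<noteq> 0"
  shows "triple_degree (D * F) (D * E + C * F) (C * E) (height C D + height E F)"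
proof -
  let ?m = "height C D" and ?n = "height E F"
  have d: "degree C \<le> ?m" "degree D \<le> ?m" "degree E \<le> ?n" "degree F \<le> ?n"
    by (auto simp: height_def)
  have dm: "degree (X * Y) \<le> ?m + ?n" if "degree X \<le> ?m" "degree Y \<le> ?n" for X Y :: "'a poly"
    using that degree_mult_le[of X Y] by linarith
  have "coeff C ?m \<noteq> 0 \<or> coeff D ?m \<noteq> 0" "coeff E ?n \<noteq> 0 \<or> coeff F ?n \<noteq> 0"
    using assms height_coeff by blast+
  then have "coeff (D * F) (?m + ?n) \<noteq> 0 \<or> coeff (D * E + C * F) (?m + ?n) \<noteq> 0
      \<or> coeff (C * E) (?m + ?n) \<noteq> 0"
    using d by (auto simp: coeff_mult_bound)
  then show ?thesis unfolding triple_degree_def using d dm by (auto intro!: degree_add_le)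
qed

section \<open>Chains of abscissae that differ by the generic point\<close>

context binary_field
begin

lemma poly_add_self [simp]: "p + p = (0::'a poly)"
  by (rule poly_eqI) (simp only: coeff_add add_self coeff_0)

lemma poly_add_self_left [simp]: "p + (p + s) = (s::'a poly)"
  by (simp add: add.assoc[symmetric])

lemma poly_two_eq_zero: "(2::'a poly) = 0"
  by (metis mult_2 mult_1 poly_add_self mult.commute)

lemma poly_add_eq_zero: "p + s = 0 \<longleftrightarrow> p = (s::'a poly)"
  by (metis add.right_neutral poly_add_self_left poly_add_self)

lemma poly_square_add: "(p + s)\<^sup>2 = p\<^sup>2 + (s::'a poly)\<^sup>2"
  by (simp add: power2_sum poly_two_eq_zero)

abbreviation X :: "'a poly" where "X \<equiv> [:0, 1:]"

lemma degree_X_power: "degree (X ^ n) = n"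
  by (simp add: degree_power_eq)

text \<open>On the curve \<open>y\<^sup>2 + x y = x\<^sup>3 + b\<^sup>2\<close>, a pair \<open>(A, B)\<close> stands for a point with abscissa \<open>A / B\<close>.
  Two such points are linked when they differ by the generic point \<open>(x, y)\<close>, up to signs.\<close>

definition link_lead :: "'a poly \<Rightarrow> 'a poly \<Rightarrow> 'a poly" where "link_lead A B = (A + X * B)\<^sup>2"
definition link_mid :: "'a poly \<Rightarrow> 'a poly \<Rightarrow> 'a poly" where "link_mid A B = A * B * X"
definition link_const :: "'a \<Rightarrow> 'a poly \<Rightarrow> 'a poly \<Rightarrow> 'a poly" where "link_const b A B = (A * X)\<^sup>2 + ([:b:] * B)\<^sup>2"

definition linked :: "'a \<Rightarrow> 'a poly \<Rightarrow> 'a poly \<Rightarrow> 'a poly \<Rightarrow> 'a poly \<Rightarrow> bool" where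
  "linked b A B C D \<longleftrightarrow> link_lead A B * C\<^sup>2 + link_mid A B * (C * D) + link_const b A B * D\<^sup>2 = 0"

text \<open>Both expressions expand to the same polynomial, as they should: differing by the generic
  point up to signs is a symmetric relation.\<close>

lemma linked_sym: "linked b A B C D \<longleftrightarrow> linked b C D A B"
proof -
  have "link_lead A B * C\<^sup>2 + link_mid A B * (C * D) + link_const b A B * D\<^sup>2
      = link_lead C D * A\<^sup>2 + link_mid C D * (A * B) + link_const b C D * B\<^sup>2"
    unfolding link_lead_def link_mid_def link_const_def by (simp add: poly_square_add algebra_simps power_mult_distrib
        del: mult_pCons_left mult_pCons_right)
  then show ?thesis by (simp add: linked_def)
qed

text \<open>With h the height, the outer coefficients of the form have the squares of the h-th
  coefficients of B and A at degree 2 h + 2, and one of these is nonzero.\<close>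

lemma triple_degree_form:
  assumes "A \<noteq> 0 \<or> B \<noteq> 0" "b \<noteq> 0"
  shows "triple_degree (link_lead A B) (link_mid A B) (link_const b A B) (2 * height A B + 2)"
proof -
  let ?h = "height A B"
  have d: "degree A \<le> ?h" "degree B \<le> ?h" by (auto simp: height_def)
  have X: "degree X \<le> 1" "coeff X 1 = 1" by auto
  have d2: "degree (A * X) \<le> ?h + 1" "degree (X * B) \<le> ?h + 1" "degree ([:b:] * B) \<le> ?h"
    "degree A \<le> ?h + 1"
    using d degree_mult_le[of A X] degree_mult_le[of X B] degree_smult_le[of b B] by auto
  have dq: "degree (P * Q) \<le> 2 * ?h + 2" if "degree P \<le> ?h + 1" "degree Q \<le> ?h + 1"
    for P Q :: "'a poly" using degree_mult_le[of P Q] that by linarith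
  have d3: "degree (A + X * B) \<le> ?h + 1" using d2 by (intro degree_add_le)
  have cf: "coeff (P * P) (2 * ?h + 2) = coeff P (?h + 1) * coeff P (?h + 1)"
    if "degree P \<le> ?h + 1" for P :: "'a poly"
    using coeff_mult_bound[OF that that] by (simp add: mult_2)
  have c1: "coeff (link_lead A B) (2 * ?h + 2) = (coeff B ?h)\<^sup>2"
    unfolding link_lead_def power2_eq_square cf[OF d3] using d coeff_eq_0[of A "?h + 1"]
    by simp
  have c2: "coeff (link_const b A B) (2 * ?h + 2) = (coeff A ?h)\<^sup>2"
    unfolding link_const_def power2_eq_square coeff_add
    using cf[OF d2(1)] cf[of "[:b:] * B"] d2(3) coeff_eq_0[of B "?h + 1"] d
      coeff_mult_bound[OF d(1) X(1)] X(2)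
    by (simp del: mult_pCons_right)
  have d4: "degree (link_lead A B) \<le> 2 * ?h + 2"
    unfolding link_lead_def power2_eq_square by (rule dq[OF d3 d3])
  have d5: "degree (link_mid A B) \<le> 2 * ?h + 2"
    unfolding link_mid_def using dq[OF d2(4) d2(2)] by (simp only: mult_ac)
  have d6: "degree (link_const b A B) \<le> 2 * ?h + 2"
    unfolding link_const_def power2_eq_square using d2 by (intro degree_add_le dq) auto
  show ?thesis unfolding triple_degree_def using height_coeff[OF assms(1)] c1 c2 d4 d5 d6 by auto
qed

text \<open>The three coefficients of the form generate the unit ideal: combinations of them produce
  X^3 B^3, then b^2 B^3, and A^4, and powers of A and B are comaximal. An ideal (E, F) containing
  the three coefficients therefore contains 1.\<close>

lemma form_unimodular:
  assumes "unimodular A B" "b \<noteq> 0"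
    and "\<And>Z. Z = link_lead A B \<or> Z = link_mid A B \<or> Z = link_const b A B \<Longrightarrow> \<exists>u v. Z = u * E + v * F"
  shows "unimodular E F"
proof -
  let ?I = "\<lambda>Z. \<exists>u v. Z = u * E + v * F"
  have add: "?I (Y + Z)" if Y: "?I Y" and Z: "?I Z" for Y Z
  proof -
    obtain u v u' v' where "Y = u * E + v * F" "Z = u' * E + v' * F" using Y Z by blast
    then have "Y + Z = (u + u') * E + (v + v') * F" by (simp add: algebra_simps)
    then show ?thesis by blast
  qed
  have mult: "?I (c * Z)" if Z: "?I Z" for c Z
  proof -
    obtain u v where "Z = u * E + v * F" using Z by blast
    then have "c * Z = (c * u) * E + (c * v) * F" by (simp add: algebra_simps)
    then show ?thesis by blast
  qed
  have I: "?I (link_lead A B)" "?I (link_mid A B)" "?I (link_const b A B)" using assms(3) by blast+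
  have x3: "?I (X ^ 3 * B ^ 3)"
  proof -
    have "X ^ 3 * B ^ 3 = X * B * link_lead A B + A * link_mid A B"
      unfolding link_lead_def link_mid_def poly_square_add
      by (simp add: algebra_simps power_mult_distrib power2_eq_square power3_eq_cube)
    then show ?thesis using add[OF mult[OF I(1)] mult[OF I(2)]] by metis
  qed
  have "?I (B ^ 3)"
  proof -
    have "[:b:]\<^sup>2 * B ^ 3 = B * link_const b A B + X\<^sup>2 * B * link_lead A B + X * (X ^ 3 * B ^ 3)"
      unfolding link_lead_def link_const_def poly_square_add
      by (simp add: algebra_simps power_mult_distrib power2_eq_square power3_eq_cube
          del: mult_pCons_left mult_pCons_right)
    then have "?I ([:b:]\<^sup>2 * B ^ 3)"
      using add[OF add[OF mult[OF I(3)] mult[OF I(1)]] mult[OF x3]] by metis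
    then have "?I ([:1/b:]\<^sup>2 * ([:b:]\<^sup>2 * B ^ 3))" by (rule mult)
    moreover have "[:1/b:]\<^sup>2 * ([:b:]\<^sup>2 * B ^ 3) = ([:1/b:] * [:b:])\<^sup>2 * B ^ 3"
      by (simp only: power_mult_distrib mult.assoc)
    moreover have "[:1/b:] * [:b:] = 1" using assms(2) by simp
    ultimately show ?thesis by simp
  qed
  moreover have "?I (A ^ 4)"
  proof -
    have "A ^ 4 = link_lead A B * (A\<^sup>2 + X\<^sup>2 * B\<^sup>2) + (X * B) * (X ^ 3 * B ^ 3)"
      unfolding link_lead_def poly_square_add
      by (simp add: algebra_simps power_mult_distrib power2_eq_square power3_eq_cube power4_eq_xxxx
          del: mult_pCons_left mult_pCons_right)
    then show ?thesis using add[OF mult[OF I(1)] mult[OF x3]] by (metis mult.commute)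
  qed
  moreover have "unimodular (A ^ 4) (B ^ 3)" using assms(1) by (rule unimodular_powers)
  ultimately have "?I 1" unfolding unimodular_def by (metis add mult)
  then show ?thesis unfolding unimodular_def by metis
qed

lemma unimodular_nonzero: "unimodular A B \<Longrightarrow> A \<noteq> (0::'a poly) \<or> B \<noteq> 0"
  by (auto simp: unimodular_def)

text \<open>Let P lie over x = A / B and let G be the generic point. The form link_lead T^2 +
  link_mid T + link_const has the abscissae of P + G and P - G as roots: their sum is x X / (x +
  X)^2 and their product (x^2 X^2 + b^2) / (x + X)^2. Given the root C / D in lowest terms, the form
  factors over the polynomials as (D T + C)(F T + E), and E / F is the other root. Comparing the
  degrees of the two expressions gives h(P + G) + h(P - G) = 2 h(P) + 2.\<close>

lemma linked_next:
  assumes uA: "unimodular A B" and uC: "unimodular C D" and b: "b \<noteq> 0" and l: "linked b A B C D"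
  shows "\<exists>E F. unimodular E F \<and> linked b A B E F \<and>
    height C D + height E F = 2 * height A B + 2"
proof -
  have l': "link_lead A B * C\<^sup>2 + link_mid A B * (C * D) + link_const b A B * D\<^sup>2 = 0" using l linked_def by blast
  have "\<exists>E F. link_lead A B = D * F \<and> link_mid A B = D * E + C * F \<and> link_const b A B = C * E"
  proof -
    \<comment> \<open>If C or D vanishes, coprimality makes the other one a unit and the relation
      kills one outer coefficient; the cofactors are then obtained by dividing by that unit.\<close>
    consider "C = 0" | "D = 0" | "C \<noteq> 0" "D \<noteq> 0" by blast
    then show ?thesis
    proof cases
      case 1
      then obtain v where v: "v * D = 1" using uC by (auto simp: unimodular_def)
      then have D: "D \<noteq> 0" by auto
      then have "link_const b A B = 0" using l' 1 by simp
      moreover have "link_lead A B = D * (v * link_lead A B)" "link_mid A B = D * (v * link_mid A B)"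
        using v by (simp_all add: mult.assoc[symmetric] mult.commute[of D])
      ultimately show ?thesis using 1 by (metis add.right_neutral mult_zero_left)
    next
      case 2
      then obtain v where v: "v * C = 1" using uC by (auto simp: unimodular_def)
      then have C: "C \<noteq> 0" by auto
      then have "link_lead A B = 0" using l' 2 by simp
      moreover have "link_const b A B = C * (v * link_const b A B)" "link_mid A B = C * (v * link_mid A B)"
        using v by (simp_all add: mult.assoc[symmetric] mult.commute[of C])
      ultimately show ?thesis using 2 by (metis add.left_neutral mult_zero_left)
    next
      case 3
      have "link_lead A B * C\<^sup>2 + D * (link_mid A B * C + link_const b A B * D) = 0"
        using l' by (simp add: algebra_simps power2_eq_square)
      then have "C * (C * link_lead A B) = D * (link_mid A B * C + link_const b A B * D)"
        by (simp add: poly_add_eq_zero power2_eq_square mult_ac)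
      then have "D dvd C * (C * link_lead A B)" by simp
      then have "D dvd link_lead A B" using unimodular_dvd_mult uC unimodular_sym by blast
      then obtain F where F: "link_lead A B = D * F" by (rule dvdE)
      have "link_const b A B * D\<^sup>2 + C * (link_mid A B * D + link_lead A B * C) = 0"
        using l' by (simp add: algebra_simps power2_eq_square)
      then have "D * (D * link_const b A B) = C * (link_mid A B * D + link_lead A B * C)"
        by (simp add: poly_add_eq_zero power2_eq_square mult_ac)
      then have "C dvd D * (D * link_const b A B)" by simp
      then have "C dvd link_const b A B" using unimodular_dvd_mult uC by blast
      then obtain E where E: "link_const b A B = C * E" by (rule dvdE)
      have "C * D * (link_mid A B + (D * E + C * F)) = 0"
        using l' unfolding E F by (simp add: algebra_simps power2_eq_square)
      then have "link_mid A B = D * E + C * F" using 3 by (simp add: poly_add_eq_zero)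
      then show ?thesis using E F by blast
    qed
  qed
  then obtain E F where EF: "link_lead A B = D * F" "link_mid A B = D * E + C * F" "link_const b A B = C * E" by blast
  have "unimodular E F"
  proof (rule form_unimodular[OF uA b])
    fix Z assume "Z = link_lead A B \<or> Z = link_mid A B \<or> Z = link_const b A B"
    then show "\<exists>u v. Z = u * E + v * F"
      using EF by (metis add.left_neutral add.right_neutral mult_zero_left)
  qed
  moreover have "linked b A B E F"
    unfolding linked_def EF by (simp add: algebra_simps power2_eq_square)
  moreover have "height C D + height E F = 2 * height A B + 2"
    using triple_degree_product[of C D E F] triple_degree_form[of A B b] triple_degree_unique
      unimodular_nonzero uA uC b calculation(1) unfolding EF by metis
  ultimately show ?thesis by blast
qed

text \<open>By the parallelogram law the second difference of the heights along a chain is 2, so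
  they form a monic quadratic polynomial in n whose other coefficients are fixed by the first two
  members.\<close>

lemma height_sequence:
  assumes "unimodular A B" "unimodular C D" "b \<noteq> 0" "linked b A B C D"
    and "int (height A B) = c" "int (height C D) = c + e + 1"
  shows "\<exists>A B C D. unimodular A B \<and> unimodular C D \<and> linked b A B C D \<and>
    int (height A B) = (int n)\<^sup>2 + e * int n + c \<and>
    int (height C D) = (int n + 1)\<^sup>2 + e * (int n + 1) + c"
proof (induction n)
  case 0
  show ?case using assms by (intro exI[of _ A] exI[of _ B] exI[of _ C] exI[of _ D]) simp
next
  case (Suc n)
  then obtain A B C D where *: "unimodular A B" "unimodular C D" "linked b A B C D"
    "int (height A B) = (int n)\<^sup>2 + e * int n + c"
    "int (height C D) = (int n + 1)\<^sup>2 + e * (int n + 1) + c" by blast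
  obtain E F where EF: "unimodular E F" "linked b C D E F"
    "height A B + height E F = 2 * height C D + 2"
    using linked_next[OF *(2,1) assms(3)] *(3) linked_sym by blast
  have "int (height E F) = 2 * int (height C D) + 2 - int (height A B)" using EF(3) by linarith
  also have "\<dots> = (int n + 2)\<^sup>2 + e * (int n + 2) + c"
    unfolding *(4,5) by (simp add: power2_eq_square algebra_simps)
  finally show ?case using * EF
    by (intro exI[of _ C] exI[of _ D] exI[of _ E] exI[of _ F]) (simp add: add.commute)
qed

text \<open>For negative k the chain is run backwards from the same two members. Exchanging them
  replaces c by c + e + 1 and e by - e - 2, which amounts to the substitution n = 1 - k in the
  quadratic.\<close>

lemma height_quadratic_nonneg:
  assumes "unimodular A B" "unimodular C D" "b \<noteq> 0" "linked b A B C D"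
    and "int (height A B) = c" "int (height C D) = c + e + 1"
  shows "k\<^sup>2 + e * k + c \<ge> 0"
proof (cases "k \<ge> 0")
  case True
  then obtain n where n: "k = int n" using nonneg_int_cases by blast
  have "\<exists>m::nat. int m = (int n)\<^sup>2 + e * int n + c" using height_sequence[OF assms, of n] by blast
  then show ?thesis unfolding n by (metis of_nat_0_le_iff)
next
  case False
  then obtain n where n: "1 - k = int n" by (metis nonneg_int_cases diff_ge_0_iff_ge linear order_trans zero_le_one)
  have "\<exists>m::nat. int m = (int n)\<^sup>2 + (- e - 2) * int n + (c + e + 1)"
    using height_sequence[OF assms(2,1,3) _ assms(6), of "- e - 2" n] assms(4,5) linked_sym
    by (simp, blast)
  moreover have "(int n)\<^sup>2 + (- e - 2) * int n + (c + e + 1) = k\<^sup>2 + e * k + c"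
    unfolding n[symmetric] by (simp add: power2_eq_square algebra_simps)
  ultimately show ?thesis by (metis of_nat_0_le_iff)
qed

text \<open>In the coordinate z = (y + b) / x the curve is z^2 + z = x + b / x, whence z^q = z + tr
  (x + b / x) with the trace read as a formal sum of 2^i-th powers. This polynomial is that formal
  trace multiplied by X^(q - 1) to clear denominators; through it the Frobenius map enters.\<close>

definition frob_sum :: "'a \<Rightarrow> 'a poly" where
  "frob_sum b = (\<Sum>i<r. X ^ (q - 1 + 2 ^ i) + [:b ^ (2 ^ i):] * X ^ (q - 1 - 2 ^ i))"

lemma poly_sum_square: "(\<Sum>i\<in>I. f i)\<^sup>2 = (\<Sum>i\<in>I. (f i :: 'a poly)\<^sup>2)"
  by (induction I rule: infinite_finite_induct) (auto simp: poly_square_add)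

lemma pow2_le: "i < r \<Longrightarrow> 2 ^ i \<le> q - 1"
proof -
  assume "i < r"
  then have "2 ^ i < (2::nat) ^ r" by simp
  then have "2 ^ i < q" using q_def by simp
  then show ?thesis by linarith
qed

text \<open>Squaring shifts the index of the formal trace by one. With T = X + b / X, square plus
  trace therefore telescope to T^q + T, here multiplied by X^(2 (q - 1)).\<close>

lemma frob_sum_square:
  "(frob_sum b)\<^sup>2 + X ^ (q - 1) * frob_sum b
    = X ^ (3 * (q - 1) + 1) + [:b:] * X ^ (q - 1 - 1) + X ^ (2 * (q - 1) + 1)
      + [:b:] * X ^ (2 * (q - 1) - 1)"
proof -
  define m where "m = q - 1"
  define f where "f = (\<lambda>i::nat. X ^ (2 * m + 2 ^ i) + [:b ^ (2 ^ i):] * X ^ (2 * m - 2 ^ i))"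
  have m: "q = m + 1" using q_ge_2 by (simp add: m_def)
  have le: "2 ^ i \<le> m" if "i < r" for i :: nat using pow2_le[OF that] by (simp add: m_def)
  have "(frob_sum b)\<^sup>2 = (\<Sum>i<r. f (Suc i))"
    unfolding frob_sum_def poly_sum_square m_def[symmetric]
  proof (intro sum.cong refl)
    fix i assume "i \<in> {..<r}"
    then have "2 ^ i \<le> m" using le by simp
    then have "(m - 2 ^ i) * 2 = 2 * m - 2 ^ Suc i" "(m + 2 ^ i) * 2 = 2 * m + 2 ^ Suc i" by auto
    moreover have "[:b ^ 2 ^ i:]\<^sup>2 = [:b ^ 2 ^ Suc i:]"
      by (simp add: power2_eq_square power_add[symmetric] mult_2)
    ultimately show "(X ^ (m + 2 ^ i) + [:b ^ 2 ^ i:] * X ^ (m - 2 ^ i))\<^sup>2 = f (Suc i)"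
      unfolding f_def poly_square_add power_mult_distrib by (simp only: power_mult[symmetric])
  qed
  moreover have "X ^ (q - 1) * frob_sum b = (\<Sum>i<r. f i)"
    unfolding frob_sum_def m_def[symmetric] sum_distrib_left
  proof (intro sum.cong refl)
    fix i assume "i \<in> {..<r}"
    then have "2 ^ i \<le> m" using le by simp
    then have e: "m + (m - 2 ^ i) = 2 * m - 2 ^ i" "m + (m + 2 ^ i) = 2 * m + 2 ^ i" by auto
    show "X ^ m * (X ^ (m + 2 ^ i) + [:b ^ 2 ^ i:] * X ^ (m - 2 ^ i)) = f i"
      unfolding f_def e(1)[symmetric] e(2)[symmetric] unfolding distrib_left power_add
      by (simp only: mult_ac)
  qed
  moreover have "(\<Sum>i<r. f (Suc i)) + (\<Sum>i<r. f i) = f r + f 0"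
  proof -
    have "(\<Sum>i<k. f (Suc i)) + (\<Sum>i<k. f i) = f k + f 0" for k
      by (induction k) (simp_all add: add_ac)
    then show ?thesis .
  qed
  moreover have "f r = X ^ (3 * m + 1) + [:b:] * X ^ (m - 1)"
  proof -
    have "(2::nat) ^ r = m + 1" using m q_def by simp
    then show ?thesis unfolding f_def power_two_r by (simp add: mult_ac)
  qed
  moreover have "f 0 = X ^ (2 * m + 1) + [:b:] * X ^ (2 * m - 1)" by (simp add: f_def)
  ultimately show ?thesis by (simp add: m_def add_ac)
qed

text \<open>X^(q - 1) takes the value 1 on units, so clearing the denominator leaves the values of
  the trace unchanged.\<close>

lemma poly_frob_sum:
  assumes "c \<noteq> 0" shows "poly (frob_sum b) c = tr (c + b * inverse c)"
proof -
  have "poly (frob_sum b) c = (\<Sum>i<r. c ^ (2 ^ i) + (b * inverse c) ^ (2 ^ i))"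
    unfolding frob_sum_def poly_sum
  proof (intro sum.cong refl)
    fix i assume "i \<in> {..<r}"
    then have le: "2 ^ i \<le> q - 1" using pow2_le by simp
    have u: "c ^ (q - 1) = 1" using power_units[OF assms] by simp
    have "c ^ (q - 1 - 2 ^ i) * c ^ (2 ^ i) = 1" unfolding power_add[symmetric] le_add_diff_inverse2[OF le] by (rule u)
    then have "c ^ (q - 1 - 2 ^ i) = inverse c ^ (2 ^ i)"
      using assms by (simp add: field_simps power_inverse)
    then show "poly (X ^ (q - 1 + 2 ^ i) + [:b ^ 2 ^ i:] * X ^ (q - 1 - 2 ^ i)) c
        = c ^ (2 ^ i) + (b * inverse c) ^ (2 ^ i)"
      using u by (simp add: power_add power_mult_distrib)
  qed
  then show ?thesis by (simp add: field_tr_def frobenius_add)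
qed

lemma degree_frob_sum: "degree (frob_sum b) \<le> 2 * (q - 1)"
  unfolding frob_sum_def
proof (rule degree_sum_le)
  fix i assume "i \<in> {..<r}"
  then have le: "2 ^ i \<le> q - 1" using pow2_le by simp
  have "degree ([:b ^ 2 ^ i:] * X ^ (q - 1 - 2 ^ i)) \<le> 2 * (q - 1)"
    using degree_smult_le[of "b ^ 2 ^ i" "X ^ (q - 1 - 2 ^ i)"] by (simp add: degree_X_power)
  then show "degree (X ^ (q - 1 + 2 ^ i) + [:b ^ 2 ^ i:] * X ^ (q - 1 - 2 ^ i)) \<le> 2 * (q - 1)"
    using le by (intro degree_add_le) (simp_all add: degree_X_power)
qed simp

text \<open>All q - 1 units are roots of X^(q - 1) + 1; degree and leading coefficient leave no
  further factor.\<close>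

lemma prod_units_linear: "(\<Prod>c\<in>UNIV - {0}. [:- c, 1:]) = X ^ (q - 1) + 1"
proof -
  let ?P = "\<Prod>c\<in>UNIV - {0::'a}. [:- c, 1:]"
  have "?P dvd X ^ (q - 1) + 1"
    by (rule prod_linear_dvd) (auto simp: power_units[simplified])
  then obtain s where s: "X ^ (q - 1) + 1 = ?P * s" by (rule dvdE)
  have m: "q - 1 > 0" using q_ge_2 by simp
  have d: "degree (X ^ (q - 1) + 1) = q - 1"
    using m by (subst degree_add_eq_left) (simp_all add: degree_X_power)
  have lc: "lead_coeff (X ^ (q - 1) + 1) = 1"
  proof -
    have "X ^ (q - 1) = monom 1 (q - 1)" by (simp add: monom_altdef)
    then show ?thesis using m unfolding d by simp
  qed
  have dP: "degree ?P = q - 1" by (simp add: degree_prod_linear card_units)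
  have lP: "lead_coeff ?P = 1" by (simp add: lead_coeff_prod)
  have s0: "s \<noteq> 0" "?P \<noteq> 0" using s lc by auto
  have "degree s = 0" using degree_mult_eq[of ?P s] s0 d dP unfolding s by simp
  moreover have "lead_coeff s = 1" using lc lP unfolding s lead_coeff_mult by simp
  ultimately have "s = 1" by (auto elim!: degree_eq_zeroE)
  then show ?thesis using s by simp
qed

text \<open>Let F be the Frobenius image of the generic point G. The chain starts at F, whose
  abscissa X^q has height q, and continues with F + G, whose abscissa is shown to have height q + 1
  - K b. Two consecutive heights determine the quadratic.\<close>

lemma kloosterman_quadratic_nonneg:
  assumes b: "b \<noteq> 0"
  shows "k\<^sup>2 - K b * k + int q \<ge> 0"
proof -
  \<comment> \<open>The quotient of the formal trace by X^(q - 1) + 1 has simple poles exactly at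
    the units in \<open>S1\<close>; at those in \<open>S0\<close> numerator and denominator both
    vanish.\<close>
  define S1 where "S1 = {c. c \<noteq> 0 \<and> lam (c + b * inverse c) = -1}"
  define S0 where "S0 = {c. c \<noteq> 0 \<and> lam (c + b * inverse c) = 1}"
  have part: "UNIV - {0} = S0 \<union> S1" "S0 \<inter> S1 = {}"
    using lam_cases by (auto simp: S0_def S1_def)
  define m where "m = q - 1"
  have m: "q = m + 1" "m > 0" using q_ge_2 by (auto simp: m_def)
  have cards: "card S0 + card S1 = m"
  proof -
    have "card (S0 \<union> S1) = card S0 + card S1" using part(2) by (intro card_Un_disjoint) auto
    then show ?thesis unfolding part(1)[symmetric] card_units m_def by (rule sym)
  qed
  define G where "G = (\<Prod>c\<in>S0. [:- c, 1:])"
  define H where "H = (\<Prod>c\<in>S1. [:- c, 1:])"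
  define W where "W = X ^ m + 1"
  define S where "S = frob_sum b"
  have GH: "W = G * H"
    unfolding W_def m_def prod_units_linear[symmetric] part(1) G_def H_def
    using part(2) by (intro prod.union_disjoint) auto
  have "G dvd S" unfolding G_def S_def
    by (rule prod_linear_dvd) (auto simp: poly_frob_sum S0_def lam_tr)
  then obtain V where V: "S = G * V" by (rule dvdE)
  have G0: "G \<noteq> 0" by (auto simp: G_def)
  \<comment> \<open>The chord through F and G has slope z + S / W, so F + G has abscissa X^q + b / X
    + (S / W)^2 + S / W. Cancelling \<open>G\<close> turns S / W into V / H, and A / B is this
    abscissa over the denominator X H^2.\<close>
  define A where "A = X ^ (m + 2) * H\<^sup>2 + [:b:] * H\<^sup>2 + X * V\<^sup>2 + X * V * H"
  define B where "B = X * H\<^sup>2"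
  \<comment> \<open>This will be \<open>A * G\<^sup>2\<close> with the square of S eliminated; in
    this form the degree is visible.\<close>
  define M where "M = X * S + W * (X ^ (m + 2) + [:b:])"
  \<comment> \<open>For T = X + b / X one has T^q + T = (X^q + X)(1 + b / X^(q + 1)). The exponents
    are expressed through l = m - 1 to avoid truncated subtraction.\<close>
  have Xs: "X * (S\<^sup>2 + X ^ m * S) = X ^ m * W * (X ^ (m + 2) + [:b:])"
  proof -
    obtain l where l: "m = Suc l" using m(2) by (cases m) auto
    have e: "3 * m + 1 = 3 * l + 4" "m - 1 = l" "2 * m + 1 = 2 * l + 3" "2 * m - 1 = 2 * l + 1"
      using l by auto
    have alg: "x * (y ^ 3 * x ^ 4 + c * y + y ^ 2 * x ^ 3 + c * (y ^ 2 * x))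
        = (x * y) * (x * y + 1) * (y * x ^ 3 + c)" for x y c :: "'a poly"
      by (simp add: algebra_simps eval_nat_numeral)
    have "S\<^sup>2 + X ^ m * S = X ^ (3 * l + 4) + [:b:] * X ^ l + X ^ (2 * l + 3) + [:b:] * X ^ (2 * l + 1)"
      using frob_sum_square[of b] unfolding m_def[symmetric] S_def[symmetric] e .
    also have "\<dots> = (X ^ l) ^ 3 * X ^ 4 + [:b:] * X ^ l + (X ^ l) ^ 2 * X ^ 3 + [:b:] * ((X ^ l) ^ 2 * X)"
      by (simp only: power_add power_mult[symmetric] mult.commute[of l] power_one_right)
    finally have "X * (S\<^sup>2 + X ^ m * S) = (X * X ^ l) * (X * X ^ l + 1) * (X ^ l * X ^ 3 + [:b:])"
      by (simp only: alg)
    moreover have "X ^ l * X ^ 3 = X ^ (m + 2)" unfolding l power_add[symmetric] by (rule arg_cong[where f = "(^) X"]) simp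
    ultimately show ?thesis unfolding W_def l power_Suc by (simp only:)
  qed
  have W1: "W + 1 = X ^ m" unfolding W_def by (simp add: add.assoc)
  have AG: "A * G\<^sup>2 = M"
  proof -
    have "A * G\<^sup>2 = (X ^ (m + 2) + [:b:]) * W\<^sup>2 + X * S\<^sup>2 + X * S * W"
      unfolding A_def GH V by (simp add: algebra_simps power_mult_distrib power2_eq_square
          del: mult_pCons_left mult_pCons_right)
    also have "\<dots> = (X ^ (m + 2) + [:b:]) * W\<^sup>2 + X * (S\<^sup>2 + X ^ m * S) + X * S"
      unfolding W1[symmetric] by (simp add: algebra_simps del: mult_pCons_left mult_pCons_right)
    also have "\<dots> = M"
      unfolding Xs unfolding W1[symmetric] M_def
      by (simp add: algebra_simps power2_eq_square del: mult_pCons_left mult_pCons_right)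
    finally show ?thesis .
  qed
  have BG: "B * G\<^sup>2 = X * W\<^sup>2"
    unfolding B_def GH by (simp only: power_mult_distrib mult_ac)
  \<comment> \<open>Up to the factor X^2 W^2 this is the linking relation between X^q and A / B
    after multiplication by G^4.\<close>
  have quad: "M\<^sup>2 + X ^ (m + 1) * M + W\<^sup>2 * ((X ^ (m + 2))\<^sup>2 + [:b:]\<^sup>2) = 0"
  proof -
    have "M\<^sup>2 + X ^ (m + 1) * M + W\<^sup>2 * ((X ^ (m + 2))\<^sup>2 + [:b:]\<^sup>2)
        = X * (X * (S\<^sup>2 + X ^ m * S)) + X * (X ^ m * W * (X ^ (m + 2) + [:b:]))"
    proof -
      have "(x * s + w * (p + c))\<^sup>2 + (x * y) * (x * s + w * (p + c)) + w\<^sup>2 * (p\<^sup>2 + c\<^sup>2)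
          = x * (x * (s\<^sup>2 + y * s)) + x * (y * w * (p + c))" for x s w p c y :: "'a poly"
        unfolding poly_square_add power_mult_distrib
        by (simp add: algebra_simps power2_eq_square)
      then show ?thesis unfolding M_def Suc_eq_plus1[symmetric] power_Suc .
    qed
    then show ?thesis unfolding Xs by (simp only: poly_add_self)
  qed
  have "linked b (X ^ q) 1 A B"
  proof -
    have link_lead: "link_lead (X ^ q) 1 = X\<^sup>2 * W\<^sup>2"
      unfolding link_lead_def W_def m(1) by (simp add: power_mult_distrib[symmetric] distrib_left
          del: mult_pCons_left mult_pCons_right)
    have link_mid: "link_mid (X ^ q) 1 = X ^ (m + 2)"
      unfolding link_mid_def m(1) by (simp add: mult.commute del: mult_pCons_left mult_pCons_right)
    have link_const: "link_const b (X ^ q) 1 = (X ^ (m + 2))\<^sup>2 + [:b:]\<^sup>2"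
      unfolding link_const_def m(1) by (simp add: mult.commute del: mult_pCons_left mult_pCons_right)
    have "(link_lead (X ^ q) 1 * A\<^sup>2 + link_mid (X ^ q) 1 * (A * B) + link_const b (X ^ q) 1 * B\<^sup>2) * (G\<^sup>2)\<^sup>2
        = link_lead (X ^ q) 1 * (A * G\<^sup>2)\<^sup>2 + link_mid (X ^ q) 1 * ((A * G\<^sup>2) * (B * G\<^sup>2)) + link_const b (X ^ q) 1 * (B * G\<^sup>2)\<^sup>2"
      by (simp add: algebra_simps power2_eq_square)
    also have "\<dots> = X\<^sup>2 * W\<^sup>2 * (M\<^sup>2 + X ^ (m + 1) * M + W\<^sup>2 * ((X ^ (m + 2))\<^sup>2 + [:b:]\<^sup>2))"
      unfolding AG BG link_lead link_mid link_const
      by (simp add: algebra_simps power2_eq_square del: mult_pCons_left mult_pCons_right)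
    finally show ?thesis unfolding linked_def quad using G0 by simp
  qed
  moreover have "unimodular (X ^ q) 1"
    unfolding unimodular_def by (rule exI[of _ 0], rule exI[of _ 1]) simp
  moreover have "unimodular A B"
  \<comment> \<open>The prime factors of B are X and X - c for c in \<open>S1\<close>. At 0 only the
    term b H^2 of A survives, and modulo H the polynomial A reduces to X V^2, which does not vanish
    on \<open>S1\<close>.\<close>
  proof -
    have "poly H 0 \<noteq> 0" unfolding H_def by (auto simp: poly_prod S1_def)
    then have "poly A 0 \<noteq> 0" using b by (simp add: A_def)
    then have "unimodular A [:- 0, 1:]" by (rule unimodular_linear)
    then have uX: "unimodular A X" by simp
    have "poly (X * V\<^sup>2) c \<noteq> 0" if "c \<in> S1" for c
    proof -
      have c: "c \<noteq> 0" "lam (c + b * inverse c) = -1" using that by (auto simp: S1_def)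
      then have "poly S c \<noteq> 0" unfolding S_def using lam_tr(2) by (simp add: poly_frob_sum)
      then show ?thesis using c unfolding V by simp
    qed
    then have "unimodular (X * V\<^sup>2) H"
      unfolding H_def by (intro unimodular_prod_linear) auto
    then have "unimodular (X * V\<^sup>2 + (X ^ (m + 2) * H + [:b:] * H + X * V) * H) H"
      by (rule unimodular_add_mult)
    also have "X * V\<^sup>2 + (X ^ (m + 2) * H + [:b:] * H + X * V) * H = A"
      unfolding A_def by (simp add: algebra_simps power2_eq_square del: mult_pCons_left mult_pCons_right)
    finally have "unimodular A H" .
    then show ?thesis unfolding B_def using uX by (intro unimodular_mult unimodular_power)
  qed
  moreover have "int (height (X ^ q) 1) = int q" by (simp add: height_def degree_X_power)
  moreover have "int (height A B) = int q + (- K b) + 1"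
  proof -
    have H0: "H \<noteq> 0" by (auto simp: H_def)
    have dB: "degree B = 1 + 2 * card S1"
      unfolding B_def using H0 degree_prod_linear[of S1]
      by (subst degree_mult_eq) (simp_all add: degree_power_eq H_def)
    have dX: "degree (X ^ (m + 2) + [:b:]) = m + 2"
      by (subst degree_add_eq_left) (simp_all add: degree_X_power del: power_Suc)
    have dW: "degree W = m" unfolding W_def using m(2)
      by (subst degree_add_eq_left) (simp_all add: degree_X_power)
    have "degree (W * (X ^ (m + 2) + [:b:])) = m + (m + 2)"
      using dX dW m(2) by (subst degree_mult_eq) auto
    \<comment> \<open>The margin is exactly one: X S has degree at most 2 m + 1, so the leading term
      of M comes from W X^(m + 2).\<close>
    moreover have "degree (X * S) < m + (m + 2)"
      using degree_frob_sum[of b] degree_mult_le[of X S] unfolding S_def m_def by auto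
    ultimately have dM: "degree M = 2 * m + 2"
      unfolding M_def by (subst degree_add_eq_right) auto
    have "A \<noteq> 0" using AG dM by auto
    then have "degree M = degree A + 2 * card S0"
      unfolding AG[symmetric] using G0 degree_prod_linear[of S0]
      by (subst degree_mult_eq) (auto simp: degree_power_eq G_def)
    then have "degree A = 2 + 2 * card S1" using dM cards by linarith
    then have "int (height A B) = 2 + 2 * int (card S1)" using dB by (simp add: height_def)
    then show ?thesis using K_eq_card[of b] by (simp add: S1_def)
  qed
  ultimately have "k\<^sup>2 + (- K b) * k + int q \<ge> 0"
    using b by (intro height_quadratic_nonneg)
  then show ?thesis by simp
qed

text \<open>Only integer arguments are available, so the quadratic is evaluated next to its vertex:
  for K b = 4 k - 1 the argument 2 k = (K b + 1) / 2 gives q >= 2 k (2 k - 1), that is (K b)^2 - 1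
  <= 4 q. Equality would make the odd number 2 k - 1 divide a power of 2 and force q <= 2. Hence (K
  b)^2 <= 4 q, where equality is excluded because K b is odd.\<close>

theorem kloosterman_in_tau_range:
  assumes "q \<ge> 4" "b \<noteq> 0"
  shows "K b \<in> tau_range q"
proof -
  have cong: "[K b = -1] (mod 4)" using assms by (intro K_mod_4) simp_all
  then have "4 dvd K b + 1" by (simp add: cong_iff_dvd_diff)
  then obtain k where "K b + 1 = 4 * k" by (rule dvdE)
  then have k: "K b = 4 * k - 1" by simp
  have "(2 * k)\<^sup>2 - K b * (2 * k) + int q \<ge> 0" using assms(2) by (rule kloosterman_quadratic_nonneg)
  then have le: "int q \<ge> 2 * k * (2 * k - 1)" unfolding k by (simp add: power2_eq_square algebra_simps)
  have "int q \<noteq> 2 * k * (2 * k - 1)"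
  proof
    assume eq: "int q = 2 * k * (2 * k - 1)"
    have "(2 * k - 1) dvd int q" unfolding eq by simp
    then have "\<bar>2 * k - 1\<bar> dvd 2 ^ r" by (simp add: q_def)
    moreover have "odd \<bar>2 * k - 1\<bar>" by simp
    then have "coprime \<bar>2 * k - 1\<bar> (2 ^ r)" by simp
    ultimately have "\<bar>2 * k - 1\<bar> dvd 1" by (simp only: coprime_absorb_left)
    then have "2 * k - 1 = 1 \<or> 2 * k - 1 = -1" by auto
    then have "int q \<le> 2"
    proof
      assume "2 * k - 1 = 1" then have "k = 1" by simp
      then show ?thesis using eq by simp
    next
      assume "2 * k - 1 = -1" then have "k = 0" by simp
      then show ?thesis using eq by simp
    qed
    then show False using assms by simp
  qed
  with le have "4 * int q > 4 * (2 * k * (2 * k - 1))" by linarith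
  also have "4 * (2 * k * (2 * k - 1)) = (K b)\<^sup>2 - 1" unfolding k by (simp add: power2_eq_square algebra_simps)
  finally have "(K b)\<^sup>2 \<le> 4 * int q" by linarith
  moreover have "(K b)\<^sup>2 \<noteq> 4 * int q"
  proof
    assume "(K b)\<^sup>2 = 4 * int q"
    then have "even (K b)" by (metis dvd_mult2 even_numeral even_power)
    then show False unfolding k by simp
  qed
  ultimately have "(K b)\<^sup>2 < 4 * int q" by simp
  then have "(real_of_int (K b))\<^sup>2 < 4 * real q"
    using of_int_less_iff[where 'a = real, of "(K b)\<^sup>2" "4 * int q"] by simp
  then have "sqrt ((real_of_int (K b))\<^sup>2) < sqrt (4 * real q)" by (rule real_sqrt_less_mono)
  then have "\<bar>real_of_int (K b)\<bar> < 2 * sqrt (real q)" by (simp add: real_sqrt_mult)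
  then show ?thesis using cong by (simp add: tau_range_def)
qed

end

section \<open>Weight distribution of a trace code\<close>

text \<open>Such a subset amounts to independent choices of a subset of prescribed size in each
  fibre of f.\<close>

lemma card_profile_subsets:
  fixes f :: "'i \<Rightarrow> 'b::finite"
  assumes I: "finite I"
  shows "card {Y. Y \<subseteq> I \<and> (\<forall>\<beta>. card {k\<in>Y. f k = \<beta>} = \<nu> \<beta>)}
    = (\<Prod>\<beta>\<in>UNIV. card {k\<in>I. f k = \<beta>} choose \<nu> \<beta>)"
proof -
  let ?T = "\<lambda>\<beta>. {Z. Z \<subseteq> {k\<in>I. f k = \<beta>} \<and> card Z = \<nu> \<beta>}"
  let ?g = "\<lambda>Y. \<lambda>\<beta>. {k\<in>Y. f k = \<beta>}"
  have "bij_betw ?g {Y. Y \<subseteq> I \<and> (\<forall>\<beta>. card {k\<in>Y. f k = \<beta>} = \<nu> \<beta>)} (PiE UNIV ?T)"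
  proof (rule bij_betw_byWitness[where f' = "\<lambda>h. \<Union>\<beta>. h \<beta>"])
    have *: "{k. (\<exists>\<beta>. k \<in> h \<beta>) \<and> f k = \<beta>} = h \<beta>" if "\<forall>\<beta>. h \<beta> \<in> ?T \<beta>" for h \<beta>
      using that by fastforce
    show "\<forall>h\<in>PiE UNIV ?T. ?g (\<Union>\<beta>. h \<beta>) = h"
      using * by (auto simp: PiE_UNIV_domain fun_eq_iff Pi_iff)
    show "(\<lambda>h. \<Union>\<beta>. h \<beta>) ` PiE UNIV ?T
        \<subseteq> {Y. Y \<subseteq> I \<and> (\<forall>\<beta>. card {k\<in>Y. f k = \<beta>} = \<nu> \<beta>)}"
    proof (clarify, intro conjI allI)
      fix h \<beta> assume "h \<in> PiE UNIV ?T"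
      then have h: "\<forall>\<beta>. h \<beta> \<in> ?T \<beta>" by (auto simp: PiE_UNIV_domain Pi_iff)
      then show "\<Union> (range h) \<subseteq> I" by fastforce
      show "card {k \<in> \<Union> (range h). f k = \<beta>} = \<nu> \<beta>" using *[OF h, of \<beta>] h by simp
    qed
  qed (auto simp: PiE_UNIV_domain)
  then have "card {Y. Y \<subseteq> I \<and> (\<forall>\<beta>. card {k\<in>Y. f k = \<beta>} = \<nu> \<beta>)} = card (PiE UNIV ?T)"
    by (rule bij_betw_same_card)
  also have "\<dots> = (\<Prod>\<beta>\<in>UNIV. card (?T \<beta>))" by (rule card_PiE) simp
  also have "\<dots> = (\<Prod>\<beta>\<in>UNIV. card {k\<in>I. f k = \<beta>} choose \<nu> \<beta>)"
    using I by (intro prod.cong refl n_subsets) simp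
  finally show ?thesis .
qed

lemma finite_families: "finite (families j :: ('a::{field,finite} \<Rightarrow> nat) set)"
proof (rule finite_subset)
  show "(families j :: ('a \<Rightarrow> nat) set) \<subseteq> PiE UNIV (\<lambda>_. {..j})"
  proof
    fix \<nu> :: "'a \<Rightarrow> nat" assume "\<nu> \<in> families j"
    then have "(\<Sum>\<beta>\<in>UNIV. \<nu> \<beta>) = j" by (simp add: families_def)
    then have "\<nu> \<beta> \<le> j" for \<beta> using member_le_sum[of \<beta> UNIV \<nu>] by simp
    then show "\<nu> \<in> PiE UNIV (\<lambda>_. {..j})" by (auto simp: PiE_UNIV_domain)
  qed
qed (simp add: finite_PiE)

text \<open>Size and sum of Y depend only on how many elements of Y lie in each fibre of f. Hence
  both conditions on Y say that this profile lies in \<open>families j\<close>, where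
  \<open>of_nat\<close> reduces the multiplicities in the field.\<close>

lemma card_zero_sum_subsets:
  fixes f :: "'i \<Rightarrow> 'a::{field,finite}"
  assumes I: "finite I"
  shows "card {Y. Y \<subseteq> I \<and> card Y = j \<and> (\<Sum>k\<in>Y. f k) = 0}
    = (\<Sum>\<nu>\<in>families j. \<Prod>\<beta>\<in>UNIV. card {k\<in>I. f k = \<beta>} choose \<nu> \<beta>)"
proof -
  let ?P = "\<lambda>\<nu>. {Y. Y \<subseteq> I \<and> (\<forall>\<beta>. card {k\<in>Y. f k = \<beta>} = \<nu> \<beta>)}"
  have 1: "card Y = (\<Sum>\<beta>\<in>UNIV. card {k\<in>Y. f k = \<beta>})" if "Y \<subseteq> I" for Y
  proof -
    have "finite Y" using that I finite_subset by blast
    then have "(\<Sum>\<beta>\<in>UNIV. \<Sum>k\<in>{k\<in>Y. f k = \<beta>}. 1) = (\<Sum>k\<in>Y. 1::nat)"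
      by (intro sum.group) auto
    then show ?thesis by simp
  qed
  have 2: "(\<Sum>k\<in>Y. f k) = (\<Sum>\<beta>\<in>UNIV. of_nat (card {k\<in>Y. f k = \<beta>}) * \<beta>)" if "Y \<subseteq> I" for Y
  proof -
    have "finite Y" using that I finite_subset by blast
    then have "(\<Sum>\<beta>\<in>UNIV. \<Sum>k\<in>{k\<in>Y. f k = \<beta>}. f k) = (\<Sum>k\<in>Y. f k)"
      by (intro sum.group) auto
    moreover have "(\<Sum>k\<in>{k\<in>Y. f k = \<beta>}. f k) = of_nat (card {k\<in>Y. f k = \<beta>}) * \<beta>" for \<beta>
      by simp
    ultimately show ?thesis by simp
  qed
  have "{Y. Y \<subseteq> I \<and> card Y = j \<and> (\<Sum>k\<in>Y. f k) = 0} = (\<Union>\<nu>\<in>families j. ?P \<nu>)"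
  proof (intro equalityI subsetI)
    fix Y assume Y: "Y \<in> {Y. Y \<subseteq> I \<and> card Y = j \<and> (\<Sum>k\<in>Y. f k) = 0}"
    then have "(\<lambda>\<beta>. card {k\<in>Y. f k = \<beta>}) \<in> families j"
      using 1[of Y] 2[of Y] by (simp add: families_def)
    then show "Y \<in> (\<Union>\<nu>\<in>families j. ?P \<nu>)" using Y by blast
  next
    fix Y assume "Y \<in> (\<Union>\<nu>\<in>families j. ?P \<nu>)"
    then show "Y \<in> {Y. Y \<subseteq> I \<and> card Y = j \<and> (\<Sum>k\<in>Y. f k) = 0}"
      using 1[of Y] 2[of Y] by (auto simp: families_def)
  qed
  also have "card \<dots> = (\<Sum>\<nu>\<in>families j. card (?P \<nu>))"
  proof (rule card_UN_disjoint)
    show "\<forall>\<nu>\<in>families j. finite (?P \<nu>)"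
      using I by (auto intro: finite_subset[OF _ finite_Pow_iff[THEN iffD2, OF I]])
    show "\<forall>\<nu>\<in>families j. \<forall>\<nu>'\<in>families j. \<nu> \<noteq> \<nu>' \<longrightarrow> ?P \<nu> \<inter> ?P \<nu>' = {}"
      by (auto simp: fun_eq_iff)
  qed (rule finite_families)
  finally show ?thesis unfolding card_profile_subsets[OF I] .
qed

text \<open>Bit vectors correspond to their supports, and the weight is the size of the
  support.\<close>

lemma weight_count_subsets:
  "weight_count gs j
    = card {Y. Y \<subseteq> {..<length gs} \<and> card Y = j \<and> (\<Sum>k\<in>Y. mat_trace (gs ! k)) = 0}"
proof -
  let ?n = "length gs"
  let ?s = "\<lambda>u::bit vec. {k. k < ?n \<and> u $ k = 1}"
  have tr: "(\<Sum>k<?n. if u $ k = 1 then mat_trace (gs ! k) else 0) = (\<Sum>k\<in>?s u. mat_trace (gs ! k))"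
    for u :: "bit vec"
    by (rule sum.mono_neutral_cong_right) auto
  have w: "hamming_weight u = card (?s u)" if "u \<in> carrier_vec ?n" for u
  proof -
    have "dim_vec u = ?n" using that by (rule carrier_vecD)
    then have "{k. k < dim_vec u \<and> u $ k \<noteq> 0} = ?s u"
      using bit_not_zero_iff by (metis (no_types, lifting))
    then show ?thesis unfolding hamming_weight_def by (rule arg_cong)
  qed
  have "bij_betw ?s {u \<in> trace_code gs. hamming_weight u = j}
     {Y. Y \<subseteq> {..<?n} \<and> card Y = j \<and> (\<Sum>k\<in>Y. mat_trace (gs ! k)) = 0}"
  proof (rule bij_betw_byWitness[where f' = "\<lambda>Y. vec ?n (\<lambda>k. if k \<in> Y then 1 else 0)"])
    show "\<forall>u\<in>{u \<in> trace_code gs. hamming_weight u = j}. vec ?n (\<lambda>k. if k \<in> ?s u then 1 else 0) = u"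
      by (auto simp: trace_code_def intro!: eq_vecI)
    have *: "?s (vec ?n (\<lambda>k. if k \<in> Y then 1 else 0)) = Y" if "Y \<subseteq> {..<?n}" for Y
      using that by (auto split: if_splits)
    then show "\<forall>Y\<in>{Y. Y \<subseteq> {..<?n} \<and> card Y = j \<and> (\<Sum>k\<in>Y. mat_trace (gs ! k)) = 0}.
        ?s (vec ?n (\<lambda>k. if k \<in> Y then 1 else 0)) = Y" by blast
    show "?s ` {u \<in> trace_code gs. hamming_weight u = j}
        \<subseteq> {Y. Y \<subseteq> {..<?n} \<and> card Y = j \<and> (\<Sum>k\<in>Y. mat_trace (gs ! k)) = 0}"
    proof clarify
      fix u assume "u \<in> trace_code gs"
      then have "u \<in> carrier_vec ?n" "(\<Sum>k\<in>?s u. mat_trace (gs ! k)) = 0"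
        unfolding trace_code_def tr by auto
      then show "?s u \<subseteq> {..<?n} \<and> card (?s u) = hamming_weight u \<and> (\<Sum>k\<in>?s u. mat_trace (gs ! k)) = 0"
        using w[of u] by auto
    qed
    show "(\<lambda>Y. vec ?n (\<lambda>k. if k \<in> Y then 1 else 0)) `
        {Y. Y \<subseteq> {..<?n} \<and> card Y = j \<and> (\<Sum>k\<in>Y. mat_trace (gs ! k)) = 0}
        \<subseteq> {u \<in> trace_code gs. hamming_weight u = j}"
    proof clarify
      fix Y assume Y: "Y \<subseteq> {..<?n}" "(\<Sum>k\<in>Y. mat_trace (gs ! k)) = 0" "j = card Y"
      let ?u = "vec ?n (\<lambda>k. if k \<in> Y then 1 else 0) :: bit vec"
      have s: "?s ?u = Y" using *[OF Y(1)] .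
      have c: "?u \<in> carrier_vec ?n" by simp
      show "?u \<in> trace_code gs \<and> hamming_weight ?u = card Y"
        unfolding trace_code_def mem_Collect_eq tr w[OF c] s using c Y(2) by blast
    qed
  qed
  then show ?thesis unfolding weight_count_def by (rule bij_betw_same_card)
qed

lemma binom_of_nat: "binom (real n) k = real (n choose k)"
  by (simp add: binom_def binomial_gbinomial[symmetric] binomial_eq_0)

text \<open>Only the fibre sizes of the trace enter, so every ordering of the set gives the same
  count. The upper arguments are cardinalities, where the real binomial coefficient is the ordinary
  one.\<close>

lemma weight_count_eq:
  fixes gs :: "'a::{field,finite} mat list"
  assumes "distinct gs"
  shows "real (weight_count gs j)
    = (\<Sum>\<nu>\<in>families j. \<Prod>\<beta>\<in>UNIV. binom (real (card {g \<in> set gs. mat_trace g = \<beta>})) (\<nu> \<beta>))"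
proof -
  have "card {k\<in>{..<length gs}. mat_trace (gs ! k) = \<beta>} = card {g \<in> set gs. mat_trace g = \<beta>}" for \<beta>
  proof (rule bij_betw_same_card[of "(!) gs"])
    show "bij_betw ((!) gs) {k\<in>{..<length gs}. mat_trace (gs ! k) = \<beta>} {g \<in> set gs. mat_trace g = \<beta>}"
      using assms by (auto simp: bij_betw_def inj_on_def nth_eq_iff_index_eq in_set_conv_nth)
  qed
  then show ?thesis
    unfolding weight_count_subsets card_zero_sum_subsets[OF finite_lessThan] binom_of_nat by simp
qed

section \<open>Nonsingular and symmetric matrices\<close>

lemma card_mat_supported:
  assumes E: "E \<subseteq> {..<m} \<times> {..<n}"
  shows "card {A \<in> carrier_mat m n. \<forall>i<m. \<forall>j<n. (i, j) \<notin> E \<longrightarrow> A $$ (i, j) = (0::'a::{finite,zero})}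
    = CARD('a) ^ card E" (is "card ?S = _")
proof -
  have fin: "finite E" using E finite_subset by blast
  have "bij_betw (\<lambda>A. restrict (\<lambda>ij. A $$ ij) E) ?S (PiE E (\<lambda>_. UNIV))"
    using E
    by (intro bij_betw_byWitness[where f' = "\<lambda>f. mat m n (\<lambda>ij. if ij \<in> E then f ij else 0)"])
       (auto intro!: eq_matI simp: PiE_iff extensional_def fun_eq_iff)
  then have "card ?S = card (PiE E (\<lambda>_. UNIV :: 'a set))" by (rule bij_betw_same_card)
  also have "\<dots> = CARD('a) ^ card E" using fin by (simp add: card_PiE)
  finally show ?thesis .
qed

lemma card_carrier_mat: "card (carrier_mat m n :: 'a::{finite,zero} mat set) = CARD('a) ^ (m * n)"
proof -
  have "carrier_mat m n = {A \<in> carrier_mat m n. \<forall>i<m. \<forall>j<n. (i, j) \<notin> {..<m} \<times> {..<n} \<longrightarrow> A $$ (i, j) = (0::'a)}"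
    by auto
  then show ?thesis using card_mat_supported[of "{..<m} \<times> {..<n}" m n, where 'a = 'a]
    by (simp add: card_cartesian_product)
qed

lemma finite_carrier_mat [simp]: "finite (carrier_mat m n :: 'a::{finite,zero} mat set)"
proof -
  have "card (carrier_mat m n :: 'a mat set) \<noteq> 0" unfolding card_carrier_mat by simp
  then show ?thesis by (metis card.infinite)
qed

lemma card_carrier_vec: "card (carrier_vec n :: 'a::{finite,zero} vec set) = CARD('a) ^ n"
proof -
  have "bij_betw (\<lambda>v. mat n 1 (\<lambda>(i, j). v $ i)) (carrier_vec n :: 'a vec set) (carrier_mat n 1)"
    by (intro bij_betw_byWitness[where f' = "\<lambda>A. vec n (\<lambda>i. A $$ (i, 0))"]) (auto intro!: eq_matI)
  then show ?thesis using bij_betw_same_card card_carrier_mat[of n 1, where 'a = 'a] by fastforce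
qed

lemma finite_carrier_vec [simp]: "finite (carrier_vec n :: 'a::{finite,zero} vec set)"
proof -
  have "card (carrier_vec n :: 'a vec set) \<noteq> 0" unfolding card_carrier_vec by simp
  then show ?thesis by (metis card.infinite)
qed

definition GL :: "nat \<Rightarrow> 'a::field mat set" where
  "GL n = {A \<in> carrier_mat n n. det A \<noteq> 0}"

definition sym_GL :: "nat \<Rightarrow> 'a::field mat set" where
  "sym_GL n = {A \<in> GL n. A\<^sup>T = A}"

text \<open>The adjugate formula makes inversion a total function, meaningful on
  \<open>GL n\<close>.\<close>

definition minv :: "'a::field mat \<Rightarrow> 'a mat" where
  "minv A = (1 / det A) \<cdot>\<^sub>m adj_mat A"

lemma GL_carrier: "A \<in> GL n \<Longrightarrow> A \<in> carrier_mat n n"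
  by (simp add: GL_def)

lemma finite_GL [simp]: "finite (GL n :: 'a::{field,finite} mat set)"
  by (simp add: GL_def)

lemma finite_sym_GL [simp]: "finite (sym_GL n :: 'a::{field,finite} mat set)"
  by (simp add: sym_GL_def)

lemma minv:
  assumes "A \<in> GL n"
  shows "minv A \<in> carrier_mat n n" "A * minv A = 1\<^sub>m n" "minv A * A = 1\<^sub>m n"
proof -
  have A: "A \<in> carrier_mat n n" "det A \<noteq> 0" using assms by (auto simp: GL_def)
  note adj = adj_mat[OF A(1)]
  show "minv A \<in> carrier_mat n n" using adj(1) by (simp add: minv_def)
  show "A * minv A = 1\<^sub>m n" "minv A * A = 1\<^sub>m n"
    using A adj by (auto simp: minv_def mult_smult_distrib[OF A(1) adj(1)]
        mult_smult_assoc_mat[OF adj(1) A(1)] intro!: eq_matI)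
qed

lemma GL_I:
  assumes "A \<in> carrier_mat n n" "B \<in> carrier_mat n n" "A * B = 1\<^sub>m n"
  shows "A \<in> GL n" "minv A = (B :: 'a::field mat)"
proof -
  have "det A * det B = 1" using det_mult[OF assms(1,2)] assms(3) by simp
  then show A: "A \<in> GL n" using assms by (auto simp: GL_def)
  have "minv A = minv A * (A * B)" using assms minv[OF A] by simp
  also have "\<dots> = (minv A * A) * B" using assoc_mult_mat[OF minv(1)[OF A] assms(1,2)] by simp
  also have "\<dots> = B" using assms minv[OF A] by simp
  finally show "minv A = B" .
qed

lemma GL_mult: "A \<in> GL n \<Longrightarrow> B \<in> GL n \<Longrightarrow> A * B \<in> GL n"
  by (auto simp: GL_def det_mult[of A n B])

lemma GL_minv: "A \<in> GL n \<Longrightarrow> minv A \<in> GL n"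
  using minv[of A n] GL_I(1)[of "minv A" n A] GL_carrier by blast

lemma GL_transpose: "A \<in> GL n \<Longrightarrow> A\<^sup>T \<in> GL n"
  by (auto simp: GL_def det_transpose)

lemma minv_transpose: "A \<in> GL n \<Longrightarrow> minv (A\<^sup>T) = (minv A)\<^sup>T"
  using minv[of A n] GL_carrier[of A n]
  by (intro GL_I(2)[of _ n]) (auto simp: transpose_mult[of "minv A" n n A n, symmetric])

lemma minv_mult_cancel:
  assumes "A \<in> GL n" "B \<in> carrier_mat n m"
  shows "A * (minv A * B) = B" "minv A * (A * B) = B"
  using assms minv[OF assms(1)] GL_carrier[OF assms(1)]
  by (simp_all add: assoc_mult_mat[of _ n n _ n B m, symmetric])

lemma mult_unit_vec:
  assumes "A \<in> carrier_mat m n" "i < n"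
  shows "(A :: 'a::field mat) *\<^sub>v unit_vec n i = col A i"
  using assms by (auto intro!: eq_vecI)

text \<open>T inverts the identity matrix with column i replaced by v, so it carries v to the i-th
  unit vector; a row swap moves this to position t. Rows at zero entries of v stay untouched, which
  later lets a congruence fix the first coordinate.\<close>

lemma ex_GL_to_unit_vec:
  fixes v :: "'a::field vec"
  assumes v: "v \<in> carrier_vec n" "i < n" "v $ i \<noteq> 0" and t: "t < n"
  shows "\<exists>P\<in>GL n. P *\<^sub>v v = unit_vec n t \<and>
    (\<forall>j<n. v $ j = 0 \<longrightarrow> j \<noteq> t \<longrightarrow> row P j = unit_vec n j)"
proof -
  define U where "U = mat n n (\<lambda>(a, c). if c = i then v $ a else if a = c then 1 else (0::'a))"
  define T where "T = mat n n (\<lambda>(a, c). if c = i then (if a = i then 1 / v $ i else - v $ a / v $ i)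
      else if a = c then 1 else (0::'a))"
  have c: "U \<in> carrier_mat n n" "T \<in> carrier_mat n n" by (auto simp: U_def T_def)
  have UT: "U * T = 1\<^sub>m n"
  proof (rule eq_matI)
    fix a b assume ab: "a < dim_row (1\<^sub>m n)" "b < dim_col (1\<^sub>m n)"
    have "(U * T) $$ (a, b) = (\<Sum>l<n. U $$ (a, l) * T $$ (l, b))"
      using ab c by (simp add: scalar_prod_def atLeast0LessThan)
    also have "\<dots> = U $$ (a, i) * T $$ (i, b) + (\<Sum>l\<in>{..<n} - {i}. U $$ (a, l) * T $$ (l, b))"
      using v(2) by (subst sum.remove[of _ i]) auto
    also have "(\<Sum>l\<in>{..<n} - {i}. U $$ (a, l) * T $$ (l, b))
        = (\<Sum>l\<in>{..<n} - {i}. if l = a then T $$ (a, b) else 0)"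
      using ab by (intro sum.cong) (auto simp: U_def)
    also have "\<dots> = (if a = i then 0 else T $$ (a, b))"
      using ab by (simp add: sum.delta)
    finally show "(U * T) $$ (a, b) = 1\<^sub>m n $$ (a, b)"
      using ab v by (auto simp: U_def T_def)
  qed (use c in auto)
  have TG: "T \<in> GL n" using GL_I(1)[OF c(2,1) mat_mult_left_right_inverse[OF c UT]] .
  have Tv: "T *\<^sub>v v = unit_vec n i"
  proof -
    have "v = U *\<^sub>v unit_vec n i"
      using v c by (subst mult_unit_vec[OF c(1) v(2)]) (auto simp: U_def intro!: eq_vecI)
    then have "T *\<^sub>v v = (T * U) *\<^sub>v unit_vec n i"
      using c by (simp add: assoc_mult_mat_vec[of T n n U n])
    then show ?thesis using mat_mult_left_right_inverse[OF c UT] by simp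
  qed
  have Trow: "row T j = unit_vec n j" if "j < n" "v $ j = 0" "j \<noteq> i" for j
    using that v by (intro eq_vecI) (auto simp: T_def)
  define W where "W = (if i = t then 1\<^sub>m n else swaprows_mat n i t :: 'a mat)"
  have Wc: "W \<in> carrier_mat n n" by (auto simp: W_def swaprows_mat_def)
  have WG: "W \<in> GL n" using v t det_swaprows_mat[of i n t, where 'a = 'a]
    by (auto simp: GL_def W_def swaprows_mat_def)
  have Wv: "W *\<^sub>v unit_vec n i = unit_vec n t"
    unfolding mult_unit_vec[OF Wc v(2)]
    using v t by (auto simp: W_def swaprows_mat_def intro!: eq_vecI)
  have Wrow: "row W j = unit_vec n j" if "j < n" "j \<noteq> i" "j \<noteq> t" for j
    using that v t by (auto simp: W_def swaprows_mat_def intro!: eq_vecI)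
  have row_unit: "row (W * T) j = row T j" if "j < n" "j \<noteq> i" "j \<noteq> t" for j
  proof (rule eq_vecI)
    fix k assume k: "k < dim_vec (row T j)"
    then have "row (W * T) j $ k = unit_vec n j \<bullet> col T k"
      using that c Wc Wrow[OF that] by simp
    then show "row (W * T) j $ k = row T j $ k" using that k c by simp
  qed (use c Wc in auto)
  have "(W * T) *\<^sub>v v = unit_vec n t"
    using Wc c v(1) Tv Wv by (simp add: assoc_mult_mat_vec[of W n n T n v])
  moreover have "row (W * T) j = unit_vec n j" if "j < n" "v $ j = 0" "j \<noteq> t" for j
    using that row_unit[of j] Trow[of j] v(3) by (cases "j = i") auto
  ultimately show ?thesis using GL_mult[OF WG TG] by blast
qed

lemma ex_nonzero_entry: "v \<in> carrier_vec n \<Longrightarrow> v \<noteq> 0\<^sub>v n \<Longrightarrow> \<exists>i<n. v $ i \<noteq> 0"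
  by (metis carrier_vecD eq_vecI index_zero_vec)

lemma split_mat:
  assumes "A \<in> carrier_mat (n1 + n2) (m1 + m2)"
  obtains A1 A2 A3 A4 where "A1 \<in> carrier_mat n1 m1" "A2 \<in> carrier_mat n1 m2"
    "A3 \<in> carrier_mat n2 m1" "A4 \<in> carrier_mat n2 m2" "A = four_block_mat A1 A2 A3 A4"
proof -
  obtain A1 A2 A3 A4 where "split_block A n1 m1 = (A1, A2, A3, A4)" by (metis prod_cases4)
  from split_block[OF this, of n2 m2] show thesis using assms that by auto
qed

lemma four_block_mat_eqD:
  assumes "four_block_mat A B C D = four_block_mat A' B' C' D'"
    and c: "A \<in> carrier_mat n1 m1" "B \<in> carrier_mat n1 m2" "C \<in> carrier_mat n2 m1" "D \<in> carrier_mat n2 m2"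
      "A' \<in> carrier_mat n1 m1" "B' \<in> carrier_mat n1 m2" "C' \<in> carrier_mat n2 m1" "D' \<in> carrier_mat n2 m2"
  shows "A = A'" "B = B'" "C = C'" "D = D'"
proof -
  have e: "four_block_mat A B C D $$ (i, j) = four_block_mat A' B' C' D' $$ (i, j)" for i j
    using assms(1) by simp
  show "A = A'"
  proof (rule eq_matI)
    fix i j assume "i < dim_row A'" "j < dim_col A'"
    then show "A $$ (i, j) = A' $$ (i, j)" using e[of i j] c by simp
  qed (use c in auto)
  show "B = B'"
  proof (rule eq_matI)
    fix i j assume "i < dim_row B'" "j < dim_col B'"
    then show "B $$ (i, j) = B' $$ (i, j)" using e[of i "j + m1"] c by simp
  qed (use c in auto)
  show "C = C'"
  proof (rule eq_matI)
    fix i j assume "i < dim_row C'" "j < dim_col C'"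
    then show "C $$ (i, j) = C' $$ (i, j)" using e[of "i + n1" j] c by simp
  qed (use c in auto)
  show "D = D'"
  proof (rule eq_matI)
    fix i j assume "i < dim_row D'" "j < dim_col D'"
    then show "D $$ (i, j) = D' $$ (i, j)" using e[of "i + n1" "j + m1"] c by simp
  qed (use c in auto)
qed

text \<open>Left multiplication carries v to the first unit vector. Matrices with that first column
  have a free row beside the corner and a nonsingular block below it.\<close>

lemma card_GL_first_col:
  fixes v :: "'a::{field,finite} vec"
  assumes v: "v \<in> carrier_vec (Suc k)" "v \<noteq> 0\<^sub>v (Suc k)"
  shows "card {A \<in> GL (Suc k). col A 0 = v} = CARD('a) ^ k * card (GL k :: 'a mat set)"
proof -
  let ?n = "Suc k"
  obtain i where "i < ?n" "v $ i \<noteq> 0" using ex_nonzero_entry[OF v] by blast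
  then obtain P where P: "P \<in> GL ?n" "P *\<^sub>v v = unit_vec ?n 0"
    using ex_GL_to_unit_vec[OF v(1), of i 0] by auto
  note Pc = GL_carrier[OF P(1)] note Pi = minv[OF P(1)]
  have col_mult: "col (M * A) 0 = M *\<^sub>v col A 0" if "M \<in> carrier_mat ?n ?n" "A \<in> carrier_mat ?n ?n"
    for M A :: "'a mat" using that by auto
  have Pv: "minv P *\<^sub>v unit_vec ?n 0 = v"
    using Pi Pc v P(2) by (metis assoc_mult_mat_vec one_mult_mat_vec)
  have "bij_betw (\<lambda>A. P * A) {A \<in> GL ?n. col A 0 = v} {A \<in> GL ?n. col A 0 = unit_vec ?n 0}"
    using P Pv GL_mult[OF P(1)] GL_mult[OF GL_minv[OF P(1)]]
      minv_mult_cancel[OF P(1), of _ ?n] col_mult[OF Pc] col_mult[OF Pi(1)]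
    by (intro bij_betw_byWitness[where f' = "\<lambda>A. minv P * A"]) (auto dest: GL_carrier)
  then have "card {A \<in> GL ?n. col A 0 = v} = card {A \<in> GL ?n. col A 0 = (unit_vec ?n 0 :: 'a vec)}"
    by (rule bij_betw_same_card)
  also have "\<dots> = card ((carrier_mat 1 k :: 'a mat set) \<times> (GL k :: 'a mat set))"
  proof (rule bij_betw_same_card[symmetric])
    let ?f = "\<lambda>(b, D). four_block_mat (1\<^sub>m 1) b (0\<^sub>m k 1) D :: 'a mat"
    show "bij_betw ?f (carrier_mat 1 k \<times> GL k) {A \<in> GL ?n. col A 0 = unit_vec ?n 0}"
      unfolding bij_betw_def
    proof
      show "inj_on ?f (carrier_mat 1 k \<times> GL k)"
      proof (rule inj_onI, clarify)
        fix b D b' D' assume "b \<in> carrier_mat 1 k" "D \<in> GL k" "b' \<in> carrier_mat 1 k" "D' \<in> GL k"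
          and eq: "four_block_mat (1\<^sub>m 1) b (0\<^sub>m k 1) D = four_block_mat (1\<^sub>m 1) b' (0\<^sub>m k 1) (D' :: 'a mat)"
        then show "b = b' \<and> D = D'"
          using four_block_mat_eqD[OF eq, of 1 1 k k] by (auto dest: GL_carrier)
      qed
      have d: "det (four_block_mat (1\<^sub>m 1) b (0\<^sub>m k 1) D) = det D"
        if "b \<in> carrier_mat 1 k" "D \<in> carrier_mat k k" for b D :: "'a mat"
        using det_four_block_mat_lower_left_zero[of "1\<^sub>m 1" 1 b k "0\<^sub>m k 1" D] that by simp
      show "?f ` (carrier_mat 1 k \<times> GL k) = {A \<in> GL ?n. col A 0 = unit_vec ?n 0}"
      proof (intro equalityI subsetI)
        fix A assume "A \<in> ?f ` (carrier_mat 1 k \<times> GL k)"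
        then obtain b D where bD: "b \<in> carrier_mat 1 k" "D \<in> GL k"
          "A = four_block_mat (1\<^sub>m 1) b (0\<^sub>m k 1) D" by auto
        note Dc = GL_carrier[OF bD(2)]
        have Ac: "A \<in> carrier_mat (1 + k) (1 + k)" unfolding bD(3) by (rule four_block_carrier_mat[OF one_carrier_mat Dc])
        then have "A \<in> GL ?n" using d[OF bD(1) Dc] bD by (simp add: GL_def)
        moreover have "col A 0 = unit_vec ?n 0"
          using Dc by (intro eq_vecI) (auto simp: bD(3) unit_vec_def)
        ultimately show "A \<in> {A \<in> GL ?n. col A 0 = unit_vec ?n 0}" by simp
      next
        fix A :: "'a mat" assume "A \<in> {A \<in> GL ?n. col A 0 = unit_vec ?n 0}"
        then have A: "A \<in> GL ?n" "col A 0 = unit_vec ?n 0" by auto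
        then have "A \<in> carrier_mat (1 + k) (1 + k)" by (simp add: GL_def)
        then obtain A1 b A3 D where s: "A1 \<in> carrier_mat 1 1" "b \<in> carrier_mat 1 k"
          "A3 \<in> carrier_mat k 1" "D \<in> carrier_mat k k" "A = four_block_mat A1 b A3 D"
          by (rule split_mat)
        have e: "A $$ (i, 0) = (if i = 0 then 1 else 0)" if "i < ?n" for i
        proof -
          have "col A 0 $ i = unit_vec ?n 0 $ i" using A(2) by simp
          then show ?thesis using that GL_carrier[OF A(1)] by (auto split: if_splits)
        qed
        have "A1 = 1\<^sub>m 1"
        proof (rule eq_matI)
          fix i j assume "i < dim_row (1\<^sub>m 1)" "j < dim_col (1\<^sub>m 1)"
          then show "A1 $$ (i, j) = 1\<^sub>m 1 $$ (i, j)" using e[of 0] s by simp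
        qed (use s in auto)
        moreover have "A3 = 0\<^sub>m k 1"
        proof (rule eq_matI)
          fix i j assume "i < dim_row (0\<^sub>m k 1)" "j < dim_col (0\<^sub>m k 1)"
          then show "A3 $$ (i, j) = 0\<^sub>m k 1 $$ (i, j)" using e[of "Suc i"] s by simp
        qed (use s in auto)
        ultimately have "A = ?f (b, D)" using s by simp
        moreover have "D \<in> GL k" using A(1) d[OF s(2,4)] s(4) calculation by (simp add: GL_def)
        ultimately show "A \<in> ?f ` (carrier_mat 1 k \<times> GL k)" using s(2) by blast
      qed
    qed
  qed
  also have "\<dots> = CARD('a) ^ k * card (GL k :: 'a mat set)"
    by (simp add: card_cartesian_product card_carrier_mat)
  finally show ?thesis .
qed

lemma card_GL_0: "card (GL 0 :: 'a::field mat set) = 1"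
proof -
  have "(GL 0 :: 'a mat set) = {1\<^sub>m 0}" by (auto simp: GL_def intro!: eq_matI)
  then show ?thesis by simp
qed

lemma card_GL_Suc:
  "card (GL (Suc k) :: 'a::{field,finite} mat set)
    = (CARD('a) ^ Suc k - 1) * CARD('a) ^ k * card (GL k :: 'a mat set)"
proof -
  let ?n = "Suc k" and ?V = "carrier_vec (Suc k) - {0\<^sub>v (Suc k)} :: 'a vec set"
  have "GL ?n = (\<Union>v\<in>?V. {A \<in> GL ?n. col A 0 = (v :: 'a vec)})"
  proof -
    have "col A 0 \<in> ?V" if A: "A \<in> GL ?n" for A :: "'a mat"
    proof -
      have Ac: "A \<in> carrier_mat ?n ?n" using A by (rule GL_carrier)
      have "col A 0 \<noteq> 0\<^sub>v ?n"
      proof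
        assume z: "col A 0 = 0\<^sub>v ?n"
        have "unit_vec ?n 0 = (minv A * A) *\<^sub>v unit_vec ?n 0" using minv[OF A] by simp
        also have "\<dots> = minv A *\<^sub>v col A 0"
          using assoc_mult_mat_vec[OF minv(1)[OF A] Ac unit_vec_carrier, of 0] mult_unit_vec[OF Ac, of 0]
          by simp
        also have "\<dots> = 0\<^sub>v ?n" unfolding z using minv(1)[OF A] by (intro eq_vecI) auto
        finally have "unit_vec ?n 0 $ 0 = (0\<^sub>v ?n $ 0 :: 'a)" by simp
        then show False by simp
      qed
      then show ?thesis using Ac by (auto intro!: carrier_vecI)
    qed
    then show ?thesis by auto
  qed
  then have "card (GL ?n :: 'a mat set) = (\<Sum>v\<in>?V. card {A \<in> GL ?n. col A 0 = v})"
    by (subst card_UN_disjoint[symmetric]) auto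
  also have "\<dots> = card ?V * (CARD('a) ^ k * card (GL k :: 'a mat set))"
    by (simp add: card_GL_first_col)
  also have "card ?V = CARD('a) ^ Suc k - 1" by (simp add: card_Diff_subset card_carrier_vec)
  finally show ?thesis by (simp add: mult.assoc)
qed

section \<open>Counting nonsingular symmetric matrices by pivots\<close>

lemma det_schur:
  fixes A :: "'a::field mat"
  assumes A: "A \<in> carrier_mat p p" "C \<in> carrier_mat p p" "C * A = 1\<^sub>m p"
    and B: "B \<in> carrier_mat p k" "E \<in> carrier_mat k p" "D \<in> carrier_mat k k"
  shows "det (four_block_mat A B E (E * C * B + D)) = det A * det D"
proof -
  let ?L = "four_block_mat (1\<^sub>m p) (0\<^sub>m p k) (E * C) (1\<^sub>m k)"
  let ?R = "four_block_mat A B (0\<^sub>m k p) D"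
  have "?L * ?R = four_block_mat A B E (E * C * B + D)"
  proof -
    have "?L * ?R = four_block_mat (1\<^sub>m p * A + 0\<^sub>m p k * 0\<^sub>m k p) (1\<^sub>m p * B + 0\<^sub>m p k * D)
        (E * C * A + 1\<^sub>m k * 0\<^sub>m k p) (E * C * B + 1\<^sub>m k * D)"
      using A B by (intro mult_four_block_mat) auto
    moreover have "E * C * A = E" using A B by (simp add: assoc_mult_mat[of E k p C p A p])
    ultimately show ?thesis using A B by simp
  qed
  moreover have "det (?L * ?R) = det ?L * det ?R"
    using A B by (intro det_mult[of _ "p + k"]) auto
  moreover have "det ?L = 1"
    using det_four_block_mat_upper_right_zero[of "1\<^sub>m p" p "0\<^sub>m p k" k "E * C" "1\<^sub>m k"] A B by simp
  moreover have "det ?R = det A * det D"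
    using det_four_block_mat_lower_left_zero[of A p B k "0\<^sub>m k p" D] A B by simp
  ultimately show ?thesis by simp
qed

lemma transpose_quad:
  assumes "C \<in> carrier_mat p p" "B \<in> carrier_mat p k" "C\<^sup>T = C"
  shows "(B\<^sup>T * C * B)\<^sup>T = B\<^sup>T * C * (B :: 'a::comm_ring_1 mat)"
proof -
  have "(B\<^sup>T * C * B)\<^sup>T = B\<^sup>T * (B\<^sup>T * C)\<^sup>T" using assms by (intro transpose_mult) auto
  also have "(B\<^sup>T * C)\<^sup>T = C * B" using assms transpose_mult[of "B\<^sup>T" k p C p] by simp
  finally show ?thesis using assms by (simp add: assoc_mult_mat[of _ k p C p B k])
qed

lemma sym_four_block:
  assumes "S \<in> carrier_mat (p + k) (p + k)" "S\<^sup>T = S"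
  obtains A B D where "A \<in> carrier_mat p p" "B \<in> carrier_mat p k" "D \<in> carrier_mat k k"
    "A\<^sup>T = A" "D\<^sup>T = D" "S = four_block_mat A B B\<^sup>T D"
proof -
  obtain A B E D where s: "A \<in> carrier_mat p p" "B \<in> carrier_mat p k"
    "E \<in> carrier_mat k p" "D \<in> carrier_mat k k" "S = four_block_mat A B E D"
    using split_mat[OF assms(1)] by metis
  have eq: "four_block_mat A\<^sup>T E\<^sup>T B\<^sup>T D\<^sup>T = four_block_mat A B E D"
    using assms(2) s transpose_four_block_mat[OF s(1-4)] by simp
  show thesis
    using that[of A B D] s four_block_mat_eqD[OF eq, of p p k k] by simp
qed

text \<open>The Schur complement of the nonsingular corner A ranges freely over
  \<open>sym_GL k\<close>, whatever the off-diagonal block B. Restricting B to a set allows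
  conditions on the first column.\<close>

lemma card_sym_GL_block:
  fixes A :: "'a::{field,finite} mat"
  assumes A: "A \<in> sym_GL p" and B: "\<B> \<subseteq> carrier_mat p k"
  shows "card {S \<in> sym_GL (p + k). \<exists>B\<in>\<B>. \<exists>D\<in>carrier_mat k k. S = four_block_mat A B B\<^sup>T D}
    = card \<B> * card (sym_GL k :: 'a mat set)"
proof -
  let ?C = "minv A"
  have AG: "A \<in> GL p" "A\<^sup>T = A" using A by (auto simp: sym_GL_def)
  note Ac = GL_carrier[OF AG(1)] note C = minv[OF AG(1)]
  have Csym: "?C\<^sup>T = ?C" using minv_transpose[OF AG(1)] AG by simp
  let ?f = "\<lambda>(B, D). four_block_mat A B B\<^sup>T (B\<^sup>T * ?C * B + D)"
  let ?T = "{S \<in> sym_GL (p + k). \<exists>B\<in>\<B>. \<exists>D\<in>carrier_mat k k. S = four_block_mat A B B\<^sup>T D}"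
  have dA: "det A \<noteq> 0" using AG by (simp add: GL_def)
  have Q: "B\<^sup>T * ?C * B \<in> carrier_mat k k" if "B \<in> \<B>" for B using that B C by auto
  have det: "det (four_block_mat A B B\<^sup>T (B\<^sup>T * ?C * B + D)) = det A * det D"
    if "B \<in> \<B>" "D \<in> carrier_mat k k" for B D
    using that B Ac C by (intro det_schur) auto
  have "bij_betw ?f (\<B> \<times> sym_GL k) ?T"
    unfolding bij_betw_def
  proof
    show "inj_on ?f (\<B> \<times> sym_GL k)"
    proof (rule inj_onI, clarify)
      fix B D B' D' assume h: "B \<in> \<B>" "D \<in> sym_GL k" "B' \<in> \<B>" "D' \<in> sym_GL k"
        and eq: "four_block_mat A B B\<^sup>T (B\<^sup>T * ?C * B + D) = four_block_mat A B' B'\<^sup>T (B'\<^sup>T * ?C * B' + D')"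
      have c: "B \<in> carrier_mat p k" "B' \<in> carrier_mat p k" "D \<in> carrier_mat k k" "D' \<in> carrier_mat k k"
        using h B by (auto simp: sym_GL_def GL_def)
      have BB: "B = B'" and DD: "B\<^sup>T * ?C * B + D = B'\<^sup>T * ?C * B' + D'"
        using four_block_mat_eqD[OF eq, of p p k k] c Ac Q h by auto
      have "D = D'"
      proof (rule eq_matI)
        fix i j assume ij: "i < dim_row D'" "j < dim_col D'"
        have "(B\<^sup>T * ?C * B + D) $$ (i, j) = (B\<^sup>T * ?C * B + D') $$ (i, j)" using DD BB by simp
        then show "D $$ (i, j) = D' $$ (i, j)" using ij c by simp
      qed (use c in auto)
      then show "B = B' \<and> D = D'" using BB by simp
    qed
    show "?f ` (\<B> \<times> sym_GL k) = ?T"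
    proof (intro equalityI subsetI)
      fix S assume "S \<in> ?f ` (\<B> \<times> sym_GL k)"
      then obtain B' D where h: "B' \<in> \<B>" "D \<in> sym_GL k"
        "S = four_block_mat A B' B'\<^sup>T (B'\<^sup>T * ?C * B' + D)" by auto
      have c: "B' \<in> carrier_mat p k" "D \<in> carrier_mat k k" "D\<^sup>T = D" "det D \<noteq> 0"
        using h B by (auto simp: sym_GL_def GL_def)
      have "(B'\<^sup>T * ?C * B' + D)\<^sup>T = B'\<^sup>T * ?C * B' + D"
        using transpose_add[OF Q[OF h(1)] c(2)] transpose_quad[OF C(1) c(1) Csym] c by simp
      then have "S\<^sup>T = S"
        using transpose_four_block_mat[of A p p B' k "B'\<^sup>T" k "B'\<^sup>T * ?C * B' + D"] c Ac Q[OF h(1)] AG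
        by (simp add: h(3))
      then have "S \<in> sym_GL (p + k)"
        using det[OF h(1) c(2)] dA c Ac Q[OF h(1)] by (simp add: sym_GL_def GL_def h(3))
      moreover have "B'\<^sup>T * ?C * B' + D \<in> carrier_mat k k" using Q[OF h(1)] c by simp
      ultimately show "S \<in> ?T" using h(1,3) by blast
    next
      fix S assume "S \<in> ?T"
      then obtain B' E where h: "S \<in> sym_GL (p + k)" "B' \<in> \<B>" "E \<in> carrier_mat k k"
        "S = four_block_mat A B' B'\<^sup>T E" by auto
      have c: "B' \<in> carrier_mat p k" using h B by auto
      note q = Q[OF h(2)]
      define D where "D = E - B'\<^sup>T * ?C * B'"
      have Dc: "D \<in> carrier_mat k k" unfolding D_def using q by (rule minus_carrier_mat)
      have ED: "E = B'\<^sup>T * ?C * B' + D" unfolding D_def using h(3) q by (intro eq_matI) auto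
      have "S\<^sup>T = S" using h(1) by (simp add: sym_GL_def)
      then have eq: "four_block_mat A\<^sup>T (B'\<^sup>T)\<^sup>T B'\<^sup>T E\<^sup>T = four_block_mat A B' B'\<^sup>T E"
        using transpose_four_block_mat[of A p p B' k "B'\<^sup>T" k E] c Ac h by simp
      have "E\<^sup>T = E" using four_block_mat_eqD(4)[OF eq, of p p k k] c Ac h by simp
      then have "D\<^sup>T = D"
        unfolding D_def using transpose_minus[OF h(3) q] transpose_quad[OF C(1) c Csym] by simp
      moreover have "det D \<noteq> 0"
        using det[OF h(2) Dc] h(1) unfolding h(4) ED by (auto simp: sym_GL_def GL_def)
      ultimately have "D \<in> sym_GL k" using Dc by (simp add: sym_GL_def GL_def)
      then show "S \<in> ?f ` (\<B> \<times> sym_GL k)" using h ED by (auto intro!: image_eqI[of _ _ "(B', D)"])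
    qed
  qed
  then have "card ?T = card (\<B> \<times> (sym_GL k :: 'a mat set))" by (simp add: bij_betw_same_card)
  then show ?thesis by (simp add: card_cartesian_product)
qed

lemma card_sym_GL_corner:
  assumes "a \<noteq> (0::'a::{field,finite})"
  shows "card {S \<in> sym_GL (Suc k). S $$ (0, 0) = a} = CARD('a) ^ k * card (sym_GL k :: 'a mat set)"
proof -
  let ?A = "mat 1 1 (\<lambda>_. a)"
  have "?A \<in> sym_GL 1"
    using assms by (auto simp: sym_GL_def GL_def det_single intro!: eq_matI)
  from card_sym_GL_block[OF this, of "carrier_mat 1 k" k]
  have "card {S \<in> sym_GL (1 + k). \<exists>B\<in>carrier_mat 1 k. \<exists>D\<in>carrier_mat k k. S = four_block_mat ?A B B\<^sup>T D}
    = CARD('a) ^ k * card (sym_GL k :: 'a mat set)" by (simp add: card_carrier_mat)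
  moreover have "{S \<in> sym_GL (1 + k). \<exists>B\<in>carrier_mat 1 k. \<exists>D\<in>carrier_mat k k. S = four_block_mat ?A B B\<^sup>T D}
    = {S \<in> sym_GL (Suc k). S $$ (0, 0) = a}"
  proof -
    have "(\<exists>B\<in>carrier_mat 1 k. \<exists>D\<in>carrier_mat k k. S = four_block_mat ?A B B\<^sup>T D) \<longleftrightarrow> S $$ (0, 0) = a"
      if S: "S \<in> sym_GL (1 + k)" for S
    proof
      assume a: "S $$ (0, 0) = a"
      have Sc: "S \<in> carrier_mat (1 + k) (1 + k)" "S\<^sup>T = S" using S by (auto simp: sym_GL_def GL_def)
      obtain A B D where s: "A \<in> carrier_mat 1 1" "B \<in> carrier_mat 1 k" "D \<in> carrier_mat k k"
        "S = four_block_mat A B B\<^sup>T D" using sym_four_block[OF Sc] by metis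
      have "A = ?A" using a s by (intro eq_matI) auto
      then show "\<exists>B\<in>carrier_mat 1 k. \<exists>D\<in>carrier_mat k k. S = four_block_mat ?A B B\<^sup>T D" using s by blast
    qed auto
    then show ?thesis by auto
  qed
  ultimately show ?thesis by simp
qed

text \<open>A zero corner cannot serve as pivot, so the leading block with rows (0, 1) and (1, d) is
  used; it is nonsingular for every d. The prescribed column makes the first row of B vanish, which
  leaves q choices for d and q^k for the second row.\<close>

lemma card_sym_GL_unit_col:
  "card {S \<in> sym_GL (Suc (Suc k)). col S 0 = (unit_vec (Suc (Suc k)) 1 :: 'a vec)}
    = CARD('a) ^ Suc k * card (sym_GL k :: 'a::{field,finite} mat set)"
proof -
  let ?n = "Suc (Suc k)"
  let ?A = "\<lambda>d. mat 2 2 (\<lambda>(i, j). if i = 0 \<and> j = 0 then 0 else if i = 1 \<and> j = 1 then d else (1::'a))"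
  let ?B = "{B \<in> carrier_mat 2 k. \<forall>i<2. \<forall>j<k. (i, j) \<notin> {1} \<times> {..<k} \<longrightarrow> B $$ (i, j) = (0::'a)}"
  let ?T = "\<lambda>d. {S \<in> sym_GL (2 + k). \<exists>B\<in>?B. \<exists>D\<in>carrier_mat k k. S = four_block_mat (?A d) B B\<^sup>T D}"
  have A: "?A d \<in> sym_GL 2" for d
  proof -
    let ?C = "mat 2 2 (\<lambda>(i, j). if i = 0 \<and> j = 0 then - d else if i = 1 \<and> j = 1 then 0 else (1::'a))"
    have "?A d * ?C = 1\<^sub>m 2"
      by (intro eq_matI) (auto simp: scalar_prod_def numeral_2_eq_2 less_Suc_eq)
    then have "?A d \<in> GL 2" by (intro GL_I(1)[of _ 2 ?C]) auto
    then show ?thesis by (auto simp: sym_GL_def intro!: eq_matI)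
  qed
  have "card ?B = CARD('a) ^ k"
  proof -
    have "{1::nat} \<times> {..<k} \<subseteq> {..<2} \<times> {..<k}" by auto
    from card_mat_supported[OF this, where 'a = 'a] show ?thesis by (simp add: card_cartesian_product)
  qed
  then have cT: "card (?T d) = CARD('a) ^ k * card (sym_GL k :: 'a mat set)" for d
    using card_sym_GL_block[OF A, of ?B k] by auto
  have "{S \<in> sym_GL ?n. col S 0 = (unit_vec ?n 1 :: 'a vec)} = (\<Union>d\<in>UNIV. ?T d)"
  proof (intro equalityI subsetI)
    fix S :: "'a mat" assume "S \<in> {S \<in> sym_GL ?n. col S 0 = unit_vec ?n 1}"
    then have S: "S \<in> sym_GL (2 + k)" "col S 0 = unit_vec ?n 1" by auto
    have Sc: "S \<in> carrier_mat (2 + k) (2 + k)" "S\<^sup>T = S" using S by (auto simp: sym_GL_def GL_def)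
    obtain A B D where s: "A \<in> carrier_mat 2 2" "B \<in> carrier_mat 2 k" "D \<in> carrier_mat k k"
      "A\<^sup>T = A" "S = four_block_mat A B B\<^sup>T D" using sym_four_block[OF Sc] by metis
    have e: "S $$ (i, 0) = (if i = 1 then 1 else 0)" if "i < ?n" for i
    proof -
      have "col S 0 $ i = unit_vec ?n 1 $ i" using S(2) by simp
      then show ?thesis using that Sc by (auto split: if_splits)
    qed
    have At: "A $$ (0, 1) = A $$ (1, 0)"
    proof -
      have "A\<^sup>T $$ (0, 1) = A $$ (1, 0)" using s(1) by simp
      then show ?thesis using s(4) by simp
    qed
    define d where "d = A $$ (1, 1)"
    have Ad: "A = ?A d"
    proof (rule eq_matI)
      fix i j assume "i < dim_row (?A d)" "j < dim_col (?A d)"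
      then have "i = 0 \<or> i = 1" "j = 0 \<or> j = 1" by auto
      then show "A $$ (i, j) = ?A d $$ (i, j)"
        using e[of 0] e[of 1] At s(1) by (auto simp: s(5) d_def)
    qed (use s in auto)
    have "B \<in> ?B"
    proof -
      have "B $$ (0, j) = 0" if "j < k" for j
        using e[of "j + 2"] that s(1-3) by (simp add: s(5))
      then show ?thesis using s(2) by (auto simp: less_2_cases_iff)
    qed
    then have "S \<in> ?T d" using S(1) s(3,5) unfolding Ad by blast
    then show "S \<in> (\<Union>d\<in>UNIV. ?T d)" by (rule UN_I[OF UNIV_I])
  next
    fix S assume "S \<in> (\<Union>d\<in>UNIV. ?T d)"
    then obtain d B D where S: "S \<in> sym_GL (2 + k)" "B \<in> ?B" "D \<in> carrier_mat k k"
      "S = four_block_mat (?A d) B B\<^sup>T D" by blast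
    have "col S 0 = unit_vec ?n 1"
    proof (rule eq_vecI)
      fix i assume i: "i < dim_vec (unit_vec ?n 1)"
      have dims: "dim_row D = k" "dim_col D = k" "dim_row B = 2" "dim_col B = k" using S(2,3) by auto
      have c0: "col S 0 $ i = S $$ (i, 0)" using i dims by (simp add: S(4))
      show "col S 0 $ i = unit_vec ?n 1 $ i"
      proof (cases "i < 2")
        case True
        then have "i = 0 \<or> i = 1" by auto
        then show ?thesis unfolding c0 using i dims by (auto simp: S(4))
      next
        case False
        then have j: "i - 2 < k" using i by simp
        then have "B $$ (0, i - 2) = 0" using S(2) by auto
        then show ?thesis unfolding c0 using i dims False j by (simp add: S(4))
      qed
    qed (use S(3) in \<open>simp add: S(4)\<close>)
    then show "S \<in> {S \<in> sym_GL ?n. col S 0 = unit_vec ?n 1}" using S(1) by simp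
  qed
  then have "card {S \<in> sym_GL ?n. col S 0 = (unit_vec ?n 1 :: 'a vec)} = card (\<Union>d\<in>UNIV. ?T d)"
    by (rule arg_cong)
  also have "\<dots> = (\<Sum>d\<in>UNIV. card (?T d))"
  proof (rule card_UN_disjoint)
    show "\<forall>d\<in>UNIV. \<forall>d'\<in>UNIV. d \<noteq> d' \<longrightarrow> ?T d \<inter> ?T d' = {}"
    proof (intro ballI impI)
      fix d d' :: 'a assume ne: "d \<noteq> d'"
      have val: "S $$ (1, 1) = d" if S: "S \<in> ?T d" for S d
      proof -
        obtain B D where "D \<in> carrier_mat k k" "S = four_block_mat (?A d) B B\<^sup>T D" using S by blast
        then show ?thesis by simp
      qed
      show "?T d \<inter> ?T d' = {}"
      proof (rule equals0I)
        fix S assume "S \<in> ?T d \<inter> ?T d'"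
        then have "S $$ (1, 1) = d" "S $$ (1, 1) = d'" using val by blast+
        then show False using ne by simp
      qed
    qed
    show "\<forall>d\<in>UNIV. finite (?T d)"
      by (intro ballI finite_subset[OF _ finite_sym_GL[of "2 + k"]]) blast
  qed (rule finite)
  also have "\<dots> = (\<Sum>d\<in>(UNIV::'a set). CARD('a) ^ k * card (sym_GL k :: 'a mat set))"
    by (intro sum.cong refl cT)
  also have "\<dots> = CARD('a) ^ Suc k * card (sym_GL k :: 'a mat set)" by simp
  finally show ?thesis .
qed

text \<open>A congruence S -> P S P^T, with the first unit vector as first row of P, sends the first
  column v of S to P v. As v has a zero first entry, P can be chosen to carry v to the second unit
  vector, the case already counted.\<close>

lemma card_sym_GL_col:
  fixes v :: "'a::{field,finite} vec"
  assumes v: "v \<in> carrier_vec (Suc (Suc k))" "v \<noteq> 0\<^sub>v (Suc (Suc k))" "v $ 0 = 0"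
  shows "card {S \<in> sym_GL (Suc (Suc k)). col S 0 = v} = CARD('a) ^ Suc k * card (sym_GL k :: 'a mat set)"
proof -
  let ?n = "Suc (Suc k)"
  obtain i where "i < ?n" "v $ i \<noteq> 0" using ex_nonzero_entry[OF v(1,2)] by blast
  then obtain P where P: "P \<in> GL ?n" "P *\<^sub>v v = unit_vec ?n 1" "row P 0 = unit_vec ?n 0"
    using ex_GL_to_unit_vec[OF v(1), of i 1] v(3) by auto
  note Pc = GL_carrier[OF P(1)] note Pi = minv[OF P(1)]
  define R where "R = minv P"
  have R: "R \<in> GL ?n" "R \<in> carrier_mat ?n ?n" "R * P = 1\<^sub>m ?n" "P * R = 1\<^sub>m ?n"
    using Pi GL_minv[OF P(1)] by (auto simp: R_def)
  have Rv: "R *\<^sub>v unit_vec ?n 1 = v"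
    using R Pc v P(2) by (metis assoc_mult_mat_vec one_mult_mat_vec)
  have Pt: "P\<^sup>T *\<^sub>v unit_vec ?n 0 = unit_vec ?n 0"
    using mult_unit_vec[of "P\<^sup>T" ?n ?n 0] Pc P(3) by simp
  have Rt: "R\<^sup>T *\<^sub>v unit_vec ?n 0 = unit_vec ?n 0"
  proof -
    have "R\<^sup>T * P\<^sup>T = 1\<^sub>m ?n" using R Pc transpose_mult[of P ?n ?n R ?n] by simp
    then have "unit_vec ?n 0 = R\<^sup>T *\<^sub>v (P\<^sup>T *\<^sub>v unit_vec ?n 0)"
      using R Pc by (metis assoc_mult_mat_vec one_mult_mat_vec transpose_carrier_mat unit_vec_carrier)
    then show ?thesis using Pt by simp
  qed
  have conj: "M * S * M\<^sup>T \<in> sym_GL ?n \<and> col (M * S * M\<^sup>T) 0 = M *\<^sub>v col S 0"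
    if M: "M \<in> GL ?n" "M\<^sup>T *\<^sub>v unit_vec ?n 0 = unit_vec ?n 0" and S: "S \<in> sym_GL ?n" for M S :: "'a mat"
  proof
    have c: "M \<in> carrier_mat ?n ?n" "S \<in> carrier_mat ?n ?n" "S\<^sup>T = S" "S \<in> GL ?n"
      using M S by (auto simp: sym_GL_def GL_def)
    have "(M * S * M\<^sup>T)\<^sup>T = M * (M * S)\<^sup>T" using c transpose_mult[of "M * S" ?n ?n "M\<^sup>T" ?n] by simp
    also have "\<dots> = M * S * M\<^sup>T"
      using c transpose_mult[of M ?n ?n S ?n] by (simp add: assoc_mult_mat[of M ?n ?n S ?n "M\<^sup>T" ?n])
    finally show "M * S * M\<^sup>T \<in> sym_GL ?n"
      using GL_mult[OF GL_mult[OF M(1) c(4)] GL_transpose[OF M(1)]] by (simp add: sym_GL_def)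
    have "col (M * S * M\<^sup>T) 0 = (M * S * M\<^sup>T) *\<^sub>v unit_vec ?n 0"
      using c by (intro mult_unit_vec[symmetric]) auto
    also have "\<dots> = (M * S) *\<^sub>v (M\<^sup>T *\<^sub>v unit_vec ?n 0)"
      using c by (intro assoc_mult_mat_vec) auto
    also have "\<dots> = M *\<^sub>v (S *\<^sub>v unit_vec ?n 0)" unfolding M(2) using c by (intro assoc_mult_mat_vec) auto
    also have "S *\<^sub>v unit_vec ?n 0 = col S 0" using c by (intro mult_unit_vec) auto
    finally show "col (M * S * M\<^sup>T) 0 = M *\<^sub>v col S 0" .
  qed
  have cancel: "M' * (M * S * M\<^sup>T) * M'\<^sup>T = S"
    if "M \<in> carrier_mat ?n ?n" "M' \<in> carrier_mat ?n ?n" "M' * M = 1\<^sub>m ?n" "S \<in> carrier_mat ?n ?n"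
    for M M' S :: "'a mat"
  proof -
    have "M' * (M * S * M\<^sup>T) = M' * (M * S) * M\<^sup>T"
      using that assoc_mult_mat[of M' ?n ?n "M * S" ?n "M\<^sup>T" ?n] by simp
    also have "M' * (M * S) = S" using that assoc_mult_mat[of M' ?n ?n M ?n S ?n] by simp
    finally have "M' * (M * S * M\<^sup>T) * M'\<^sup>T = S * (M\<^sup>T * M'\<^sup>T)"
      using that assoc_mult_mat[of S ?n ?n "M\<^sup>T" ?n "M'\<^sup>T" ?n] by simp
    also have "M\<^sup>T * M'\<^sup>T = 1\<^sub>m ?n" using that transpose_mult[of M' ?n ?n M ?n] by simp
    finally show ?thesis using that by simp
  qed
  have "bij_betw (\<lambda>S. P * S * P\<^sup>T) {S \<in> sym_GL ?n. col S 0 = v} {S \<in> sym_GL ?n. col S 0 = unit_vec ?n 1}"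
    using conj[OF P(1) Pt] conj[OF R(1) Rt] cancel[OF Pc R(2,3)] cancel[OF R(2) Pc R(4)] P(2) Rv
    by (intro bij_betw_byWitness[where f' = "\<lambda>S. R * S * R\<^sup>T"]) (auto simp: sym_GL_def dest: GL_carrier)
  from bij_betw_same_card[OF this] show ?thesis unfolding card_sym_GL_unit_col .
qed

lemma card_sym_GL_0: "card (sym_GL 0 :: 'a::field mat set) = 1"
proof -
  have "(sym_GL 0 :: 'a mat set) = {1\<^sub>m 0}" by (auto simp: sym_GL_def GL_def intro!: eq_matI)
  then show ?thesis by simp
qed

lemma card_sym_GL_split:
  "card (sym_GL (Suc k) :: 'a::{field,finite} mat set)
    = (CARD('a) - 1) * CARD('a) ^ k * card (sym_GL k :: 'a mat set)
      + (\<Sum>v\<in>{v \<in> carrier_vec (Suc k). v $ 0 = (0::'a)}. card {S \<in> sym_GL (Suc k). col S 0 = v})"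
proof -
  let ?n = "Suc k"
  let ?V = "{v \<in> carrier_vec ?n. v $ 0 = (0::'a)}"
  have "(sym_GL ?n :: 'a mat set) = (\<Union>a\<in>UNIV - {0}. {S \<in> sym_GL ?n. S $$ (0, 0) = a})
      \<union> (\<Union>v\<in>?V. {S \<in> sym_GL ?n. col S 0 = v})"
  proof -
    have "col S 0 \<in> ?V" if "S \<in> sym_GL ?n" "S $$ (0, 0) = 0" for S :: "'a mat"
      using that by (auto simp: sym_GL_def GL_def intro!: carrier_vecI)
    then show ?thesis by auto
  qed
  also have "card \<dots> = card (\<Union>a\<in>UNIV - {0::'a}. {S \<in> sym_GL ?n. S $$ (0, 0) = a})
      + card (\<Union>v\<in>?V. {S \<in> sym_GL ?n. col S 0 = v})"
  proof (rule card_Un_disjoint)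
    have "S $$ (0, 0) = 0" if "S \<in> sym_GL ?n" "col S 0 \<in> ?V" for S :: "'a mat"
    proof -
      have "S \<in> carrier_mat ?n ?n" using that by (auto simp: sym_GL_def GL_def)
      then have "col S 0 $ 0 = S $$ (0, 0)" by simp
      then show ?thesis using that by simp
    qed
    then show "(\<Union>a\<in>UNIV - {0::'a}. {S \<in> sym_GL ?n. S $$ (0, 0) = a})
        \<inter> (\<Union>v\<in>?V. {S \<in> sym_GL ?n. col S 0 = v}) = {}" by blast
    have "finite ?V" by simp
    then show "finite (\<Union>v\<in>?V. {S \<in> sym_GL ?n. col S 0 = v})" by (intro finite_UN_I) auto
  qed auto
  also have "card (\<Union>a\<in>UNIV - {0::'a}. {S \<in> sym_GL ?n. S $$ (0, 0) = a})
      = (\<Sum>a\<in>UNIV - {0::'a}. card {S \<in> sym_GL ?n. S $$ (0, 0) = a})"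
    by (rule card_UN_disjoint) auto
  also have "\<dots> = (CARD('a) - 1) * CARD('a) ^ k * card (sym_GL k :: 'a mat set)"
    by (simp add: card_sym_GL_corner card_Diff_subset)
  also have "card (\<Union>v\<in>?V. {S \<in> sym_GL ?n. col S 0 = v})
      = (\<Sum>v\<in>?V. card {S \<in> sym_GL ?n. col S 0 = v})"
    by (rule card_UN_disjoint) auto
  finally show ?thesis .
qed

lemma card_sym_GL_zero_col: "card {S \<in> sym_GL (Suc k). col S 0 = (0\<^sub>v (Suc k) :: 'a::field vec)} = 0"
proof -
  let ?n = "Suc k"
  have "col S 0 \<noteq> 0\<^sub>v ?n" if S: "S \<in> sym_GL ?n" for S :: "'a mat"
  proof
    assume z: "col S 0 = 0\<^sub>v ?n"
    have A: "S \<in> GL ?n" using S by (simp add: sym_GL_def)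
    note Ac = GL_carrier[OF A]
    have "unit_vec ?n 0 = (minv S * S) *\<^sub>v unit_vec ?n 0" using minv[OF A] by simp
    also have "\<dots> = minv S *\<^sub>v col S 0"
      using assoc_mult_mat_vec[OF minv(1)[OF A] Ac unit_vec_carrier, of 0] mult_unit_vec[OF Ac, of 0]
      by simp
    also have "\<dots> = 0\<^sub>v ?n" unfolding z using minv(1)[OF A] by (intro eq_vecI) auto
    finally have "unit_vec ?n 0 $ 0 = (0\<^sub>v ?n $ 0 :: 'a)" by simp
    then show False by simp
  qed
  then have "{S \<in> sym_GL ?n. col S 0 = (0\<^sub>v ?n :: 'a vec)} = {}" by blast
  then show ?thesis by (simp only: card.empty)
qed

lemma card_sym_GL_1: "card (sym_GL 1 :: 'a::{field,finite} mat set) = CARD('a) - 1"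
proof -
  have "{v \<in> carrier_vec (Suc 0). v $ 0 = (0::'a)} = {0\<^sub>v (Suc 0)}" by (auto intro!: eq_vecI)
  then show ?thesis
    using card_sym_GL_split[of 0, where 'a = 'a] card_sym_GL_zero_col[of 0, where 'a = 'a]
    by (simp add: card_sym_GL_0)
qed

text \<open>Among first columns with zero top entry the zero column contributes nothing and the
  other q^(k + 1) - 1 columns contribute equally; nonzero corners are handled by a 1 x 1 pivot. The
  result is a two-step recursion.\<close>

lemma card_sym_GL_Suc_Suc:
  "card (sym_GL (Suc (Suc k)) :: 'a::{field,finite} mat set)
    = (CARD('a) - 1) * CARD('a) ^ Suc k * card (sym_GL (Suc k) :: 'a mat set)
      + (CARD('a) ^ Suc k - 1) * CARD('a) ^ Suc k * card (sym_GL k :: 'a mat set)"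
proof -
  let ?n = "Suc (Suc k)"
  let ?V = "{v \<in> carrier_vec ?n. v $ 0 = (0::'a)}"
  let ?c = "\<lambda>v. card {S \<in> sym_GL ?n. col S 0 = (v :: 'a vec)}"
  have z: "0\<^sub>v ?n \<in> ?V" by simp
  have fin: "finite ?V" by simp
  have "bij_betw (\<lambda>v. vec (Suc k) (\<lambda>i. v $ Suc i)) ?V (carrier_vec (Suc k))"
  proof (rule bij_betw_byWitness[where f' = "\<lambda>w. vec ?n (\<lambda>i. if i = 0 then 0 else w $ (i - 1))"])
    show "\<forall>v\<in>?V. vec ?n (\<lambda>i. if i = 0 then 0 else vec (Suc k) (\<lambda>i. v $ Suc i) $ (i - 1)) = v"
      by (auto intro!: eq_vecI)
  qed (auto intro!: eq_vecI)
  then have cV: "card ?V = CARD('a) ^ Suc k" by (simp add: bij_betw_same_card card_carrier_vec)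
  have "(\<Sum>v\<in>?V. ?c v) = ?c (0\<^sub>v ?n) + (\<Sum>v\<in>?V - {0\<^sub>v ?n}. ?c v)"
    by (rule sum.remove[OF fin z])
  also have "\<dots> = card (?V - {0\<^sub>v ?n}) * (CARD('a) ^ Suc k * card (sym_GL k :: 'a mat set))"
    unfolding card_sym_GL_zero_col by (simp add: card_sym_GL_col)
  also have "card (?V - {0\<^sub>v ?n}) = CARD('a) ^ Suc k - 1" using cV z by (simp add: card_Diff_subset)
  finally show ?thesis unfolding card_sym_GL_split[of "Suc k"] by (simp add: mult.assoc)
qed

section \<open>The group \<open>SO\<^sup>-(2, q)\<close> and character sums over matrices\<close>

locale minus_type = binary_field r q field_type
  for r q :: nat and field_type :: "'a::{field,finite} itself" +
  fixes \<kappa> :: 'a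
  assumes irreducible_kappa: "irreducible [:\<kappa>, 1, 1:]"
begin

text \<open>Irreducibility excludes roots of z^2 + z = \<kappa>, of which there are 1 + lam
  \<kappa>. This sign is the source of the factor (-1)^s.\<close>

lemma lam_kappa: "lam \<kappa> = -1"
proof (rule ccontr)
  assume "lam \<kappa> \<noteq> -1"
  then have "lam \<kappa> = 1" using lam_cases by blast
  then have "card {z. z\<^sup>2 + z = \<kappa>} \<noteq> 0" using card_artin_schreier[of \<kappa>] by auto
  then obtain z where z: "z\<^sup>2 + z = \<kappa>" by (metis (mono_tags, lifting) Collect_empty_eq card.empty)
  have "poly [:\<kappa>, 1, 1:] z = 0" using z by (simp add: power2_eq_square algebra_simps)
  then have "[:- z, 1:] dvd [:\<kappa>, 1, 1:]" by (simp only: poly_eq_0_iff_dvd)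
  then obtain s where s: "[:\<kappa>, 1, 1:] = [:- z, 1:] * s" by (rule dvdE)
  have "is_unit [:- z, 1:] \<or> is_unit s" using irreducible_kappa s by (simp only: irreducible_def)
  moreover have "\<not> is_unit [:- z, 1:]" by (auto simp: is_unit_pCons_iff)
  moreover have "\<not> is_unit s"
  proof
    assume "is_unit s"
    then obtain a where a: "s = [:a:]" by (metis is_unit_poly_iff)
    have "degree [:\<kappa>, 1, 1:] \<le> 1" unfolding s a by simp
    then show False by simp
  qed
  ultimately show False by blast
qed

text \<open>The norm of a + b w from the field with q^2 elements, where w^2 = w + \<kappa>; it is
  the anisotropic part of \<theta>^-.\<close>

definition nrm :: "'a \<Rightarrow> 'a \<Rightarrow> 'a" where "nrm a b = a\<^sup>2 + a * b + \<kappa> * b\<^sup>2"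

text \<open>Multiplication by a + b w in the basis 1, w, so that SO^-(2, q) is the group of elements
  of norm 1.\<close>

definition so2 :: "'a \<Rightarrow> 'a \<Rightarrow> 'a mat" where
  "so2 a b = mat_of_rows_list 2 [[a, \<kappa> * b], [b, a + b]]"

lemma so2_index [simp]:
  "so2 a b $$ (0, 0) = a" "so2 a b $$ (0, Suc 0) = \<kappa> * b" "so2 a b $$ (Suc 0, 0) = b"
  "so2 a b $$ (Suc 0, Suc 0) = a + b" "so2 a b \<in> carrier_mat 2 2"
  "dim_row (so2 a b) = 2" "dim_col (so2 a b) = 2"
  by (simp_all add: so2_def mat_of_rows_list_def numeral_2_eq_2)

lemma SO2_eq: "SO2_minus \<kappa> = (\<lambda>(a, b). so2 a b) ` {(a, b). nrm a b = 1}"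
  unfolding SO2_minus_def so2_def nrm_def by auto

lemma inj_so2: "inj_on (\<lambda>(a, b). so2 a b) P"
proof (rule inj_onI, clarify)
  fix a b a' b' assume eq: "so2 a b = so2 a' b'"
  have "so2 a b $$ (0, 0) = so2 a' b' $$ (0, 0)" "so2 a b $$ (Suc 0, 0) = so2 a' b' $$ (Suc 0, 0)"
    unfolding eq by simp_all
  then show "a = a' \<and> b = b'" by simp
qed

lemma finite_SO2 [simp]: "finite (SO2_minus \<kappa>)"
  unfolding SO2_eq by (rule finite_imageI) (rule finite)

lemma so2_in_SO2: "nrm a b = 1 \<Longrightarrow> so2 a b \<in> SO2_minus \<kappa>"
  unfolding SO2_eq by (rule image_eqI[of _ _ "(a, b)"]) simp_all

lemma SO2_cases:
  assumes "w \<in> SO2_minus \<kappa>"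
  obtains a b where "w = so2 a b" "nrm a b = 1"
proof -
  obtain p where "p \<in> {(a, b). nrm a b = 1}" "w = (\<lambda>(a, b). so2 a b) p"
    using assms unfolding SO2_eq by blast
  then show thesis using that by (cases p) simp
qed

text \<open>For nonzero b the equation nrm a b = 1 is quadratic in a with 1 + lam (1 / b^2 +
  \<kappa>) = 1 - lam (1 / b) solutions; for b = 0 only a = 1 is left.\<close>

lemma sum_SO2:
  "(\<Sum>w\<in>SO2_minus \<kappa>. f (w $$ (Suc 0, 0)) :: int)
    = (\<Sum>b\<in>UNIV. f b) - (\<Sum>b\<in>UNIV - {0}. f b * lam (inverse b))"
proof -
  have cnt: "int (card {a. nrm a b = 1}) = (if b = 0 then 1 else 1 - lam (inverse b))" for b
  proof (cases "b = 0")
    case True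
    have "{a. nrm a b = 1} = {1}"
    proof -
      have "a\<^sup>2 = 1 \<longleftrightarrow> a = 1" for a :: 'a using square_eq_iff[of a 1] by simp
      then show ?thesis using True by (auto simp: nrm_def)
    qed
    then show ?thesis using True by simp
  next
    case False
    have "{a. nrm a b = 1} = {a. a\<^sup>2 + b * a = 1 + \<kappa> * b\<^sup>2}"
    proof -
      have "nrm a b = 1 \<longleftrightarrow> a\<^sup>2 + b * a = 1 + \<kappa> * b\<^sup>2" for a
      proof -
        have "nrm a b + 1 = (a\<^sup>2 + b * a) + (1 + \<kappa> * b\<^sup>2)" by (simp add: nrm_def algebra_simps)
        then show ?thesis using add_eq_zero_char2[of "nrm a b" 1] add_eq_zero_char2[of "a\<^sup>2 + b * a"]
          by (simp only:)
      qed
      then show ?thesis by simp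
    qed
    moreover have "(1 + \<kappa> * b\<^sup>2) / b\<^sup>2 = (inverse b)\<^sup>2 + \<kappa>"
      using False by (simp add: field_simps power_divide)
    ultimately show ?thesis
      using card_quadratic[OF False, of "1 + \<kappa> * b\<^sup>2"] False
      by (simp only: lam_add lam_square_arg lam_kappa) simp
  qed
  have "(\<Sum>w\<in>SO2_minus \<kappa>. f (w $$ (Suc 0, 0))) = (\<Sum>(a, b)\<in>{(a, b). nrm a b = 1}. f b)"
    unfolding SO2_eq by (subst sum.reindex[OF inj_so2]) (simp add: case_prod_unfold)
  also have "\<dots> = (\<Sum>b\<in>UNIV. \<Sum>a\<in>{a. nrm a b = 1}. f b)"
  proof (subst sum.Sigma)
    show "(\<Sum>(a, b)\<in>{(a, b). nrm a b = 1}. f b) = (\<Sum>(b, a)\<in>(SIGMA b:UNIV. {a. nrm a b = 1}). f b)"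
      by (rule sum.reindex_bij_witness[of _ "\<lambda>(b, a). (a, b)" "\<lambda>(a, b). (b, a)"]) auto
  qed auto
  also have "\<dots> = (\<Sum>b\<in>UNIV. (if b = 0 then 1 else 1 - lam (inverse b)) * f b)"
    by (simp add: cnt)
  also have "\<dots> = f 0 + (\<Sum>b\<in>UNIV - {0}. (1 - lam (inverse b)) * f b)"
    by (subst sum.remove[of _ 0]) auto
  also have "\<dots> = (\<Sum>b\<in>UNIV. f b) - (\<Sum>b\<in>UNIV - {0}. f b * lam (inverse b))"
  proof -
    have "(\<Sum>b\<in>UNIV - {0}. (1 - lam (inverse b)) * f b)
        = (\<Sum>b\<in>UNIV - {0}. f b) - (\<Sum>b\<in>UNIV - {0}. f b * lam (inverse b))"
      unfolding sum_subtractf[symmetric] by (intro sum.cong) (auto simp: algebra_simps)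
    then show ?thesis using sum_units[of f] by simp
  qed
  finally show ?thesis .
qed

lemma card_SO2: "int (card (SO2_minus \<kappa>)) = int q + 1"
  using sum_SO2[of "\<lambda>_. 1"] sum_inverse_units[of lam] by (simp add: sum_units sum_lam)

lemma SO2_trace: "w \<in> SO2_minus \<kappa> \<Longrightarrow> w $$ (0, 0) + w $$ (Suc 0, Suc 0) = w $$ (Suc 0, 0)"
proof (elim SO2_cases)
  fix a b assume w: "w = so2 a b"
  show "w $$ (0, 0) + w $$ (Suc 0, Suc 0) = w $$ (Suc 0, 0)"
    unfolding w so2_index by (rule add_self_left)
qed

text \<open>The trace of w is its lower left entry b. Weighting lam (c b) by 1 leaves nothing, and
  weighting it by - lam (1 / b) gives the Kloosterman sum with its minus sign.\<close>

lemma sum_SO2_lam: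
  assumes "c \<noteq> 0"
  shows "(\<Sum>w\<in>SO2_minus \<kappa>. lam (c * (w $$ (0, 0) + w $$ (Suc 0, Suc 0)))) = - K c"
proof -
  have "(\<Sum>w\<in>SO2_minus \<kappa>. lam (c * (w $$ (0, 0) + w $$ (Suc 0, Suc 0))))
      = (\<Sum>w\<in>SO2_minus \<kappa>. lam (c * (w $$ (Suc 0, 0))))"
    by (intro sum.cong) (auto simp: SO2_trace)
  also have "\<dots> = (\<Sum>b\<in>UNIV. lam (c * b)) - (\<Sum>b\<in>UNIV - {0}. lam (c * b) * lam (inverse b))"
    by (rule sum_SO2)
  also have "(\<Sum>b\<in>UNIV. lam (c * b)) = 0" using sum_lam_mult[of c] assms by (simp add: mult.commute)
  also have "(\<Sum>b\<in>UNIV - {0}. lam (c * b) * lam (inverse b)) = K c"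
    using K_scaled[OF assms, of 1] by (simp add: lam_add)
  finally show ?thesis by simp
qed

lemma SO2_mult:
  assumes "w \<in> SO2_minus \<kappa>" "w' \<in> SO2_minus \<kappa>" shows "w * w' \<in> SO2_minus \<kappa>"
proof -
  obtain a b where w: "w = so2 a b" "nrm a b = 1" using assms SO2_cases by blast
  obtain a' b' where w': "w' = so2 a' b'" "nrm a' b' = 1" using assms SO2_cases by blast
  let ?a = "a * a' + \<kappa> * b * b'" and ?b = "b * a' + a * b' + b * b'"
  have "so2 a b * so2 a' b' = so2 ?a ?b"
    by (rule eq_matI) (auto simp: scalar_prod_def numeral_2_eq_2 less_Suc_eq algebra_simps)
  moreover have "nrm ?a ?b = nrm a b * nrm a' b'"
    unfolding nrm_def square_add by (simp add: algebra_simps power2_eq_square)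
  ultimately show ?thesis using w w' so2_in_SO2[of ?a ?b] by simp
qed

lemma SO2_inverse:
  assumes "w \<in> SO2_minus \<kappa>" shows "\<exists>w'\<in>SO2_minus \<kappa>. w * w' = 1\<^sub>m 2 \<and> w' * w = 1\<^sub>m 2"
proof -
  obtain a b where w: "w = so2 a b" "nrm a b = 1" using assms SO2_cases by blast
  have n: "a * a + (a * b + \<kappa> * (b * b)) = 1" using w(2) by (simp add: nrm_def power2_eq_square add.assoc)
  have "a * a = (a * a + (a * b + \<kappa> * (b * b))) + (a * b + \<kappa> * (b * b))"
    by (simp only: add.assoc add_self add_0_right)
  then have n': "a * a = 1 + (a * b + \<kappa> * (b * b))" unfolding n .
  have "so2 a b * so2 (a + b) b = 1\<^sub>m 2"
    by (rule eq_matI) (auto simp: scalar_prod_def numeral_2_eq_2 less_Suc_eq algebra_simps n')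
  moreover have "so2 (a + b) b * so2 a b = 1\<^sub>m 2"
    using mat_mult_left_right_inverse[of "so2 a b" 2 "so2 (a + b) b"] calculation by simp
  moreover have "nrm (a + b) b = nrm a b"
    unfolding nrm_def square_add by (simp add: algebra_simps power2_eq_square)
  ultimately show ?thesis using w so2_in_SO2[of "a + b" b] by auto
qed

lemma SO2_carrier: "w \<in> SO2_minus \<kappa> \<Longrightarrow> w \<in> carrier_mat 2 2"
  by (elim SO2_cases) simp

lemma SO2_GL: "w \<in> SO2_minus \<kappa> \<Longrightarrow> w \<in> GL 2"
  by (metis SO2_inverse SO2_carrier GL_I(1))

lemma nrm_so2:
  assumes "nrm a b = 1"
  shows "nrm (a * x + \<kappa> * b * y) (b * x + (a + b) * y) = nrm x y"
proof -
  have "nrm (a * x + \<kappa> * b * y) (b * x + (a + b) * y) = nrm a b * nrm x y"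
    unfolding nrm_def square_add by (simp add: algebra_simps power2_eq_square)
  then show ?thesis using assms by simp
qed

lemma lam_sum: "finite A \<Longrightarrow> lam (\<Sum>x\<in>A. f x) = (\<Prod>x\<in>A. lam (f x))"
  by (induction A rule: finite_induct) (auto simp: lam_add)

text \<open>A sign-reversing involution; in the applications it is translation by an element on
  which the character is -1, which is an involution in characteristic 2.\<close>

lemma character_sum_zero:
  assumes "\<And>x. x \<in> V \<Longrightarrow> t x \<in> V" "\<And>x. x \<in> V \<Longrightarrow> t (t x) = x"
    and "\<And>x. x \<in> V \<Longrightarrow> lam (L (t x)) = - lam (L x)"
  shows "(\<Sum>x\<in>V. lam (L x)) = 0"
proof -
  have "(\<Sum>x\<in>V. lam (L x)) = (\<Sum>x\<in>V. lam (L (t x)))"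
    using assms(1,2) by (intro sum.reindex_bij_witness[of _ t t]) auto
  also have "\<dots> = - (\<Sum>x\<in>V. lam (L x))" using assms(3) by (simp add: sum_negf)
  finally show ?thesis by simp
qed

lemma sum_lam_vec:
  assumes "s \<le> N"
  shows "(\<Sum>u\<in>carrier_vec N. lam (\<Sum>k<s. u $ k * t k)) = (if \<forall>k<s. t k = 0 then int q ^ N else 0)"
proof (cases "\<forall>k<s. t k = 0")
  case True
  then show ?thesis by (simp add: card_carrier_vec)
next
  case False
  then obtain k0 where k0: "k0 < s" "t k0 \<noteq> 0" by blast
  obtain x where x: "lam x = -1" using ex_lam_neg by blast
  define e where "e = (x / t k0) \<cdot>\<^sub>v unit_vec N k0"
  have e: "e \<in> carrier_vec N" by (simp add: e_def)
  have "(\<Sum>u\<in>carrier_vec N. lam (\<Sum>k<s. u $ k * t k)) = 0"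
  proof (rule character_sum_zero[where t = "\<lambda>u. u + e"])
    fix u :: "'a vec" assume u: "u \<in> carrier_vec N"
    show "u + e \<in> carrier_vec N" using u e by simp
    show "u + e + e = u" using u e by (intro eq_vecI) (auto simp: add.assoc)
    have "(\<Sum>k<s. (u + e) $ k * t k) = (\<Sum>k<s. u $ k * t k) + (\<Sum>k<s. if k = k0 then x else 0)"
      unfolding sum.distrib[symmetric]
      using u e k0 assms by (intro sum.cong) (auto simp: e_def distrib_right)
    also have "(\<Sum>k<s. if k = k0 then x else 0) = x" using k0 by simp
    finally show "lam (\<Sum>k<s. (u + e) $ k * t k) = - lam (\<Sum>k<s. u $ k * t k)"
      by (simp add: lam_add x)
  qed
  then show ?thesis unfolding if_not_P[OF False] .
qed

text \<open>Off-diagonal terms occur twice and cancel.\<close>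

lemma sum_symmetric_char2:
  fixes s :: nat
  assumes "\<And>k l. k < s \<Longrightarrow> l < s \<Longrightarrow> f k l = f l k"
  shows "(\<Sum>k<s. \<Sum>l<s. f k l) = (\<Sum>k<s. f k k :: 'a)"
  using assms
proof (induction s)
  case (Suc s)
  have "(\<Sum>k<Suc s. \<Sum>l<Suc s. f k l) = (\<Sum>k<s. \<Sum>l<s. f k l) + (\<Sum>k<s. f k s) + ((\<Sum>l<s. f s l) + f s s)"
    by (simp add: sum.distrib)
  also have "(\<Sum>l<s. f s l) = (\<Sum>k<s. f k s)" using Suc.prems by (intro sum.cong) auto
  finally show ?case using Suc.IH Suc.prems by (simp add: add.assoc)
qed simp

lemma card_vec_prefix:
  assumes "s \<le> N"
  shows "card {v \<in> carrier_vec N. \<forall>k<s. v $ k = (a k :: 'a)} = q ^ (N - s)"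
proof -
  have "bij_betw (\<lambda>v. vec (N - s) (\<lambda>i. v $ (s + i))) {v \<in> carrier_vec N. \<forall>k<s. v $ k = a k} (carrier_vec (N - s))"
    using assms
    by (intro bij_betw_byWitness[where f' = "\<lambda>w. vec N (\<lambda>i. if i < s then a i else w $ (i - s))"])
       (auto intro!: eq_vecI)
  then show ?thesis by (simp add: bij_betw_same_card card_carrier_vec)
qed

text \<open>For a symmetric \<open>S\<close> with inverse \<open>R\<close>, the off-diagonal terms of
  \<open>s = Tr (S R)\<close> cancel in pairs, so only \<open>\<Sum> S\<^sub>k\<^sub>k R\<^sub>k\<^sub>k = s\<close> survives.\<close>

lemma sum_quadratic_rows:
  assumes S: "S \<in> sym_GL s" and sN: "s \<le> N" and c: "c \<noteq> 0"
  shows "(\<Sum>u\<in>carrier_vec N. \<Sum>v\<in>carrier_vec N.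
      lam (c * (\<Sum>k<s. \<Sum>l<s. S $$ (k, l) * (u $ k * u $ l + u $ k * v $ l + \<kappa> * v $ k * v $ l))))
    = (-1) ^ s * int q ^ (N + (N - s))"
proof -
  define R where "R = minv S"
  have SG: "S \<in> GL s" "S\<^sup>T = S" using S by (auto simp: sym_GL_def)
  note Sc = GL_carrier[OF SG(1)]
  have R: "R \<in> carrier_mat s s" "S * R = 1\<^sub>m s" "R * S = 1\<^sub>m s" "R\<^sup>T = R"
    using minv[OF SG(1)] minv_transpose[OF SG(1)] SG by (auto simp: R_def)
  have Ssym: "S $$ (k, l) = S $$ (l, k)" if "k < s" "l < s" for k l
  proof -
    have "S\<^sup>T $$ (k, l) = S $$ (l, k)" using that Sc by simp
    then show ?thesis unfolding SG(2) .
  qed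
  have Rsym: "R $$ (k, l) = R $$ (l, k)" if "k < s" "l < s" for k l
  proof -
    have "R\<^sup>T $$ (k, l) = R $$ (l, k)" using that R(1) by simp
    then show ?thesis unfolding R(4) .
  qed
  have SR: "(\<Sum>l<s. S $$ (k, l) * R $$ (l, j)) = (if k = j then 1 else 0)" if "k < s" "j < s" for k j
  proof -
    have "(S * R) $$ (k, j) = (\<Sum>l<s. S $$ (k, l) * R $$ (l, j))"
      using that Sc R(1) by (simp add: scalar_prod_def atLeast0LessThan)
    then show ?thesis using that unfolding R(2) by simp
  qed
  have RS: "(\<Sum>l<s. R $$ (k, l) * S $$ (l, j)) = (if k = j then 1 else 0)" if "k < s" "j < s" for k j
  proof -
    have "(R * S) $$ (k, j) = (\<Sum>l<s. R $$ (k, l) * S $$ (l, j))"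
      using that Sc R(1) by (simp add: scalar_prod_def atLeast0LessThan)
    then show ?thesis using that unfolding R(3) by simp
  qed
  \<comment> \<open>Since lam (x^2) = lam x, the diagonal terms c S_kk u_k^2 = (e_k u_k)^2 may be
    replaced by e_k u_k, and the exponent becomes affine in u.\<close>
  define e where "e = (\<lambda>k. SOME y. y\<^sup>2 = c * S $$ (k, k))"
  have e: "(e k)\<^sup>2 = c * S $$ (k, k)" for k unfolding e_def using ex_sqrt by (rule someI_ex)
  define t where "t = (\<lambda>v k. e k + c * (\<Sum>l<s. S $$ (k, l) * v $ l))"
  define z where "z = (\<lambda>v :: 'a vec. c * \<kappa> * (\<Sum>k<s. \<Sum>l<s. S $$ (k, l) * v $ k * v $ l))"
  \<comment> \<open>The sum over u survives only if t v vanishes at the first s indices;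
    multiplication by R solves this uniquely by v = a there.\<close>
  define a where "a = (\<lambda>l. (\<Sum>k<s. R $$ (l, k) * e k) / c)"
  have lin: "lam (c * (\<Sum>k<s. \<Sum>l<s. S $$ (k, l) * (u $ k * u $ l + u $ k * v $ l + \<kappa> * v $ k * v $ l)))
      = lam (\<Sum>k<s. u $ k * t v k) * lam (z v)" for u v :: "'a vec"
  proof -
    have "(\<Sum>k<s. \<Sum>l<s. S $$ (k, l) * (u $ k * u $ l + u $ k * v $ l + \<kappa> * v $ k * v $ l))
        = (\<Sum>k<s. \<Sum>l<s. S $$ (k, l) * (u $ k * u $ l)) + (\<Sum>k<s. \<Sum>l<s. S $$ (k, l) * (u $ k * v $ l))
          + \<kappa> * (\<Sum>k<s. \<Sum>l<s. S $$ (k, l) * v $ k * v $ l)"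
      by (simp add: sum.distrib sum_distrib_left distrib_left mult_ac)
    also have "(\<Sum>k<s. \<Sum>l<s. S $$ (k, l) * (u $ k * u $ l)) = (\<Sum>k<s. S $$ (k, k) * (u $ k * u $ k))"
      by (rule sum_symmetric_char2) (simp add: Ssym mult_ac)
    finally have "c * (\<Sum>k<s. \<Sum>l<s. S $$ (k, l) * (u $ k * u $ l + u $ k * v $ l + \<kappa> * v $ k * v $ l))
        = (\<Sum>k<s. (e k * u $ k)\<^sup>2) + (\<Sum>k<s. u $ k * (c * (\<Sum>l<s. S $$ (k, l) * v $ l))) + z v"
      by (simp add: distrib_left z_def power_mult_distrib e sum_distrib_left mult_ac power2_eq_square[of "_ $ _"])
    moreover have "lam (\<Sum>k<s. (e k * u $ k)\<^sup>2) = lam (\<Sum>k<s. u $ k * e k)"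
      by (simp add: lam_sum lam_square_arg mult.commute)
    ultimately show ?thesis
      by (simp add: lam_add t_def distrib_left sum.distrib)
  qed
  have t0: "(\<forall>k<s. t v k = 0) \<longleftrightarrow> (\<forall>k<s. v $ k = a k)" for v :: "'a vec"
  proof
    assume h: "\<forall>k<s. t v k = 0"
    show "\<forall>k<s. v $ k = a k"
    proof (intro allI impI)
      fix j assume j: "j < s"
      have ek: "e k = c * (\<Sum>l<s. S $$ (k, l) * v $ l)" if "k < s" for k
        using h that by (auto simp: t_def add_eq_zero_char2)
      have "a j = (\<Sum>k<s. R $$ (j, k) * (\<Sum>l<s. S $$ (k, l) * v $ l))"
        using c by (simp add: a_def ek sum_divide_distrib)
      also have "\<dots> = (\<Sum>l<s. (\<Sum>k<s. R $$ (j, k) * S $$ (k, l)) * v $ l)"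
        unfolding sum_distrib_left sum_distrib_right by (subst sum.swap) (simp add: mult.assoc)
      also have "\<dots> = (\<Sum>l<s. if l = j then v $ j else 0)" using j by (intro sum.cong) (auto simp: RS)
      also have "\<dots> = v $ j" using j by simp
      finally show "v $ j = a j" by simp
    qed
  next
    assume h: "\<forall>k<s. v $ k = a k"
    show "\<forall>k<s. t v k = 0"
    proof (intro allI impI)
      fix j assume j: "j < s"
      have cv: "c * v $ l = (\<Sum>k<s. R $$ (l, k) * e k)" if "l < s" for l
        using h c that by (simp add: a_def)
      have "c * (\<Sum>l<s. S $$ (j, l) * v $ l) = (\<Sum>l<s. S $$ (j, l) * (c * v $ l))"
        by (simp add: sum_distrib_left mult_ac)
      also have "\<dots> = (\<Sum>l<s. S $$ (j, l) * (\<Sum>k<s. R $$ (l, k) * e k))"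
        by (intro sum.cong refl) (simp add: cv)
      also have "\<dots> = (\<Sum>k<s. (\<Sum>l<s. S $$ (j, l) * R $$ (l, k)) * e k)"
        unfolding sum_distrib_left sum_distrib_right by (subst sum.swap) (simp add: mult.assoc)
      also have "\<dots> = (\<Sum>l<s. if l = j then e j else 0)" using j by (intro sum.cong) (auto simp: SR)
      also have "\<dots> = e j" using j by simp
      finally show "t v j = 0" by (simp add: t_def)
    qed
  qed
  have zval: "lam (z v) = (-1) ^ s" if "\<forall>k<s. v $ k = a k" for v
  proof -
    have tv: "c * (\<Sum>l<s. S $$ (k, l) * v $ l) = e k" if "k < s" for k
      using t0[of v] \<open>\<forall>k<s. v $ k = a k\<close> that by (auto simp: t_def add_eq_zero_char2)
    have "z v = \<kappa> * (\<Sum>k<s. v $ k * (c * (\<Sum>l<s. S $$ (k, l) * v $ l)))"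
      unfolding z_def by (simp add: sum_distrib_left mult_ac)
    also have "(\<Sum>k<s. v $ k * (c * (\<Sum>l<s. S $$ (k, l) * v $ l))) = (\<Sum>k<s. a k * e k)"
    proof (rule sum.cong[OF refl])
      fix k assume "k \<in> {..<s}"
      then have k: "k < s" by simp
      show "v $ k * (c * (\<Sum>l<s. S $$ (k, l) * v $ l)) = a k * e k"
        unfolding tv[OF k] using that k by simp
    qed
    also have "\<dots> = (\<Sum>k<s. \<Sum>l<s. R $$ (k, l) * e l * e k) / c"
      by (simp add: a_def sum_divide_distrib sum_distrib_right)
    also have "(\<Sum>k<s. \<Sum>l<s. R $$ (k, l) * e l * e k) = (\<Sum>k<s. R $$ (k, k) * e k * e k)"
      by (rule sum_symmetric_char2) (simp add: Rsym mult_ac)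
    also have "\<dots> / c = (\<Sum>k<s. S $$ (k, k) * R $$ (k, k))"
      unfolding sum_divide_distrib
    proof (rule sum.cong[OF refl])
      fix k
      have eq: "R $$ (k, k) * e k * e k = R $$ (k, k) * (c * S $$ (k, k))"
        unfolding e[of k, symmetric] by (simp add: power2_eq_square mult.assoc)
      show "R $$ (k, k) * e k * e k / c = S $$ (k, k) * R $$ (k, k)" unfolding eq using c by simp
    qed
    also have "\<dots> = (\<Sum>k<s. \<Sum>l<s. S $$ (k, l) * R $$ (l, k))"
      by (rule sum_symmetric_char2[symmetric]) (simp add: Rsym Ssym mult_ac)
    also have "\<dots> = of_nat s" by (simp add: SR)
    finally have "z v = \<kappa> * of_nat s" .
    then show ?thesis by (simp add: of_nat_char2 lam_kappa)
  qed
  have eq1: "(\<Sum>u\<in>carrier_vec N. \<Sum>v\<in>carrier_vec N.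
      lam (c * (\<Sum>k<s. \<Sum>l<s. S $$ (k, l) * (u $ k * u $ l + u $ k * v $ l + \<kappa> * v $ k * v $ l))))
    = (\<Sum>v\<in>carrier_vec N. (\<Sum>u\<in>carrier_vec N. lam (\<Sum>k<s. u $ k * t v k)) * lam (z v))"
    unfolding lin by (subst sum.swap) (simp add: sum_distrib_right)
  have eq2: "(\<Sum>v\<in>carrier_vec N. (\<Sum>u\<in>carrier_vec N. lam (\<Sum>k<s. u $ k * t v k)) * lam (z v))
      = (\<Sum>v\<in>carrier_vec N. if \<forall>k<s. v $ k = a k then int q ^ N * (-1) ^ s else 0)"
    unfolding sum_lam_vec[OF sN] t0 by (intro sum.cong) (auto simp: zval)
  also have "\<dots> = int (card {v \<in> carrier_vec N. \<forall>k<s. v $ k = a k}) * (int q ^ N * (-1) ^ s)"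
    by (subst sum.inter_filter[symmetric]) simp_all
  also have "\<dots> = (-1) ^ s * int q ^ (N + (N - s))"
    by (simp add: card_vec_prefix[OF sN] power_add mult_ac)
  finally show ?thesis unfolding eq1 .
qed

end

section \<open>Block lower triangular and alternating matrices\<close>

lemma minv_lower_block:
  fixes A1 :: "'a::field mat"
  assumes "A1 \<in> GL s" "A4 \<in> GL m" "A3 \<in> carrier_mat m s"
  shows "four_block_mat A1 (0\<^sub>m s m) A3 A4 \<in> GL (s + m)"
    and "minv (four_block_mat A1 (0\<^sub>m s m) A3 A4)
      = four_block_mat (minv A1) (0\<^sub>m s m) (- (minv A4 * A3 * minv A1)) (minv A4)"
proof -
  let ?M = "four_block_mat A1 (0\<^sub>m s m) A3 A4"
  let ?R = "four_block_mat (minv A1) (0\<^sub>m s m) (- (minv A4 * A3 * minv A1)) (minv A4)"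
  note c = GL_carrier[OF assms(1)] GL_carrier[OF assms(2)] assms(3)
  note i1 = minv[OF assms(1)] note i4 = minv[OF assms(2)]
  have "?M * ?R = four_block_mat (A1 * minv A1 + 0\<^sub>m s m * (- (minv A4 * A3 * minv A1)))
      (A1 * 0\<^sub>m s m + 0\<^sub>m s m * minv A4)
      (A3 * minv A1 + A4 * (- (minv A4 * A3 * minv A1))) (A3 * 0\<^sub>m s m + A4 * minv A4)"
    using c i1(1) i4(1) by (intro mult_four_block_mat) auto
  also have "A3 * minv A1 + A4 * (- (minv A4 * A3 * minv A1)) = 0\<^sub>m m s"
  proof -
    have "A4 * (minv A4 * A3 * minv A1) = A3 * minv A1"
    proof -
      have "A4 * (minv A4 * A3 * minv A1) = A4 * (minv A4 * (A3 * minv A1))"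
        using c i1(1) i4(1) by (simp add: assoc_mult_mat[of "minv A4" m m A3 s "minv A1" s])
      also have "\<dots> = A3 * minv A1" using c i1(1) by (intro minv_mult_cancel(1)[OF assms(2), of _ s]) auto
      finally show ?thesis .
    qed
    moreover have "A4 * (- (minv A4 * A3 * minv A1)) = - (A4 * (minv A4 * A3 * minv A1))"
      using c i1(1) i4(1) by (simp add: uminus_mult_right_mat)
    ultimately show ?thesis using c i1(1) by (auto intro!: eq_matI)
  qed
  moreover have "1\<^sub>m s + - 0\<^sub>m s s = (1\<^sub>m s :: 'a mat)" by (auto intro!: eq_matI)
  ultimately have MR: "?M * ?R = 1\<^sub>m (s + m)" using c i1 i4 by simp
  have Mc: "?M \<in> carrier_mat (s + m) (s + m)" "?R \<in> carrier_mat (s + m) (s + m)"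
    using c i1(1) i4(1) by auto
  show "?M \<in> GL (s + m)" "minv ?M = ?R" using GL_I[OF Mc MR] by auto
qed

lemma lower_block_cases:
  assumes A: "A \<in> GL (s + m)" and z: "\<And>i j. i < s \<Longrightarrow> j < m \<Longrightarrow> A $$ (i, s + j) = (0::'a::field)"
  obtains A1 A3 A4 where "A1 \<in> GL s" "A3 \<in> carrier_mat m s" "A4 \<in> GL m"
    "A = four_block_mat A1 (0\<^sub>m s m) A3 A4"
proof -
  obtain A1 A2 A3 A4 where s: "A1 \<in> carrier_mat s s" "A2 \<in> carrier_mat s m"
    "A3 \<in> carrier_mat m s" "A4 \<in> carrier_mat m m" "A = four_block_mat A1 A2 A3 A4"
    using split_mat[OF GL_carrier[OF A]] by metis
  have A2: "A2 = 0\<^sub>m s m"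
  proof (rule eq_matI)
    fix i j assume "i < dim_row (0\<^sub>m s m)" "j < dim_col (0\<^sub>m s m)"
    then show "A2 $$ (i, j) = 0\<^sub>m s m $$ (i, j)" using z[of i j] s by simp
  qed (use s in auto)
  have "det A = det A1 * det A4"
    unfolding s(5) using s A2 by (intro det_four_block_mat_upper_right_zero) auto
  then have "A1 \<in> GL s" "A4 \<in> GL m" using A s by (auto simp: GL_def)
  then show thesis using that s A2 by blast
qed

text \<open>The leading block ranges over an arbitrary set P because two instances occur: symmetric
  blocks in the character sum, and all of \<open>GL s\<close> in the stabilizer.\<close>

lemma bij_lower_block:
  assumes P: "P \<subseteq> GL s"
  shows "bij_betw (\<lambda>(A1, A3, A4). four_block_mat A1 (0\<^sub>m s m) A3 A4) (P \<times> carrier_mat m s \<times> GL m)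
    {A \<in> GL (s + m). (\<forall>i<s. \<forall>j<m. A $$ (i, s + j) = (0::'a::field)) \<and> mat s s (\<lambda>ij. A $$ ij) \<in> P}"
    (is "bij_betw ?f ?D ?T")
  unfolding bij_betw_def
proof
  have corner: "mat s s (\<lambda>ij. four_block_mat A1 (0\<^sub>m s m) A3 A4 $$ ij) = A1"
    if "A1 \<in> carrier_mat s s" "A4 \<in> carrier_mat m m" for A1 A3 A4 :: "'a mat"
    using that by (intro eq_matI) auto
  show "inj_on ?f ?D"
  proof (rule inj_onI)
    fix x y assume D: "x \<in> ?D" "y \<in> ?D" and f: "?f x = ?f y"
    obtain A1 A3 A4 where x: "x = (A1, A3, A4)" by (cases x)
    obtain B1 B3 B4 where y: "y = (B1, B3, B4)" by (cases y)
    have h: "A1 \<in> P" "A3 \<in> carrier_mat m s" "A4 \<in> GL m" "B1 \<in> P" "B3 \<in> carrier_mat m s" "B4 \<in> GL m"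
      and eq: "four_block_mat A1 (0\<^sub>m s m) A3 A4 = four_block_mat B1 (0\<^sub>m s m) B3 B4"
      using D f by (auto simp: x y)
    have "A1 \<in> carrier_mat s s" "B1 \<in> carrier_mat s s" using h P by (auto dest!: GL_carrier)
    then show "x = y"
      using four_block_mat_eqD[OF eq, of s s m m] h by (auto simp: x y dest: GL_carrier)
  qed
  show "?f ` ?D = ?T"
  proof (intro equalityI subsetI)
    fix A assume "A \<in> ?f ` ?D"
    then obtain A1 A3 A4 where h: "A1 \<in> P" "A3 \<in> carrier_mat m s" "A4 \<in> GL m"
      "A = four_block_mat A1 (0\<^sub>m s m) A3 A4" by auto
    have A1: "A1 \<in> GL s" using h P by auto
    have "A \<in> GL (s + m)" unfolding h(4) using A1 h by (intro minv_lower_block)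
    moreover have "\<forall>i<s. \<forall>j<m. A $$ (i, s + j) = 0"
      using GL_carrier[OF A1] GL_carrier[OF h(3)] by (simp add: h(4))
    moreover have "mat s s (\<lambda>ij. A $$ ij) = A1"
      unfolding h(4) using corner GL_carrier[OF A1] GL_carrier[OF h(3)] by blast
    ultimately show "A \<in> ?T" using h(1) by simp
  next
    fix A assume A: "A \<in> ?T"
    then obtain A1 A3 A4 where h: "A1 \<in> GL s" "A3 \<in> carrier_mat m s" "A4 \<in> GL m"
      "A = four_block_mat A1 (0\<^sub>m s m) A3 A4"
      using lower_block_cases[of A s m] by auto
    have "mat s s (\<lambda>ij. A $$ ij) = A1"
      unfolding h(4) using corner GL_carrier[OF h(1)] GL_carrier[OF h(3)] by blast
    then have "A1 \<in> P" using A by simp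
    then show "A \<in> ?f ` ?D" using h by (intro image_eqI[of _ _ "(A1, A3, A4)"]) auto
  qed
qed

definition Alt :: "nat \<Rightarrow> 'a::zero mat set" where
  "Alt N = {C \<in> carrier_mat N N. alternating_mat C}"

lemma Alt_iff: "C \<in> Alt N \<longleftrightarrow> C \<in> carrier_mat N N \<and> (\<forall>i<N. C $$ (i, i) = 0) \<and>
   (\<forall>i<N. \<forall>j<N. C $$ (i, j) = C $$ (j, i))"
proof -
  have "C\<^sup>T = C \<longleftrightarrow> (\<forall>i<N. \<forall>j<N. C $$ (i, j) = C $$ (j, i))" if c: "C \<in> carrier_mat N N"
  proof
    assume t: "C\<^sup>T = C"
    show "\<forall>i<N. \<forall>j<N. C $$ (i, j) = C $$ (j, i)"
    proof (intro allI impI)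
      fix i j assume "i < N" "j < N"
      then have "C\<^sup>T $$ (i, j) = C $$ (j, i)" using c by simp
      then show "C $$ (i, j) = C $$ (j, i)" unfolding t .
    qed
  qed (use c in \<open>auto intro!: eq_matI\<close>)
  then show ?thesis by (auto simp: Alt_def alternating_mat_def)
qed

lemma finite_Alt [simp]: "finite (Alt N :: 'a::{finite,zero} mat set)"
  by (simp add: Alt_def)

text \<open>An alternating matrix is determined by its entries below the diagonal, and a zero
  leading corner leaves i free entries in each row i >= s. The case s = 0 counts all alternating
  matrices.\<close>

lemma card_Alt_corner_zero:
  "card {C \<in> Alt N. \<forall>i<s. \<forall>j<s. C $$ (i, j) = (0::'a::{finite,zero})} = CARD('a) ^ (\<Sum>i\<in>{s..<N}. i)"
  if sN: "s \<le> N"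
proof -
  let ?E = "SIGMA i:{s..<N}. {..<i}"
  have E: "?E \<subseteq> {..<N} \<times> {..<N}" by auto
  let ?T = "{A \<in> carrier_mat N N. \<forall>i<N. \<forall>j<N. (i, j) \<notin> ?E \<longrightarrow> A $$ (i, j) = (0::'a)}"
  have "bij_betw (\<lambda>C. mat N N (\<lambda>ij. if ij \<in> ?E then C $$ ij else 0))
      {C \<in> Alt N. \<forall>i<s. \<forall>j<s. C $$ (i, j) = (0::'a)} ?T"
  proof (rule bij_betw_byWitness[where f' = "\<lambda>L. mat N N (\<lambda>(i, j). if (i, j) \<in> ?E then L $$ (i, j)
      else if (j, i) \<in> ?E then L $$ (j, i) else 0)"])
    show "\<forall>C\<in>{C \<in> Alt N. \<forall>i<s. \<forall>j<s. C $$ (i, j) = (0::'a)}.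
       mat N N (\<lambda>(i, j). if (i, j) \<in> ?E then mat N N (\<lambda>ij. if ij \<in> ?E then C $$ ij else 0) $$ (i, j)
          else if (j, i) \<in> ?E then mat N N (\<lambda>ij. if ij \<in> ?E then C $$ ij else 0) $$ (j, i) else 0) = C"
    proof
      fix C :: "'a mat" assume "C \<in> {C \<in> Alt N. \<forall>i<s. \<forall>j<s. C $$ (i, j) = 0}"
      then have C: "C \<in> carrier_mat N N" "\<And>i. i < N \<Longrightarrow> C $$ (i, i) = 0"
        "\<And>i j. i < N \<Longrightarrow> j < N \<Longrightarrow> C $$ (i, j) = C $$ (j, i)"
        "\<And>i j. i < s \<Longrightarrow> j < s \<Longrightarrow> C $$ (i, j) = 0" by (auto simp: Alt_iff)
      show "mat N N (\<lambda>(i, j). if (i, j) \<in> ?E then mat N N (\<lambda>ij. if ij \<in> ?E then C $$ ij else 0) $$ (i, j)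
          else if (j, i) \<in> ?E then mat N N (\<lambda>ij. if ij \<in> ?E then C $$ ij else 0) $$ (j, i) else 0) = C"
      proof (rule eq_matI)
        fix i j assume "i < dim_row C" "j < dim_col C"
        then have ij: "i < N" "j < N" using C(1) by auto
        consider "j < i" "s \<le> i" | "i < j" "s \<le> j" | "i = j" | "i < s" "j < s" by linarith
        then show "mat N N (\<lambda>(i, j). if (i, j) \<in> ?E then mat N N (\<lambda>ij. if ij \<in> ?E then C $$ ij else 0) $$ (i, j)
          else if (j, i) \<in> ?E then mat N N (\<lambda>ij. if ij \<in> ?E then C $$ ij else 0) $$ (j, i) else 0) $$ (i, j) = C $$ (i, j)"
          using ij C by cases auto
      qed (use C in auto)
    qed
    show "\<forall>L\<in>?T. mat N N (\<lambda>ij. if ij \<in> ?E then mat N N (\<lambda>(i, j). if (i, j) \<in> ?E then L $$ (i, j)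
      else if (j, i) \<in> ?E then L $$ (j, i) else 0) $$ ij else 0) = L"
      by (auto intro!: eq_matI)
    show "(\<lambda>C. mat N N (\<lambda>ij. if ij \<in> ?E then C $$ ij else 0)) ` {C \<in> Alt N. \<forall>i<s. \<forall>j<s. C $$ (i, j) = (0::'a)} \<subseteq> ?T"
      by auto
    show "(\<lambda>L. mat N N (\<lambda>(i, j). if (i, j) \<in> ?E then L $$ (i, j) else if (j, i) \<in> ?E then L $$ (j, i) else 0)) ` ?T
      \<subseteq> {C \<in> Alt N. \<forall>i<s. \<forall>j<s. C $$ (i, j) = (0::'a)}"
      using sN by (auto simp: Alt_iff)
  qed
  then have "card {C \<in> Alt N. \<forall>i<s. \<forall>j<s. C $$ (i, j) = (0::'a)} = card ?T"
    by (rule bij_betw_same_card)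
  then show ?thesis unfolding card_mat_supported[OF E] by simp
qed

lemma card_Alt: "card (Alt N :: 'a::{finite,zero} mat set) = CARD('a) ^ (\<Sum>i<N. i)"
  using card_Alt_corner_zero[of 0 N, where 'a = 'a] by (simp add: atLeast0LessThan)

section \<open>Kloosterman sums over GL(m, q) for m <= 2\<close>

context binary_field
begin

definition gl_kloosterman :: "nat \<Rightarrow> 'a \<Rightarrow> int" where
  "gl_kloosterman m c = (\<Sum>A\<in>GL m. lam (c * (\<Sum>k<m. A $$ (k, k) + minv A $$ (k, k))))"

lemma gl_kloosterman_0: "gl_kloosterman 0 c = 1"
  using card_GL_0[where 'a = 'a] by (simp add: gl_kloosterman_def)

lemma gl_kloosterman_1:
  assumes "c \<noteq> 0" shows "gl_kloosterman 1 c = K c"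
proof -
  let ?m = "\<lambda>a::'a. mat 1 1 (\<lambda>_. a)"
  have inv: "?m a \<in> GL 1 \<and> minv (?m a) = ?m (inverse a)" if "a \<noteq> 0" for a
  proof -
    have "?m a * ?m (inverse a) = 1\<^sub>m 1" using that by (intro eq_matI) (auto simp: scalar_prod_def)
    then show ?thesis using GL_I[of "?m a" 1 "?m (inverse a)"] by simp
  qed
  have "gl_kloosterman 1 c = (\<Sum>a\<in>UNIV - {0}. lam (c * (a + inverse a)))"
    unfolding gl_kloosterman_def
  proof (rule sum.reindex_bij_witness[of _ ?m "\<lambda>A. A $$ (0, 0)"])
    fix A :: "'a mat" assume A: "A \<in> GL 1"
    then have Ac: "A \<in> carrier_mat 1 1" by (rule GL_carrier)
    show e: "?m (A $$ (0, 0)) = A" using Ac by (intro eq_matI) auto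
    have "det A = A $$ (0, 0)" using Ac by (simp add: det_single)
    then show nz: "A $$ (0, 0) \<in> UNIV - {0}" using A by (simp add: GL_def)
    have "minv A = ?m (inverse (A $$ (0, 0)))" using inv[of "A $$ (0, 0)"] nz e by simp
    then show "lam (c * (A $$ (0, 0) + inverse (A $$ (0, 0))))
        = lam (c * (\<Sum>k<1. A $$ (k, k) + minv A $$ (k, k)))" by simp
  next
    fix a :: 'a assume "a \<in> UNIV - {0}"
    then show "?m a $$ (0, 0) = a" "?m a \<in> GL 1" using inv[of a] by auto
  qed
  then show ?thesis using K_eq_units_sum[OF assms] by simp
qed

lemma card_mult_eq: "int (card {(x, y). x * y = (e::'a)}) = int q - 1 + (if e = 0 then int q else 0)"
proof (cases "e = 0")
  case True
  have "{(x, y). x * y = e} = ({0} \<times> UNIV) \<union> ((UNIV - {0::'a}) \<times> {0})" using True by auto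
  also have "card \<dots> = q + (q - 1)"
    by (subst card_Un_disjoint) (auto simp: card_cartesian_product card_units)
  finally show ?thesis using True q_ge_2 by (simp add: of_nat_diff)
next
  case False
  have "bij_betw (\<lambda>x. (x, e / x)) (UNIV - {0}) {(x, y). x * y = e}"
    using False by (intro bij_betw_byWitness[where f' = fst]) auto
  then have "card {(x, y). x * y = e} = q - 1" using bij_betw_same_card card_units by fastforce
  then show ?thesis using False q_ge_2 by (simp add: of_nat_diff)
qed

text \<open>With e = det A the exponent is c (a + d)(1 + 1 / e), so the off-diagonal entries matter
  only through the number of pairs with b x = a d + e: this is q - 1, and q more if e = a d. The
  uniform part is a full sum over a and d that survives only for e = 1; in the extra part e = a d
  the exponent separates into a + 1 / a and d + 1 / d.\<close>

lemma gl_kloosterman_2: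
  assumes c: "c \<noteq> 0" shows "gl_kloosterman 2 c = int q * (K c)\<^sup>2 + (int q)\<^sup>2 * (int q - 1)"
proof -
  let ?m = "\<lambda>(a, d, b, x). mat 2 2 (\<lambda>(i, j). if i = 0 then (if j = 0 then a else b) else (if j = 0 then x else (d::'a)))"
  let ?D = "\<lambda>(a, d, b, x). a * d + b * (x::'a)"
  let ?S = "{p. ?D p \<noteq> 0}"
  have inv: "?m (a, d, b, x) \<in> GL 2 \<and> minv (?m (a, d, b, x)) $$ (0, 0) = d / (a * d + b * x)
      \<and> minv (?m (a, d, b, x)) $$ (1, 1) = a / (a * d + b * x)" if "a * d + b * x \<noteq> 0" for a d b x
  proof -
    let ?e = "a * d + b * x"
    let ?R = "?m (d / ?e, a / ?e, b / ?e, x / ?e)"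
    have "?m (a, d, b, x) * ?R = 1\<^sub>m 2"
      using that by (intro eq_matI)
        (auto simp: scalar_prod_def numeral_2_eq_2 less_Suc_eq add_divide_distrib[symmetric] mult.commute)
    then show ?thesis using GL_I[of "?m (a, d, b, x)" 2 ?R] by auto
  qed
  have det: "?D (A $$ (0, 0), A $$ (1, 1), A $$ (0, 1), A $$ (1, 0)) \<noteq> 0" if A: "A \<in> GL 2" for A :: "'a mat"
  proof
    assume z: "?D (A $$ (0, 0), A $$ (1, 1), A $$ (0, 1), A $$ (1, 0)) = 0"
    note Ac = GL_carrier[OF A] note i = minv[OF A]
    have e: "(\<Sum>l<2. A $$ (a, l) * minv A $$ (l, b)) = (if a = b then 1 else 0)" if "a < 2" "b < 2" for a b
    proof -
      have "(A * minv A) $$ (a, b) = (\<Sum>l<2. A $$ (a, l) * minv A $$ (l, b))"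
        using that Ac i(1) by (simp add: scalar_prod_def atLeast0LessThan)
      then show ?thesis using that unfolding i(2) by simp
    qed
    have s2: "(\<Sum>l<2. f l) = f 0 + f 1" for f :: "nat \<Rightarrow> 'a" by (simp add: numeral_2_eq_2)
    have e': "A $$ (0, 0) * minv A $$ (0, 0) + A $$ (0, 1) * minv A $$ (1, 0) = 1"
      "A $$ (0, 0) * minv A $$ (0, 1) + A $$ (0, 1) * minv A $$ (1, 1) = 0"
      "A $$ (1, 0) * minv A $$ (0, 0) + A $$ (1, 1) * minv A $$ (1, 0) = 0"
      "A $$ (1, 0) * minv A $$ (0, 1) + A $$ (1, 1) * minv A $$ (1, 1) = 1"
      using e[of 0 0] e[of 0 1] e[of 1 0] e[of 1 1] unfolding s2 by simp_all
    have z': "A $$ (0, 0) * A $$ (1, 1) = A $$ (0, 1) * A $$ (1, 0)"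
      using z by (simp add: add_eq_zero_char2)
    have "A $$ (1, 1) = A $$ (1, 1) * (A $$ (0, 0) * minv A $$ (0, 0) + A $$ (0, 1) * minv A $$ (1, 0))"
      unfolding e'(1) by simp
    also have "\<dots> = A $$ (0, 1) * (A $$ (1, 0) * minv A $$ (0, 0) + A $$ (1, 1) * minv A $$ (1, 0))"
      using z' by (simp add: algebra_simps)
    finally have a11: "A $$ (1, 1) = 0" unfolding e'(3) by simp
    then have "A $$ (1, 0) \<noteq> 0" "A $$ (0, 1) * A $$ (1, 0) = 0" using e'(4) z' by auto
    then have "A $$ (0, 1) = 0" by simp
    then have "A $$ (0, 0) * minv A $$ (0, 1) = 0" "A $$ (0, 0) * minv A $$ (0, 0) = 1" using e' by auto
    then have "minv A $$ (0, 1) = 0" by auto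
    then show False using e'(4) a11 by simp
  qed
  have "gl_kloosterman 2 c = (\<Sum>p\<in>?S. case p of (a, d, b, x) \<Rightarrow> lam (c * ((a + d) * (1 + inverse (a * d + b * x)))))"
    unfolding gl_kloosterman_def
  proof (rule sum.reindex_bij_witness[of _ ?m "\<lambda>A. (A $$ (0, 0), A $$ (1, 1), A $$ (0, 1), A $$ (1, 0))"])
    fix A :: "'a mat" assume A: "A \<in> GL 2"
    note Ac = GL_carrier[OF A]
    show e: "?m (A $$ (0, 0), A $$ (1, 1), A $$ (0, 1), A $$ (1, 0)) = A"
      using Ac by (intro eq_matI) (auto simp: numeral_2_eq_2 less_Suc_eq)
    show d: "(A $$ (0, 0), A $$ (1, 1), A $$ (0, 1), A $$ (1, 0)) \<in> ?S" using det[OF A] by simp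
    have i: "minv A $$ (0, 0) = A $$ (1, 1) / (A $$ (0, 0) * A $$ (1, 1) + A $$ (0, 1) * A $$ (1, 0))"
      "minv A $$ (1, 1) = A $$ (0, 0) / (A $$ (0, 0) * A $$ (1, 1) + A $$ (0, 1) * A $$ (1, 0))"
      using inv[of "A $$ (0, 0)" "A $$ (1, 1)" "A $$ (0, 1)" "A $$ (1, 0)"] d unfolding e by auto
    have s2: "(\<Sum>k<2. A $$ (k, k) + minv A $$ (k, k))
        = (A $$ (0, 0) + minv A $$ (0, 0)) + (A $$ (1, 1) + minv A $$ (1, 1))"
      by (simp add: numeral_2_eq_2)
    show "(case (A $$ (0, 0), A $$ (1, 1), A $$ (0, 1), A $$ (1, 0)) of
          (a, d, b, x) \<Rightarrow> lam (c * ((a + d) * (1 + inverse (a * d + b * x)))))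
        = lam (c * (\<Sum>k<2. A $$ (k, k) + minv A $$ (k, k)))"
      unfolding s2 i by (simp add: algebra_simps divide_inverse)
  next
    fix p assume "p \<in> ?S"
    then show "?m p \<in> GL 2" "(?m p $$ (0, 0), ?m p $$ (1, 1), ?m p $$ (0, 1), ?m p $$ (1, 0)) = p"
      using inv by (auto split: prod.splits)
  qed
  also have "\<dots> = (\<Sum>a\<in>UNIV. \<Sum>d\<in>UNIV. \<Sum>e\<in>UNIV - {0}.
      (int q - 1 + (if e = a * d then int q else 0)) * lam (c * ((a + d) * (1 + inverse e))))"
  proof -
    \<comment> \<open>The determinant e is added as a coordinate determined by the others, so that
      (b, x) can be counted for fixed a, d, e.\<close>
    let ?T = "SIGMA a:(UNIV::'a set). SIGMA d:(UNIV::'a set). SIGMA e:UNIV - {0::'a}. {(b, x). b * x = a * d + e}"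
    have "(\<Sum>p\<in>?S. case p of (a, d, b, x) \<Rightarrow> lam (c * ((a + d) * (1 + inverse (a * d + b * x)))))
        = (\<Sum>(a, d, e, b, x)\<in>?T. lam (c * ((a + d) * (1 + inverse e))))"
      by (rule sum.reindex_bij_witness[of _ "\<lambda>(a, d, e, b, x). (a, d, b, x)" "\<lambda>(a, d, b, x). (a, d, a * d + b * x, b, x)"])
         auto
    also have "\<dots> = (\<Sum>a\<in>UNIV. \<Sum>d\<in>UNIV. \<Sum>e\<in>UNIV - {0}. \<Sum>(b, x)\<in>{(b, x). b * x = a * d + e}.
        lam (c * ((a + d) * (1 + inverse e))))"
      by (simp add: sum.Sigma split_def del: sum_constant)
    also have "\<dots> = (\<Sum>a\<in>UNIV. \<Sum>d\<in>UNIV. \<Sum>e\<in>UNIV - {0}.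
      (int q - 1 + (if e = a * d then int q else 0)) * lam (c * ((a + d) * (1 + inverse e))))"
      by (intro sum.cong refl) (auto simp: card_mult_eq add_eq_zero_char2)
    finally show ?thesis .
  qed
  also have "\<dots> = (int q - 1) * (\<Sum>e\<in>UNIV - {0}. \<Sum>a\<in>UNIV. \<Sum>d\<in>UNIV. lam (c * ((a + d) * (1 + inverse e))))
      + int q * (\<Sum>a\<in>UNIV. \<Sum>d\<in>UNIV. \<Sum>e\<in>UNIV - {0}. if e = a * d then lam (c * ((a + d) * (1 + inverse e))) else 0)"
  proof -
    have 1: "(\<Sum>a\<in>UNIV. \<Sum>d\<in>UNIV. \<Sum>e\<in>UNIV - {0}. g a d e) = (\<Sum>e\<in>UNIV - {0}. \<Sum>a\<in>UNIV. \<Sum>d\<in>UNIV. g a d e)"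
      for g :: "'a \<Rightarrow> 'a \<Rightarrow> 'a \<Rightarrow> int"
    proof -
      have "(\<Sum>a\<in>UNIV. \<Sum>d\<in>UNIV. \<Sum>e\<in>UNIV - {0}. g a d e) = (\<Sum>a\<in>UNIV. \<Sum>e\<in>UNIV - {0}. \<Sum>d\<in>UNIV. g a d e)"
        by (intro sum.cong refl sum.swap)
      also have "\<dots> = (\<Sum>e\<in>UNIV - {0}. \<Sum>a\<in>UNIV. \<Sum>d\<in>UNIV. g a d e)" by (rule sum.swap)
      finally show ?thesis .
    qed
    have 2: "(int q - 1 + (if e = a * d then int q else 0)) * z = (int q - 1) * z + int q * (if e = a * d then z else 0)"
      for e a d :: 'a and z by (simp add: algebra_simps)
    show ?thesis unfolding 2 sum.distrib sum_distrib_left[symmetric] by (simp only: 1)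
  qed
  also have "(\<Sum>e\<in>UNIV - {0}. \<Sum>a\<in>UNIV. \<Sum>d\<in>UNIV. lam (c * ((a + d) * (1 + inverse e)))) = (int q)\<^sup>2"
  proof -
    have "(\<Sum>a\<in>UNIV. \<Sum>d\<in>UNIV. lam (c * ((a + d) * (1 + inverse e)))) = (if e = 1 then (int q)\<^sup>2 else 0)"
      if "e \<in> UNIV - {0}" for e
    proof -
      have "(\<Sum>a\<in>UNIV. \<Sum>d\<in>UNIV. lam (c * ((a + d) * (1 + inverse e))))
          = (\<Sum>a\<in>UNIV. \<Sum>d\<in>UNIV. lam (a * (c * (1 + inverse e))) * lam (d * (c * (1 + inverse e))))"
        unfolding lam_add[symmetric] by (intro sum.cong refl arg_cong[where f = lam]) (simp add: algebra_simps)
      also have "\<dots> = (\<Sum>a\<in>UNIV. lam (a * (c * (1 + inverse e)))) * (\<Sum>a\<in>UNIV. lam (a * (c * (1 + inverse e))))"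
        by (rule sum_product[symmetric])
      also have "\<dots> = (if e = 1 then (int q)\<^sup>2 else 0)"
      proof -
        have "c * (1 + inverse e) = 0 \<longleftrightarrow> e = 1" using c that by (auto simp: add_eq_zero_char2 field_simps)
        then show ?thesis by (simp add: sum_lam_mult power2_eq_square)
      qed
      finally show ?thesis .
    qed
    then have "(\<Sum>e\<in>UNIV - {0}. \<Sum>a\<in>UNIV. \<Sum>d\<in>UNIV. lam (c * ((a + d) * (1 + inverse e))))
        = (\<Sum>e\<in>UNIV - {0::'a}. if e = 1 then (int q)\<^sup>2 else 0)" by (rule sum.cong[OF refl])
    then show ?thesis by simp
  qed
  also have "(\<Sum>a\<in>UNIV. \<Sum>d\<in>UNIV. \<Sum>e\<in>UNIV - {0}. if e = a * d then lam (c * ((a + d) * (1 + inverse e))) else 0)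
      = (K c)\<^sup>2"
  proof -
    have "(\<Sum>e\<in>UNIV - {0}. if e = a * d then lam (c * ((a + d) * (1 + inverse e))) else 0)
        = (if a \<noteq> 0 \<and> d \<noteq> 0 then lam (c * (a + inverse a)) * lam (c * (d + inverse d)) else 0)" for a d
    proof (cases "a = 0 \<or> d = 0")
      case False
      have "(a + d) * (1 + inverse (a * d)) = (a + inverse a) + (d + inverse d)"
        using False by (simp add: field_simps)
      then show ?thesis using False by (simp add: lam_add distrib_left)
    qed auto
    then have "(\<Sum>a\<in>UNIV. \<Sum>d\<in>UNIV. \<Sum>e\<in>UNIV - {0}. if e = a * d then lam (c * ((a + d) * (1 + inverse e))) else 0)
       = (\<Sum>a\<in>UNIV. \<Sum>d\<in>UNIV. (if a \<noteq> 0 then lam (c * (a + inverse a)) else 0) * (if d \<noteq> 0 then lam (c * (d + inverse d)) else 0))"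
      by (simp only:) (intro sum.cong refl, auto)
    also have "\<dots> = (\<Sum>a\<in>UNIV. if a \<noteq> 0 then lam (c * (a + inverse a)) else 0)
        * (\<Sum>a\<in>UNIV. if a \<noteq> 0 then lam (c * (a + inverse a)) else 0)"
      by (rule sum_product[symmetric])
    also have "(\<Sum>a\<in>UNIV. if a \<noteq> 0 then lam (c * (a + inverse a)) else 0) = K c"
      unfolding K_eq_units_sum[OF c, symmetric] by (rule sum.mono_neutral_cong_right) auto
    finally show ?thesis by (simp add: power2_eq_square)
  qed
  finally show ?thesis by (simp add: algebra_simps)
qed

end

section \<open>The group \<open>Q\<close> and its double cosets\<close>

text \<open>The zeros are those of matrices that preserve the span of the first N basis vectors and
  its orthogonal complement, which also contains the last two.\<close>

definition blk :: "nat \<Rightarrow> 'a mat \<Rightarrow> 'a mat \<Rightarrow> 'a mat \<Rightarrow> 'a mat \<Rightarrow> 'a mat \<Rightarrow> 'a mat \<Rightarrow> 'a::zero mat" where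
  "blk N A Y Z D G w = mat (2 * N + 2) (2 * N + 2) (\<lambda>(i, j).
     if i < N then (if j < N then A $$ (i, j) else if j < 2 * N then Y $$ (i, j - N) else Z $$ (i, j - 2 * N))
     else if i < 2 * N then (if N \<le> j \<and> j < 2 * N then D $$ (i - N, j - N) else 0)
     else (if j < N then 0 else if j < 2 * N then G $$ (i - 2 * N, j - N) else w $$ (i - 2 * N, j - 2 * N)))"

lemma blk_carrier [simp]: "blk N A Y Z D G w \<in> carrier_mat (2 * N + 2) (2 * N + 2)"
  by (simp add: blk_def)

lemma diag_times_unipotent:
  fixes A :: "'a::field mat"
  assumes "A \<in> carrier_mat N N" "E \<in> carrier_mat N N" "w \<in> carrier_mat 2 2"
    "B \<in> carrier_mat N N" "h \<in> carrier_mat 2 N"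
  shows "diag_block_mat [A, E, w] * Q_unipotent (Suc N) w B h
    = blk N A (A * B) (A * (h\<^sup>T * w\<^sup>T * eta_mat * w)) E (w * h) w"
proof -
  define X where "X = h\<^sup>T * w\<^sup>T * eta_mat * w"
  have eta: "eta_mat \<in> carrier_mat 2 2" by (simp add: eta_mat_def mat_of_rows_list_def numeral_2_eq_2)
  have X: "X \<in> carrier_mat N 2" unfolding X_def using assms eta by auto
  let ?P = "four_block_mat A (0\<^sub>m N N) (0\<^sub>m N N) E"
  let ?U = "four_block_mat (1\<^sub>m N) B (0\<^sub>m N N) (1\<^sub>m N)"
  let ?XX = "X @\<^sub>r 0\<^sub>m N 2" and ?H = "append_cols (0\<^sub>m 2 N) h"
  have d: "diag_block_mat [A, E, w] = four_block_mat ?P (0\<^sub>m (N + N) 2) (0\<^sub>m 2 (N + N)) w"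
    using assms by (intro eq_matI) (auto simp: Let_def)
  have u: "Q_unipotent (Suc N) w B h = four_block_mat ?U ?XX ?H (1\<^sub>m 2)"
    by (simp add: Q_unipotent_def X_def)
  have c: "?P \<in> carrier_mat (N + N) (N + N)" "?U \<in> carrier_mat (N + N) (N + N)"
    "?XX \<in> carrier_mat (N + N) 2" "?H \<in> carrier_mat 2 (N + N)"
    using assms X by (auto simp: append_cols_def)
  have prod: "diag_block_mat [A, E, w] * Q_unipotent (Suc N) w B h
      = four_block_mat (?P * ?U + 0\<^sub>m (N + N) 2 * ?H) (?P * ?XX + 0\<^sub>m (N + N) 2 * 1\<^sub>m 2)
        (0\<^sub>m 2 (N + N) * ?U + w * ?H) (0\<^sub>m 2 (N + N) * ?XX + w * 1\<^sub>m 2)"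
    unfolding d u using c assms by (intro mult_four_block_mat) auto
  have PU: "?P * ?U = four_block_mat A (A * B) (0\<^sub>m N N) E"
  proof -
    have "?P * ?U = four_block_mat (A * 1\<^sub>m N + 0\<^sub>m N N * 0\<^sub>m N N) (A * B + 0\<^sub>m N N * 1\<^sub>m N)
        (0\<^sub>m N N * 1\<^sub>m N + E * 0\<^sub>m N N) (0\<^sub>m N N * B + E * 1\<^sub>m N)"
      using assms by (intro mult_four_block_mat) auto
    then show ?thesis using assms by simp
  qed
  have PX: "(?P * ?XX) $$ (i, j) = (if i < N then (A * X) $$ (i, j) else 0)" if "i < N + N" "j < 2" for i j
  proof -
    have xx: "?XX = four_block_mat X (0\<^sub>m N 0) (0\<^sub>m N 2) (0\<^sub>m N 0)"
      using X by (simp add: append_rows_def)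
    have "?P * ?XX = four_block_mat (A * X + 0\<^sub>m N N * 0\<^sub>m N 2) (A * 0\<^sub>m N 0 + 0\<^sub>m N N * 0\<^sub>m N 0)
        (0\<^sub>m N N * X + E * 0\<^sub>m N 2) (0\<^sub>m N N * 0\<^sub>m N 0 + E * 0\<^sub>m N 0)"
      unfolding xx using assms X by (intro mult_four_block_mat) auto
    then show ?thesis using assms X that by simp
  qed
  have wH: "(w * ?H) $$ (i, j) = (if j < N then 0 else (w * h) $$ (i, j - N))" if "i < 2" "j < N + N" for i j
  proof -
    have "col ?H j = (if j < N then 0\<^sub>v 2 else col h (j - N))"
      using that assms by (auto simp: append_cols_def intro!: eq_vecI)
    then show ?thesis using that c assms by auto
  qed
  show ?thesis
    unfolding X_def[symmetric]
  proof (rule eq_matI)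
    fix i j assume "i < dim_row (blk N A (A * B) (A * X) E (w * h) w)"
      "j < dim_col (blk N A (A * B) (A * X) E (w * h) w)"
    then have ij: "i < 2 * N + 2" "j < 2 * N + 2" by (auto simp: blk_def)
    have dims: "dim_row A = N" "dim_col A = N" "dim_row E = N" "dim_col E = N" "dim_row w = 2" "dim_col w = 2"
      "dim_row B = N" "dim_col B = N" "dim_row X = N" "dim_col X = 2" "dim_row h = 2" "dim_col h = N"
      "dim_row ?H = 2" "dim_col ?H = N + N" "dim_row ?XX = N + N" "dim_col ?XX = 2"
      using assms X carrier_matD[OF c(3)] carrier_matD[OF c(4)] by auto
    consider "i < N + N" "j < N + N" | "i < N + N" "N + N \<le> j" | "N + N \<le> i" "j < N + N" | "N + N \<le> i" "N + N \<le> j"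
      by linarith
    then show "(diag_block_mat [A, E, w] * Q_unipotent (Suc N) w B h) $$ (i, j)
        = blk N A (A * B) (A * X) E (w * h) w $$ (i, j)"
    proof cases
      case 1
      then show ?thesis unfolding prod PU using ij dims by (auto simp: blk_def)
    next
      case 2
      then show ?thesis unfolding prod PU using ij dims PX[of i "j - (N + N)"] by (auto simp: blk_def mult_2)
    next
      case 3
      then show ?thesis unfolding prod PU using ij dims wH[of "i - (N + N)" j] by (auto simp: blk_def mult_2)
    next
      case 4
      then show ?thesis unfolding prod PU using ij dims by (auto simp: blk_def mult_2)
    qed
  qed (use assms in \<open>auto simp: blk_def Q_unipotent_def\<close>)
qed

lemma sum_split3: "(\<Sum>j<2 * N + 2. f j) = (\<Sum>j<N. f j) + (\<Sum>j<N. f (N + j)) + f (2 * N) + f (2 * N + 1 :: nat)"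
proof -
  have "(\<Sum>j<N + M. f j) = (\<Sum>j<N. f j) + (\<Sum>j<M. f (N + j))" for M
    by (induction M) (simp_all add: add.assoc)
  from this[of N] show ?thesis by (simp add: mult_2)
qed

lemma index_mult_mat_sum:
  "A \<in> carrier_mat m n \<Longrightarrow> B \<in> carrier_mat n p \<Longrightarrow> i < m \<Longrightarrow> j < p \<Longrightarrow>
    (A * B) $$ (i, j) = (\<Sum>l<n. A $$ (i, l) * B $$ (l, j))"
  by (simp add: scalar_prod_def atLeast0LessThan)

lemma index_mult_vec_sum:
  "A \<in> carrier_mat m n \<Longrightarrow> x \<in> carrier_vec n \<Longrightarrow> i < m \<Longrightarrow>
    (A *\<^sub>v x) $ i = (\<Sum>l<n. A $$ (i, l) * x $ l)"
  by (simp add: scalar_prod_def atLeast0LessThan)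

section \<open>The quadratic form and its isometries\<close>

context minus_type
begin

text \<open>Here N = n - 1, the dimension is 2 N + 2, and coordinates are counted from 0.\<close>

definition theta :: "nat \<Rightarrow> 'a vec \<Rightarrow> 'a" where
  "theta N x = (\<Sum>i<N. x $ i * x $ (N + i)) + nrm (x $ (2 * N)) (x $ (2 * N + 1))"

definition polar :: "nat \<Rightarrow> 'a vec \<Rightarrow> 'a vec \<Rightarrow> 'a" where
  "polar N x y = (\<Sum>i<N. x $ i * y $ (N + i) + x $ (N + i) * y $ i)
     + x $ (2 * N) * y $ (2 * N + 1) + x $ (2 * N + 1) * y $ (2 * N)"

lemma theta_add:
  assumes "x \<in> carrier_vec (2 * N + 2)" "y \<in> carrier_vec (2 * N + 2)"
  shows "theta N (x + y) = theta N x + theta N y + polar N x y"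
proof -
  have "theta N (x + y) = (\<Sum>i<N. (x $ i + y $ i) * (x $ (N + i) + y $ (N + i)))
      + nrm (x $ (2 * N) + y $ (2 * N)) (x $ (2 * N + 1) + y $ (2 * N + 1))"
    using assms by (simp add: theta_def)
  also have "(\<Sum>i<N. (x $ i + y $ i) * (x $ (N + i) + y $ (N + i)))
      = (\<Sum>i<N. x $ i * x $ (N + i)) + (\<Sum>i<N. y $ i * y $ (N + i))
        + (\<Sum>i<N. x $ i * y $ (N + i) + x $ (N + i) * y $ i)"
    unfolding sum.distrib[symmetric] by (intro sum.cong) (auto simp: algebra_simps)
  finally show ?thesis
    by (simp add: theta_def polar_def nrm_def square_add algebra_simps)
qed

lemma polar_unit:
  assumes "x \<in> carrier_vec (2 * N + 2)"
  shows "i < N \<Longrightarrow> polar N x (unit_vec (2 * N + 2) i) = x $ (N + i)"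
    and "i < N \<Longrightarrow> polar N x (unit_vec (2 * N + 2) (N + i)) = x $ i"
    and "polar N x (unit_vec (2 * N + 2) (2 * N)) = x $ (2 * N + 1)"
    and "polar N x (unit_vec (2 * N + 2) (2 * N + 1)) = x $ (2 * N)"
proof -
  show "polar N x (unit_vec (2 * N + 2) i) = x $ (N + i)" if "i < N"
  proof -
    have "(\<Sum>k<N. x $ k * unit_vec (2 * N + 2) i $ (N + k) + x $ (N + k) * unit_vec (2 * N + 2) i $ k)
        = (\<Sum>k<N. if k = i then x $ (N + i) else 0)"
      using that by (intro sum.cong) auto
    then show ?thesis using that by (simp add: polar_def)
  qed
  show "polar N x (unit_vec (2 * N + 2) (N + i)) = x $ i" if "i < N"
  proof -
    have "(\<Sum>k<N. x $ k * unit_vec (2 * N + 2) (N + i) $ (N + k) + x $ (N + k) * unit_vec (2 * N + 2) (N + i) $ k)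
        = (\<Sum>k<N. if k = i then x $ i else 0)"
      using that by (intro sum.cong) auto
    then show ?thesis using that by (simp add: polar_def)
  qed
  have z: "(\<Sum>k<N. x $ k * unit_vec (2 * N + 2) t $ (N + k) + x $ (N + k) * unit_vec (2 * N + 2) t $ k) = 0"
    if "2 * N \<le> t" "t < 2 * N + 2" for t
    using that by (intro sum.neutral) auto
  show "polar N x (unit_vec (2 * N + 2) (2 * N)) = x $ (2 * N + 1)"
    unfolding polar_def using z[of "2 * N"] by simp
  show "polar N x (unit_vec (2 * N + 2) (2 * N + 1)) = x $ (2 * N)"
    unfolding polar_def using z[of "2 * N + 1"] by simp
qed

definition isom :: "nat \<Rightarrow> 'a mat \<Rightarrow> bool" where
  "isom N M \<longleftrightarrow> M \<in> carrier_mat (2 * N + 2) (2 * N + 2) \<and>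
     (\<forall>x\<in>carrier_vec (2 * N + 2). theta N (M *\<^sub>v x) = theta N x)"

lemma isom_mult: "isom N M \<Longrightarrow> isom N M' \<Longrightarrow> isom N (M * M')"
  unfolding isom_def by (auto simp: assoc_mult_mat_vec[of M "2 * N + 2" "2 * N + 2" M' "2 * N + 2"])

lemma isom_polar:
  assumes "isom N M" "x \<in> carrier_vec (2 * N + 2)" "y \<in> carrier_vec (2 * N + 2)"
  shows "polar N (M *\<^sub>v x) (M *\<^sub>v y) = polar N x y"
proof -
  have M: "M \<in> carrier_mat (2 * N + 2) (2 * N + 2)" using assms by (simp add: isom_def)
  have t: "theta N (M *\<^sub>v z) = theta N z" if "z \<in> carrier_vec (2 * N + 2)" for z
    using assms that by (simp add: isom_def)
  have Mc: "M *\<^sub>v x \<in> carrier_vec (2 * N + 2)" "M *\<^sub>v y \<in> carrier_vec (2 * N + 2)" using mult_mat_vec_carrier[OF M] assms by auto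
  have "theta N (M *\<^sub>v (x + y)) = theta N x + theta N y + polar N (M *\<^sub>v x) (M *\<^sub>v y)"
    using theta_add[OF Mc] mult_add_distrib_mat_vec[OF M assms(2,3)] t assms by simp
  moreover have "theta N (M *\<^sub>v (x + y)) = theta N x + theta N y + polar N x y"
    using t[of "x + y"] theta_add[OF assms(2,3)] assms by simp
  ultimately show ?thesis by simp
qed

text \<open>A vector killed by an isometry is orthogonal to everything, and the polar form is
  nondegenerate because pairing with unit vectors reads off every coordinate.\<close>

lemma isom_GL:
  assumes "isom N M" shows "M \<in> GL (2 * N + 2)"
proof (rule ccontr)
  assume "M \<notin> GL (2 * N + 2)"
  moreover have M: "M \<in> carrier_mat (2 * N + 2) (2 * N + 2)" using assms by (simp add: isom_def)
  ultimately have "det M = 0" by (simp add: GL_def)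
  then obtain x where x: "x \<in> carrier_vec (2 * N + 2)" "x \<noteq> 0\<^sub>v (2 * N + 2)" "M *\<^sub>v x = 0\<^sub>v (2 * N + 2)"
    using det_0_iff_vec_prod_zero_field[OF M] by blast
  have "polar N x y = 0" if "y \<in> carrier_vec (2 * N + 2)" for y
  proof -
    have "polar N (0\<^sub>v (2 * N + 2)) (M *\<^sub>v y) = 0" by (simp add: polar_def)
    then show ?thesis using isom_polar[OF assms x(1) that] x(3) by simp
  qed
  then have z: "polar N x (unit_vec (2 * N + 2) i) = 0" for i by simp
  have "x $ i = 0" if i: "i < 2 * N + 2" for i
  proof -
    consider "i < N" | "N \<le> i" "i < 2 * N" | "i = 2 * N" | "i = 2 * N + 1" using i by linarith
    then show ?thesis
    proof cases
      case 1 then show ?thesis using polar_unit(2)[OF x(1) 1] z by simp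
    next
      case 2
      then have i: "i - N < N" "N + (i - N) = i" by auto
      show ?thesis using polar_unit(1)[OF x(1) i(1)] z i(2) by simp
    next
      case 3 then show ?thesis using polar_unit(4)[OF x(1)] z by simp
    next
      case 4 then show ?thesis using polar_unit(3)[OF x(1)] z by simp
    qed
  qed
  then have "x = 0\<^sub>v (2 * N + 2)" using x(1) by (intro eq_vecI) auto
  then show False using x(2) by simp
qed

text \<open>\<open>Q\<^sup>-(2N + 2, q)\<close> as a parabolic subgroup of the isometry group: in this form closure under
  products and inverses needs no computation with the parameters \<open>A, B, h, i\<close>.\<close>

definition Qset :: "nat \<Rightarrow> 'a mat set" where
  "Qset N = {M. isom N M \<and> (\<forall>i j. N \<le> i \<longrightarrow> i < 2 * N + 2 \<longrightarrow> j < N \<longrightarrow> M $$ (i, j) = 0) \<and>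
     (\<forall>i j. N \<le> i \<longrightarrow> i < 2 * N \<longrightarrow> 2 * N \<le> j \<longrightarrow> j < 2 * N + 2 \<longrightarrow> M $$ (i, j) = 0) \<and>
     mat 2 2 (\<lambda>(a, b). M $$ (2 * N + a, 2 * N + b)) \<in> SO2_minus \<kappa>}"

lemma Qset_carrier: "M \<in> Qset N \<Longrightarrow> M \<in> carrier_mat (2 * N + 2) (2 * N + 2)"
  by (simp add: Qset_def isom_def)

lemma finite_Qset [simp]: "finite (Qset N)"
  by (rule finite_subset[OF _ finite_carrier_mat[of "2 * N + 2" "2 * N + 2"]]) (auto dest: Qset_carrier)

lemma Qset_mult:
  assumes M: "M \<in> Qset N" and M': "M' \<in> Qset N" shows "M * M' \<in> Qset N"
proof -
  note c = Qset_carrier[OF M] Qset_carrier[OF M']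
  have z1: "M $$ (i, j) = 0" "M' $$ (i, j) = 0" if "N \<le> i" "i < 2 * N + 2" "j < N" for i j
    using M M' that by (auto simp: Qset_def)
  have z2: "M $$ (i, j) = 0" "M' $$ (i, j) = 0" if "N \<le> i" "i < 2 * N" "2 * N \<le> j" "j < 2 * N + 2" for i j
    using M M' that by (auto simp: Qset_def)
  have e: "(M * M') $$ (i, j) = (\<Sum>l<N. M $$ (i, l) * M' $$ (l, j)) + (\<Sum>l<N. M $$ (i, N + l) * M' $$ (N + l, j))
     + M $$ (i, 2 * N) * M' $$ (2 * N, j) + M $$ (i, 2 * N + 1) * M' $$ (2 * N + 1, j)"
    if "i < 2 * N + 2" "j < 2 * N + 2" for i j
    using index_mult_mat_sum[OF c that] unfolding sum_split3 .
  have "(M * M') $$ (i, j) = 0" if "N \<le> i" "i < 2 * N + 2" "j < N" for i j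
    using that by (subst e) (auto simp: z1)
  moreover have "(M * M') $$ (i, j) = 0" if "N \<le> i" "i < 2 * N" "2 * N \<le> j" "j < 2 * N + 2" for i j
    using that by (subst e) (auto simp: z1 z2)
  moreover have "mat 2 2 (\<lambda>(a, b). (M * M') $$ (2 * N + a, 2 * N + b))
      = mat 2 2 (\<lambda>(a, b). M $$ (2 * N + a, 2 * N + b)) * mat 2 2 (\<lambda>(a, b). M' $$ (2 * N + a, 2 * N + b))"
  proof (rule eq_matI)
    fix a b assume "a < dim_row (mat 2 2 (\<lambda>(a, b). M $$ (2 * N + a, 2 * N + b)) * mat 2 2 (\<lambda>(a, b). M' $$ (2 * N + a, 2 * N + b)))"
      "b < dim_col (mat 2 2 (\<lambda>(a, b). M $$ (2 * N + a, 2 * N + b)) * mat 2 2 (\<lambda>(a, b). M' $$ (2 * N + a, 2 * N + b)))"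
    then have ab: "a < 2" "b < 2" by auto
    then have "(M * M') $$ (2 * N + a, 2 * N + b)
        = M $$ (2 * N + a, 2 * N) * M' $$ (2 * N, 2 * N + b) + M $$ (2 * N + a, 2 * N + 1) * M' $$ (2 * N + 1, 2 * N + b)"
      by (subst e) (auto simp: z1 z2)
    then show "mat 2 2 (\<lambda>(a, b). (M * M') $$ (2 * N + a, 2 * N + b)) $$ (a, b)
      = (mat 2 2 (\<lambda>(a, b). M $$ (2 * N + a, 2 * N + b)) * mat 2 2 (\<lambda>(a, b). M' $$ (2 * N + a, 2 * N + b))) $$ (a, b)"
      using ab by (subst index_mult_mat_sum[of _ 2 2 _ 2]) (auto simp: numeral_2_eq_2)
  qed auto
  ultimately show ?thesis
    using M M' SO2_mult isom_mult[of N M M'] by (auto simp: Qset_def)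
qed

lemma so2_one: "so2 1 0 = 1\<^sub>m 2"
  by (rule eq_matI) (auto simp: numeral_2_eq_2 less_Suc_eq)

lemma Qset_one: "1\<^sub>m (2 * N + 2) \<in> Qset N"
proof -
  have "mat 2 2 (\<lambda>(a, b). 1\<^sub>m (2 * N + 2) $$ (2 * N + a, 2 * N + b)) = so2 1 0"
    unfolding so2_one by (intro eq_matI) auto
  then have "mat 2 2 (\<lambda>(a, b). 1\<^sub>m (2 * N + 2) $$ (2 * N + a, 2 * N + b)) \<in> SO2_minus \<kappa>"
    using so2_in_SO2[of 1 0] by (simp add: nrm_def)
  then show ?thesis by (auto simp: Qset_def isom_def)
qed

text \<open>Left multiplication by M maps the finite set \<open>Qset N\<close> injectively into
  itself, so it reaches the identity.\<close>

lemma Qset_inverse: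
  assumes M: "M \<in> Qset N"
  shows "\<exists>M'\<in>Qset N. M * M' = 1\<^sub>m (2 * N + 2) \<and> M' * M = 1\<^sub>m (2 * N + 2)"
proof -
  let ?n = "2 * N + 2"
  have G: "M \<in> GL ?n" using M isom_GL by (simp add: Qset_def)
  have inj: "inj_on (\<lambda>X. M * X) (Qset N)"
    by (rule inj_on_inverseI[where g = "\<lambda>X. minv M * X"])
       (auto intro!: minv_mult_cancel(2)[OF G] dest: Qset_carrier)
  have "(\<lambda>X. M * X) ` Qset N \<subseteq> Qset N" using Qset_mult[OF M] by auto
  then have "(\<lambda>X. M * X) ` Qset N = Qset N" using inj by (intro endo_inj_surj) auto
  then obtain M' where M': "M' \<in> Qset N" "M * M' = 1\<^sub>m ?n" using Qset_one[of N] by (metis imageE)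
  then show ?thesis
    using mat_mult_left_right_inverse[OF Qset_carrier[OF M] Qset_carrier[OF M'(1)]] by blast
qed

end

lemma sum_lessThan_2: "(\<Sum>l<2::nat. f l) = f 0 + (f (Suc 0) :: 'b::comm_monoid_add)"
  by (simp add: numeral_2_eq_2)

lemma eta_mat_index:
  "eta_mat $$ (0, 0) = (0::'a::field)" "eta_mat $$ (0, Suc 0) = (1::'a)"
  "eta_mat $$ (Suc 0, 0) = (1::'a)" "eta_mat $$ (Suc 0, Suc 0) = (0::'a)"
  "(eta_mat :: 'a mat) \<in> carrier_mat 2 2"
  by (simp_all add: eta_mat_def mat_of_rows_list_def numeral_2_eq_2)

lemma delta_mat_index:
  "delta_mat k $$ (0, 0) = (1::'a::field)" "delta_mat k $$ (0, Suc 0) = (1::'a)"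
  "delta_mat k $$ (Suc 0, 0) = (0::'a)" "delta_mat k $$ (Suc 0, Suc 0) = k"
  "delta_mat k \<in> carrier_mat 2 2"
  by (simp_all add: delta_mat_def mat_of_rows_list_def numeral_2_eq_2)

lemma blk_index:
  assumes "i < N" "j < N" "a < 2" "b < 2"
  shows "blk N A Y Z D G w $$ (i, j) = A $$ (i, j)" "blk N A Y Z D G w $$ (i, N + j) = Y $$ (i, j)"
    "blk N A Y Z D G w $$ (i, 2 * N + b) = Z $$ (i, b)" "blk N A Y Z D G w $$ (N + i, j) = 0"
    "blk N A Y Z D G w $$ (N + i, N + j) = D $$ (i, j)" "blk N A Y Z D G w $$ (N + i, 2 * N + b) = 0"
    "blk N A Y Z D G w $$ (2 * N + a, j) = 0" "blk N A Y Z D G w $$ (2 * N + a, N + j) = G $$ (a, j)"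
  using assms by (auto simp: blk_def)

lemma blk_index_corner:
  assumes "a < 2" "b < 2"
  shows "blk N A Y Z D G w $$ (2 * N + a, 2 * N + b) = w $$ (a, b)"
  using assms by (auto simp: blk_def)

section \<open>Parametrization of Q\<close>

context minus_type
begin

lemma eta_carrier: "(eta_mat :: 'a mat) \<in> carrier_mat 2 2"
  by (rule eta_mat_index(5))

text \<open>The two factors of an element of Q multiplied out. The upper right block simplifies
  because w preserves eta.\<close>

definition qel :: "nat \<Rightarrow> 'a mat \<Rightarrow> 'a mat \<Rightarrow> 'a mat \<Rightarrow> 'a mat \<Rightarrow> 'a mat" where
  "qel N A w B h = blk N A (A * B) (A * (h\<^sup>T * eta_mat)) ((minv A)\<^sup>T) (w * h) w"

text \<open>The condition that the columns N + k of the unipotent factor are singular vectors and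
  mutually orthogonal.\<close>

definition alt_pair :: "nat \<Rightarrow> 'a mat \<Rightarrow> 'a mat \<Rightarrow> bool" where
  "alt_pair N B h \<longleftrightarrow> (\<forall>k<N. B $$ (k, k) = nrm (h $$ (0, k)) (h $$ (1, k))) \<and>
     (\<forall>k<N. \<forall>l<N. B $$ (k, l) + B $$ (l, k) = h $$ (0, k) * h $$ (1, l) + h $$ (0, l) * h $$ (1, k))"

lemma alternating_iff_alt_pair:
  assumes B: "B \<in> carrier_mat N N" and h: "h \<in> carrier_mat 2 N"
  shows "alternating_mat (B\<^sup>T + h\<^sup>T * delta_mat \<kappa> * h) \<longleftrightarrow> alt_pair N B h"
proof -
  let ?M = "B\<^sup>T + h\<^sup>T * delta_mat \<kappa> * h"
  note d = delta_mat_index[where k = \<kappa>]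
  have Mc: "?M \<in> carrier_mat N N" using B h d by auto
  have hd: "(h\<^sup>T * delta_mat \<kappa>) $$ (k, a) = (\<Sum>b<2. h $$ (b, k) * delta_mat \<kappa> $$ (b, a))"
    if "k < N" "a < 2" for k a
    using that h d(5) by (subst index_mult_mat_sum[of _ N 2 _ 2]) auto
  have e: "?M $$ (k, l) = B $$ (l, k) + (h $$ (0, k) * h $$ (0, l) + h $$ (0, k) * h $$ (1, l) + \<kappa> * h $$ (1, k) * h $$ (1, l))"
    if kl: "k < N" "l < N" for k l
  proof -
    have "(h\<^sup>T * delta_mat \<kappa> * h) $$ (k, l) = (\<Sum>a<2. (h\<^sup>T * delta_mat \<kappa>) $$ (k, a) * h $$ (a, l))"
      using kl h d(5) by (intro index_mult_mat_sum[of _ N 2]) auto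
    also have "\<dots> = h $$ (0, k) * h $$ (0, l) + h $$ (0, k) * h $$ (1, l) + \<kappa> * h $$ (1, k) * h $$ (1, l)"
      using kl by (simp add: hd sum_lessThan_2 d algebra_simps)
    finally show ?thesis using kl B h d(5) by simp
  qed
  have "alternating_mat ?M \<longleftrightarrow> ?M \<in> Alt N" using Mc by (simp add: Alt_def)
  also have "\<dots> \<longleftrightarrow> (\<forall>k<N. ?M $$ (k, k) = 0) \<and> (\<forall>k<N. \<forall>l<N. ?M $$ (k, l) = ?M $$ (l, k))"
    using Mc by (simp add: Alt_iff)
  also have "\<dots> \<longleftrightarrow> alt_pair N B h"
    unfolding alt_pair_def
  proof (intro arg_cong2[where f = "(\<and>)"])
    have "?M $$ (k, k) = 0 \<longleftrightarrow> B $$ (k, k) = nrm (h $$ (0, k)) (h $$ (1, k))" if "k < N" for k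
      unfolding e[OF that that] add_eq_zero_char2 nrm_def by (simp add: power2_eq_square algebra_simps)
    then show "(\<forall>k<N. ?M $$ (k, k) = 0) \<longleftrightarrow> (\<forall>k<N. B $$ (k, k) = nrm (h $$ (0, k)) (h $$ (1, k)))" by auto
    have "?M $$ (k, l) = ?M $$ (l, k) \<longleftrightarrow>
        B $$ (k, l) + B $$ (l, k) = h $$ (0, k) * h $$ (1, l) + h $$ (0, l) * h $$ (1, k)"
      if kl: "k < N" "l < N" for k l
    proof -
      have "?M $$ (k, l) + ?M $$ (l, k)
          = (B $$ (k, l) + B $$ (l, k)) + (h $$ (0, k) * h $$ (1, l) + h $$ (0, l) * h $$ (1, k))"
        unfolding e[OF kl] e[OF kl(2,1)] by (simp add: algebra_simps)
      then show ?thesis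
        using add_eq_zero_char2[of "?M $$ (k, l)" "?M $$ (l, k)"]
          add_eq_zero_char2[of "B $$ (k, l) + B $$ (l, k)"] by (simp only:)
    qed
    then show "(\<forall>k<N. \<forall>l<N. ?M $$ (k, l) = ?M $$ (l, k)) \<longleftrightarrow>
      (\<forall>k<N. \<forall>l<N. B $$ (k, l) + B $$ (l, k) = h $$ (0, k) * h $$ (1, l) + h $$ (0, l) * h $$ (1, k))"
      by auto
  qed
  finally show ?thesis .
qed

text \<open>A 2 x 2 matrix multiplies the alternating form eta by its determinant, here the norm
  1.\<close>

lemma SO2_eta:
  assumes "w \<in> SO2_minus \<kappa>" shows "w\<^sup>T * eta_mat * w = eta_mat"
proof -
  obtain a b where w: "w = so2 a b" "nrm a b = 1" using assms SO2_cases by blast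
  have n: "a * a + (a * b + \<kappa> * (b * b)) = 1" using w(2) by (simp add: nrm_def power2_eq_square add.assoc)
  have "(so2 a b)\<^sup>T * eta_mat = mat 2 2 (\<lambda>(i, j). if i = 0 then (if j = 0 then b else a) else (if j = 0 then a + b else \<kappa> * b))"
    by (rule eq_matI) (auto simp: scalar_prod_def numeral_2_eq_2 less_Suc_eq eta_mat_index eta_mat_def mat_of_rows_list_def)
  moreover have "mat 2 2 (\<lambda>(i, j). if i = 0 then (if j = 0 then b else a) else (if j = 0 then a + b else \<kappa> * b)) * so2 a b = eta_mat"
    by (rule eq_matI) (use n in \<open>auto simp: scalar_prod_def numeral_2_eq_2 less_Suc_eq eta_mat_def mat_of_rows_list_def algebra_simps\<close>)
  ultimately show ?thesis unfolding w by simp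
qed

definition params :: "nat \<Rightarrow> ('a mat \<times> 'a mat \<times> 'a mat \<times> 'a mat) set" where
  "params N = {(A, w, B, h). A \<in> GL N \<and> w \<in> SO2_minus \<kappa> \<and> B \<in> carrier_mat N N \<and>
     h \<in> carrier_mat 2 N \<and> alt_pair N B h}"

lemma Q_minus_eq_params: "Q_minus \<kappa> (Suc N) = (\<lambda>(A, w, B, h). qel N A w B h) ` params N"
proof -
  have q: "diag_block_mat [A, (minv A)\<^sup>T, w] * Q_unipotent (Suc N) w B h = qel N A w B h"
    if p: "(A, w, B, h) \<in> params N" for A w B h
  proof -
    have c: "A \<in> carrier_mat N N" "minv A \<in> carrier_mat N N" "w \<in> carrier_mat 2 2" "B \<in> carrier_mat N N"
      "h \<in> carrier_mat 2 N" "w \<in> SO2_minus \<kappa>"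
      using p minv by (auto simp: params_def GL_carrier SO2_carrier)
    have "h\<^sup>T * w\<^sup>T * eta_mat * w = h\<^sup>T * (w\<^sup>T * eta_mat * w)"
    proof -
      have "h\<^sup>T * w\<^sup>T * eta_mat = h\<^sup>T * (w\<^sup>T * eta_mat)"
        using c eta_carrier by (intro assoc_mult_mat[of _ N 2 _ 2 _ 2]) auto
      moreover have "h\<^sup>T * (w\<^sup>T * eta_mat) * w = h\<^sup>T * (w\<^sup>T * eta_mat * w)"
        using c eta_carrier by (intro assoc_mult_mat[of _ N 2 _ 2 _ 2]) auto
      ultimately show ?thesis by simp
    qed
    then have "h\<^sup>T * w\<^sup>T * eta_mat * w = h\<^sup>T * eta_mat" using SO2_eta[OF c(6)] by simp
    then show ?thesis
      using diag_times_unipotent[of A N "(minv A)\<^sup>T" w B h] c by (simp add: qel_def)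
  qed
  show ?thesis
  proof (intro equalityI subsetI)
    fix M assume "M \<in> Q_minus \<kappa> (Suc N)"
    then obtain A A' w B h where M: "M = diag_block_mat [A, A'\<^sup>T, w] * Q_unipotent (Suc N) w B h"
      "A \<in> carrier_mat N N" "A' \<in> carrier_mat N N" "inverts_mat A A'"
      "w \<in> SO2_minus \<kappa>" "B \<in> carrier_mat N N" "h \<in> carrier_mat 2 N"
      "alternating_mat (B\<^sup>T + h\<^sup>T * delta_mat \<kappa> * h)"
      unfolding Q_minus_def by auto
    have "A * A' = 1\<^sub>m N" using M by (simp add: inverts_mat_def)
    from GL_I[OF M(2,3) this] have A: "A \<in> GL N" "minv A = A'" by auto
    have p: "(A, w, B, h) \<in> params N"
      using A M alternating_iff_alt_pair[OF M(6,7)] by (simp add: params_def)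
    then show "M \<in> (\<lambda>(A, w, B, h). qel N A w B h) ` params N"
      using q[OF p] M(1) A(2) by (intro image_eqI[of _ _ "(A, w, B, h)"]) auto
  next
    fix M assume "M \<in> (\<lambda>(A, w, B, h). qel N A w B h) ` params N"
    then obtain A w B h where p: "(A, w, B, h) \<in> params N" "M = qel N A w B h" by auto
    then have A: "A \<in> GL N" "w \<in> SO2_minus \<kappa>" "B \<in> carrier_mat N N" "h \<in> carrier_mat 2 N" "alt_pair N B h"
      by (auto simp: params_def)
    note i = minv[OF A(1)] note Ac = GL_carrier[OF A(1)]
    have inv: "inverts_mat A (minv A)" "inverts_mat (minv A) A" using i Ac by (auto simp: inverts_mat_def)
    show "M \<in> Q_minus \<kappa> (Suc N)"
      unfolding p(2) q[OF p(1), symmetric] Q_minus_def mem_Collect_eq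
      by (rule exI[of _ A], rule exI[of _ "minv A"], rule exI[of _ w], rule exI[of _ B],
          rule exI[of _ h]) (use inv A Ac i(1) alternating_iff_alt_pair[OF A(3,4)] in simp)
  qed
qed

lemma transpose_mult_eta:
  assumes "h \<in> carrier_mat 2 N" "k < N"
  shows "(h\<^sup>T * eta_mat) $$ (k, 0) = h $$ (1, k)" "(h\<^sup>T * eta_mat) $$ (k, Suc 0) = (h $$ (0, k) :: 'a)"
proof -
  have "(h\<^sup>T * eta_mat) $$ (k, b) = (\<Sum>l<2. h\<^sup>T $$ (k, l) * eta_mat $$ (l, b))" if "b < 2" for b
    using assms eta_carrier that by (intro index_mult_mat_sum) auto
  from this[of 0] this[of 1]
  show "(h\<^sup>T * eta_mat) $$ (k, 0) = h $$ (1, k)" "(h\<^sup>T * eta_mat) $$ (k, Suc 0) = (h $$ (0, k) :: 'a)"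
    using assms by (simp_all add: sum_lessThan_2 eta_mat_index del: index_mult_mat)
qed

text \<open>Adding to B the coefficient array of z -> nrm (h z) gives a symmetric array with zero
  diagonal, whose quadratic form vanishes in characteristic 2.\<close>

lemma alt_pair_quadratic:
  assumes "alt_pair N B h"
  shows "(\<Sum>k<N. z k * (\<Sum>l<N. B $$ (k, l) * z l)) = nrm (\<Sum>k<N. h $$ (0, k) * z k) (\<Sum>k<N. h $$ (1, k) * z k)"
proof -
  let ?g = "\<lambda>k l. B $$ (k, l) + (h $$ (0, k) * h $$ (0, l) + h $$ (0, k) * h $$ (1, l) + \<kappa> * h $$ (1, k) * h $$ (1, l))"
  have sym: "z k * z l * ?g k l = z l * z k * ?g l k" if kl: "k < N" "l < N" for k l
  proof -
    have "?g k l + ?g l k = (B $$ (k, l) + B $$ (l, k)) + (h $$ (0, k) * h $$ (1, l) + h $$ (0, l) * h $$ (1, k))"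
      by (simp add: algebra_simps)
    also have "\<dots> = 0" using assms kl by (simp add: alt_pair_def)
    finally have "?g k l = ?g l k" by (simp only: add_eq_zero_char2)
    then show ?thesis by (simp only: mult.commute[of "z k"])
  qed
  have "(\<Sum>k<N. \<Sum>l<N. z k * z l * ?g k l) = (\<Sum>k<N. z k * z k * ?g k k)"
    using sym by (rule sum_symmetric_char2)
  also have "\<dots> = 0"
  proof (rule sum.neutral, rule ballI)
    fix k assume "k \<in> {..<N}"
    then have "B $$ (k, k) = nrm (h $$ (0, k)) (h $$ (1, k))" using assms by (simp add: alt_pair_def)
    then show "z k * z k * ?g k k = 0" by (simp add: nrm_def power2_eq_square mult.assoc)
  qed
  finally have 0: "(\<Sum>k<N. \<Sum>l<N. z k * z l * ?g k l) = 0" .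
  have "(\<Sum>k<N. \<Sum>l<N. z k * z l * ?g k l)
      = (\<Sum>k<N. \<Sum>l<N. z k * (B $$ (k, l) * z l))
        + ((\<Sum>k<N. \<Sum>l<N. (h $$ (0, k) * z k) * (h $$ (0, l) * z l))
        + (\<Sum>k<N. \<Sum>l<N. (h $$ (0, k) * z k) * (h $$ (1, l) * z l))
        + \<kappa> * (\<Sum>k<N. \<Sum>l<N. (h $$ (1, k) * z k) * (h $$ (1, l) * z l)))"
    unfolding sum.distrib[symmetric] sum_distrib_left by (intro sum.cong refl) (simp add: algebra_simps)
  also have "\<dots> = (\<Sum>k<N. z k * (\<Sum>l<N. B $$ (k, l) * z l))
      + nrm (\<Sum>k<N. h $$ (0, k) * z k) (\<Sum>k<N. h $$ (1, k) * z k)"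
    unfolding nrm_def power2_eq_square sum_product by (simp add: sum_distrib_left)
  finally show ?thesis using 0 by (simp add: add_eq_zero_char2)
qed

text \<open>In the hyperbolic part of theta the blocks A and A^-T cancel, and B and h add nrm (h z)
  plus a polar term. The last two coordinates gain the same amount from h, while w preserves the
  norm, so the changes cancel.\<close>

lemma qel_isom:
  assumes p: "(A, w, B, h) \<in> params N"
  shows "isom N (qel N A w B h)"
  unfolding isom_def
proof (intro conjI ballI)
  let ?M = "qel N A w B h" and ?n = "2 * N + 2"
  show Mc: "?M \<in> carrier_mat ?n ?n" unfolding qel_def by (rule blk_carrier)
  have A: "A \<in> GL N" "w \<in> SO2_minus \<kappa>" "B \<in> carrier_mat N N" "h \<in> carrier_mat 2 N" "alt_pair N B h"
    using p by (auto simp: params_def)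
  note Ac = GL_carrier[OF A(1)] note Ai = minv[OF A(1)] note wc = SO2_carrier[OF A(2)]
  fix x :: "'a vec" assume x: "x \<in> carrier_vec ?n"
  \<comment> \<open>The functions u, z and v are the three blocks of coordinates of x after the
    unipotent factor, before the block diagonal factor acts.\<close>
  define z where "z = (\<lambda>k. x $ (N + k))"
  define u where "u = (\<lambda>j. x $ j + (\<Sum>l<N. B $$ (j, l) * z l) + h $$ (1, j) * x $ (2 * N) + h $$ (0, j) * x $ (2 * N + 1))"
  define v where "v = (\<lambda>b. x $ (2 * N + b) + (\<Sum>l<N. h $$ (b, l) * z l))"
  have Mx: "(?M *\<^sub>v x) $ i = (\<Sum>j<N. ?M $$ (i, j) * x $ j) + (\<Sum>j<N. ?M $$ (i, N + j) * x $ (N + j))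
      + ?M $$ (i, 2 * N) * x $ (2 * N) + ?M $$ (i, 2 * N + 1) * x $ (2 * N + 1)" if "i < ?n" for i
    using index_mult_vec_sum[OF Mc x that] unfolding sum_split3 .
  have y1: "(?M *\<^sub>v x) $ i = (\<Sum>j<N. A $$ (i, j) * u j)" if i: "i < N" for i
  proof -
    have "(\<Sum>j<N. ?M $$ (i, N + j) * x $ (N + j)) = (\<Sum>j<N. A $$ (i, j) * (\<Sum>l<N. B $$ (j, l) * z l))"
    proof -
      have "(\<Sum>j<N. ?M $$ (i, N + j) * x $ (N + j)) = (\<Sum>j<N. (\<Sum>l<N. A $$ (i, l) * B $$ (l, j)) * z j)"
        using i Ac A(3) unfolding z_def qel_def
        by (intro sum.cong refl) (simp add: blk_index[of i N _ 0 0] index_mult_mat_sum[of A N N B N] del: index_mult_mat)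
      also have "\<dots> = (\<Sum>j<N. A $$ (i, j) * (\<Sum>l<N. B $$ (j, l) * z l))"
        unfolding sum_distrib_left sum_distrib_right by (subst sum.swap) (simp add: mult.assoc)
      finally show ?thesis .
    qed
    moreover have "?M $$ (i, 2 * N + b) = (\<Sum>j<N. A $$ (i, j) * (h\<^sup>T * eta_mat) $$ (j, b))" if "b < 2" for b
      unfolding qel_def blk_index(3)[OF i i pos2 that]
      using i that Ac A(4) eta_carrier by (intro index_mult_mat_sum[of _ N N _ 2]) auto
    from this[of 0] this[of 1]
    have "?M $$ (i, 2 * N) = (\<Sum>j<N. A $$ (i, j) * h $$ (1, j))"
      "?M $$ (i, 2 * N + 1) = (\<Sum>j<N. A $$ (i, j) * h $$ (0, j))"
      using A(4) by (simp_all add: transpose_mult_eta del: index_mult_mat)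
    moreover have "(\<Sum>j<N. ?M $$ (i, j) * x $ j) = (\<Sum>j<N. A $$ (i, j) * x $ j)"
      using i unfolding qel_def by (intro sum.cong refl) (simp add: blk_index[of i N _ 0 0])
    ultimately show ?thesis
      using i Mx[of i] by (simp add: u_def distrib_left sum.distrib sum_distrib_right mult.assoc)
  qed
  have y2: "(?M *\<^sub>v x) $ (N + i) = (\<Sum>j<N. minv A $$ (j, i) * z j)" if i: "i < N" for i
  proof -
    have "?M $$ (N + i, j) = 0" "?M $$ (N + i, N + j) = minv A $$ (j, i)" if "j < N" for j
      using i that Ai(1) unfolding qel_def by (simp_all add: blk_index[of i N j 0 0])
    moreover have "?M $$ (N + i, 2 * N) = 0" "?M $$ (N + i, 2 * N + 1) = 0"
      using blk_index(6)[OF i i, of 0 0] blk_index(6)[OF i i, of 0 1] unfolding qel_def by simp_all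
    ultimately show ?thesis using i Mx[of "N + i"] by (simp add: z_def)
  qed
  have y3: "(?M *\<^sub>v x) $ (2 * N + a) = (\<Sum>b<2. w $$ (a, b) * v b)" if a: "a < 2" for a
  proof -
    have "(\<Sum>j<N. ?M $$ (2 * N + a, j) * x $ j) = 0"
      using a unfolding qel_def by (intro sum.neutral) (auto simp: blk_index(7)[where i = 0 and b = 0] blk_def)
    moreover have "(\<Sum>j<N. ?M $$ (2 * N + a, N + j) * x $ (N + j)) = (\<Sum>j<N. (\<Sum>b<2. w $$ (a, b) * h $$ (b, j)) * z j)"
      using a wc A(4) unfolding qel_def z_def
      by (intro sum.cong refl) (auto simp: blk_def index_mult_mat_sum[of w 2 2 h N] simp del: index_mult_mat)
    moreover have "?M $$ (2 * N + a, 2 * N) = w $$ (a, 0)" "?M $$ (2 * N + a, 2 * N + 1) = w $$ (a, 1)"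
      using blk_index_corner[OF a, of 0] blk_index_corner[OF a, of 1] unfolding qel_def by simp_all
    ultimately show ?thesis
      using a Mx[of "2 * N + a"]
      by (simp add: v_def sum_lessThan_2 distrib_left distrib_right sum.distrib sum_distrib_left mult.assoc add_ac)
  qed
  have hyp: "(\<Sum>i<N. (?M *\<^sub>v x) $ i * (?M *\<^sub>v x) $ (N + i)) = (\<Sum>j<N. u j * z j)"
  proof -
    have "(\<Sum>i<N. (?M *\<^sub>v x) $ i * (?M *\<^sub>v x) $ (N + i))
        = (\<Sum>i<N. \<Sum>k<N. \<Sum>j<N. (minv A $$ (k, i) * A $$ (i, j)) * (u j * z k))"
    proof (rule sum.cong[OF refl])
      fix i assume "i \<in> {..<N}"
      then have i: "i < N" by simp
      have "(?M *\<^sub>v x) $ i * (?M *\<^sub>v x) $ (N + i) = (\<Sum>k<N. minv A $$ (k, i) * z k) * (\<Sum>j<N. A $$ (i, j) * u j)"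
        unfolding y1[OF i] y2[OF i] by (rule mult.commute)
      also have "\<dots> = (\<Sum>k<N. \<Sum>j<N. (minv A $$ (k, i) * A $$ (i, j)) * (u j * z k))"
        unfolding sum_product by (intro sum.cong refl) (simp only: mult_ac)
      finally show "(?M *\<^sub>v x) $ i * (?M *\<^sub>v x) $ (N + i)
        = (\<Sum>k<N. \<Sum>j<N. (minv A $$ (k, i) * A $$ (i, j)) * (u j * z k))" .
    qed
    also have "\<dots> = (\<Sum>k<N. \<Sum>i<N. \<Sum>j<N. (minv A $$ (k, i) * A $$ (i, j)) * (u j * z k))"
      by (rule sum.swap)
    also have "\<dots> = (\<Sum>k<N. \<Sum>j<N. \<Sum>i<N. (minv A $$ (k, i) * A $$ (i, j)) * (u j * z k))"
      by (intro sum.cong refl sum.swap)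
    also have "\<dots> = (\<Sum>k<N. \<Sum>j<N. (if j = k then u k * z k else 0))"
    proof (intro sum.cong refl)
      fix k j assume "k \<in> {..<N}" "j \<in> {..<N}"
      then have kj: "k < N" "j < N" by auto
      have "(\<Sum>i<N. minv A $$ (k, i) * A $$ (i, j)) = (minv A * A) $$ (k, j)"
        using kj Ac Ai(1) by (intro index_mult_mat_sum[symmetric]) auto
      also have "\<dots> = (if j = k then 1 else 0)" using kj unfolding Ai(3) by simp
      finally show "(\<Sum>i<N. minv A $$ (k, i) * A $$ (i, j) * (u j * z k)) = (if j = k then u k * z k else 0)"
        by (simp add: sum_distrib_right[symmetric])
    qed
    also have "\<dots> = (\<Sum>j<N. u j * z j)" by (intro sum.cong refl) simp
    finally show ?thesis .
  qed
  have nrm3: "nrm ((?M *\<^sub>v x) $ (2 * N)) ((?M *\<^sub>v x) $ (2 * N + 1)) = nrm (v 0) (v 1)"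
  proof -
    obtain a b where w: "w = so2 a b" "nrm a b = 1" using A(2) SO2_cases by blast
    have "(?M *\<^sub>v x) $ (2 * N) = a * v 0 + \<kappa> * b * v 1" "(?M *\<^sub>v x) $ (2 * N + 1) = b * v 0 + (a + b) * v 1"
      using y3[of 0] y3[of 1] unfolding w sum_lessThan_2 by simp_all
    then show ?thesis using nrm_so2[OF w(2)] by simp
  qed
  define X0 where "X0 = x $ (2 * N)"
  define X1 where "X1 = x $ (2 * N + 1)"
  define H0 where "H0 = (\<Sum>k<N. h $$ (0, k) * z k)"
  define H1 where "H1 = (\<Sum>k<N. h $$ (1, k) * z k)"
  have "(\<Sum>j<N. u j * z j) = (\<Sum>j<N. x $ j * z j) + (\<Sum>j<N. z j * (\<Sum>l<N. B $$ (j, l) * z l)) + H1 * X0 + H0 * X1"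
    unfolding u_def H0_def H1_def X0_def X1_def sum_distrib_right sum.distrib[symmetric]
    by (intro sum.cong refl) (simp add: algebra_simps)
  also have "(\<Sum>j<N. z j * (\<Sum>l<N. B $$ (j, l) * z l)) = nrm H0 H1"
    unfolding H0_def H1_def by (rule alt_pair_quadratic[OF A(5)])
  finally have 1: "(\<Sum>j<N. u j * z j) = (\<Sum>j<N. x $ j * z j) + nrm H0 H1 + H1 * X0 + H0 * X1" .
  have 2: "nrm (v 0) (v 1) = nrm X0 X1 + nrm H0 H1 + H1 * X0 + H0 * X1"
    unfolding v_def X0_def X1_def H0_def H1_def nrm_def square_add by (simp add: algebra_simps)
  have "theta N (?M *\<^sub>v x) = (\<Sum>j<N. x $ j * z j) + nrm X0 X1"
    unfolding theta_def hyp nrm3 1 2 by (simp add: add_ac)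
  then show "theta N (?M *\<^sub>v x) = theta N x" by (simp add: theta_def z_def X0_def X1_def)
qed

lemma theta_unit:
  assumes "k < N" shows "theta N (unit_vec (2 * N + 2) (N + k)) = 0"
proof -
  have "(\<Sum>i<N. unit_vec (2 * N + 2) (N + k) $ i * unit_vec (2 * N + 2) (N + k) $ (N + i)) = (0::'a)"
    using assms by (intro sum.neutral) auto
  then show ?thesis using assms by (simp add: theta_def nrm_def)
qed

lemma polar_so2:
  assumes "nrm a b = 1"
  shows "(a * x + \<kappa> * b * y) * (b * x' + (a + b) * y') + (a * x' + \<kappa> * b * y') * (b * x + (a + b) * y)
    = x * y' + x' * y"
proof -
  have "(a * x + \<kappa> * b * y) * (b * x' + (a + b) * y') + (a * x' + \<kappa> * b * y') * (b * x + (a + b) * y)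
     = nrm a b * (x * y' + x' * y)"
    by (simp add: nrm_def algebra_simps power2_eq_square)
  then show ?thesis using assms by simp
qed

text \<open>The parameters are recovered from the columns of M. Polar products of columns j and N +
  k give A^T D = 1; those among the columns N + k, together with the vanishing of theta on them,
  give the conditions on B and h; those of columns N + k and 2 N + e determine the upper right
  block. The choices B = A^-1 Y and h = w^-1 G undo the block diagonal factor.\<close>

lemma Qset_subset_params:
  assumes M: "M \<in> Qset N"
  shows "M \<in> (\<lambda>(A, w, B, h). qel N A w B h) ` params N"
proof -
  let ?n = "2 * N + 2"
  have iso: "isom N M" using M by (simp add: Qset_def)
  note Mc = Qset_carrier[OF M]
  have z1: "M $$ (i, j) = 0" if "N \<le> i" "i < ?n" "j < N" for i j using M that by (auto simp: Qset_def)
  have z2: "M $$ (i, j) = 0" if "N \<le> i" "i < 2 * N" "2 * N \<le> j" "j < ?n" for i j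
    using M that by (auto simp: Qset_def)
  define A where "A = mat N N (\<lambda>(i, j). M $$ (i, j))"
  define Y where "Y = mat N N (\<lambda>(i, j). M $$ (i, N + j))"
  define D where "D = mat N N (\<lambda>(i, j). M $$ (N + i, N + j))"
  define Z where "Z = mat N 2 (\<lambda>(i, b). M $$ (i, 2 * N + b))"
  define G where "G = mat 2 N (\<lambda>(a, j). M $$ (2 * N + a, N + j))"
  define w where "w = mat 2 2 (\<lambda>(a, b). M $$ (2 * N + a, 2 * N + b))"
  have c: "A \<in> carrier_mat N N" "Y \<in> carrier_mat N N" "D \<in> carrier_mat N N" "Z \<in> carrier_mat N 2"
    "G \<in> carrier_mat 2 N" "w \<in> carrier_mat 2 2"
    by (auto simp: A_def Y_def D_def Z_def G_def w_def)
  have w: "w \<in> SO2_minus \<kappa>" using M by (simp add: Qset_def w_def)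
  have col: "M *\<^sub>v unit_vec ?n j = col M j" if "j < ?n" for j using mult_unit_vec[OF Mc that] .
  have colv: "col M j $ i = M $$ (i, j)" if "i < ?n" "j < ?n" for i j using Mc that by simp
  have pol: "polar N (col M i) (col M j) = polar N (unit_vec ?n i) (unit_vec ?n j)" if "i < ?n" "j < ?n" for i j
    using isom_polar[OF iso, of "unit_vec ?n i" "unit_vec ?n j"] col[OF that(1)] col[OF that(2)] by simp
  have polM: "polar N (col M i) (col M j) = (\<Sum>l<N. M $$ (l, i) * M $$ (N + l, j) + M $$ (N + l, i) * M $$ (l, j))
      + M $$ (2 * N, i) * M $$ (2 * N + 1, j) + M $$ (2 * N + 1, i) * M $$ (2 * N, j)" if "i < ?n" "j < ?n" for i j
    unfolding polar_def using that by (simp add: colv del: index_col)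
  have AD: "(\<Sum>l<N. M $$ (l, j) * M $$ (N + l, N + k)) = (if j = k then 1 else 0)" if jk: "j < N" "k < N" for j k
  proof -
    have "polar N (unit_vec ?n j) (unit_vec ?n (N + k)) = (if j = k then 1 else 0)"
      using jk polar_unit(2)[of "unit_vec ?n j" N k] by simp
    then have "polar N (col M j) (col M (N + k)) = (if j = k then 1 else 0)" using jk by (subst pol) auto
    then show ?thesis using jk by (subst (asm) polM) (auto simp: z1)
  qed
  have "A\<^sup>T * D = 1\<^sub>m N"
  proof (rule eq_matI)
    fix j k assume "j < dim_row (1\<^sub>m N)" "k < dim_col (1\<^sub>m N)"
    then have jk: "j < N" "k < N" by auto
    have "(A\<^sup>T * D) $$ (j, k) = (\<Sum>l<N. A\<^sup>T $$ (j, l) * D $$ (l, k))"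
      using jk c by (intro index_mult_mat_sum) auto
    then show "(A\<^sup>T * D) $$ (j, k) = 1\<^sub>m N $$ (j, k)"
      using AD[OF jk] jk by (simp add: A_def D_def)
  qed (use c in auto)
  from GL_I[OF transpose_carrier_mat[THEN iffD2, OF c(1)] c(3) this]
  have "A\<^sup>T \<in> GL N" "minv (A\<^sup>T) = D" by auto
  then have A: "A \<in> GL N" and "(minv A)\<^sup>T = D"
    using GL_transpose[of "A\<^sup>T" N] minv_transpose[of A N] by auto
  note Ai = minv[OF A]
  have Dm: "D $$ (i, l) = minv A $$ (l, i)" if "i < N" "l < N" for i l
    using that Ai(1) unfolding \<open>(minv A)\<^sup>T = D\<close>[symmetric] by simp
  define B where "B = minv A * Y"
  have Bc: "B \<in> carrier_mat N N" unfolding B_def using Ai(1) c by auto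
  have AB: "A * B = Y" unfolding B_def using minv_mult_cancel(1)[OF A c(2)] .
  have Bi: "B $$ (l, k) = (\<Sum>i<N. M $$ (i, N + k) * M $$ (N + i, N + l))" if "l < N" "k < N" for l k
  proof -
    have "B $$ (l, k) = (\<Sum>i<N. minv A $$ (l, i) * Y $$ (i, k))"
      unfolding B_def using that Ai(1) c by (intro index_mult_mat_sum) auto
    also have "\<dots> = (\<Sum>i<N. M $$ (i, N + k) * M $$ (N + i, N + l))"
      using that by (intro sum.cong refl) (simp add: Dm[symmetric] D_def Y_def mult.commute)
    finally show ?thesis .
  qed
  obtain w' where w': "w' \<in> SO2_minus \<kappa>" "w * w' = 1\<^sub>m 2" using SO2_inverse[OF w] by blast
  define h where "h = w' * G"
  have hc: "h \<in> carrier_mat 2 N" unfolding h_def using SO2_carrier[OF w'(1)] c by auto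
  have wh: "w * h = G"
    unfolding h_def using assoc_mult_mat[OF c(6) SO2_carrier[OF w'(1)] c(5)] w'(2) c(5) by simp
  obtain a b where ab: "w = so2 a b" "nrm a b = 1" using w SO2_cases by blast
  have Gi: "G $$ (0, k) = a * h $$ (0, k) + \<kappa> * b * h $$ (1, k)"
    "G $$ (1, k) = b * h $$ (0, k) + (a + b) * h $$ (1, k)" if "k < N" for k
  proof -
    have "G $$ (e, k) = (\<Sum>l<2. w $$ (e, l) * h $$ (l, k))" if "e < 2" for e
      unfolding wh[symmetric] using that \<open>k < N\<close> c hc by (intro index_mult_mat_sum) auto
    from this[of 0] this[of 1] show "G $$ (0, k) = a * h $$ (0, k) + \<kappa> * b * h $$ (1, k)"
      "G $$ (1, k) = b * h $$ (0, k) + (a + b) * h $$ (1, k)"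
      by (simp_all add: ab(1) sum_lessThan_2)
  qed
  have alt: "alt_pair N B h"
    unfolding alt_pair_def
  proof (intro conjI allI impI)
    fix k assume k: "k < N"
    have "theta N (col M (N + k)) = 0"
    proof -
      have "N + k < ?n" using k by simp
      from col[OF this] show ?thesis
        using iso theta_unit[OF k] unit_vec_carrier[of ?n "N + k"] unfolding isom_def by metis
    qed
    then have "B $$ (k, k) + nrm (G $$ (0, k)) (G $$ (1, k)) = 0"
      using k by (simp add: theta_def Bi G_def colv del: index_col)
    then show "B $$ (k, k) = nrm (h $$ (0, k)) (h $$ (1, k))"
      using Gi[OF k] nrm_so2[OF ab(2)] by (simp add: add_eq_zero_char2)
    fix l assume l: "l < N"
    have "polar N (unit_vec ?n (N + k)) (unit_vec ?n (N + l)) = 0"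
      using k l polar_unit(2)[of "unit_vec ?n (N + k)" N l] by simp
    then have "polar N (col M (N + k)) (col M (N + l)) = 0" using k l by (subst pol) auto
    then have "B $$ (k, l) + B $$ (l, k) + (G $$ (0, k) * G $$ (1, l) + G $$ (0, l) * G $$ (1, k)) = 0"
      using k l by (subst (asm) polM) (auto simp: Bi G_def sum.distrib mult.commute add_ac)
    then show "B $$ (k, l) + B $$ (l, k) = h $$ (0, k) * h $$ (1, l) + h $$ (0, l) * h $$ (1, k)"
      unfolding Gi[OF k] Gi[OF l] polar_so2[OF ab(2)] by (simp only: add_eq_zero_char2)
  qed
  have Zi: "Z = A * (h\<^sup>T * eta_mat)"
  proof -
    have "minv A * Z = G\<^sup>T * eta_mat * w"
    proof (rule eq_matI)
      fix k e assume "k < dim_row (G\<^sup>T * eta_mat * w)" "e < dim_col (G\<^sup>T * eta_mat * w)"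
      then have ke: "k < N" "e < 2" using c by auto
      have "(minv A * Z) $$ (k, e) = (\<Sum>i<N. minv A $$ (k, i) * Z $$ (i, e))"
        using ke Ai(1) c by (intro index_mult_mat_sum) auto
      also have "\<dots> = (\<Sum>i<N. M $$ (N + i, N + k) * M $$ (i, 2 * N + e))"
        using ke by (intro sum.cong refl) (simp add: Dm[symmetric] D_def Z_def)
      finally have L: "(minv A * Z) $$ (k, e) = (\<Sum>i<N. M $$ (N + i, N + k) * M $$ (i, 2 * N + e))" .
      have "(G\<^sup>T * eta_mat * w) $$ (k, e) = (\<Sum>l<2. (G\<^sup>T * eta_mat) $$ (k, l) * w $$ (l, e))"
        using ke c eta_carrier by (intro index_mult_mat_sum) auto
      then have R: "(G\<^sup>T * eta_mat * w) $$ (k, e) = G $$ (1, k) * w $$ (0, e) + G $$ (0, k) * w $$ (1, e)"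
        using ke transpose_mult_eta[OF c(5), of k] by (simp add: sum_lessThan_2 del: index_mult_mat)
      have "polar N (unit_vec ?n (N + k)) (unit_vec ?n (2 * N + e)) = 0"
        using ke polar_unit(3,4)[of "unit_vec ?n (N + k)" N] by (cases "e = 0") (auto simp: less_2_cases_iff)
      then have "polar N (col M (N + k)) (col M (2 * N + e)) = 0" using ke by (subst pol) auto
      then have "(\<Sum>i<N. M $$ (N + i, N + k) * M $$ (i, 2 * N + e))
          + (G $$ (1, k) * w $$ (0, e) + G $$ (0, k) * w $$ (1, e)) = 0"
        using ke by (subst (asm) polM) (auto simp: z2 G_def w_def add_ac)
      then show "(minv A * Z) $$ (k, e) = (G\<^sup>T * eta_mat * w) $$ (k, e)"
        unfolding L R by (simp only: add_eq_zero_char2)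
    qed (use Ai(1) c in auto)
    also have "\<dots> = h\<^sup>T * eta_mat"
    proof -
      have "G\<^sup>T = h\<^sup>T * w\<^sup>T" unfolding wh[symmetric] using c hc by (intro transpose_mult) auto
      then have "G\<^sup>T * eta_mat * w = h\<^sup>T * w\<^sup>T * eta_mat * w" by simp
      also have "h\<^sup>T * w\<^sup>T * eta_mat = h\<^sup>T * (w\<^sup>T * eta_mat)"
        using c hc eta_carrier by (intro assoc_mult_mat[of _ N 2 _ 2 _ 2]) auto
      also have "h\<^sup>T * (w\<^sup>T * eta_mat) * w = h\<^sup>T * (w\<^sup>T * eta_mat * w)"
        using c hc eta_carrier by (intro assoc_mult_mat[of _ N 2 _ 2 _ 2]) auto
      finally show ?thesis unfolding SO2_eta[OF w] .
    qed
    finally have "A * (minv A * Z) = A * (h\<^sup>T * eta_mat)" by simp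
    then show ?thesis using minv_mult_cancel(1)[OF A c(4)] by simp
  qed
  have "M = blk N A Y Z D G w"
  proof (rule eq_matI)
    fix i j assume "i < dim_row (blk N A Y Z D G w)" "j < dim_col (blk N A Y Z D G w)"
    then have ij: "i < ?n" "j < ?n" by (auto simp: blk_def)
    then show "M $$ (i, j) = blk N A Y Z D G w $$ (i, j)"
      by (auto simp: blk_def A_def Y_def Z_def D_def G_def w_def z1 z2)
  qed (use Mc in \<open>auto simp: blk_def\<close>)
  then have "M = qel N A w B h"
    by (simp add: qel_def AB Zi[symmetric] wh \<open>(minv A)\<^sup>T = D\<close>)
  then show ?thesis
    using A w Bc hc alt by (intro image_eqI[of _ _ "(A, w, B, h)"]) (auto simp: params_def)
qed

lemma params_subset_Qset:
  assumes p: "(A, w, B, h) \<in> params N" shows "qel N A w B h \<in> Qset N"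
proof -
  have w: "w \<in> SO2_minus \<kappa>" using p by (simp add: params_def)
  have "mat 2 2 (\<lambda>(a, b). qel N A w B h $$ (2 * N + a, 2 * N + b)) = w"
    using SO2_carrier[OF w] by (intro eq_matI) (auto simp: qel_def blk_index_corner)
  then show ?thesis
    unfolding Qset_def mem_Collect_eq using qel_isom[OF p] w by (auto simp: qel_def blk_def)
qed

lemma Q_minus_eq_Qset: "Q_minus \<kappa> (Suc N) = Qset N"
  unfolding Q_minus_eq_params using Qset_subset_params params_subset_Qset by auto

lemma Qset_eq_params: "Qset N = (\<lambda>(A, w, B, h). qel N A w B h) ` params N"
  using Q_minus_eq_Qset Q_minus_eq_params by simp

lemma inj_qel: "inj_on (\<lambda>(A, w, B, h). qel N A w B h) (params N)"
proof (rule inj_onI)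
  fix x y assume xy: "x \<in> params N" "y \<in> params N"
    and eq: "(\<lambda>(A, w, B, h). qel N A w B h) x = (\<lambda>(A, w, B, h). qel N A w B h) y"
  obtain A w B h where x: "x = (A, w, B, h)" by (cases x)
  obtain A' w' B' h' where y: "y = (A', w', B', h')" by (cases y)
  have p: "A \<in> GL N" "w \<in> SO2_minus \<kappa>" "B \<in> carrier_mat N N" "h \<in> carrier_mat 2 N"
    "A' \<in> GL N" "w' \<in> SO2_minus \<kappa>" "B' \<in> carrier_mat N N" "h' \<in> carrier_mat 2 N"
    using xy by (auto simp: x y params_def)
  note c = GL_carrier[OF p(1)] GL_carrier[OF p(5)] SO2_carrier[OF p(2)] SO2_carrier[OF p(6)]
  have e: "qel N A w B h $$ ij = qel N A' w' B' h' $$ ij" for ij using eq by (simp add: x y)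
  have A: "A = A'"
  proof (rule eq_matI)
    fix i j assume "i < dim_row A'" "j < dim_col A'"
    then show "A $$ (i, j) = A' $$ (i, j)" using e[of "(i, j)"] c by (simp add: qel_def blk_def)
  qed (use c in auto)
  have w: "w = w'"
  proof (rule eq_matI)
    fix i j assume "i < dim_row w'" "j < dim_col w'"
    then show "w $$ (i, j) = w' $$ (i, j)" using e[of "(2 * N + i, 2 * N + j)"] c by (simp add: qel_def blk_def)
  qed (use c in auto)
  have "A * B = A * B'"
  proof (rule eq_matI)
    fix i j assume "i < dim_row (A * B')" "j < dim_col (A * B')"
    then show "(A * B) $$ (i, j) = (A * B') $$ (i, j)"
      using e[of "(i, N + j)"] c p A by (simp add: qel_def blk_def del: index_mult_mat(1))
  qed (use c p in auto)
  then have "minv A * (A * B) = minv A * (A * B')" by simp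
  then have B: "B = B'" using minv_mult_cancel(2)[OF p(1,3)] minv_mult_cancel(2)[OF p(1,7)] by simp
  have "w * h = w * h'"
  proof (rule eq_matI)
    fix i j assume "i < dim_row (w * h')" "j < dim_col (w * h')"
    then show "(w * h) $$ (i, j) = (w * h') $$ (i, j)"
      using e[of "(2 * N + i, N + j)"] c p w by (simp add: qel_def blk_def del: index_mult_mat(1))
  qed (use c p in auto)
  then have "minv w * (w * h) = minv w * (w * h')" by simp
  then have "h = h'"
    using minv_mult_cancel(2)[OF SO2_GL[OF p(2)] p(4)] minv_mult_cancel(2)[OF SO2_GL[OF p(2)] p(8)] by simp
  then show "x = y" using A w B by (simp add: x y)
qed

end

section \<open>Traces, the permutation \<sigma> and the matrix \<rho>\<close>

lemma mat_trace_commute: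
  fixes X Y :: "'a::comm_ring_1 mat"
  assumes "X \<in> carrier_mat n n" "Y \<in> carrier_mat n n"
  shows "mat_trace (X * Y) = mat_trace (Y * X)"
proof -
  have "mat_trace (X * Y) = (\<Sum>k<n. \<Sum>l<n. X $$ (k, l) * Y $$ (l, k))"
    using assms unfolding mat_trace_def
    by (intro sum.cong) (auto simp: index_mult_mat_sum[OF assms] simp del: index_mult_mat(1))
  also have "\<dots> = (\<Sum>l<n. \<Sum>k<n. Y $$ (l, k) * X $$ (k, l))"
    by (subst sum.swap) (simp add: mult.commute)
  also have "\<dots> = mat_trace (Y * X)"
    using assms unfolding mat_trace_def
    by (intro sum.cong) (auto simp: index_mult_mat_sum[OF assms(2,1)] simp del: index_mult_mat(1))
  finally show ?thesis .
qed

text \<open>The index map of \<open>sigma_mat\<close>. It is an involution, so rows and columns are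
  permuted by the same map.\<close>

definition sigma_index :: "nat \<Rightarrow> nat \<Rightarrow> nat \<Rightarrow> nat" where
  "sigma_index N s j = (if j < s then N + j else if N \<le> j \<and> j < N + s then j - N else j)"

lemma sigma_index:
  assumes "s \<le> N"
  shows "sigma_index N s (sigma_index N s j) = j" "j < 2 * N + 2 \<Longrightarrow> sigma_index N s j < 2 * N + 2"
    "j < s \<Longrightarrow> sigma_index N s j = N + j" "j < s \<Longrightarrow> sigma_index N s (N + j) = j"
    "s \<le> j \<Longrightarrow> j < N \<Longrightarrow> sigma_index N s j = j" "s \<le> j \<Longrightarrow> sigma_index N s (N + j) = N + j"
    "sigma_index N s (2 * N) = 2 * N" "sigma_index N s (2 * N + 1) = 2 * N + 1"
    "2 * N \<le> j \<Longrightarrow> sigma_index N s j = j"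
  using assms by (auto simp: sigma_index_def)

lemma sigma_mat_spi:
  "sigma_mat (Suc N) s = mat (2 * N + 2) (2 * N + 2) (\<lambda>(i, j). if i = sigma_index N s j then 1 else (0::'a::field))"
  unfolding sigma_mat_def sigma_index_def by (rule cong_mat) auto

lemma sigma_carrier: "sigma_mat (Suc N) s \<in> carrier_mat (2 * N + 2) (2 * N + 2)"
  unfolding sigma_mat_spi by simp

lemma mult_sigma_right:
  assumes "s \<le> N" "X \<in> carrier_mat (2 * N + 2) (2 * N + 2)" "i < 2 * N + 2" "j < 2 * N + 2"
  shows "(X * sigma_mat (Suc N) s) $$ (i, j) = (X $$ (i, sigma_index N s j) :: 'a::field)"
proof -
  have "(X * sigma_mat (Suc N) s) $$ (i, j) = (\<Sum>l<2 * N + 2. X $$ (i, l) * sigma_mat (Suc N) s $$ (l, j))"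
    using assms sigma_carrier by (intro index_mult_mat_sum) auto
  also have "\<dots> = (\<Sum>l<2 * N + 2. if l = sigma_index N s j then X $$ (i, sigma_index N s j) else 0)"
    using assms by (intro sum.cong) (auto simp: sigma_mat_spi)
  finally show ?thesis using sigma_index(2)[OF assms(1,4)] by simp
qed

lemma mult_sigma_left:
  assumes "s \<le> N" "X \<in> carrier_mat (2 * N + 2) (2 * N + 2)" "i < 2 * N + 2" "j < 2 * N + 2"
  shows "(sigma_mat (Suc N) s * X) $$ (i, j) = (X $$ (sigma_index N s i, j) :: 'a::field)"
proof -
  have "(sigma_mat (Suc N) s * X) $$ (i, j) = (\<Sum>l<2 * N + 2. sigma_mat (Suc N) s $$ (i, l) * X $$ (l, j))"
    using assms sigma_carrier by (intro index_mult_mat_sum) auto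
  also have "\<dots> = (\<Sum>l<2 * N + 2. if l = sigma_index N s i then X $$ (sigma_index N s i, j) else 0)"
    using assms sigma_index(1)[OF assms(1)] by (intro sum.cong) (auto simp: sigma_mat_spi)
  finally show ?thesis using sigma_index(2)[OF assms(1,3)] by simp
qed

lemma sigma_sigma: "s \<le> N \<Longrightarrow> sigma_mat (Suc N) s * sigma_mat (Suc N) s = (1\<^sub>m (2 * N + 2) :: 'a::field mat)"
proof (rule eq_matI)
  fix i j assume s: "s \<le> N" and "i < dim_row (1\<^sub>m (2 * N + 2) :: 'a mat)" "j < dim_col (1\<^sub>m (2 * N + 2) :: 'a mat)"
  then have ij: "i < 2 * N + 2" "j < 2 * N + 2" by auto
  have "(sigma_mat (Suc N) s * sigma_mat (Suc N) s) $$ (i, j) = (sigma_mat (Suc N) s $$ (i, sigma_index N s j) :: 'a)"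
    by (rule mult_sigma_right[OF s sigma_carrier ij])
  then show "(sigma_mat (Suc N) s * sigma_mat (Suc N) s) $$ (i, j) = (1\<^sub>m (2 * N + 2) $$ (i, j) :: 'a)"
    using ij sigma_index(1)[OF s, of j] sigma_index(2)[OF s, of j] by (simp add: sigma_mat_spi)
qed (simp_all add: sigma_mat_spi)

lemma rho_index:
  assumes "i < 2 * N + 2" "j < 2 * N + 2"
  shows "rho_mat (Suc N) $$ (i, j) = (if i = j \<or> i = 2 * N \<and> j = 2 * N + 1 then 1 else (0::'a::field))"
  using assms unfolding rho_mat_def
  by (auto simp: Let_def mat_of_rows_list_def nth_Cons' less_Suc_eq)

lemma rho_carrier: "rho_mat (Suc N) \<in> carrier_mat (2 * N + 2) (2 * N + 2)"
  unfolding rho_mat_def by (auto simp: Let_def mat_of_rows_list_def)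

lemma mult_rho_left:
  assumes "X \<in> carrier_mat (2 * N + 2) (2 * N + 2)" "i < 2 * N + 2" "j < 2 * N + 2"
  shows "(rho_mat (Suc N) * X) $$ (i, j) = X $$ (i, j) + (if i = 2 * N then X $$ (2 * N + 1, j) else (0 :: 'a::field))"
proof -
  have "(rho_mat (Suc N) * X) $$ (i, j) = (\<Sum>l<2 * N + 2. rho_mat (Suc N) $$ (i, l) * X $$ (l, j))"
    using assms rho_carrier by (intro index_mult_mat_sum) auto
  also have "\<dots> = (\<Sum>l<2 * N + 2. (if l = i then X $$ (i, j) else 0)
      + (if l = 2 * N + 1 then (if i = 2 * N then X $$ (2 * N + 1, j) else 0) else 0))"
    using assms by (intro sum.cong) (auto simp: rho_index)
  finally show ?thesis using assms by (simp add: sum.distrib)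
qed

lemma mult_rho_right:
  assumes "X \<in> carrier_mat (2 * N + 2) (2 * N + 2)" "i < 2 * N + 2" "j < 2 * N + 2"
  shows "(X * rho_mat (Suc N)) $$ (i, j) = X $$ (i, j) + (if j = 2 * N + 1 then X $$ (i, 2 * N) else (0 :: 'a::field))"
proof -
  have "(X * rho_mat (Suc N)) $$ (i, j) = (\<Sum>l<2 * N + 2. X $$ (i, l) * rho_mat (Suc N) $$ (l, j))"
    using assms rho_carrier by (intro index_mult_mat_sum) auto
  also have "\<dots> = (\<Sum>l<2 * N + 2. (if l = j then X $$ (i, j) else 0)
      + (if l = 2 * N then (if j = 2 * N + 1 then X $$ (i, 2 * N) else 0) else 0))"
    using assms by (intro sum.cong) (auto simp: rho_index)
  finally show ?thesis using assms by (simp add: sum.distrib)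
qed

context minus_type
begin

lemma isom_sigma: "s \<le> N \<Longrightarrow> isom N (sigma_mat (Suc N) s)"
  unfolding isom_def
proof (intro conjI ballI)
  assume s: "s \<le> N"
  show "sigma_mat (Suc N) s \<in> carrier_mat (2 * N + 2) (2 * N + 2)" by (rule sigma_carrier)
  fix x :: "'a vec" assume x: "x \<in> carrier_vec (2 * N + 2)"
  have e: "(sigma_mat (Suc N) s *\<^sub>v x) $ i = x $ sigma_index N s i" if i: "i < 2 * N + 2" for i
  proof -
    have "(sigma_mat (Suc N) s *\<^sub>v x) $ i = (\<Sum>l<2 * N + 2. sigma_mat (Suc N) s $$ (i, l) * x $ l)"
      using index_mult_vec_sum[OF sigma_carrier x i] .
    also have "\<dots> = (\<Sum>l<2 * N + 2. if l = sigma_index N s i then x $ sigma_index N s i else 0)"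
      using i sigma_index(1)[OF s] by (intro sum.cong) (auto simp: sigma_mat_spi)
    finally show ?thesis using sigma_index(2)[OF s i] by simp
  qed
  have "(\<Sum>i<N. x $ sigma_index N s i * x $ sigma_index N s (N + i)) = (\<Sum>i<N. x $ i * x $ (N + i))"
    using s by (intro sum.cong refl) (auto simp: sigma_index_def mult.commute)
  then show "theta N (sigma_mat (Suc N) s *\<^sub>v x) = theta N x"
    unfolding theta_def by (simp add: e sigma_index(7,8)[OF s] sigma_index(9)[OF s])
qed

lemma isom_rho: "isom N (rho_mat (Suc N))"
  unfolding isom_def
proof (intro conjI ballI)
  show "rho_mat (Suc N) \<in> carrier_mat (2 * N + 2) (2 * N + 2)" by (rule rho_carrier)
  fix x :: "'a vec" assume x: "x \<in> carrier_vec (2 * N + 2)"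
  have e: "(rho_mat (Suc N) *\<^sub>v x) $ i = x $ i + (if i = 2 * N then x $ (2 * N + 1) else 0)" if i: "i < 2 * N + 2" for i
  proof -
    have "(rho_mat (Suc N) *\<^sub>v x) $ i = (\<Sum>l<2 * N + 2. rho_mat (Suc N) $$ (i, l) * x $ l)"
      using index_mult_vec_sum[OF rho_carrier x i] .
    also have "\<dots> = (\<Sum>l<2 * N + 2. (if l = i then x $ i else 0)
        + (if l = 2 * N + 1 then (if i = 2 * N then x $ (2 * N + 1) else 0) else 0))"
      using i by (intro sum.cong) (auto simp: rho_index)
    finally show ?thesis using i by (simp add: sum.distrib)
  qed
  have "nrm (x $ (2 * N) + x $ (2 * N + 1)) (x $ (2 * N + 1)) = nrm (x $ (2 * N)) (x $ (2 * N + 1))"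
    unfolding nrm_def square_add by (simp add: algebra_simps power2_eq_square)
  then show "theta N (rho_mat (Suc N) *\<^sub>v x) = theta N x"
    unfolding theta_def by (simp add: e)
qed

lemma rho_rho: "rho_mat (Suc N) * rho_mat (Suc N) = (1\<^sub>m (2 * N + 2) :: 'a mat)"
proof (rule eq_matI)
  fix i j assume "i < dim_row (1\<^sub>m (2 * N + 2) :: 'a mat)" "j < dim_col (1\<^sub>m (2 * N + 2) :: 'a mat)"
  then have ij: "i < 2 * N + 2" "j < 2 * N + 2" by auto
  show "(rho_mat (Suc N) * rho_mat (Suc N)) $$ (i, j) = (1\<^sub>m (2 * N + 2) $$ (i, j) :: 'a)"
    unfolding mult_rho_left[OF rho_carrier ij] using ij by (auto simp: rho_index)
qed (use rho_carrier in auto)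

text \<open>On the last block, conjugation by \<rho> is the nontrivial automorphism of the field
  with q^2 elements: it sends a + b w to (a + b) + b w and keeps the norm. So \<rho> normalizes
  Q.\<close>

lemma rho_conj_Qset:
  assumes M: "M \<in> Qset N"
  shows "rho_mat (Suc N) * M * rho_mat (Suc N) \<in> Qset N"
proof -
  let ?r = "rho_mat (Suc N) :: 'a mat" and ?n = "2 * N + 2"
  note Mc = Qset_carrier[OF M]
  have rMc: "?r * M \<in> carrier_mat ?n ?n" using mult_carrier_mat[OF rho_carrier Mc] .
  have e: "(?r * M * ?r) $$ (i, j) = M $$ (i, j) + (if i = 2 * N then M $$ (2 * N + 1, j) else 0)
      + (if j = 2 * N + 1 then M $$ (i, 2 * N) + (if i = 2 * N then M $$ (2 * N + 1, 2 * N) else 0) else 0)"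
    if "i < ?n" "j < ?n" for i j
    unfolding mult_rho_right[OF rMc that] mult_rho_left[OF Mc that]
    using that mult_rho_left[OF Mc that(1), of "2 * N"] by simp
  have z1: "M $$ (i, j) = 0" if "N \<le> i" "i < ?n" "j < N" for i j using M that by (auto simp: Qset_def)
  have z2: "M $$ (i, j) = 0" if "N \<le> i" "i < 2 * N" "2 * N \<le> j" "j < ?n" for i j
    using M that by (auto simp: Qset_def)
  have "mat 2 2 (\<lambda>(a, b). M $$ (2 * N + a, 2 * N + b)) \<in> SO2_minus \<kappa>" using M by (simp add: Qset_def)
  then obtain a b where ab: "mat 2 2 (\<lambda>(a, b). M $$ (2 * N + a, 2 * N + b)) = so2 a b" "nrm a b = 1"
    using SO2_cases by blast
  have v: "M $$ (2 * N + i, 2 * N + j) = so2 a b $$ (i, j)" if "i < 2" "j < 2" for i j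
    unfolding ab(1)[symmetric] using that by simp
  have "mat 2 2 (\<lambda>(a, b). (?r * M * ?r) $$ (2 * N + a, 2 * N + b)) = so2 (a + b) b"
  proof (rule eq_matI)
    fix i j assume "i < dim_row (so2 (a + b) b)" "j < dim_col (so2 (a + b) b)"
    then have ij: "i = 0 \<or> i = 1" "j = 0 \<or> j = 1" by auto
    then show "mat 2 2 (\<lambda>(a, b). (?r * M * ?r) $$ (2 * N + a, 2 * N + b)) $$ (i, j) = so2 (a + b) b $$ (i, j)"
      using v[of 0 0] v[of 0 1] v[of 1 0] v[of 1 1] by (auto simp: e add_ac)
  qed auto
  moreover have "nrm (a + b) b = 1"
    using ab(2) unfolding nrm_def square_add by (simp add: algebra_simps power2_eq_square)
  ultimately have "mat 2 2 (\<lambda>(a, b). (?r * M * ?r) $$ (2 * N + a, 2 * N + b)) \<in> SO2_minus \<kappa>"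
    using so2_in_SO2 by simp
  moreover have "isom N (?r * M * ?r)" using M by (intro isom_mult isom_rho) (simp add: Qset_def)
  ultimately show ?thesis unfolding Qset_def mem_Collect_eq by (auto simp: e z1 z2)
qed

lemma Qset_minv:
  assumes "M \<in> Qset N" shows "M \<in> GL (2 * N + 2)" "minv M \<in> Qset N"
proof -
  obtain M' where M': "M' \<in> Qset N" "M * M' = 1\<^sub>m (2 * N + 2)" using Qset_inverse[OF assms] by blast
  from GL_I[OF Qset_carrier[OF assms] Qset_carrier[OF M'(1)] M'(2)] M'(1)
  show "M \<in> GL (2 * N + 2)" "minv M \<in> Qset N" by auto
qed

text \<open>Every element of a double coset \<open>Q S Q\<close> has the same number of representations \<open>x S y\<close>, and
  conjugation moves the right factor to the left.\<close>

lemma double_coset_count: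
  fixes f :: "'a mat \<Rightarrow> 'b"
  assumes S: "S \<in> carrier_mat (2 * N + 2) (2 * N + 2)" "S * S = 1\<^sub>m (2 * N + 2)"
    and f: "\<And>x y. x \<in> Qset N \<Longrightarrow> y \<in> Qset N \<Longrightarrow> f (x * S * y) = f (t y * x * S)"
    and t: "\<And>y. y \<in> Qset N \<Longrightarrow> t y \<in> Qset N"
  shows "card {g \<in> {x * S * y | x y. x \<in> Qset N \<and> y \<in> Qset N}. f g = \<beta>} * card {x \<in> Qset N. S * x * S \<in> Qset N}
    = card (Qset N) * card {x \<in> Qset N. f (x * S) = \<beta>}"
proof -
  let ?n = "2 * N + 2" and ?Q = "Qset N"
  let ?B = "{x \<in> ?Q. S * x * S \<in> ?Q}"
  let ?P = "{(x, y). x \<in> ?Q \<and> y \<in> ?Q \<and> f (x * S * y) = \<beta>}"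
  let ?F = "\<lambda>(x, y). x * S * y"
  note c = Qset_carrier note G = Qset_minv(1) note mc = c[OF Qset_minv(2)]
  note assoc = assoc_mult_mat[of _ ?n ?n _ ?n _ ?n]
  note mcarr = mult_carrier_mat[of _ ?n ?n _ ?n]
  have SS: "S * (S * X) = X" if "X \<in> carrier_mat ?n ?n" for X
    using assoc[OF S(1) S(1) that] S(2) that by simp
  have can: "minv x * (x * X) = X" "x * (minv x * X) = X" if "x \<in> ?Q" "X \<in> carrier_mat ?n ?n" for x X
    using minv_mult_cancel[OF G[OF that(1)] that(2)] by auto
  have fin: "finite ?P" by (rule finite_subset[of _ "?Q \<times> ?Q"]) auto
  have "card ?P = (\<Sum>g\<in>?F ` ?P. card {p \<in> ?P. ?F p = g})"
    using sum.image_gen[OF fin, of "\<lambda>_. 1::nat" ?F] by simp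
  also have "\<dots> = (\<Sum>g\<in>?F ` ?P. card ?B)"
  proof (rule sum.cong[OF refl])
    fix g assume "g \<in> ?F ` ?P"
    then obtain x0 y0 where g: "x0 \<in> ?Q" "y0 \<in> ?Q" "f (x0 * S * y0) = \<beta>" "g = x0 * S * y0" by auto
    note c0 = c[OF g(1)] c[OF g(2)]
    \<comment> \<open>The left factors of the other representations of g are x0 b with b in the
      intersection of Q and S Q S, and b determines the right factor.\<close>
    have "bij_betw (\<lambda>x. (x0 * x, S * minv x * S * y0)) ?B {p \<in> ?P. ?F p = g}"
    proof (rule bij_betw_byWitness[where f' = "\<lambda>(x, y). minv x0 * x"])
      show "\<forall>x\<in>?B. (\<lambda>(x, y). minv x0 * x) (x0 * x, S * minv x * S * y0) = x"
        using can(1)[OF g(1)] c by auto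
      show "\<forall>p\<in>{p \<in> ?P. ?F p = g}. (\<lambda>x. (x0 * x, S * minv x * S * y0)) ((\<lambda>(x, y). minv x0 * x) p) = p"
      proof
        fix p assume "p \<in> {p \<in> ?P. ?F p = g}"
        then obtain x y where p: "p = (x, y)" "x \<in> ?Q" "y \<in> ?Q" "x * S * y = x0 * S * y0" using g(4) by auto
        note cp = c[OF p(2)] c[OF p(3)]
        define x' where "x' = minv x0 * x"
        have x'Q: "x' \<in> ?Q" unfolding x'_def using Qset_minv(2)[OF g(1)] p(2) by (rule Qset_mult)
        note cx' = c[OF x'Q] mc[OF x'Q]
        have x: "x0 * x' = x" unfolding x'_def using can(2)[OF g(1) cp(1)] .
        have "x0 * (x' * (S * y)) = x0 * (S * y0)"
          using p(4) unfolding x[symmetric] using c0 cx' cp S(1) by (simp add: assoc mcarr)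
        then have "minv x0 * (x0 * (x' * (S * y))) = minv x0 * (x0 * (S * y0))" by simp
        then have "x' * (S * y) = S * y0"
          using can(1)[OF g(1)] mcarr[OF cx'(1) mcarr[OF S(1) cp(2)]] mcarr[OF S(1) c0(2)] by simp
        then have "minv x' * (x' * (S * y)) = minv x' * (S * y0)" by simp
        then have "S * y = minv x' * (S * y0)" using can(1)[OF x'Q mcarr[OF S(1) cp(2)]] by simp
        then have "S * (S * y) = S * (minv x' * (S * y0))" by simp
        then have "y = S * (minv x' * (S * y0))" using SS[OF cp(2)] by simp
        then have "y = S * minv x' * S * y0" using c0 cx' S(1) by (simp add: assoc mcarr)
        then show "(\<lambda>x. (x0 * x, S * minv x * S * y0)) ((\<lambda>(x, y). minv x0 * x) p) = p"
          using x by (simp add: p(1) x'_def)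
      qed
      show "(\<lambda>x. (x0 * x, S * minv x * S * y0)) ` ?B \<subseteq> {p \<in> ?P. ?F p = g}"
      proof clarify
        fix x assume x: "x \<in> ?Q" "S * x * S \<in> ?Q"
        note cx = c[OF x(1)] mc[OF x(1)]
        have "S * x * S * (S * minv x * S) = 1\<^sub>m ?n"
        proof -
          have "S * x * S * (S * minv x * S) = S * (x * (S * (S * (minv x * S))))"
            using cx S(1) by (simp add: assoc mcarr)
          also have "\<dots> = S * S" using SS[OF mcarr[OF cx(2) S(1)]] can(2)[OF x(1) S(1)] by simp
          finally show ?thesis using S(2) by simp
        qed
        then have "minv (S * x * S) = S * minv x * S"
          using cx S(1) by (intro GL_I(2)[of _ ?n]) (auto intro!: mcarr)
        then have inv: "S * minv x * S \<in> ?Q" using Qset_minv(2)[OF x(2)] by simp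
        have "x0 * x * S * (S * minv x * S * y0) = x0 * (x * (S * (S * (minv x * (S * y0)))))"
          using cx S(1) c0 by (simp add: assoc mcarr)
        also have "\<dots> = x0 * S * y0"
          using SS[OF mcarr[OF cx(2) mcarr[OF S(1) c0(2)]]] can(2)[OF x(1) mcarr[OF S(1) c0(2)]]
            assoc[OF c0(1) S(1) c0(2)] by simp
        finally have "x0 * x * S * (S * minv x * S * y0) = g" using g(4) by simp
        then show "(x0 * x, S * minv x * S * y0) \<in> ?P \<and> x0 * x * S * (S * minv x * S * y0) = g"
          using Qset_mult[OF g(1) x(1)] Qset_mult[OF inv g(2)] g(3,4) by simp
      qed
      show "(\<lambda>(x, y). minv x0 * x) ` {p \<in> ?P. ?F p = g} \<subseteq> ?B"
      proof clarify
        fix x y assume xy: "x \<in> ?Q" "y \<in> ?Q" "g = x * S * y"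
        note cp = c[OF xy(1)] c[OF xy(2)] mc[OF g(1)] mc[OF xy(2)]
        have "minv x0 * (x * (S * y)) = minv x0 * (x0 * (S * y0))"
          using xy(3) g(4) c0 cp S(1) by (simp add: assoc mcarr)
        also have "\<dots> = S * y0" using can(1)[OF g(1) mcarr[OF S(1) c0(2)]] .
        finally have "minv x0 * (x * (S * y)) = S * y0" .
        then have "S * (minv x0 * (x * (S * y)) * minv y) = S * (S * y0 * minv y)" by simp
        moreover have "S * (S * y0 * minv y) = y0 * minv y"
          using SS[OF mcarr[OF c0(2) cp(4)]] c0 cp S(1) by (simp add: assoc mcarr)
        moreover have "S * (minv x0 * (x * (S * y)) * minv y) = S * (minv x0 * x) * S"
        proof -
          have "S * (minv x0 * (x * (S * y)) * minv y) = S * (minv x0 * (x * (S * (y * minv y))))"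
            using cp S(1) by (simp add: assoc mcarr)
          also have "y * minv y = 1\<^sub>m ?n" using minv(2)[OF G[OF xy(2)]] .
          finally show ?thesis using cp S(1) by (simp add: assoc mcarr)
        qed
        ultimately have "S * (minv x0 * x) * S = y0 * minv y" by simp
        then show "minv x0 * x \<in> ?Q \<and> S * (minv x0 * x) * S \<in> ?Q"
          using Qset_mult[OF Qset_minv(2)[OF g(1)] xy(1)] Qset_mult[OF g(2) Qset_minv(2)[OF xy(2)]] by simp
      qed
    qed
    then show "card {p \<in> ?P. ?F p = g} = card ?B" by (simp add: bij_betw_same_card)
  qed
  also have "\<dots> = card (?F ` ?P) * card ?B" by simp
  also have "?F ` ?P = {g \<in> {x * S * y | x y. x \<in> ?Q \<and> y \<in> ?Q}. f g = \<beta>}" by auto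
  finally have 1: "card ?P = card {g \<in> {x * S * y | x y. x \<in> ?Q \<and> y \<in> ?Q}. f g = \<beta>} * card ?B" .
  have "card ?P = card (SIGMA y:?Q. {x \<in> ?Q. f (x * S * y) = \<beta>})"
    by (rule bij_betw_same_card[of "\<lambda>(x, y). (y, x)"])
       (auto intro!: bij_betw_byWitness[where f' = "\<lambda>(y, x). (x, y)"])
  also have "\<dots> = (\<Sum>y\<in>?Q. card {x \<in> ?Q. f (x * S * y) = \<beta>})" by (rule card_SigmaI) auto
  also have "\<dots> = (\<Sum>y\<in>?Q. card {x \<in> ?Q. f (x * S) = \<beta>})"
  proof (rule sum.cong[OF refl])
    fix y assume y: "y \<in> ?Q"
    note ty = t[OF y] Qset_minv(2)[OF t[OF y]]
    \<comment> \<open>The assumption on f trades the right factor y for the left factor t y, which a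
      translation of Q absorbs.\<close>
    have "bij_betw (\<lambda>x. t y * x) {x \<in> ?Q. f (x * S * y) = \<beta>} {x \<in> ?Q. f (x * S) = \<beta>}"
    proof (rule bij_betw_byWitness[where f' = "\<lambda>x. minv (t y) * x"])
      show "(\<lambda>x. t y * x) ` {x \<in> ?Q. f (x * S * y) = \<beta>} \<subseteq> {x \<in> ?Q. f (x * S) = \<beta>}"
        using f y Qset_mult[OF ty(1)] by auto
      show "(\<lambda>x. minv (t y) * x) ` {x \<in> ?Q. f (x * S) = \<beta>} \<subseteq> {x \<in> ?Q. f (x * S * y) = \<beta>}"
        using f[OF _ y] Qset_mult[OF ty(2)] can(2)[OF ty(1)] c by auto
    qed (use can[OF ty(1)] c in auto)
    then show "card {x \<in> ?Q. f (x * S * y) = \<beta>} = card {x \<in> ?Q. f (x * S) = \<beta>}"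
      by (rule bij_betw_same_card)
  qed
  also have "\<dots> = card ?Q * card {x \<in> ?Q. f (x * S) = \<beta>}" by simp
  finally show ?thesis using 1 by simp
qed

text \<open>The flag marks the cosets with the extra factor \<rho>. Keeping \<rho> in the function
  and not in the set lets both kinds share one count on Q \<sigma> Q.\<close>

definition trace_mode :: "bool \<Rightarrow> nat \<Rightarrow> 'a mat \<Rightarrow> 'a" where
  "trace_mode e N g = (if e then mat_trace (rho_mat (Suc N) * g) else mat_trace g)"

text \<open>Multiplication by \<rho> adds the lower left entry of w to its trace. By
  \<open>SO2_trace\<close> the two are equal, so with \<rho> the contribution of w cancels.\<close>

definition so2_trace :: "bool \<Rightarrow> 'a mat \<Rightarrow> 'a" where
  "so2_trace e w = (if e then 0 else w $$ (0, 0) + w $$ (Suc 0, Suc 0))"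

lemma sum_lessThan_add: "(\<Sum>k<s + m. f k) = (\<Sum>k<s. f k) + (\<Sum>j<m. f (s + j) :: 'b::comm_monoid_add)"
  for s m :: nat
  by (induction m) (simp_all add: add.assoc)

text \<open>For k < s the columns k and N + k are exchanged: the diagonal then shows A B in the
  upper block and 0 in the middle one. The other m indices keep the diagonals of A and A^-1.\<close>

lemma trace_qel:
  assumes p: "(A, w, B, h) \<in> params N" and N: "N = s + m"
  shows "trace_mode e N (qel N A w B h * sigma_mat (Suc N) s)
    = (\<Sum>k<s. (A * B) $$ (k, k)) + (\<Sum>j<m. A $$ (s + j, s + j) + minv A $$ (s + j, s + j)) + so2_trace e w"
proof -
  let ?M = "qel N A w B h" and ?n = "2 * N + 2" and ?S = "sigma_mat (Suc N) s :: 'a mat"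
  have Mc: "?M \<in> carrier_mat ?n ?n" unfolding qel_def by (rule blk_carrier)
  have sN: "s \<le> N" using N by simp
  have A: "A \<in> GL N" "w \<in> SO2_minus \<kappa>" using p by (auto simp: params_def)
  note Ai = minv[OF A(1)]
  have MSc: "?M * ?S \<in> carrier_mat ?n ?n" using mult_carrier_mat[OF Mc sigma_carrier] .
  have e: "(?M * ?S) $$ (i, j) = ?M $$ (i, sigma_index N s j)" if "i < ?n" "j < ?n" for i j
    using mult_sigma_right[OF sN Mc that] .
  have "mat_trace (?M * ?S) = (\<Sum>k<?n. ?M $$ (k, sigma_index N s k))"
    unfolding mat_trace_def using MSc e by (intro sum.cong) auto
  also have "\<dots> = (\<Sum>k<N. ?M $$ (k, sigma_index N s k)) + (\<Sum>k<N. ?M $$ (N + k, sigma_index N s (N + k)))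
      + ?M $$ (2 * N, 2 * N) + ?M $$ (2 * N + 1, 2 * N + 1)"
    unfolding sum_split3 sigma_index(7,8)[OF sN] ..
  also have "?M $$ (2 * N, 2 * N) = w $$ (0, 0)"
    using blk_index_corner[of 0 0 N] unfolding qel_def by simp
  also have "?M $$ (2 * N + 1, 2 * N + 1) = w $$ (Suc 0, Suc 0)"
    using blk_index_corner[of 1 1 N] unfolding qel_def by simp
  also have "(\<Sum>k<N. ?M $$ (k, sigma_index N s k)) = (\<Sum>k<s. (A * B) $$ (k, k)) + (\<Sum>j<m. A $$ (s + j, s + j))"
    unfolding N sum_lessThan_add
    using sN by (intro arg_cong2[where f = "(+)"] sum.cong refl)
      (auto simp: sigma_index_def N qel_def blk_def simp del: index_mult_mat(1))
  also have "(\<Sum>k<N. ?M $$ (N + k, sigma_index N s (N + k))) = (\<Sum>j<m. minv A $$ (s + j, s + j))"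
  proof -
    have "(\<Sum>k<s. ?M $$ (N + k, sigma_index N s (N + k))) = 0"
      using sN by (intro sum.neutral) (auto simp: sigma_index_def qel_def blk_def)
    moreover have "(\<Sum>j<m. ?M $$ (N + (s + j), sigma_index N s (N + (s + j)))) = (\<Sum>j<m. minv A $$ (s + j, s + j))"
      using sN N Ai(1) by (intro sum.cong refl) (auto simp: sigma_index_def qel_def blk_def)
    ultimately show ?thesis using sum_lessThan_add[of "\<lambda>k. ?M $$ (N + k, sigma_index N s (N + k))" s m] N by simp
  qed
  finally have T: "mat_trace (?M * ?S) = (\<Sum>k<s. (A * B) $$ (k, k))
      + (\<Sum>j<m. A $$ (s + j, s + j) + minv A $$ (s + j, s + j)) + (w $$ (0, 0) + w $$ (Suc 0, Suc 0))"
    by (simp add: sum.distrib add_ac)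
  have "mat_trace (rho_mat (Suc N) * (?M * ?S)) = mat_trace (?M * ?S) + w $$ (Suc 0, 0)"
  proof -
    have rc: "rho_mat (Suc N) * (?M * ?S) \<in> carrier_mat ?n ?n" using mult_carrier_mat[OF rho_carrier MSc] .
    have "mat_trace (rho_mat (Suc N) * (?M * ?S))
        = (\<Sum>k<?n. (?M * ?S) $$ (k, k) + (if k = 2 * N then (?M * ?S) $$ (2 * N + 1, 2 * N) else 0))"
      unfolding mat_trace_def carrier_matD(1)[OF rc] using mult_rho_left[OF MSc] by (intro sum.cong) auto
    also have "\<dots> = mat_trace (?M * ?S) + (?M * ?S) $$ (2 * N + 1, 2 * N)"
      unfolding mat_trace_def carrier_matD(1)[OF MSc] sum.distrib by (simp del: index_mult_mat(1))
    also have "(?M * ?S) $$ (2 * N + 1, 2 * N) = w $$ (Suc 0, 0)"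
      using e[of "2 * N + 1" "2 * N"] sigma_index(7)[OF sN] blk_index_corner[of 1 0 N] unfolding qel_def by simp
    finally show ?thesis .
  qed
  then show ?thesis using T SO2_trace[OF A(2)] by (simp add: trace_mode_def so2_trace_def add.assoc)
qed

text \<open>A particular solution B of \<open>alt_pair N B h\<close>. All others differ from it by
  an alternating matrix, which becomes the free parameter in place of B.\<close>

definition quad :: "nat \<Rightarrow> 'a mat \<Rightarrow> 'a mat" where
  "quad N h = mat N N (\<lambda>(k, l). h $$ (0, l) * h $$ (0, k) + h $$ (0, l) * h $$ (1, k) + \<kappa> * h $$ (1, l) * h $$ (1, k))"

lemma sum_params:
  "(\<Sum>x\<in>params N. F x) = (\<Sum>A\<in>GL N. \<Sum>w\<in>SO2_minus \<kappa>. \<Sum>h\<in>carrier_mat 2 N. \<Sum>C\<in>Alt N. F (A, w, C + quad N h, h))"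
proof -
  have qc: "quad N h \<in> carrier_mat N N" for h by (simp add: quad_def)
  have inv: "(X + quad N h) + quad N h = X" if "X \<in> carrier_mat N N" for X h
    using that qc[of h] by (intro eq_matI) (auto simp: add.assoc)
  have alt: "alt_pair N (X + quad N h) h \<longleftrightarrow> X \<in> Alt N" if X: "X \<in> carrier_mat N N" for X h
  proof -
    have d: "(X + quad N h) $$ (k, l) = X $$ (k, l) + (h $$ (0, l) * h $$ (0, k) + h $$ (0, l) * h $$ (1, k) + \<kappa> * h $$ (1, l) * h $$ (1, k))"
      if "k < N" "l < N" for k l using that X by (simp add: quad_def)
    have 1: "(X + quad N h) $$ (k, k) = nrm (h $$ (0, k)) (h $$ (1, k)) \<longleftrightarrow> X $$ (k, k) = 0" if "k < N" for k
      unfolding d[OF that that] nrm_def by (simp add: power2_eq_square mult.assoc)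
    have 2: "(X + quad N h) $$ (k, l) + (X + quad N h) $$ (l, k) = h $$ (0, k) * h $$ (1, l) + h $$ (0, l) * h $$ (1, k)
        \<longleftrightarrow> X $$ (k, l) = X $$ (l, k)" if kl: "k < N" "l < N" for k l
    proof -
      have "(X + quad N h) $$ (k, l) + (X + quad N h) $$ (l, k)
          = (X $$ (k, l) + X $$ (l, k)) + (h $$ (0, k) * h $$ (1, l) + h $$ (0, l) * h $$ (1, k))"
        unfolding d[OF kl] d[OF kl(2,1)] by (simp add: algebra_simps)
      then show ?thesis by (simp add: add_eq_zero_char2)
    qed
    show ?thesis unfolding alt_pair_def Alt_iff using X 1 2 by auto
  qed
  have "(\<Sum>x\<in>params N. F x)
      = (\<Sum>(A, w, h, C)\<in>GL N \<times> SO2_minus \<kappa> \<times> carrier_mat 2 N \<times> Alt N. F (A, w, C + quad N h, h))"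
  proof (rule sum.reindex_bij_witness[of _ "\<lambda>(A, w, h, C). (A, w, C + quad N h, h)" "\<lambda>(A, w, B, h). (A, w, h, B + quad N h)"])
    fix x assume x: "x \<in> params N"
    obtain A w B h where xx: "x = (A, w, B, h)" by (cases x)
    have p: "A \<in> GL N" "w \<in> SO2_minus \<kappa>" "B \<in> carrier_mat N N" "h \<in> carrier_mat 2 N" "alt_pair N B h"
      using x by (auto simp: xx params_def)
    show "(case case x of (A, w, B, h) \<Rightarrow> (A, w, h, B + quad N h) of (A, w, h, C) \<Rightarrow> (A, w, C + quad N h, h)) = x"
      using inv[OF p(3), of h] by (simp add: xx)
    show "(case x of (A, w, B, h) \<Rightarrow> (A, w, h, B + quad N h)) \<in> GL N \<times> SO2_minus \<kappa> \<times> carrier_mat 2 N \<times> Alt N"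
      using p alt[of "B + quad N h" h] inv[OF p(3), of h] qc[of h] by (simp add: xx)
    show "(case case x of (A, w, B, h) \<Rightarrow> (A, w, h, B + quad N h) of (A, w, h, C) \<Rightarrow> F (A, w, C + quad N h, h)) = F x"
      using inv[OF p(3), of h] by (simp add: xx)
  next
    fix y :: "'a mat \<times> 'a mat \<times> 'a mat \<times> 'a mat" assume y: "y \<in> GL N \<times> SO2_minus \<kappa> \<times> carrier_mat 2 N \<times> Alt N"
    obtain A w h C where yy: "y = (A, w, h, C)" by (cases y)
    have p: "A \<in> GL N" "w \<in> SO2_minus \<kappa>" "h \<in> carrier_mat 2 N" "C \<in> Alt N" using y by (auto simp: yy)
    have Cc: "C \<in> carrier_mat N N" using p(4) by (simp add: Alt_def)
    show "(case case y of (A, w, h, C) \<Rightarrow> (A, w, C + quad N h, h) of (A, w, B, h) \<Rightarrow> (A, w, h, B + quad N h)) = y"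
      using inv[OF Cc, of h] by (simp add: yy)
    show "(case y of (A, w, h, C) \<Rightarrow> (A, w, C + quad N h, h)) \<in> params N"
      using p alt[OF Cc, of h] Cc qc[of h] by (simp add: yy params_def)
  qed
  also have "\<dots> = (\<Sum>A\<in>GL N. \<Sum>w\<in>SO2_minus \<kappa>. \<Sum>h\<in>carrier_mat 2 N. \<Sum>C\<in>Alt N. F (A, w, C + quad N h, h))"
    by (simp add: sum.cartesian_product)
  finally show ?thesis .
qed

lemma sum_Qset:
  "(\<Sum>M\<in>Qset N. F M) = (\<Sum>A\<in>GL N. \<Sum>w\<in>SO2_minus \<kappa>. \<Sum>h\<in>carrier_mat 2 N. \<Sum>C\<in>Alt N. F (qel N A w (C + quad N h) h))"
proof -
  have "(\<Sum>M\<in>Qset N. F M) = (\<Sum>x\<in>params N. F ((\<lambda>(A, w, B, h). qel N A w B h) x))"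
    unfolding Qset_eq_params by (subst sum.reindex[OF inj_qel]) simp
  then show ?thesis unfolding sum_params by simp
qed

lemma params_quad:
  assumes "A \<in> GL N" "w \<in> SO2_minus \<kappa>" "h \<in> carrier_mat 2 N" "C \<in> Alt N"
  shows "(A, w, C + quad N h, h) \<in> params N"
proof -
  have Cc: "C \<in> carrier_mat N N" using assms(4) by (simp add: Alt_def)
  have "alt_pair N (C + quad N h) h"
    using assms(4) unfolding alt_pair_def Alt_iff
    by (auto simp: quad_def nrm_def power2_eq_square mult.assoc algebra_simps)
  then show ?thesis using assms Cc by (simp add: params_def quad_def)
qed

text \<open>The exponent is linear in C and vanishes identically exactly under the two conditions on
  A. Otherwise some off-diagonal entry of C has a nonzero coefficient, and translation by an
  alternating matrix supported there reverses the sign.\<close>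

lemma sum_Alt_lam:
  assumes c: "c \<noteq> 0" and sN: "s \<le> N"
  shows "(\<Sum>C\<in>Alt N. lam (c * (\<Sum>k<s. \<Sum>l<N. A $$ (k, l) * C $$ (l, k))))
    = (if (\<forall>k<s. \<forall>l<N. s \<le> l \<longrightarrow> A $$ (k, l) = 0) \<and> (\<forall>k<s. \<forall>l<s. A $$ (k, l) = A $$ (l, k))
       then int (card (Alt N :: 'a mat set)) else 0)" (is "_ = (if ?c1 \<and> ?c2 then _ else _)")
proof (cases "?c1 \<and> ?c2")
  case True
  have "(\<Sum>k<s. \<Sum>l<N. A $$ (k, l) * C $$ (l, k)) = 0" if C: "C \<in> Alt N" for C
  proof -
    have "(\<Sum>k<s. \<Sum>l<N. A $$ (k, l) * C $$ (l, k)) = (\<Sum>k<s. \<Sum>l<s. A $$ (k, l) * C $$ (l, k))"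
      using sN True by (intro sum.cong refl sum.mono_neutral_right) auto
    also have "\<dots> = (\<Sum>k<s. A $$ (k, k) * C $$ (k, k))"
    proof (rule sum_symmetric_char2)
      fix k l assume kl: "k < s" "l < s"
      then have "C $$ (l, k) = C $$ (k, l)" "A $$ (k, l) = A $$ (l, k)" using C sN True by (auto simp: Alt_iff)
      then show "A $$ (k, l) * C $$ (l, k) = A $$ (l, k) * C $$ (k, l)" by simp
    qed
    also have "\<dots> = 0" using C sN by (intro sum.neutral) (auto simp: Alt_iff)
    finally show ?thesis .
  qed
  then have "(\<Sum>C\<in>Alt N. lam (c * (\<Sum>k<s. \<Sum>l<N. A $$ (k, l) * C $$ (l, k)))) = (\<Sum>C\<in>(Alt N :: 'a mat set). 1)"
    by (intro sum.cong) auto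
  then show ?thesis using True by simp
next
  case False
  \<comment> \<open>The entries of C at (k0, l0) and (l0, k0) agree, so their common coefficient
    adds A at both places, the second one only if its row is among the first s.\<close>
  have "\<exists>k0 l0. k0 < s \<and> l0 < N \<and> k0 \<noteq> l0 \<and> A $$ (k0, l0) + (if l0 < s then A $$ (l0, k0) else 0) \<noteq> 0"
  proof (cases ?c1)
    case True
    then obtain k l where "k < s" "l < s" "A $$ (k, l) \<noteq> A $$ (l, k)" using False by blast
    then show ?thesis using sN by (intro exI[of _ k] exI[of _ l]) (auto simp: add_eq_zero_char2)
  next
    case False
    then obtain k l where "k < s" "l < N" "s \<le> l" "A $$ (k, l) \<noteq> 0" by blast
    then show ?thesis by (intro exI[of _ k] exI[of _ l]) auto
  qed
  then obtain k0 l0 where k0: "k0 < s" "l0 < N" "k0 \<noteq> l0"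
    "A $$ (k0, l0) + (if l0 < s then A $$ (l0, k0) else 0) \<noteq> 0" by blast
  define d where "d = A $$ (k0, l0) + (if l0 < s then A $$ (l0, k0) else 0)"
  have d0: "d \<noteq> 0" using k0 by (simp add: d_def)
  obtain y where y: "lam y = -1" using ex_lam_neg by blast
  define x where "x = y / (c * d)"
  define C0 where "C0 = mat N N (\<lambda>(i, j). if i = k0 \<and> j = l0 \<or> i = l0 \<and> j = k0 then x else 0)"
  have k0N: "k0 < N" using k0 sN by simp
  have C0: "C0 \<in> Alt N" using k0 k0N by (auto simp: Alt_iff C0_def)
  have C0s: "(\<Sum>k<s. \<Sum>l<N. A $$ (k, l) * C0 $$ (l, k)) = x * d"
  proof -
    have "(\<Sum>k<s. \<Sum>l<N. A $$ (k, l) * C0 $$ (l, k))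
        = (\<Sum>k<s. \<Sum>l<N. (if k = k0 then (if l = l0 then A $$ (k0, l0) * x else 0) else 0)
          + (if k = l0 then (if l = k0 then A $$ (l0, k0) * x else 0) else 0))"
      using k0 sN by (intro sum.cong refl) (auto simp: C0_def)
    also have "\<dots> = (\<Sum>k<s. (if k = k0 then A $$ (k0, l0) * x else 0) + (if k = l0 then A $$ (l0, k0) * x else 0))"
    proof (intro sum.cong refl)
      fix k
      show "(\<Sum>l<N. (if k = k0 then (if l = l0 then A $$ (k0, l0) * x else 0) else 0)
          + (if k = l0 then (if l = k0 then A $$ (l0, k0) * x else 0) else 0))
        = (if k = k0 then A $$ (k0, l0) * x else 0) + (if k = l0 then A $$ (l0, k0) * x else 0)"
        using k0 k0N by (cases "k = k0"; cases "k = l0") auto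
    qed
    also have "\<dots> = x * d" using k0 by (auto simp: sum.distrib d_def algebra_simps)
    finally show ?thesis .
  qed
  have "(\<Sum>C\<in>Alt N. lam (c * (\<Sum>k<s. \<Sum>l<N. A $$ (k, l) * C $$ (l, k)))) = 0"
  proof (rule character_sum_zero[where t = "\<lambda>C. C + C0"])
    fix C :: "'a mat" assume C: "C \<in> Alt N"
    have cc: "C \<in> carrier_mat N N" "C0 \<in> carrier_mat N N" using C C0 by (auto simp: Alt_def)
    show "C + C0 \<in> Alt N" using C C0 cc by (auto simp: Alt_iff)
    show "C + C0 + C0 = C" using cc by (intro eq_matI) (auto simp: add.assoc)
    have "(\<Sum>k<s. \<Sum>l<N. A $$ (k, l) * (C + C0) $$ (l, k))
        = (\<Sum>k<s. \<Sum>l<N. A $$ (k, l) * C $$ (l, k)) + (\<Sum>k<s. \<Sum>l<N. A $$ (k, l) * C0 $$ (l, k))"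
      unfolding sum.distrib[symmetric] using cc sN by (intro sum.cong refl) (auto simp: distrib_left)
    then have "c * (\<Sum>k<s. \<Sum>l<N. A $$ (k, l) * (C + C0) $$ (l, k))
        = c * (\<Sum>k<s. \<Sum>l<N. A $$ (k, l) * C $$ (l, k)) + y"
      unfolding C0s using c d0 by (simp add: distrib_left x_def)
    then show "lam (c * (\<Sum>k<s. \<Sum>l<N. A $$ (k, l) * (C + C0) $$ (l, k)))
        = - lam (c * (\<Sum>k<s. \<Sum>l<N. A $$ (k, l) * C $$ (l, k)))"
      by (simp only: lam_add y)
  qed
  then show ?thesis unfolding if_not_P[OF False] .
qed

lemma sum_h_lam:
  assumes S: "S \<in> sym_GL s" and sN: "s \<le> N" and c: "c \<noteq> 0"
  shows "(\<Sum>h\<in>carrier_mat 2 N. lam (c * (\<Sum>k<s. \<Sum>l<s. S $$ (k, l) * quad N h $$ (l, k))))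
    = (-1) ^ s * int q ^ (N + (N - s))"
proof -
  let ?m = "\<lambda>(u, v). mat 2 N (\<lambda>(i, k). if i = 0 then u $ k else (v $ k :: 'a))"
  have "(\<Sum>h\<in>carrier_mat 2 N. lam (c * (\<Sum>k<s. \<Sum>l<s. S $$ (k, l) * quad N h $$ (l, k))))
      = (\<Sum>(u, v)\<in>carrier_vec N \<times> carrier_vec N.
        lam (c * (\<Sum>k<s. \<Sum>l<s. S $$ (k, l) * (u $ k * u $ l + u $ k * v $ l + \<kappa> * v $ k * v $ l))))"
  proof (rule sum.reindex_bij_witness[of _ ?m "\<lambda>h. (row h 0, row h 1)"])
    fix h :: "'a mat" assume h: "h \<in> carrier_mat 2 N"
    show "?m (row h 0, row h 1) = h" using h by (intro eq_matI) (auto simp: less_2_cases_iff)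
    show "(row h 0, row h 1) \<in> carrier_vec N \<times> carrier_vec N" using h by (auto intro!: carrier_vecI)
    have "(\<Sum>k<s. \<Sum>l<s. S $$ (k, l) * quad N h $$ (l, k))
      = (\<Sum>k<s. \<Sum>l<s. S $$ (k, l) * (row h 0 $ k * row h 0 $ l + row h 0 $ k * row h 1 $ l + \<kappa> * row h 1 $ k * row h 1 $ l))"
      using h sN by (intro sum.cong refl) (auto simp: quad_def)
    then show "(case (row h 0, row h 1) of (u, v) \<Rightarrow>
        lam (c * (\<Sum>k<s. \<Sum>l<s. S $$ (k, l) * (u $ k * u $ l + u $ k * v $ l + \<kappa> * v $ k * v $ l))))
      = lam (c * (\<Sum>k<s. \<Sum>l<s. S $$ (k, l) * quad N h $$ (l, k)))" by simp
  next
    fix uv :: "'a vec \<times> 'a vec" assume "uv \<in> carrier_vec N \<times> carrier_vec N"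
    then show "?m uv \<in> carrier_mat 2 N" "(row (?m uv) 0, row (?m uv) 1) = uv"
      by (auto intro!: eq_vecI)
  qed
  also have "\<dots> = (\<Sum>u\<in>carrier_vec N. \<Sum>v\<in>carrier_vec N.
      lam (c * (\<Sum>k<s. \<Sum>l<s. S $$ (k, l) * (u $ k * u $ l + u $ k * v $ l + \<kappa> * v $ k * v $ l))))"
    by (rule sum.cartesian_product[symmetric])
  finally show ?thesis unfolding sum_quadratic_rows[OF assms] .
qed

lemma symmetric_lower_block_iff:
  assumes A: "A \<in> GL (s + m)"
  shows "(\<forall>k<s. \<forall>l<s + m. s \<le> l \<longrightarrow> A $$ (k, l) = 0) \<and> (\<forall>k<s. \<forall>l<s. A $$ (k, l) = A $$ (l, k)) \<longleftrightarrow>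
    (\<forall>i<s. \<forall>j<m. A $$ (i, s + j) = (0::'a)) \<and> mat s s (\<lambda>ij. A $$ ij) \<in> sym_GL s" (is "?L \<longleftrightarrow> ?R")
proof
  assume L: ?L
  then have z: "\<And>i j. i < s \<Longrightarrow> j < m \<Longrightarrow> A $$ (i, s + j) = 0" by simp
  then obtain A1 A3 A4 where b: "A1 \<in> GL s" "A3 \<in> carrier_mat m s" "A4 \<in> GL m"
    "A = four_block_mat A1 (0\<^sub>m s m) A3 A4" using lower_block_cases[OF A] by blast
  have "mat s s (\<lambda>ij. A $$ ij) = A1"
    using GL_carrier[OF b(1)] GL_carrier[OF b(3)] by (intro eq_matI) (auto simp: b(4))
  moreover have "(mat s s (\<lambda>ij. A $$ ij))\<^sup>T = mat s s (\<lambda>ij. A $$ ij)" using L by (intro eq_matI) auto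
  ultimately show ?R using z b(1) by (simp add: sym_GL_def)
next
  assume R: ?R
  have "A $$ (k, l) = 0" if "k < s" "l < s + m" "s \<le> l" for k l
  proof -
    have "l - s < m" "s + (l - s) = l" using that by auto
    then show ?thesis using R that(1) by metis
  qed
  moreover have "A $$ (k, l) = A $$ (l, k)" if "k < s" "l < s" for k l
  proof -
    have "(mat s s (\<lambda>ij. A $$ ij))\<^sup>T $$ (k, l) = A $$ (l, k)" using that by simp
    moreover have "(mat s s (\<lambda>ij. A $$ ij))\<^sup>T = mat s s (\<lambda>ij. A $$ ij)" using R by (simp add: sym_GL_def)
    ultimately show ?thesis using that by simp
  qed
  ultimately show ?L by blast
qed

lemma sum_so2_trace:
  assumes "c \<noteq> 0"
  shows "(\<Sum>w\<in>SO2_minus \<kappa>. lam (c * so2_trace e w)) = (if e then int q + 1 else - K c)"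
  using sum_SO2_lam[OF assms] card_SO2 by (simp add: so2_trace_def)

text \<open>The sum over C leaves block lower triangular A with symmetric leading block. The
  exponent of q collects N + m from h, m s from the free lower left block of A, and the number of
  free entries of C.\<close>

lemma sum_Qset_lam:
  assumes c: "c \<noteq> 0" and N: "N = s + m"
  shows "(\<Sum>M\<in>Qset N. lam (c * trace_mode e N (M * sigma_mat (Suc N) s)))
    = (-1) ^ s * int q ^ (N + m + m * s + (\<Sum>i<N. i)) * int (card (sym_GL s :: 'a mat set))
      * gl_kloosterman m c * (if e then int q + 1 else - K c)"
proof -
  define W where "W = (if e then int q + 1 else - K c)"
  define al where "al = int (card (Alt N :: 'a mat set))"
  define cnd where "cnd = (\<lambda>A::'a mat. (\<forall>k<s. \<forall>l<N. s \<le> l \<longrightarrow> A $$ (k, l) = 0) \<and> (\<forall>k<s. \<forall>l<s. A $$ (k, l) = A $$ (l, k)))"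
  define tl where "tl = (\<lambda>A::'a mat. \<Sum>j<m. A $$ (s + j, s + j) + minv A $$ (s + j, s + j))"
  define Hs where "Hs = (\<lambda>A::'a mat. \<Sum>h\<in>carrier_mat 2 N. lam (c * (\<Sum>k<s. \<Sum>l<N. A $$ (k, l) * quad N h $$ (l, k))))"
  have sN: "s \<le> N" using N by simp
  have cnd_eq: "{A \<in> GL N. cnd A}
      = {A \<in> GL (s + m). (\<forall>i<s. \<forall>j<m. A $$ (i, s + j) = 0) \<and> mat s s (\<lambda>ij. A $$ ij) \<in> sym_GL s}"
    unfolding cnd_def N by (rule Collect_cong, rule conj_cong[OF refl], rule symmetric_lower_block_iff)
  have summand: "lam (c * trace_mode e N (qel N A w (C + quad N h) h * sigma_mat (Suc N) s))
      = lam (c * tl A) * lam (c * so2_trace e w) * (lam (c * (\<Sum>k<s. \<Sum>l<N. A $$ (k, l) * quad N h $$ (l, k)))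
        * lam (c * (\<Sum>k<s. \<Sum>l<N. A $$ (k, l) * C $$ (l, k))))"
    if A: "A \<in> GL N" and w: "w \<in> SO2_minus \<kappa>" and h: "h \<in> carrier_mat 2 N" and C: "C \<in> Alt N" for A w h C
  proof -
    have cc: "A \<in> carrier_mat N N" "C \<in> carrier_mat N N" "quad N h \<in> carrier_mat N N"
      using GL_carrier[OF A] C by (auto simp: Alt_def quad_def)
    have "(\<Sum>k<s. (A * (C + quad N h)) $$ (k, k))
        = (\<Sum>k<s. \<Sum>l<N. A $$ (k, l) * C $$ (l, k)) + (\<Sum>k<s. \<Sum>l<N. A $$ (k, l) * quad N h $$ (l, k))"
      unfolding sum.distrib[symmetric]
    proof (intro sum.cong refl)
      fix k assume "k \<in> {..<s}"
      then have k: "k < N" using sN by simp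
      have "(A * (C + quad N h)) $$ (k, k) = (\<Sum>l<N. A $$ (k, l) * (C + quad N h) $$ (l, k))"
        using k cc by (intro index_mult_mat_sum) auto
      also have "\<dots> = (\<Sum>l<N. A $$ (k, l) * C $$ (l, k) + A $$ (k, l) * quad N h $$ (l, k))"
        using k cc by (intro sum.cong refl) (simp add: distrib_left)
      finally show "(A * (C + quad N h)) $$ (k, k)
        = (\<Sum>l<N. A $$ (k, l) * C $$ (l, k) + A $$ (k, l) * quad N h $$ (l, k))" .
    qed
    then show ?thesis
      unfolding trace_qel[OF params_quad[OF A w h C] N] tl_def by (simp only: distrib_left lam_add mult_ac)
  qed
  have "(\<Sum>M\<in>Qset N. lam (c * trace_mode e N (M * sigma_mat (Suc N) s)))
      = (\<Sum>A\<in>GL N. \<Sum>w\<in>SO2_minus \<kappa>. \<Sum>h\<in>carrier_mat 2 N. \<Sum>C\<in>Alt N.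
          lam (c * tl A) * lam (c * so2_trace e w) * (lam (c * (\<Sum>k<s. \<Sum>l<N. A $$ (k, l) * quad N h $$ (l, k)))
        * lam (c * (\<Sum>k<s. \<Sum>l<N. A $$ (k, l) * C $$ (l, k)))))"
    unfolding sum_Qset by (intro sum.cong refl) (simp only: summand)
  also have "\<dots> = (\<Sum>A\<in>GL N. lam (c * tl A) * (\<Sum>w\<in>SO2_minus \<kappa>. lam (c * so2_trace e w)) * (Hs A
        * (\<Sum>C\<in>Alt N. lam (c * (\<Sum>k<s. \<Sum>l<N. A $$ (k, l) * C $$ (l, k))))))"
  proof -
    have "(\<Sum>w\<in>P. \<Sum>h\<in>H. \<Sum>C\<in>R. k * u w * (v h * z C)) = k * (\<Sum>w\<in>P. u w) * ((\<Sum>h\<in>H. v h) * (\<Sum>C\<in>R. z C))"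
      for P H R :: "'a mat set" and u v z and k :: int
      by (simp add: sum_distrib_left[symmetric] sum_distrib_right[symmetric])
    then show ?thesis unfolding Hs_def by (intro sum.cong refl)
  qed
  also have "\<dots> = (\<Sum>A\<in>GL N. if cnd A then lam (c * tl A) * W * (Hs A * al) else 0)"
  proof -
    have "(\<Sum>C\<in>Alt N. lam (c * (\<Sum>k<s. \<Sum>l<N. A $$ (k, l) * C $$ (l, k)))) = (if cnd A then al else 0)" for A
      unfolding cnd_def al_def by (rule sum_Alt_lam[OF c sN])
    then show ?thesis unfolding sum_so2_trace[OF c] W_def[symmetric] by (intro sum.cong refl) simp
  qed
  also have "\<dots> = (\<Sum>A\<in>{A \<in> GL N. cnd A}. lam (c * tl A) * W * (Hs A * al))"
    by (rule sum.inter_filter[symmetric]) simp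
  also have "\<dots> = (\<Sum>x\<in>sym_GL s \<times> carrier_mat m s \<times> GL m. (\<lambda>A. lam (c * tl A) * W * (Hs A * al)) ((\<lambda>(A1, A3, A4). four_block_mat A1 (0\<^sub>m s m) A3 A4) x))"
    unfolding cnd_eq by (rule sum.reindex_bij_betw[symmetric, OF bij_lower_block]) (auto simp: sym_GL_def)
  also have "\<dots> = (\<Sum>(A1, A3, A4)\<in>(sym_GL s :: 'a mat set) \<times> (carrier_mat m s :: 'a mat set) \<times> GL m.
      lam (c * (\<Sum>j<m. A4 $$ (j, j) + minv A4 $$ (j, j))) * (W * ((-1) ^ s * int q ^ (N + m) * al)))"
  proof (rule sum.cong[OF refl])
    fix x :: "'a mat \<times> 'a mat \<times> 'a mat" assume "x \<in> sym_GL s \<times> carrier_mat m s \<times> GL m"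
    then obtain A1 A3 A4 where x: "x = (A1, A3, A4)" "A1 \<in> sym_GL s" "A3 \<in> carrier_mat m s" "A4 \<in> GL m" by auto
    let ?A = "four_block_mat A1 (0\<^sub>m s m) A3 A4"
    have A1: "A1 \<in> GL s" using x(2) by (simp add: sym_GL_def)
    note c1 = GL_carrier[OF A1] GL_carrier[OF x(4)] minv(1)[OF A1] minv(1)[OF x(4)]
    have "tl ?A = (\<Sum>j<m. A4 $$ (j, j) + minv A4 $$ (j, j))"
      unfolding tl_def minv_lower_block(2)[OF A1 x(4,3)] using c1 by (intro sum.cong refl) simp
    moreover have "Hs ?A = (-1) ^ s * int q ^ (N + m)"
    proof -
      have "(\<Sum>k<s. \<Sum>l<N. ?A $$ (k, l) * quad N h $$ (l, k)) = (\<Sum>k<s. \<Sum>l<s. A1 $$ (k, l) * quad N h $$ (l, k))" for h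
      proof (rule sum.cong[OF refl])
        fix k assume "k \<in> {..<s}"
        then have k: "k < s" by simp
        have "(\<Sum>l<N. ?A $$ (k, l) * quad N h $$ (l, k)) = (\<Sum>l<s. ?A $$ (k, l) * quad N h $$ (l, k))"
          using k c1 N by (intro sum.mono_neutral_right) auto
        also have "\<dots> = (\<Sum>l<s. A1 $$ (k, l) * quad N h $$ (l, k))" using k c1 by (intro sum.cong refl) simp
        finally show "(\<Sum>l<N. ?A $$ (k, l) * quad N h $$ (l, k)) = (\<Sum>l<s. A1 $$ (k, l) * quad N h $$ (l, k))" .
      qed
      then show ?thesis unfolding Hs_def using sum_h_lam[OF x(2) sN c] N by simp
    qed
    ultimately show "(\<lambda>A. lam (c * tl A) * W * (Hs A * al)) ((\<lambda>(A1, A3, A4). four_block_mat A1 (0\<^sub>m s m) A3 A4) x)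
        = (case x of (A1, A3, A4) \<Rightarrow> lam (c * (\<Sum>j<m. A4 $$ (j, j) + minv A4 $$ (j, j))) * (W * ((-1) ^ s * int q ^ (N + m) * al)))"
      by (simp add: x(1))
  qed
  also have "\<dots> = (\<Sum>A1\<in>(sym_GL s :: 'a mat set). \<Sum>A3\<in>(carrier_mat m s :: 'a mat set). \<Sum>A4\<in>GL m.
      lam (c * (\<Sum>j<m. A4 $$ (j, j) + minv A4 $$ (j, j))) * (W * ((-1) ^ s * int q ^ (N + m) * al)))"
    by (simp add: sum.cartesian_product del: sum_constant)
  also have "\<dots> = int (card (sym_GL s :: 'a mat set)) * (int q ^ (m * s) * (gl_kloosterman m c * (W * ((-1) ^ s * int q ^ (N + m) * al))))"
    unfolding gl_kloosterman_def sum_distrib_right[symmetric] by (simp add: card_carrier_mat)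
  also have "al = int q ^ (\<Sum>i<N. i)" by (simp add: al_def card_Alt)
  finally show ?thesis unfolding W_def[symmetric] by (simp only: power_add mult_ac)
qed

lemma card_Qset:
  "int (card (Qset N)) = int (card (GL N :: 'a mat set)) * (int q + 1) * int q ^ (2 * N + (\<Sum>i<N. i))"
proof -
  have "(\<Sum>M\<in>Qset N. 1 :: int) = int (card (GL N :: 'a mat set)) * (int (card (SO2_minus \<kappa>))
      * (int (card (carrier_mat 2 N :: 'a mat set)) * int (card (Alt N :: 'a mat set))))"
    unfolding sum_Qset by simp
  then show ?thesis by (simp add: card_SO2 card_carrier_mat card_Alt power_add mult_ac)
qed

text \<open>Conjugation by \<sigma> exchanges the indices i and N + i for i < s, so the entries
  moved into the zero blocks of Q must vanish: the upper right part of A, the first s columns of w h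
  and the leading corner of A B. Invertibility of w and of the leading block of A turns these into
  conditions on h and B, and where the columns of h vanish, B agrees with C.\<close>

lemma qel_stabilizer_iff:
  assumes A: "A \<in> GL N" and w: "w \<in> SO2_minus \<kappa>" and h: "h \<in> carrier_mat 2 N" and C: "C \<in> Alt N"
    and N: "N = s + m"
  shows "sigma_mat (Suc N) s * qel N A w (C + quad N h) h * sigma_mat (Suc N) s \<in> Qset N \<longleftrightarrow>
    (\<forall>i<s. \<forall>j<m. A $$ (i, s + j) = 0) \<and> (\<forall>a<2. \<forall>k<s. h $$ (a, k) = 0) \<and> (\<forall>i<s. \<forall>j<s. C $$ (i, j) = 0)"
    (is "?S * ?M * ?S \<in> _ \<longleftrightarrow> ?z1 \<and> ?z2 \<and> ?z3")
proof -
  let ?n = "2 * N + 2"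
  define B where "B = C + quad N h"
  have sN: "s \<le> N" using N by simp
  have p: "(A, w, B, h) \<in> params N" unfolding B_def by (rule params_quad[OF A w h C])
  have MQ: "?M \<in> Qset N" using params_subset_Qset[OF p] by (simp add: B_def)
  note Mc = Qset_carrier[OF MQ]
  have cc: "A \<in> carrier_mat N N" "C \<in> carrier_mat N N" "B \<in> carrier_mat N N" "w \<in> carrier_mat 2 2"
    using GL_carrier[OF A] C SO2_carrier[OF w] by (auto simp: Alt_def B_def quad_def)
  note Ai = minv[OF A]
  have SMc: "?S * ?M \<in> carrier_mat ?n ?n" using mult_carrier_mat[OF sigma_carrier Mc] .
  have e: "(?S * ?M * ?S) $$ (i, j) = ?M $$ (sigma_index N s i, sigma_index N s j)" if "i < ?n" "j < ?n" for i j
    using mult_sigma_right[OF sN SMc that] mult_sigma_left[OF sN Mc that(1) sigma_index(2)[OF sN that(2)]] by simp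
  have quad0: "quad N h $$ (i, j) = 0" if ?z2 "i < s" "j < s" for i j
    using that sN by (simp add: quad_def)
  have ABsum: "(A * B) $$ (i, j) = (\<Sum>l<N. A $$ (i, l) * B $$ (l, j))" if "i < N" "j < N" for i j
    using that cc by (intro index_mult_mat_sum) auto
  show ?thesis
  proof
    assume "?S * ?M * ?S \<in> Qset N"
    then have z: "?M $$ (sigma_index N s i, sigma_index N s j) = 0" if "N \<le> i" "i < ?n" "j < N" for i j
      using e[of i j] that unfolding Qset_def by auto
    have z1: "A $$ (i, s + j) = 0" if "i < s" "j < m" for i j
    proof -
      have "?M $$ (i, s + j) = 0" using z[of "N + i" "s + j"] that N sigma_index[OF sN] by simp
      then show ?thesis using that N by (simp add: qel_def blk_def)
    qed
    obtain A1 A3 A4 where b: "A1 \<in> GL s" "A3 \<in> carrier_mat m s" "A4 \<in> GL m"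
      "A = four_block_mat A1 (0\<^sub>m s m) A3 A4" using lower_block_cases[of A s m] A z1 N by blast
    note bc = GL_carrier[OF b(1)] GL_carrier[OF b(3)]
    have wh: "(w * h) $$ (a, k) = 0" if "a < 2" "k < s" for a k
    proof -
      have "?M $$ (2 * N + a, N + k) = 0" using z[of "2 * N + a" k] that N sigma_index[OF sN] by simp
      then show ?thesis using that N by (simp add: qel_def blk_def del: index_mult_mat(1))
    qed
    have z2: "h $$ (a, k) = 0" if "a < 2" "k < s" for a k
    proof -
      have "h = minv w * (w * h)" using minv_mult_cancel(2)[OF SO2_GL[OF w] h] by simp
      then have "h $$ (a, k) = (\<Sum>l<2. minv w $$ (a, l) * (w * h) $$ (l, k))"
        using index_mult_mat_sum[of "minv w" 2 2 "w * h" N a k] minv(1)[OF SO2_GL[OF w]] cc h that sN by simp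
      then show ?thesis using wh that(2) by (simp del: index_mult_mat(1))
    qed
    have AB: "(A * B) $$ (i, j) = 0" if "i < s" "j < s" for i j
    proof -
      have "?M $$ (i, N + j) = 0" using z[of "N + i" j] that N sigma_index[OF sN] by simp
      then show ?thesis using that N by (simp add: qel_def blk_def B_def del: index_mult_mat(1))
    qed
    have B11: "B $$ (i, j) = 0" if ij: "i < s" "j < s" for i j
    proof -
      define V where "V = mat s s (\<lambda>ij. B $$ ij)"
      have Vc: "V \<in> carrier_mat s s" by (simp add: V_def)
      \<comment> \<open>As A is block lower triangular, the leading corner of A B is A1 times that
        of B.\<close>
      have "A1 * V = 0\<^sub>m s s"
      proof (rule eq_matI)
        fix i j assume "i < dim_row (0\<^sub>m s s :: 'a mat)" "j < dim_col (0\<^sub>m s s :: 'a mat)"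
        then have ij: "i < s" "j < s" by auto
        have "(A1 * V) $$ (i, j) = (\<Sum>l<s. A1 $$ (i, l) * V $$ (l, j))"
          using ij bc Vc by (intro index_mult_mat_sum) auto
        also have "\<dots> = (\<Sum>l<s. A $$ (i, l) * B $$ (l, j))" using ij bc by (intro sum.cong refl) (simp add: V_def b(4))
        also have "\<dots> = (\<Sum>l<N. A $$ (i, l) * B $$ (l, j))"
          using ij bc sN N by (intro sum.mono_neutral_left) (auto simp: b(4))
        also have "\<dots> = 0" using ABsum[of i j] AB[OF ij] ij sN by simp
        finally show "(A1 * V) $$ (i, j) = 0\<^sub>m s s $$ (i, j)" using ij by simp
      qed (use bc Vc in auto)
      then have "V = minv A1 * 0\<^sub>m s s" using minv_mult_cancel(2)[OF b(1) Vc] by simp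
      then have "V = 0\<^sub>m s s" using minv(1)[OF b(1)] by simp
      then have "V $$ (i, j) = 0" using ij by simp
      then show ?thesis using ij by (simp add: V_def)
    qed
    have "C $$ (i, j) = 0" if "i < s" "j < s" for i j
    proof -
      have "B $$ (i, j) = C $$ (i, j) + quad N h $$ (i, j)" using that sN cc by (simp add: B_def quad_def)
      then show ?thesis using B11[OF that] quad0[of i j] z2 that by simp
    qed
    then show "?z1 \<and> ?z2 \<and> ?z3" using z1 z2 by blast
  next
    assume zz: "?z1 \<and> ?z2 \<and> ?z3"
    then obtain A1 A3 A4 where b: "A1 \<in> GL s" "A3 \<in> carrier_mat m s" "A4 \<in> GL m"
      "A = four_block_mat A1 (0\<^sub>m s m) A3 A4" using lower_block_cases[of A s m] A N by blast
    note bc = GL_carrier[OF b(1)] GL_carrier[OF b(3)] minv(1)[OF b(1)] minv(1)[OF b(3)]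
    have A12: "A $$ (i, j) = 0" if "i < s" "s \<le> j" "j < N" for i j
      using that bc N by (simp add: b(4))
    have Ai12: "minv A $$ (i, j) = 0" if "i < s" "s \<le> j" "j < N" for i j
      unfolding b(4) minv_lower_block(2)[OF b(1,3,2)] using that bc N by simp
    have B11: "B $$ (i, j) = 0" if "i < s" "j < s" for i j
      using that zz quad0[of i j] sN cc by (simp add: B_def quad_def)
    have M1: "?M $$ (i, N + j) = 0" if ij: "i < s" "j < s" for i j
    proof -
      have "(A * B) $$ (i, j) = 0"
        unfolding ABsum[OF less_le_trans[OF ij(1) sN] less_le_trans[OF ij(2) sN]]
        using ij B11 A12 by (intro sum.neutral) (metis lessThan_iff linorder_not_less mult_eq_0_iff)
      then show ?thesis using ij N by (simp add: qel_def blk_def B_def del: index_mult_mat(1))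
    qed
    have M2: "?M $$ (i, j) = 0" if "i < s" "s \<le> j" "j < N" for i j
      using A12[OF that] that N by (simp add: qel_def blk_def)
    have M3: "?M $$ (N + i, N + j) = 0" if "s \<le> i" "i < N" "j < s" for i j
      using Ai12[OF that(3,1,2)] that Ai(1) N by (simp add: qel_def blk_def)
    have M4: "?M $$ (2 * N + a, N + j) = 0" if "a < 2" "j < s" for a j
    proof -
      have "(w * h) $$ (a, j) = (\<Sum>l<2. w $$ (a, l) * h $$ (l, j))"
        using that cc h sN by (intro index_mult_mat_sum[of _ 2 2 _ N]) auto
      also have "\<dots> = 0" using zz that by (intro sum.neutral) auto
      finally show ?thesis using that N by (simp add: qel_def blk_def del: index_mult_mat(1))
    qed
    have M5: "?M $$ (i, 2 * N + a) = 0" if ia: "i < s" "a < 2" for i a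
    proof -
      have "(A * (h\<^sup>T * eta_mat)) $$ (i, a) = (\<Sum>l<N. A $$ (i, l) * (h\<^sup>T * eta_mat) $$ (l, a))"
        using ia sN cc h eta_carrier by (intro index_mult_mat_sum[of _ N N _ 2]) auto
      also have "\<dots> = 0"
      proof (rule sum.neutral, rule ballI)
        fix l assume l: "l \<in> {..<N}"
        show "A $$ (i, l) * (h\<^sup>T * eta_mat) $$ (l, a) = 0"
        proof (cases "l < s")
          case True
          have "a = 0 \<or> a = Suc 0" using ia by auto
          then have "(h\<^sup>T * eta_mat) $$ (l, a) = 0" using transpose_mult_eta[OF h, of l] l True zz by auto
          then show ?thesis by simp
        next
          case False
          then show ?thesis using A12[of i l] ia l by simp
        qed
      qed
      finally show ?thesis using ia N by (simp add: qel_def blk_def del: index_mult_mat(1))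
    qed
    have Mz1: "?M $$ (i, j) = 0" if "N \<le> i" "i < ?n" "j < N" for i j using MQ that by (auto simp: Qset_def)
    have Mz2: "?M $$ (i, j) = 0" if "N \<le> i" "i < 2 * N" "2 * N \<le> j" "j < ?n" for i j
      using MQ that by (auto simp: Qset_def)
    have "(?S * ?M * ?S) $$ (i, j) = 0" if ij: "N \<le> i" "i < ?n" "j < N" for i j
    proof -
      have ej: "(?S * ?M * ?S) $$ (i, j) = ?M $$ (sigma_index N s i, sigma_index N s j)" using e ij by simp
      consider "i < N + s" | "N + s \<le> i" "i < 2 * N" | "2 * N \<le> i" by linarith
      then show ?thesis
      proof cases
        case 1
        then have "sigma_index N s i = i - N" "i - N < s" using ij by (auto simp: sigma_index_def N)
        then show ?thesis unfolding ej using M1[of "i - N" j] M2[of "i - N" j] ij by (cases "j < s") (auto simp: sigma_index_def)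
      next
        case 2
        then have "sigma_index N s i = N + (i - N)" "s \<le> i - N" "i - N < N" using ij by (auto simp: sigma_index_def N)
        then show ?thesis unfolding ej using M3[of "i - N" j] Mz1[of i j] ij by (cases "j < s") (auto simp: sigma_index_def)
      next
        case 3
        then have "sigma_index N s i = 2 * N + (i - 2 * N)" "i - 2 * N < 2" using ij sN by (auto simp: sigma_index_def)
        then show ?thesis unfolding ej using M4[of "i - 2 * N" j] Mz1[of i j] ij 3 by (cases "j < s") (auto simp: sigma_index_def)
      qed
    qed
    moreover have "(?S * ?M * ?S) $$ (i, j) = 0" if ij: "N \<le> i" "i < 2 * N" "2 * N \<le> j" "j < ?n" for i j
    proof -
      have ej: "(?S * ?M * ?S) $$ (i, j) = ?M $$ (sigma_index N s i, j)" using e[of i j] ij sigma_index(9)[OF sN ij(3)] by simp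
      show ?thesis
      proof (cases "i < N + s")
        case True
        then have "sigma_index N s i = i - N" "i - N < s" using ij by (auto simp: sigma_index_def N)
        then show ?thesis unfolding ej using M5[of "i - N" "j - 2 * N"] ij by simp
      next
        case False
        then have "sigma_index N s i = i" using ij by (auto simp: sigma_index_def N)
        then show ?thesis unfolding ej using Mz2 ij by simp
      qed
    qed
    moreover have "mat 2 2 (\<lambda>(a, b). (?S * ?M * ?S) $$ (2 * N + a, 2 * N + b)) = mat 2 2 (\<lambda>(a, b). ?M $$ (2 * N + a, 2 * N + b))"
      by (rule cong_mat) (auto simp: e sigma_index(9)[OF sN])
    moreover have "isom N (?S * ?M * ?S)" using MQ by (intro isom_mult isom_sigma sN) (simp add: Qset_def)
    ultimately show "?S * ?M * ?S \<in> Qset N" using MQ unfolding Qset_def mem_Collect_eq by simp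
  qed
qed

text \<open>The conditions on A, h and C are independent of each other, so the count is a
  product.\<close>

lemma card_stabilizer:
  assumes N: "N = s + m"
  shows "int (card {M \<in> Qset N. sigma_mat (Suc N) s * M * sigma_mat (Suc N) s \<in> Qset N})
    = int (card (GL s :: 'a mat set)) * int q ^ (m * s) * int (card (GL m :: 'a mat set)) * (int q + 1)
      * int q ^ (2 * m + (\<Sum>i\<in>{s..<N}. i))"
proof -
  let ?P = "\<lambda>M. sigma_mat (Suc N) s * M * sigma_mat (Suc N) s \<in> Qset N"
  let ?TA = "{A \<in> GL N. \<forall>i<s. \<forall>j<m. A $$ (i, s + j) = (0::'a)}"
  let ?Th = "{h \<in> carrier_mat 2 N. \<forall>a<2. \<forall>k<s. h $$ (a, k) = (0::'a)}"
  let ?TC = "{C \<in> Alt N. \<forall>i<s. \<forall>j<s. C $$ (i, j) = (0::'a)}"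
  have sN: "s \<le> N" using N by simp
  have "int (card {M \<in> Qset N. ?P M}) = (\<Sum>M\<in>Qset N. if ?P M then 1 else 0)"
    by (simp add: sum.If_cases Int_def)
  also have "\<dots> = (\<Sum>A\<in>GL N. \<Sum>w\<in>SO2_minus \<kappa>. \<Sum>h\<in>carrier_mat 2 N. \<Sum>C\<in>Alt N.
      (if A \<in> ?TA then 1 else 0) * ((if h \<in> ?Th then 1 else 0) * (if C \<in> ?TC then 1 else 0)))"
    unfolding sum_Qset
  proof (intro sum.cong refl)
    fix A w h C :: "'a mat" assume "A \<in> GL N" "w \<in> SO2_minus \<kappa>" "h \<in> carrier_mat 2 N" "C \<in> Alt N"
    then show "(if ?P (qel N A w (C + quad N h) h) then 1 else 0)
        = (if A \<in> ?TA then 1 else 0) * ((if h \<in> ?Th then 1 else 0) * (if C \<in> ?TC then 1 else (0::int)))"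
      using qel_stabilizer_iff[OF _ _ _ _ N] by auto
  qed
  also have "\<dots> = (\<Sum>A\<in>GL N. if A \<in> ?TA then 1 else 0) * (int (card (SO2_minus \<kappa>))
      * ((\<Sum>h\<in>carrier_mat 2 N. if h \<in> ?Th then 1 else 0) * (\<Sum>C\<in>Alt N. if C \<in> ?TC then 1 else 0)))"
    unfolding sum_distrib_left[symmetric] sum_distrib_right[symmetric] sum_constant by simp
  also have "(\<Sum>A\<in>GL N. if A \<in> ?TA then 1 else 0) = int (card ?TA)"
    by (simp add: sum.If_cases Int_def)
  also have "(\<Sum>h\<in>carrier_mat 2 N. if h \<in> ?Th then 1 else 0) = int (card ?Th)"
    by (simp add: sum.If_cases Int_def)
  also have "(\<Sum>C\<in>Alt N. if C \<in> ?TC then 1 else 0) = int (card ?TC)"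
    by (simp add: sum.If_cases Int_def)
  also have "card ?TC = q ^ (\<Sum>i\<in>{s..<N}. i)" using card_Alt_corner_zero[OF sN, where 'a = 'a] by simp
  also have "card ?Th = q ^ (2 * m)"
  proof -
    have E: "{..<2::nat} \<times> {s..<N} \<subseteq> {..<2} \<times> {..<N}" by auto
    have "?Th = {A \<in> carrier_mat 2 N. \<forall>i<2. \<forall>j<N. (i, j) \<notin> {..<2} \<times> {s..<N} \<longrightarrow> A $$ (i, j) = (0::'a)}"
      using sN by auto
    then show ?thesis using card_mat_supported[OF E, where 'a = 'a] N by (simp add: card_cartesian_product)
  qed
  also have "card ?TA = card (GL s :: 'a mat set) * (q ^ (m * s) * card (GL m :: 'a mat set))"
  proof -
    have "mat s s (\<lambda>ij. A $$ ij) \<in> GL s" if A: "A \<in> GL (s + m)" "\<forall>i<s. \<forall>j<m. A $$ (i, s + j) = 0" for A :: "'a mat"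
    proof -
      obtain A1 A3 A4 where b: "A1 \<in> GL s" "A3 \<in> carrier_mat m s" "A4 \<in> GL m"
        "A = four_block_mat A1 (0\<^sub>m s m) A3 A4" using lower_block_cases[of A s m] A by blast
      have "mat s s (\<lambda>ij. A $$ ij) = A1"
        using GL_carrier[OF b(1)] GL_carrier[OF b(3)] by (intro eq_matI) (auto simp: b(4))
      then show ?thesis using b(1) by simp
    qed
    then have "?TA = {A \<in> GL (s + m). (\<forall>i<s. \<forall>j<m. A $$ (i, s + j) = (0::'a)) \<and> mat s s (\<lambda>ij. A $$ ij) \<in> GL s}"
      unfolding N by blast
    moreover have "card {A \<in> GL (s + m). (\<forall>i<s. \<forall>j<m. A $$ (i, s + j) = (0::'a)) \<and> mat s s (\<lambda>ij. A $$ ij) \<in> GL s}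
        = card ((GL s :: 'a mat set) \<times> (carrier_mat m s :: 'a mat set) \<times> (GL m :: 'a mat set))"
      using bij_betw_same_card[OF bij_lower_block[OF order_refl, of s m, where 'a = 'a]] by simp
    ultimately show ?thesis by (simp add: card_cartesian_product card_carrier_mat)
  qed
  finally show ?thesis by (simp add: card_SO2 power_add mult_ac)
qed

end

section \<open>Distribution of traces on a double coset\<close>

text \<open>Odd and even exponents are kept apart: the order of \<open>sym_GL\<close> involves only
  odd ones and that of \<open>GL\<close> both, so the even ones are what remains in B.\<close>

definition odd_prod :: "real \<Rightarrow> nat \<Rightarrow> real" where "odd_prod x k = (\<Prod>j=1..k. x ^ (2 * j - 1) - 1)"
definition even_prod :: "real \<Rightarrow> nat \<Rightarrow> real" where "even_prod x k = (\<Prod>j=1..k. x ^ (2 * j) - 1)"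

lemma odd_prod_simps [simp]: "odd_prod x 0 = 1" "odd_prod x (Suc k) = odd_prod x k * (x ^ (2 * k + 1) - 1)"
  by (simp_all add: odd_prod_def)

lemma even_prod_simps [simp]: "even_prod x 0 = 1" "even_prod x (Suc k) = even_prod x k * (x ^ (2 * k + 2) - 1)"
  by (simp_all add: even_prod_def)

lemma sum_lessThan_odd: "(\<Sum>i<2 * k + 1. i) = k * (2 * k + 1 :: nat)"
  by (induction k) (simp_all add: algebra_simps)

lemma sum_lessThan_even: "(\<Sum>i<2 * k + 2. i) = (k + 1) * (2 * k + 1 :: nat)"
  by (induction k) (simp_all add: algebra_simps)

context minus_type
begin

definition gl_order :: "nat \<Rightarrow> real" where "gl_order k = real (card (GL k :: 'a mat set))"
definition sym_order :: "nat \<Rightarrow> real" where "sym_order k = real (card (sym_GL k :: 'a mat set))"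

lemma real_q: "real q > 1"
  using q_ge_2 by simp

lemma gl_order_Suc: "gl_order (Suc k) = (real q ^ Suc k - 1) * real q ^ k * gl_order k" "gl_order 0 = 1"
proof -
  have "1 \<le> q ^ Suc k" using q_ge_2 by (intro one_le_power) simp
  then show "gl_order (Suc k) = (real q ^ Suc k - 1) * real q ^ k * gl_order k"
    unfolding gl_order_def card_GL_Suc by (simp add: of_nat_diff)
qed (simp add: gl_order_def card_GL_0)

lemma sym_order_rec: "sym_order 0 = 1" "sym_order 1 = real q - 1"
  "sym_order (Suc (Suc k)) = (real q - 1) * real q ^ Suc k * sym_order (Suc k) + (real q ^ Suc k - 1) * real q ^ Suc k * sym_order k"
proof -
  have q1: "1 \<le> q ^ Suc k" "1 \<le> q" using q_ge_2 by (auto intro!: one_le_power)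
  show "sym_order 0 = 1" by (simp add: sym_order_def card_sym_GL_0)
  show "sym_order 1 = real q - 1" unfolding sym_order_def card_sym_GL_1 using q1 by (simp add: of_nat_diff)
  show "sym_order (Suc (Suc k)) = (real q - 1) * real q ^ Suc k * sym_order (Suc k) + (real q ^ Suc k - 1) * real q ^ Suc k * sym_order k"
    unfolding sym_order_def card_sym_GL_Suc_Suc using q1 by (simp add: of_nat_diff)
qed

text \<open>The recursion multiplies the order by q^(2 k + 2) from size 2 k + 1 to 2 k + 2, and by
  q^(2 k + 3) - 1 from there to 2 k + 3. Hence only odd exponents give factors.\<close>

lemma sym_order_closed: "sym_order (2 * k) = real q ^ (k * (k + 1)) * odd_prod (real q) k \<and>
   sym_order (2 * k + 1) = real q ^ (k * (k + 1)) * odd_prod (real q) (Suc k)"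
proof (induction k)
  case 0
  show ?case using sym_order_rec by simp
next
  case (Suc k)
  let ?x = "real q" and ?P = "odd_prod (real q) (Suc k)"
  let ?y = "?x ^ (2 * k + 1)"
  have y: "?x ^ (Suc k * (Suc k + 1)) = ?x ^ (k * (k + 1)) * (?x * ?y)"
    unfolding power_Suc[symmetric] power_add[symmetric] by (rule arg_cong[where f = "(^) ?x"]) (simp add: algebra_simps)
  have e: "sym_order (2 * Suc k) = ?x ^ (Suc k * (Suc k + 1)) * ?P"
  proof -
    have "sym_order (2 * Suc k) = (?x - 1) * ?y * sym_order (2 * k + 1) + (?y - 1) * ?y * sym_order (2 * k)"
      using sym_order_rec(3)[of "2 * k"] by simp
    also have "\<dots> = ?x ^ (k * (k + 1)) * odd_prod ?x k * (?y - 1) * ?y * ((?x - 1) + 1)"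
      unfolding conjunct1[OF Suc.IH] conjunct2[OF Suc.IH] odd_prod_simps(2) by (simp only: algebra_simps)
    finally show ?thesis unfolding y odd_prod_simps(2) by (simp only: mult_ac) (simp add: mult_ac)
  qed
  have "sym_order (2 * Suc k + 1) = (?x - 1) * (?x * ?y) * sym_order (2 * Suc k) + (?x * ?y - 1) * (?x * ?y) * sym_order (2 * k + 1)"
    using sym_order_rec(3)[of "2 * k + 1"] by simp
  also have "\<dots> = ?x ^ (Suc k * (Suc k + 1)) * (?P * (?x * (?x * ?y) - 1))"
    unfolding e y conjunct2[OF Suc.IH] by (simp only: algebra_simps)
  also have "?P * (?x * (?x * ?y) - 1) = odd_prod ?x (Suc (Suc k))"
    unfolding odd_prod_simps(2)[of ?x "Suc k"] by simp
  finally show ?case using e by simp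
qed

lemma gl_order_closed: "gl_order (2 * k + 1) = real q ^ (k * (2 * k + 1)) * odd_prod (real q) (Suc k) * even_prod (real q) k \<and>
  gl_order (2 * k + 2) = real q ^ ((k + 1) * (2 * k + 1)) * odd_prod (real q) (Suc k) * even_prod (real q) (Suc k)"
proof (induction k)
  case 0
  show ?case using gl_order_Suc(1)[of 0] gl_order_Suc(1)[of 1] gl_order_Suc(2) by (simp add: numeral_2_eq_2)
next
  case (Suc k)
  let ?x = "real q"
  have 1: "gl_order (2 * Suc k + 1) = ?x ^ (Suc k * (2 * Suc k + 1)) * odd_prod ?x (Suc (Suc k)) * even_prod ?x (Suc k)"
  proof -
    have "gl_order (2 * Suc k + 1) = (?x ^ (2 * k + 3) - 1) * ?x ^ (2 * k + 2) * gl_order (2 * k + 2)"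
      using gl_order_Suc(1)[of "2 * k + 2"] by (simp add: eval_nat_numeral)
    moreover have "?x ^ (Suc k * (2 * Suc k + 1)) = ?x ^ (2 * k + 2) * ?x ^ ((k + 1) * (2 * k + 1))"
      unfolding power_add[symmetric] by (rule arg_cong[where f = "(^) ?x"]) (simp add: algebra_simps)
    moreover have "odd_prod ?x (Suc (Suc k)) = odd_prod ?x (Suc k) * (?x ^ (2 * k + 3) - 1)"
      unfolding odd_prod_simps(2)[of ?x "Suc k"] by (simp add: eval_nat_numeral)
    ultimately show ?thesis unfolding conjunct2[OF Suc.IH] by (simp only: mult_ac)
  qed
  have "gl_order (2 * Suc k + 2) = (?x ^ (2 * k + 4) - 1) * ?x ^ (2 * k + 3) * gl_order (2 * Suc k + 1)"
    using gl_order_Suc(1)[of "2 * Suc k + 1"] by (simp add: eval_nat_numeral)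
  moreover have "?x ^ ((Suc k + 1) * (2 * Suc k + 1)) = ?x ^ (2 * k + 3) * ?x ^ (Suc k * (2 * Suc k + 1))"
    unfolding power_add[symmetric] by (rule arg_cong[where f = "(^) ?x"]) (simp add: algebra_simps)
  moreover have "even_prod ?x (Suc (Suc k)) = even_prod ?x (Suc k) * (?x ^ (2 * k + 4) - 1)"
    unfolding even_prod_simps(2)[of ?x "Suc k"] by (simp add: eval_nat_numeral)
  ultimately have "gl_order (2 * Suc k + 2) = ?x ^ ((Suc k + 1) * (2 * Suc k + 1)) * odd_prod ?x (Suc (Suc k)) * even_prod ?x (Suc (Suc k))"
    unfolding 1 by (simp only: mult_ac)
  with 1 show ?case by blast
qed

lemma gl_order_pos: "gl_order k > 0"
proof (induction k)
  case (Suc k)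
  have "real q ^ Suc k > 1" using real_q by (intro one_less_power) auto
  then show ?case using Suc real_q by (simp add: gl_order_Suc(1))
qed (simp add: gl_order_Suc(2))

text \<open>For \<open>N = s + m\<close> and \<open>\<sigma> = \<sigma>\<^sub>s\<close>, \<open>qcard\<close> is \<open>|Q|\<close>, \<open>stab\<close> is \<open>|Q \<inter> \<sigma> Q \<sigma>|\<close>, and \<open>ampl\<close> is the absolute
  value of the part of the character sum over \<open>Q \<sigma>\<close> that does not depend on the character \<open>c\<close>;
  \<open>freq\<close> collects the part that does.\<close>

definition qcard :: "nat \<Rightarrow> real" where
  "qcard N = gl_order N * (real q + 1) * real q ^ (2 * N + (\<Sum>i<N. i))"

definition stab :: "nat \<Rightarrow> nat \<Rightarrow> real" where
  "stab s m = gl_order s * real q ^ (m * s) * gl_order m * (real q + 1) * real q ^ (2 * m + (\<Sum>i\<in>{s..<s + m}. i))"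

definition ampl :: "nat \<Rightarrow> nat \<Rightarrow> real" where
  "ampl s m = real q ^ (s + m + m + m * s + (\<Sum>i<s + m. i)) * sym_order s"

definition freq :: "bool \<Rightarrow> nat \<Rightarrow> 'a \<Rightarrow> int" where
  "freq e m \<beta> = (\<Sum>c\<in>UNIV - {0}. lam (c * \<beta>) * (gl_kloosterman m c * (if e then int q + 1 else - K c)))"

definition dcoset :: "bool \<Rightarrow> nat \<Rightarrow> nat \<Rightarrow> 'a mat set" where
  "dcoset e N s = (if e then (\<lambda>x. rho_mat (Suc N) * x) ` double_coset \<kappa> (Suc N) s else double_coset \<kappa> (Suc N) s)"

text \<open>Orthogonality on Q: the index c = 0 gives |Q|, and the nonzero ones give the sums over Q
  \<sigma>, whose dependence on c is gathered in \<open>freq\<close>. Passing from Q \<sigma> to the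
  double coset costs the factor |Q| / stab.\<close>

lemma card_trace_dcoset:
  fixes \<beta> :: 'a
  assumes N: "N = s + m"
  shows "real (card {x \<in> dcoset e N s. mat_trace x = \<beta>}) * real q * stab s m
    = qcard N * (qcard N + (-1) ^ s * ampl s m * of_int (freq e m \<beta>))"
proof -
  let ?S = "sigma_mat (Suc N) s :: 'a mat" and ?n = "2 * N + 2" and ?r = "rho_mat (Suc N) :: 'a mat"
  let ?D = "{x * ?S * y | x y. x \<in> Qset N \<and> y \<in> Qset N}"
  have sN: "s \<le> N" using N by simp
  have D: "double_coset \<kappa> (Suc N) s = ?D" by (simp add: double_coset_def Q_minus_eq_Qset)
  note Sc = sigma_carrier[of N s, where 'a = 'a] note rc = rho_carrier[of N, where 'a = 'a]
  have Dc: "x \<in> carrier_mat ?n ?n" if x: "x \<in> ?D" for x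
  proof -
    obtain y z where "x = y * ?S * z" "y \<in> Qset N" "z \<in> Qset N" using x by blast
    then show ?thesis using mult_carrier_mat[OF mult_carrier_mat[OF Qset_carrier Sc] Qset_carrier] by blast
  qed
  have e1: "card {x \<in> dcoset e N s. mat_trace x = \<beta>} = card {x \<in> ?D. trace_mode e N x = \<beta>}"
  proof (cases e)
    case True
    have inj: "inj_on (\<lambda>x. ?r * x) ?D"
    proof (rule inj_on_inverseI[where g = "\<lambda>x. ?r * x"])
      fix x assume "x \<in> ?D"
      from Dc[OF this] show "?r * (?r * x) = x"
        using assoc_mult_mat[OF rc rc, of x ?n] rho_rho[of N] by simp
    qed
    have "{x \<in> dcoset e N s. mat_trace x = \<beta>} = (\<lambda>x. ?r * x) ` {x \<in> ?D. trace_mode e N x = \<beta>}"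
      unfolding dcoset_def D trace_mode_def using True by auto
    then show ?thesis using card_image[OF inj_on_subset[OF inj]] by (metis (no_types, lifting) mem_Collect_eq subsetI)
  next
    case False
    then show ?thesis by (simp add: dcoset_def D trace_mode_def)
  qed
  have e2: "card {x \<in> ?D. trace_mode e N x = \<beta>} * card {x \<in> Qset N. ?S * x * ?S \<in> Qset N}
      = card (Qset N) * card {x \<in> Qset N. trace_mode e N (x * ?S) = \<beta>}"
  \<comment> \<open>Moving y cyclically past \<rho> turns it into \<rho> y \<rho>, which is again in
    Q.\<close>
  proof (rule double_coset_count[OF Sc sigma_sigma[OF sN], where t = "\<lambda>y. if e then ?r * y * ?r else y"])
    fix y assume y: "y \<in> Qset N"
    show "(if e then ?r * y * ?r else y) \<in> Qset N" using y rho_conj_Qset by simp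
    fix x assume x: "x \<in> Qset N"
    note c = Qset_carrier[OF x] Qset_carrier[OF y]
    note assoc = assoc_mult_mat[of _ ?n ?n _ ?n _ ?n] note mc = mult_carrier_mat[of _ ?n ?n _ ?n]
    have xSc: "x * ?S \<in> carrier_mat ?n ?n" using mc[OF c(1) Sc] .
    show "trace_mode e N (x * ?S * y) = trace_mode e N ((if e then ?r * y * ?r else y) * x * ?S)"
    proof (cases e)
      case True
      have "mat_trace (?r * (x * ?S * y)) = mat_trace (?r * (x * ?S) * y)"
        using assoc[OF rc xSc c(2)] by simp
      also have "\<dots> = mat_trace (y * (?r * (x * ?S)))" by (rule mat_trace_commute[OF mc[OF rc xSc] c(2)])
      also have "y * (?r * (x * ?S)) = ?r * (?r * y * ?r * x * ?S)"
      proof -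
        have "?r * (?r * y * ?r * x * ?S) = ?r * (?r * (y * (?r * (x * ?S))))"
          using c Sc rc by (simp add: assoc mc)
        also have "\<dots> = (?r * ?r) * (y * (?r * (x * ?S)))"
          using assoc[OF rc rc mc[OF c(2) mc[OF rc xSc]]] by simp
        also have "\<dots> = y * (?r * (x * ?S))" unfolding rho_rho by (rule left_mult_one_mat[OF mc[OF c(2) mc[OF rc xSc]]])
        finally show ?thesis by simp
      qed
      finally show ?thesis using True by (simp add: trace_mode_def)
    next
      case False
      have "mat_trace (x * ?S * y) = mat_trace (y * (x * ?S))" by (rule mat_trace_commute[OF xSc c(2)])
      then show ?thesis using False assoc[OF c(2,1) Sc] by (simp add: trace_mode_def)
    qed
  qed
  have 1: "real (card {x \<in> dcoset e N s. mat_trace x = \<beta>}) * real (card {x \<in> Qset N. ?S * x * ?S \<in> Qset N})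
      = real (card (Qset N)) * real (card {x \<in> Qset N. trace_mode e N (x * ?S) = \<beta>})"
    unfolding e1 of_nat_mult[symmetric] by (rule arg_cong[OF e2])
  have stab: "real (card {x \<in> Qset N. ?S * x * ?S \<in> Qset N}) = stab s m"
  proof -
    have "{s..<N} = {s..<s + m}" unfolding N ..
    note arg_cong[OF card_stabilizer[OF N, unfolded this], of real_of_int]
    also have "real_of_int (int (card (GL s :: 'a mat set)) * int q ^ (m * s) * int (card (GL m :: 'a mat set)) * (int q + 1)
      * int q ^ (2 * m + (\<Sum>i\<in>{s..<s + m}. i))) = stab s m" unfolding stab_def gl_order_def by simp
    finally show ?thesis unfolding of_int_of_nat_eq .
  qed
  have Q: "real (card (Qset N)) = qcard N"
  proof -
    have "real_of_int (int (card (Qset N))) = qcard N" unfolding card_Qset qcard_def gl_order_def by simp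
    then show ?thesis by simp
  qed
  have am: "ampl s m = real q ^ (N + m + m * s + (\<Sum>i<N. i)) * real (card (sym_GL s :: 'a mat set))"
    unfolding ampl_def sym_order_def N ..
  have "int q * int (card {x \<in> Qset N. trace_mode e N (x * ?S) = \<beta>})
      = (\<Sum>c\<in>UNIV. lam (c * \<beta>) * (\<Sum>x\<in>Qset N. lam (c * trace_mode e N (x * ?S))))"
    by (rule q_card_eq) simp
  also have "\<dots> = int (card (Qset N)) + (\<Sum>c\<in>UNIV - {0}. lam (c * \<beta>) * (\<Sum>x\<in>Qset N. lam (c * trace_mode e N (x * ?S))))"
    by (simp add: sum_units)
  also have "(\<Sum>c\<in>UNIV - {0}. lam (c * \<beta>) * (\<Sum>x\<in>Qset N. lam (c * trace_mode e N (x * ?S))))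
      = (-1) ^ s * int q ^ (N + m + m * s + (\<Sum>i<N. i)) * int (card (sym_GL s :: 'a mat set)) * freq e m \<beta>"
  proof -
    have "lam (c * \<beta>) * (\<Sum>x\<in>Qset N. lam (c * trace_mode e N (x * ?S)))
      = (-1) ^ s * int q ^ (N + m + m * s + (\<Sum>i<N. i)) * int (card (sym_GL s :: 'a mat set)) * (lam (c * \<beta>) * (gl_kloosterman m c * (if e then int q + 1 else - K c)))"
      if c: "c \<in> UNIV - {0}" for c
    proof -
      have "c \<noteq> 0" using c by simp
      show ?thesis unfolding sum_Qset_lam[OF \<open>c \<noteq> 0\<close> N] by (simp only: mult_ac)
    qed
    then show ?thesis unfolding freq_def sum_distrib_left[of _ _ "UNIV - {0}"] by (rule sum.cong[OF refl])
  qed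
  finally have "real_of_int (int q * int (card {x \<in> Qset N. trace_mode e N (x * ?S) = \<beta>}))
     = real_of_int (int (card (Qset N)) + (-1) ^ s * int q ^ (N + m + m * s + (\<Sum>i<N. i)) * int (card (sym_GL s :: 'a mat set)) * freq e m \<beta>)"
    by simp
  then have "real q * real (card {x \<in> Qset N. trace_mode e N (x * ?S) = \<beta>})
      = qcard N + (-1) ^ s * ampl s m * of_int (freq e m \<beta>)"
    unfolding am Q[symmetric] by (simp add: mult_ac)
  then show ?thesis using 1 unfolding stab Q by (simp add: mult_ac)
qed

definition trace_val :: "'a \<Rightarrow> real" where
  "trace_val \<beta> = (if \<beta> = 0 then 1 else 1 + real q * of_int (lam (inverse \<beta>)))"

text \<open>For z = q this is the negated Fourier transform of K^2. The value z = q^2 arises when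
  K^2 is replaced by K^2 + q (q - 1), the sum over \<open>GL 2\<close> divided by q.\<close>

definition kl_val :: "real \<Rightarrow> 'a \<Rightarrow> real" where
  "kl_val z \<beta> = (if \<beta> = 0 then z + 1 - z * real q else z + 1 - real q * of_int (K (inverse \<beta>)))"

lemma freq_0: "of_int (freq False 0 \<beta>) = - trace_val \<beta>"
proof -
  have "freq False 0 \<beta> = - (\<Sum>c\<in>UNIV - {0}. lam (c * \<beta>) * K c)"
    unfolding freq_def by (simp add: gl_kloosterman_0 sum_negf)
  then show ?thesis unfolding sum_lam_kloosterman by (simp add: trace_val_def)
qed

lemma freq_1_rho: "of_int (freq True 1 \<beta>) = (real q + 1) * trace_val \<beta>"
proof -
  have "freq True 1 \<beta> = (int q + 1) * (\<Sum>c\<in>UNIV - {0}. lam (c * \<beta>) * K c)"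
    unfolding freq_def sum_distrib_left by (intro sum.cong refl) (simp add: gl_kloosterman_1[unfolded One_nat_def] mult_ac)
  then show ?thesis unfolding sum_lam_kloosterman by (simp add: trace_val_def)
qed

lemma freq_1: "of_int (freq False 1 \<beta>) = kl_val (real q) \<beta>"
proof -
  have "freq False 1 \<beta> = - (\<Sum>c\<in>UNIV - {0}. lam (c * \<beta>) * (K c)\<^sup>2)"
    unfolding freq_def sum_negf[symmetric]
    by (intro sum.cong refl) (simp add: gl_kloosterman_1[unfolded One_nat_def] power2_eq_square mult_ac)
  then show ?thesis unfolding sum_lam_kloosterman_square by (simp add: kl_val_def power2_eq_square)
qed

lemma freq_2_rho: "of_int (freq True 2 \<beta>) = - ((real q + 1) * real q * kl_val ((real q)\<^sup>2) \<beta>)"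
proof -
  have "freq True 2 \<beta> = (int q + 1) * (int q * (\<Sum>c\<in>UNIV - {0}. lam (c * \<beta>) * (K c)\<^sup>2)
      + (int q)\<^sup>2 * (int q - 1) * (\<Sum>c\<in>UNIV - {0}. lam (c * \<beta>)))"
    unfolding freq_def sum_distrib_left sum.distrib[symmetric]
    by (intro sum.cong refl) (simp add: gl_kloosterman_2 algebra_simps)
  from arg_cong[OF this[unfolded sum_lam_kloosterman_square sum_units_lam_mult], of real_of_int] show ?thesis
    by (cases "\<beta> = 0") (simp_all add: kl_val_def power2_eq_square algebra_simps)
qed

text \<open>Two identities determine A and B, where f is the positive factor of \<open>freq\<close>
  independent of \<beta> and \<epsilon>' its sign. Each of the four kinds of cosets then reduces to
  checking these identities.\<close>

lemma card_trace_coef: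
  assumes N: "N = s + m" and fr: "of_int (freq e m \<beta>) = \<epsilon>' * f * v" and f: "f > 0"
    and A: "A * stab s m = qcard N * (ampl s m * f)" and B: "B * (ampl s m * f) = qcard N"
  shows "real (card {x \<in> dcoset e N s. mat_trace x = \<beta>}) = A * (B + (-1) ^ s * \<epsilon>' * v) / real q"
proof -
  have st: "stab s m > 0" unfolding stab_def using gl_order_pos real_q by (simp add: zero_less_mult_iff)
  have "real (card {x \<in> dcoset e N s. mat_trace x = \<beta>}) * real q * stab s m
      = qcard N * (qcard N + (-1) ^ s * ampl s m * (\<epsilon>' * f * v))"
    using card_trace_dcoset[OF N, of e \<beta>] unfolding fr .
  also have "\<dots> = qcard N * (ampl s m * f) * (B + (-1) ^ s * \<epsilon>' * v)"
    unfolding B[symmetric] by (simp add: algebra_simps)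
  also have "\<dots> = A * (B + (-1) ^ s * \<epsilon>' * v) * stab s m" unfolding A[symmetric] by (simp add: mult_ac)
  finally have "real (card {x \<in> dcoset e N s. mat_trace x = \<beta>}) * real q = A * (B + (-1) ^ s * \<epsilon>' * v)"
    using st by simp
  then show ?thesis using real_q by (simp add: field_simps)
qed

end

section \<open>Matching with the closed forms of A and B\<close>

definition tri :: "nat \<Rightarrow> nat" where "tri N = (\<Sum>i<N. i)"

lemma tri_odd: "tri (2 * k + 1) = k * (2 * k + 1)"
  unfolding tri_def by (rule sum_lessThan_odd)

lemma tri_even: "tri (2 * k + 2) = (k + 1) * (2 * k + 1)"
  unfolding tri_def by (rule sum_lessThan_even)

lemma tri_odd': "tri (2 * k + 3) = (k + 1) * (2 * k + 3)"
  using tri_odd[of "k + 1"] by (simp add: eval_nat_numeral)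

lemma q_binomial_1: "q_binomial x m 1 = (x ^ m - 1) / (x - 1)"
  by (simp add: q_binomial_def)

lemma q_binomial_2: "q_binomial x (s + 2) 2 = (x ^ (s + 2) - 1) * (x ^ (s + 1) - 1) / ((x\<^sup>2 - 1) * (x - 1))"
  by (simp add: q_binomial_def numeral_2_eq_2)

lemma A_plus_eqs:
  "A_plus 1 n x = x ^ ((5 * n\<^sup>2 - 2 * n - 4) div 4) * ((x ^ (n - 1) - 1) * odd_prod x ((n - 2) div 2))"
  "A_plus 2 n x = x ^ ((5 * n\<^sup>2 - 2 * n - 8) div 4) * q_binomial x (n - 1) 1 * odd_prod x ((n - 2) div 2)"
  "A_plus 3 n x = (x + 1) * A_plus 2 n x"
  "A_plus 4 n x = (x + 1) * x ^ ((5 * n\<^sup>2 - 6 * n - 4) div 4) * q_binomial x (n - 1) 2 * odd_prod x ((n - 2) div 2)"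
  by (simp_all add: A_plus_def odd_prod_def)

lemma B_plus_eqs:
  "B_plus 1 n x = x ^ (n\<^sup>2 div 4) * ((x + 1) * even_prod x ((n - 2) div 2))"
  "B_plus 2 n x = x ^ ((n - 2)\<^sup>2 div 4) * ((x + 1) * (x ^ (n - 1) - 1) * even_prod x ((n - 2) div 2))"
  "B_plus 3 n x = x ^ ((n - 2)\<^sup>2 div 4) * ((x ^ (n - 1) - 1) * even_prod x ((n - 2) div 2))"
  "B_plus 4 n x = x ^ ((n - 2)\<^sup>2 div 4) * ((x ^ (n - 1) - 1) * even_prod x ((n - 2) div 2))"
  by (simp_all add: B_plus_def even_prod_def)

lemma A_minus_eqs:
  "A_minus 1 n x = x ^ (5 * (n\<^sup>2 - 1) div 4) * odd_prod x ((n - 1) div 2)"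
  "A_minus 2 n x = x ^ ((5 * n\<^sup>2 - 4 * n - 5) div 4) * q_binomial x (n - 1) 1 * odd_prod x ((n - 1) div 2)"
  "A_minus 3 n x = (x + 1) * A_minus 2 n x"
  "A_minus 4 n x = (x + 1) * x ^ ((5 * n\<^sup>2 - 4 * n - 9) div 4) * q_binomial x (n - 1) 2 * odd_prod x ((n - 3) div 2)"
  by (simp_all add: A_minus_def odd_prod_def)

lemma B_minus_eqs:
  "B_minus 1 n x = x ^ ((n - 1)\<^sup>2 div 4) * ((x + 1) * even_prod x ((n - 1) div 2))"
  "B_minus 2 n x = x ^ ((n - 1)\<^sup>2 div 4) * ((x + 1) * even_prod x ((n - 1) div 2))"
  "B_minus 3 n x = x ^ ((n - 1)\<^sup>2 div 4) * even_prod x ((n - 1) div 2)"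
  "B_minus 4 n x = x ^ ((n - 3)\<^sup>2 div 4) * ((x ^ (n - 2) - 1) * (x ^ (n - 1) - 1) * even_prod x ((n - 3) div 2))"
  by (simp_all add: B_minus_def even_prod_def)

lemma div_eq_4: "m = 4 * k \<Longrightarrow> m div 4 = (k :: nat)"
  by simp

context minus_type
begin

lemma qcard_eq: "qcard N = gl_order N * (real q + 1) * real q ^ (2 * N + tri N)"
  unfolding qcard_def tri_def ..

lemma gl_order_1: "gl_order 1 = real q - 1" and gl_order_2: "gl_order 2 = ((real q)\<^sup>2 - 1) * real q * (real q - 1)"
  using gl_order_Suc(1)[of 0] gl_order_Suc(1)[of 1] gl_order_Suc(2) by (simp_all add: numeral_2_eq_2)

lemma stab_0: "stab s 0 = gl_order s * (real q + 1)"
  unfolding stab_def by (simp add: gl_order_Suc(2))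

lemma stab_1: "stab s 1 = gl_order s * real q ^ s * (real q - 1) * (real q + 1) * real q ^ (s + 2)"
proof -
  have "(\<Sum>i\<in>{s..<s + 1}. i) = s" by simp
  then show ?thesis unfolding stab_def gl_order_1 by (simp add: add.commute)
qed

lemma stab_2: "stab s 2 = gl_order s * real q ^ (2 * s) * (((real q)\<^sup>2 - 1) * real q * (real q - 1)) * (real q + 1) * real q ^ (2 * s + 5)"
proof -
  have "(\<Sum>i\<in>{s..<s + 2}. i) = 2 * s + 1" by (simp add: numeral_2_eq_2)
  then have "2 * 2 + (\<Sum>i\<in>{s..<s + 2}. i) = 2 * s + 5" by simp
  then show ?thesis unfolding stab_def gl_order_2 by (simp only:)
qed

lemma ampl_0: "ampl s 0 = real q ^ (s + tri s) * sym_order s"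
  unfolding ampl_def tri_def by simp

lemma ampl_1: "ampl s 1 = real q ^ (2 * s + 2 + tri (s + 1)) * sym_order s"
  unfolding ampl_def tri_def[symmetric] by (rule arg_cong[where f = "\<lambda>e. real q ^ e * sym_order s"]) simp

lemma ampl_2: "ampl s 2 = real q ^ (3 * s + 4 + tri (s + 2)) * sym_order s"
  unfolding ampl_def tri_def[symmetric] by (rule arg_cong[where f = "\<lambda>e. real q ^ e * sym_order s"]) simp

lemma dcoset_DC:
  "DC 1 \<kappa> (Suc N) = dcoset False N N"
  "DC 2 \<kappa> (s + 2) = dcoset False (s + 1) s"
  "DC 3 \<kappa> (s + 2) = dcoset True (s + 1) s"
  "DC 4 \<kappa> (s + 3) = dcoset True (s + 2) s"
  unfolding DC_def dcoset_def by (simp_all add: eval_nat_numeral)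

text \<open>P is the product of odd type in the order of the symmetric matrices. The equation of
  exponents is left as an assumption, a matter of arithmetic once the parity of n is fixed.\<close>

lemma A_rel_0:
  assumes sg: "sym_order s = real q ^ es * P" and e: "e = 2 * s + tri s + (s + tri s + es)"
  shows "real q ^ e * P * stab s 0 = qcard s * (ampl s 0 * 1)"
  unfolding e stab_0 qcard_eq ampl_0 sg power_add by (simp only: mult_ac mult_1_right mult_1_left)

text \<open>Up to a power of q, the q-binomial coefficient is the order of GL(s + 1) divided by
  those of GL(s) and GL(1). The exponents are compared additively to avoid subtraction.\<close>

lemma A_rel_1:
  assumes sg: "sym_order s = real q ^ es * P"
    and e: "e + (s + 2) = 2 * (s + 1) + tri (s + 1) + (2 * s + 2 + tri (s + 1) + es)"
  shows "real q ^ e * q_binomial (real q) (s + 1) 1 * P * stab s 1 = qcard (s + 1) * ampl s 1"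
proof -
  define x where "x = real q"
  define w where "w = x ^ (s + 1) - 1"
  have d: "x - 1 \<noteq> 0" using real_q by (simp add: x_def)
  have g: "gl_order (s + 1) = w * x ^ s * gl_order s"
    unfolding w_def x_def Suc_eq_plus1[symmetric] by (rule gl_order_Suc(1))
  have "x ^ e * (w / (x - 1)) * P * (gl_order s * x ^ s * (x - 1) * (x + 1) * x ^ (s + 2))
     = x ^ e * x ^ (s + 2) * (P * w * x ^ s * gl_order s * (x + 1))"
    using d by (simp add: mult_ac)
  also have "x ^ e * x ^ (s + 2) = x ^ (2 * (s + 1) + tri (s + 1)) * (x ^ (2 * s + 2 + tri (s + 1)) * x ^ es)"
    unfolding power_add[symmetric] e ..
  also have "\<dots> * (P * w * x ^ s * gl_order s * (x + 1))
     = w * x ^ s * gl_order s * (x + 1) * x ^ (2 * (s + 1) + tri (s + 1)) * (x ^ (2 * s + 2 + tri (s + 1)) * (x ^ es * P))"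
    by (simp only: mult_ac)
  finally show ?thesis
    unfolding q_binomial_1 stab_1 qcard_eq ampl_1 g sg x_def w_def .
qed

lemma A_rel_2:
  assumes sg: "sym_order s = real q ^ es * P"
    and e: "e + (2 * s + 5) = 1 + (2 * (s + 2) + tri (s + 2)) + (3 * s + 4 + tri (s + 2) + es)"
  shows "(real q + 1) * real q ^ e * q_binomial (real q) (s + 2) 2 * P * stab s 2
    = qcard (s + 2) * (ampl s 2 * (real q * (real q + 1)))"
proof -
  define x where "x = real q"
  define w where "w = (x ^ (s + 2) - 1) * (x ^ (s + 1) - 1)"
  define d where "d = (x\<^sup>2 - 1) * (x - 1)"
  have "x > 1" using real_q by (simp add: x_def)
  then have d: "d \<noteq> 0" by (auto simp: power2_eq_1_iff d_def)
  have g: "gl_order (s + 2) = w * (x ^ (2 * s) * x) * gl_order s"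
  proof -
    have "x ^ (2 * s) = x ^ s * x ^ s" by (simp add: mult_2 power_add)
    then show ?thesis using gl_order_Suc(1)[of s] gl_order_Suc(1)[of "Suc s"] by (simp add: w_def x_def mult_ac)
  qed
  have "(x + 1) * x ^ e * (w / d) * P * (gl_order s * x ^ (2 * s) * ((x\<^sup>2 - 1) * x * (x - 1)) * (x + 1) * x ^ (2 * s + 5))
     = x ^ e * x ^ (2 * s + 5) * (w / d * d * P * (x ^ (2 * s) * x) * gl_order s * (x + 1) * (x + 1))"
    unfolding d_def by (simp only: mult_ac)
  also have "w / d * d = w" using d by simp
  also have "x ^ e * x ^ (2 * s + 5) = x * x ^ (2 * (s + 2) + tri (s + 2)) * (x ^ (3 * s + 4 + tri (s + 2)) * x ^ es)"
    unfolding power_add[symmetric] e unfolding power_add power_one_right ..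
  also have "\<dots> * (w * P * (x ^ (2 * s) * x) * gl_order s * (x + 1) * (x + 1))
     = w * (x ^ (2 * s) * x) * gl_order s * (x + 1) * x ^ (2 * (s + 2) + tri (s + 2)) * (x ^ (3 * s + 4 + tri (s + 2)) * (x ^ es * P) * (x * (x + 1)))"
    by (simp only: mult_ac)
  finally show ?thesis
    unfolding q_binomial_2 stab_2 qcard_eq ampl_2 g sg x_def w_def d_def .
qed

text \<open>The assumption on exponents matches the powers of q, and b P f = (q + 1) G the remaining
  factors; ef and f separate the power of q in the constant taken from \<open>freq\<close>.\<close>

lemma B_rel:
  assumes am: "ampl s m = real q ^ ea * sym_order s" and sg: "sym_order s = real q ^ es * P"
    and g: "gl_order N = real q ^ tri N * G" and e: "e + ea + es + ef = tri N + (2 * N + tri N)"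
    and b: "b * P * f = (real q + 1) * G"
  shows "real q ^ e * b * (ampl s m * (real q ^ ef * f)) = qcard N"
proof -
  have "real q ^ e * b * (ampl s m * (real q ^ ef * f)) = real q ^ (e + ea + es + ef) * (b * P * f)"
    unfolding am sg power_add by (simp only: mult_ac)
  also have "\<dots> = qcard N" unfolding e b qcard_eq g unfolding power_add by (simp only: mult_ac)
  finally show ?thesis .
qed

lemmas B_rel_0 = B_rel[OF ampl_0, where ef = 0, unfolded power_0 mult_1_left]
lemmas B_rel_1 = B_rel[OF ampl_1, where ef = 0, unfolded power_0 mult_1_left]
lemmas B_rel_2 = B_rel[OF ampl_2, where ef = 1, unfolded power_one_right]

text \<open>Here m = 0 and s = N; the extra -1 is the sign of the Kloosterman sum over SO^-(2,
  q).\<close>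

lemma card_trace_1:
  assumes A: "A = real q ^ e * P" and B: "B = real q ^ e' * b"
    and sg: "sym_order N = real q ^ es * P" and g: "gl_order N = real q ^ tri N * G"
    and e: "e = 2 * N + tri N + (N + tri N + es)" and e': "e' + (N + tri N) + es + 0 = tri N + (2 * N + tri N)"
    and b: "b * P * 1 = (real q + 1) * G"
  shows "real (card {x \<in> DC 1 \<kappa> (N + 1). mat_trace x = \<beta>}) = A * (B + (-1) ^ N * (-1) * trace_val \<beta>) / real q"
  unfolding Suc_eq_plus1[symmetric] dcoset_DC(1)
proof (rule card_trace_coef)
  show "N = N + 0" by simp
  show "of_int (freq False 0 \<beta>) = (-1) * 1 * trace_val \<beta>" by (simp add: freq_0)
  show "(0::real) < 1" by simp
  show "A * stab N 0 = qcard N * (ampl N 0 * 1)" unfolding A by (rule A_rel_0[OF sg e])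
  show "B * (ampl N 0 * 1) = qcard N" unfolding B by (rule B_rel_0[OF sg g e' b])
qed

text \<open>Here m = 1: GL(1) and SO^-(2, q) together give - (K c)^2, whose sign is already part of
  \<open>kl_val\<close>.\<close>

lemma card_trace_2:
  assumes A: "A = real q ^ e * q_binomial (real q) (s + 1) 1 * P" and B: "B = real q ^ e' * b"
    and sg: "sym_order s = real q ^ es * P" and g: "gl_order (s + 1) = real q ^ tri (s + 1) * G"
    and e: "e + (s + 2) = 2 * (s + 1) + tri (s + 1) + (2 * s + 2 + tri (s + 1) + es)"
    and e': "e' + (2 * s + 2 + tri (s + 1)) + es + 0 = tri (s + 1) + (2 * (s + 1) + tri (s + 1))"
    and b: "b * P * 1 = (real q + 1) * G"
  shows "real (card {x \<in> DC 2 \<kappa> (s + 2). mat_trace x = \<beta>}) = A * (B + (-1) ^ s * 1 * kl_val (real q) \<beta>) / real q"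
  unfolding dcoset_DC(2)
proof (rule card_trace_coef[OF refl])
  show "of_int (freq False 1 \<beta>) = 1 * 1 * kl_val (real q) \<beta>" by (simp only: freq_1 mult_1_left)
  show "(0::real) < 1" by simp
  show "A * stab s 1 = qcard (s + 1) * (ampl s 1 * 1)" unfolding A mult_1_right by (rule A_rel_1[OF sg e])
  show "B * (ampl s 1 * 1) = qcard (s + 1)" unfolding B by (rule B_rel_1[OF sg g e' b])
qed

text \<open>With \<rho> the group SO^-(2, q) contributes only its order q + 1, which joins the
  constant; \<open>K\<close> comes from GL(1) with a positive sign.\<close>

lemma card_trace_3:
  assumes A: "A = (real q + 1) * (real q ^ e * q_binomial (real q) (s + 1) 1 * P)" and B: "B = real q ^ e' * b"
    and sg: "sym_order s = real q ^ es * P" and g: "gl_order (s + 1) = real q ^ tri (s + 1) * G"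
    and e: "e + (s + 2) = 2 * (s + 1) + tri (s + 1) + (2 * s + 2 + tri (s + 1) + es)"
    and e': "e' + (2 * s + 2 + tri (s + 1)) + es + 0 = tri (s + 1) + (2 * (s + 1) + tri (s + 1))"
    and b: "b * P * (real q + 1) = (real q + 1) * G"
  shows "real (card {x \<in> DC 3 \<kappa> (s + 2). mat_trace x = \<beta>}) = A * (B + (-1) ^ s * 1 * trace_val \<beta>) / real q"
  unfolding dcoset_DC(3)
proof (rule card_trace_coef[OF refl])
  show "of_int (freq True 1 \<beta>) = 1 * (real q + 1) * trace_val \<beta>" by (simp only: freq_1_rho mult_1_left)
  show "0 < real q + 1" using real_q by simp
  have "A * stab s 1 = (real q + 1) * (real q ^ e * q_binomial (real q) (s + 1) 1 * P * stab s 1)"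
    unfolding A by (simp only: mult_ac)
  then show "A * stab s 1 = qcard (s + 1) * (ampl s 1 * (real q + 1))"
    unfolding A_rel_1[OF sg e] by (simp only: mult_ac)
  show "B * (ampl s 1 * (real q + 1)) = qcard (s + 1)" unfolding B by (rule B_rel_1[OF sg g e' b])
qed

text \<open>Here m = 2 with \<rho>. The square of K from GL(2) enters positively, whereas
  \<open>kl_val\<close> is a negated transform; this explains the factor -1. The constant is q (q +
  1).\<close>

lemma card_trace_4:
  assumes A: "A = (real q + 1) * real q ^ e * q_binomial (real q) (s + 2) 2 * P" and B: "B = real q ^ e' * b"
    and sg: "sym_order s = real q ^ es * P" and g: "gl_order (s + 2) = real q ^ tri (s + 2) * G"
    and e: "e + (2 * s + 5) = 1 + (2 * (s + 2) + tri (s + 2)) + (3 * s + 4 + tri (s + 2) + es)"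
    and e': "e' + (3 * s + 4 + tri (s + 2)) + es + 1 = tri (s + 2) + (2 * (s + 2) + tri (s + 2))"
    and b: "b * P * (real q + 1) = (real q + 1) * G"
  shows "real (card {x \<in> DC 4 \<kappa> (s + 3). mat_trace x = \<beta>}) = A * (B + (-1) ^ s * (-1) * kl_val ((real q)\<^sup>2) \<beta>) / real q"
  unfolding dcoset_DC(4)
proof (rule card_trace_coef[OF refl])
  show "of_int (freq True 2 \<beta>) = (-1) * (real q * (real q + 1)) * kl_val ((real q)\<^sup>2) \<beta>" by (simp add: freq_2_rho)
  show "0 < real q * (real q + 1)" using real_q by simp
  show "A * stab s 2 = qcard (s + 2) * (ampl s 2 * (real q * (real q + 1)))" unfolding A by (rule A_rel_2[OF sg e])
  show "B * (ampl s 2 * (real q * (real q + 1))) = qcard (s + 2)" unfolding B by (rule B_rel_2[OF sg g e' b])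
qed

lemma gl_order_even: "gl_order (2 * k) = real q ^ tri (2 * k) * (odd_prod (real q) k * even_prod (real q) k)"
proof (cases k)
  case 0
  then show ?thesis by (simp add: tri_def gl_order_Suc(2))
next
  case (Suc l)
  have "2 * Suc l = 2 * l + 2" by simp
  then show ?thesis unfolding Suc using gl_order_closed[of l] unfolding tri_even[symmetric] by (simp only: mult.assoc)
qed

lemma gl_order_odd: "gl_order (2 * k + 1) = real q ^ tri (2 * k + 1) * (odd_prod (real q) (Suc k) * even_prod (real q) k)"
  using gl_order_closed[of k] unfolding tri_odd[symmetric] by (simp only: mult.assoc)

text \<open>For n = 2 k + 2 the index s = 2 k + 1 is odd, so its sign cancels the -1 and \<epsilon>
  = 1 results.\<close>

lemma card_trace_plus_1:
  "real (card {x \<in> DC 1 \<kappa> (2 * k + 2). mat_trace x = \<beta>})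
    = A_plus 1 (2 * k + 2) (real q) * (B_plus 1 (2 * k + 2) (real q) + trace_val \<beta>) / real q"
proof -
  have n: "2 * k + 2 - 1 = 2 * k + 1" "(2 * k + 2 - 2) div 2 = k" "2 * k + 1 + 1 = 2 * k + 2" by simp_all
  have e: "(5 * (2 * k + 2)\<^sup>2 - 2 * (2 * k + 2) - 4) div 4 = 5 * (k * k) + 9 * k + 3"
    "(2 * k + 2)\<^sup>2 div 4 = k * k + 2 * k + 1"
    unfolding power2_eq_square by (rule div_eq_4, simp add: algebra_simps)+
  have "real (card {x \<in> DC 1 \<kappa> (2 * k + 1 + 1). mat_trace x = \<beta>})
      = A_plus 1 (2 * k + 2) (real q) * (B_plus 1 (2 * k + 2) (real q) + (-1) ^ (2 * k + 1) * (-1) * trace_val \<beta>) / real q"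
  proof (rule card_trace_1[OF A_plus_eqs(1)[of "2 * k + 2" "real q", unfolded n e] B_plus_eqs(1)[of "2 * k + 2" "real q", unfolded n e] _ gl_order_odd[of k], where es = "k * (k + 1)"])
    show "sym_order (2 * k + 1) = real q ^ (k * (k + 1)) * ((real q ^ (2 * k + 1) - 1) * odd_prod (real q) k)"
      using sym_order_closed[of k] by (simp add: mult_ac)
  qed (simp_all only: tri_odd, simp_all add: algebra_simps)
  then show ?thesis unfolding n by simp
qed

lemma card_trace_plus_2:
  "real (card {x \<in> DC 2 \<kappa> (2 * k + 2). mat_trace x = \<beta>})
    = A_plus 2 (2 * k + 2) (real q) * (B_plus 2 (2 * k + 2) (real q) + kl_val (real q) \<beta>) / real q"
  and card_trace_plus_3:
  "real (card {x \<in> DC 3 \<kappa> (2 * k + 2). mat_trace x = \<beta>})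
    = A_plus 3 (2 * k + 2) (real q) * (B_plus 3 (2 * k + 2) (real q) + trace_val \<beta>) / real q"
proof -
  have n: "2 * k + 2 - 1 = 2 * k + 1" "2 * k + 2 - 2 = 2 * k" "2 * k div 2 = k" by simp_all
  have e: "(5 * (2 * k + 2)\<^sup>2 - 2 * (2 * k + 2) - 8) div 4 = 5 * (k * k) + 9 * k + 2"
    "(2 * k)\<^sup>2 div 4 = k * k"
    unfolding power2_eq_square by (rule div_eq_4, simp add: algebra_simps)+
  note A = A_plus_eqs(2)[of "2 * k + 2" "real q", unfolded n e]
  note A' = A_plus_eqs(3)[of "2 * k + 2" "real q", unfolded A]
  note sg = conjunct1[OF sym_order_closed[of k]]
  have "real (card {x \<in> DC 2 \<kappa> (2 * k + 2). mat_trace x = \<beta>})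
      = A_plus 2 (2 * k + 2) (real q) * (B_plus 2 (2 * k + 2) (real q) + (-1) ^ (2 * k) * 1 * kl_val (real q) \<beta>) / real q"
    by (rule card_trace_2[OF A B_plus_eqs(2)[of "2 * k + 2" "real q", unfolded n e] sg gl_order_odd[of k]])
      (simp_all only: tri_odd, simp_all add: algebra_simps)
  then show "real (card {x \<in> DC 2 \<kappa> (2 * k + 2). mat_trace x = \<beta>})
    = A_plus 2 (2 * k + 2) (real q) * (B_plus 2 (2 * k + 2) (real q) + kl_val (real q) \<beta>) / real q" by simp
  have "real (card {x \<in> DC 3 \<kappa> (2 * k + 2). mat_trace x = \<beta>})
      = A_plus 3 (2 * k + 2) (real q) * (B_plus 3 (2 * k + 2) (real q) + (-1) ^ (2 * k) * 1 * trace_val \<beta>) / real q"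
    by (rule card_trace_3[OF A' B_plus_eqs(3)[of "2 * k + 2" "real q", unfolded n e] sg gl_order_odd[of k]])
      (simp_all only: tri_odd, simp_all add: algebra_simps)
  then show "real (card {x \<in> DC 3 \<kappa> (2 * k + 2). mat_trace x = \<beta>})
    = A_plus 3 (2 * k + 2) (real q) * (B_plus 3 (2 * k + 2) (real q) + trace_val \<beta>) / real q" by simp
qed

lemma card_trace_plus_4:
  "real (card {x \<in> DC 4 \<kappa> (2 * k + 4). mat_trace x = \<beta>})
    = A_plus 4 (2 * k + 4) (real q) * (B_plus 4 (2 * k + 4) (real q) + kl_val ((real q)\<^sup>2) \<beta>) / real q"
proof -
  have n: "2 * k + 4 - 1 = 2 * k + 1 + 2" "2 * k + 4 - 2 = 2 * k + 2" "(2 * k + 2) div 2 = Suc k"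
    "2 * k + 1 + 3 = 2 * k + 4" by simp_all
  have n3: "2 * k + 1 + 2 = 2 * Suc k + 1" "2 * k + 1 + 2 = 2 * k + 3" by simp_all
  have e: "(5 * (2 * k + 4)\<^sup>2 - 6 * (2 * k + 4) - 4) div 4 = 5 * (k * k) + 17 * k + 13"
    "(2 * k + 2)\<^sup>2 div 4 = k * k + 2 * k + 1"
    unfolding power2_eq_square by (rule div_eq_4, simp add: algebra_simps)+
  have "real (card {x \<in> DC 4 \<kappa> (2 * k + 1 + 3). mat_trace x = \<beta>})
      = A_plus 4 (2 * k + 4) (real q) * (B_plus 4 (2 * k + 4) (real q) + (-1) ^ (2 * k + 1) * (-1) * kl_val ((real q)\<^sup>2) \<beta>) / real q"
    by (rule card_trace_4[OF A_plus_eqs(4)[of "2 * k + 4" "real q", unfolded n e] B_plus_eqs(4)[of "2 * k + 4" "real q", unfolded n e] conjunct2[OF sym_order_closed[of k]] gl_order_odd[of "Suc k", folded n3(1)]])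
      (simp_all only: n3(2) tri_odd', simp_all add: algebra_simps eval_nat_numeral)
  then show ?thesis unfolding n by simp
qed

text \<open>For n = 2 k + 1 the index s = 2 k is even, so the -1 of the Kloosterman sum over SO^-(2,
  q) remains and \<epsilon> = -1 results.\<close>

lemma card_trace_minus_1:
  "real (card {x \<in> DC 1 \<kappa> (2 * k + 1). mat_trace x = \<beta>})
    = A_minus 1 (2 * k + 1) (real q) * (B_minus 1 (2 * k + 1) (real q) + - trace_val \<beta>) / real q"
proof -
  have n: "2 * k + 1 - 1 = 2 * k" "2 * k div 2 = k" by simp_all
  have e: "5 * ((2 * k + 1)\<^sup>2 - 1) div 4 = 5 * (k * k) + 5 * k" "(2 * k)\<^sup>2 div 4 = k * k"
    unfolding power2_eq_square by (rule div_eq_4, simp add: algebra_simps)+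
  \<comment> \<open>The additive form avoids the subtraction in tri (2 k) = k (2 k - 1).\<close>
  have t: "tri (2 * k) + k = 2 * (k * k)" by (induction k) (simp_all add: tri_def)
  have "real (card {x \<in> DC 1 \<kappa> (2 * k + 1). mat_trace x = \<beta>})
      = A_minus 1 (2 * k + 1) (real q) * (B_minus 1 (2 * k + 1) (real q) + (-1) ^ (2 * k) * (-1) * trace_val \<beta>) / real q"
    by (rule card_trace_1[OF A_minus_eqs(1)[of "2 * k + 1" "real q", unfolded n e] B_minus_eqs(1)[of "2 * k + 1" "real q", unfolded n e] conjunct1[OF sym_order_closed[of k]] gl_order_even[of k]])
      (use t in \<open>simp_all add: algebra_simps\<close>)
  then show ?thesis by simp
qed

lemma card_trace_minus_2:
  "real (card {x \<in> DC 2 \<kappa> (2 * k + 3). mat_trace x = \<beta>})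
    = A_minus 2 (2 * k + 3) (real q) * (B_minus 2 (2 * k + 3) (real q) + - kl_val (real q) \<beta>) / real q"
  and card_trace_minus_3:
  "real (card {x \<in> DC 3 \<kappa> (2 * k + 3). mat_trace x = \<beta>})
    = A_minus 3 (2 * k + 3) (real q) * (B_minus 3 (2 * k + 3) (real q) + - trace_val \<beta>) / real q"
proof -
  have n: "2 * k + 3 - 1 = 2 * k + 1 + 1" "(2 * k + 1 + 1) div 2 = Suc k" by simp_all
  have n2: "2 * k + 1 + 1 = 2 * Suc k" "2 * k + 1 + 1 = 2 * k + 2" "2 * k + 1 + 2 = 2 * k + 3" by simp_all
  have e: "(5 * (2 * k + 3)\<^sup>2 - 4 * (2 * k + 3) - 5) div 4 = 5 * (k * k) + 13 * k + 7"
    "(2 * k + 1 + 1)\<^sup>2 div 4 = k * k + 2 * k + 1"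
    unfolding power2_eq_square by (rule div_eq_4, simp add: algebra_simps)+
  note A = A_minus_eqs(2)[of "2 * k + 3" "real q", unfolded n e]
  note A' = A_minus_eqs(3)[of "2 * k + 3" "real q", unfolded A]
  note sg = conjunct2[OF sym_order_closed[of k]] note g = gl_order_even[of "Suc k", folded n2(1)]
  have "real (card {x \<in> DC 2 \<kappa> (2 * k + 1 + 2). mat_trace x = \<beta>})
      = A_minus 2 (2 * k + 3) (real q) * (B_minus 2 (2 * k + 3) (real q) + (-1) ^ (2 * k + 1) * 1 * kl_val (real q) \<beta>) / real q"
    by (rule card_trace_2[OF A B_minus_eqs(2)[of "2 * k + 3" "real q", unfolded n e] sg g])
      (simp_all only: n2(2) tri_even, simp_all add: algebra_simps)
  then show "real (card {x \<in> DC 2 \<kappa> (2 * k + 3). mat_trace x = \<beta>})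
    = A_minus 2 (2 * k + 3) (real q) * (B_minus 2 (2 * k + 3) (real q) + - kl_val (real q) \<beta>) / real q" unfolding n2(3) by simp
  have "real (card {x \<in> DC 3 \<kappa> (2 * k + 1 + 2). mat_trace x = \<beta>})
      = A_minus 3 (2 * k + 3) (real q) * (B_minus 3 (2 * k + 3) (real q) + (-1) ^ (2 * k + 1) * 1 * trace_val \<beta>) / real q"
    by (rule card_trace_3[OF A' B_minus_eqs(3)[of "2 * k + 3" "real q", unfolded n e] sg g])
      (simp_all only: n2(2) tri_even, simp_all add: algebra_simps)
  then show "real (card {x \<in> DC 3 \<kappa> (2 * k + 3). mat_trace x = \<beta>})
    = A_minus 3 (2 * k + 3) (real q) * (B_minus 3 (2 * k + 3) (real q) + - trace_val \<beta>) / real q" unfolding n2(3) by simp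
qed

lemma card_trace_minus_4:
  "real (card {x \<in> DC 4 \<kappa> (2 * k + 3). mat_trace x = \<beta>})
    = A_minus 4 (2 * k + 3) (real q) * (B_minus 4 (2 * k + 3) (real q) + - kl_val ((real q)\<^sup>2) \<beta>) / real q"
proof -
  have n: "2 * k + 3 - 1 = 2 * k + 2" "2 * k + 3 - 2 = 2 * k + 1" "2 * k + 3 - 3 = 2 * k" "2 * k div 2 = k" by simp_all
  have n2: "2 * k + 2 = 2 * Suc k" by simp
  have e: "(5 * (2 * k + 3)\<^sup>2 - 4 * (2 * k + 3) - 9) div 4 = 5 * (k * k) + 13 * k + 6"
    "(2 * k)\<^sup>2 div 4 = k * k"
    unfolding power2_eq_square by (rule div_eq_4, simp add: algebra_simps)+
  have "real (card {x \<in> DC 4 \<kappa> (2 * k + 3). mat_trace x = \<beta>})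
      = A_minus 4 (2 * k + 3) (real q) * (B_minus 4 (2 * k + 3) (real q) + (-1) ^ (2 * k) * (-1) * kl_val ((real q)\<^sup>2) \<beta>) / real q"
    by (rule card_trace_4[OF A_minus_eqs(4)[of "2 * k + 3" "real q", unfolded n e] B_minus_eqs(4)[of "2 * k + 3" "real q", unfolded n e] conjunct1[OF sym_order_closed[of k]] gl_order_even[of "Suc k", folded n2]])
      (simp_all only: tri_even, simp_all add: algebra_simps)
  then show ?thesis by simp
qed

text \<open>The number \<open>v\<close> for which \<open>A (B + \<epsilon> v) / q\<close> elements of the double coset have trace \<open>\<beta>\<close>.\<close>

definition deviation :: "nat \<Rightarrow> 'a \<Rightarrow> real" where
  "deviation i \<beta> = (if i = 1 \<or> i = 3 then trace_val \<beta> else if i = 2 then kl_val (real q) \<beta> else kl_val ((real q)\<^sup>2) \<beta>)"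

lemma card_trace_DC:
  assumes "DC_range \<epsilon> i n"
  shows "real (card {x \<in> DC i \<kappa> n. mat_trace x = \<beta>})
    = coef_A \<epsilon> i n (real q) * (coef_B \<epsilon> i n (real q) + of_int \<epsilon> * deviation i \<beta>) / real q"
proof -
  consider "\<epsilon> = 1" "even n" "n \<ge> (if i = 4 then 4 else 2)" | "\<epsilon> = -1" "odd n" "n \<ge> (if i = 1 then 1 else 3)"
    using assms unfolding DC_range_def by blast
  moreover have i: "i = 1 \<or> i = 2 \<or> i = 3 \<or> i = 4" using assms unfolding DC_range_def by blast
  ultimately show ?thesis
  proof cases
    case 1
    then have "n \<ge> 2" by (simp split: if_splits)
    then obtain k where k: "n = 2 * k + 2" using \<open>even n\<close> by (metis add.commute dvd_add_right_iff dvdE dvd_refl le_Suc_ex)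
    \<comment> \<open>For i = 4 the range starts at n = 4, hence the shift of k.\<close>
    have k4: "n = 2 * (k - 1) + 4" if "i = 4" using that 1 k by simp
    have ab: "coef_A \<epsilon> i n (real q) = A_plus i n (real q)" "coef_B \<epsilon> i n (real q) = B_plus i n (real q)" "real_of_int \<epsilon> * y = y" for y
      using 1 by (simp_all add: coef_A_def coef_B_def)
    show ?thesis unfolding ab using i
    proof (elim disjE)
      assume "i = 4"
      then show "real (card {x \<in> DC i \<kappa> n. mat_trace x = \<beta>}) = A_plus i n (real q) * (B_plus i n (real q) + deviation i \<beta>) / real q"
        using card_trace_plus_4[of "k - 1" \<beta>, folded k4[OF \<open>i = 4\<close>]] by (simp add: deviation_def)
    qed (use card_trace_plus_1[of k \<beta>] card_trace_plus_2[of k \<beta>] card_trace_plus_3[of k \<beta>] in \<open>simp_all only: deviation_def k, simp_all\<close>)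
  next
    case 2
    obtain k where k: "n = 2 * k + 1" using \<open>odd n\<close> by (rule oddE)
    have k3: "n = 2 * (k - 1) + 3" if "i \<noteq> 1" using that 2 k by simp
    have ab: "coef_A \<epsilon> i n (real q) = A_minus i n (real q)" "coef_B \<epsilon> i n (real q) = B_minus i n (real q)" "real_of_int \<epsilon> * y = - y" for y
      using 2 by (simp_all add: coef_A_def coef_B_def)
    show ?thesis unfolding ab
    proof (cases "i = 1")
      case True
      then show "real (card {x \<in> DC i \<kappa> n. mat_trace x = \<beta>}) = A_minus i n (real q) * (B_minus i n (real q) + - deviation i \<beta>) / real q"
        using card_trace_minus_1[of k \<beta>] by (simp add: deviation_def k)
    next
      case False
      note c = card_trace_minus_2[of "k - 1" \<beta>, folded k3[OF False]] card_trace_minus_3[of "k - 1" \<beta>, folded k3[OF False]]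
        card_trace_minus_4[of "k - 1" \<beta>, folded k3[OF False]]
      show "real (card {x \<in> DC i \<kappa> n. mat_trace x = \<beta>}) = A_minus i n (real q) * (B_minus i n (real q) + - deviation i \<beta>) / real q"
        using i False c by (elim disjE) (simp_all add: deviation_def)
    qed
  qed
qed

end

lemma (in binary_field) prod_split_tr:
  fixes F :: "'a \<Rightarrow> real"
  shows "(\<Prod>\<beta>\<in>UNIV. F \<beta>) = F 0 * (\<Prod>\<beta> | \<beta> \<noteq> 0 \<and> tr (inverse \<beta>) = 0. F \<beta>) * (\<Prod>\<beta> | \<beta> \<noteq> 0 \<and> tr (inverse \<beta>) = 1. F \<beta>)"
proof -
  have U: "UNIV = {0} \<union> ({\<beta>. \<beta> \<noteq> 0 \<and> tr (inverse \<beta>) = 0} \<union> {\<beta>. \<beta> \<noteq> 0 \<and> tr (inverse \<beta>) = 1} :: 'a set)"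
    using tr_cases by blast
  show ?thesis unfolding U by (subst prod.union_disjoint, simp, simp, force, subst prod.union_disjoint) auto
qed

lemma finite_tau_range: "finite (tau_range q)"
proof (rule finite_subset)
  show "tau_range q \<subseteq> {- \<lceil>2 * sqrt (real q)\<rceil>..\<lceil>2 * sqrt (real q)\<rceil>}"
  proof
    fix t assume "t \<in> tau_range q"
    then have "\<bar>real_of_int t\<bar> < 2 * sqrt (real q)" by (simp add: tau_range_def)
    then have "real_of_int \<bar>t\<bar> \<le> real_of_int \<lceil>2 * sqrt (real q)\<rceil>" by linarith
    then show "t \<in> {- \<lceil>2 * sqrt (real q)\<rceil>..\<lceil>2 * sqrt (real q)\<rceil>}" by (auto simp only: of_int_le_iff atLeastAtMost_iff)
  qed
qed simp

text \<open>The Weil bound and the congruence modulo 4 place every K (1 / \<beta>) in the range of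
  \<tau>, so the nonzero \<beta> are partitioned by their values; a \<tau> that is not attained
  contributes an empty product.\<close>

lemma (in binary_field) prod_split_kloosterman:
  fixes F :: "'a \<Rightarrow> real"
  assumes "q \<ge> 4"
  shows "(\<Prod>\<beta>\<in>UNIV. F \<beta>) = F 0 * (\<Prod>\<tau>\<in>tau_range q. \<Prod>\<beta> | \<beta> \<noteq> 0 \<and> K (inverse \<beta>) = \<tau>. F \<beta>)"
proof -
  have "(\<Prod>\<tau>\<in>tau_range q. \<Prod>\<beta> | \<beta> \<in> UNIV - {0} \<and> K (inverse \<beta>) = \<tau>. F \<beta>) = (\<Prod>\<beta>\<in>UNIV - {0}. F \<beta>)"
    by (rule prod.group) (auto simp: finite_tau_range intro!: kloosterman_in_tau_range[OF assms])
  then show ?thesis by (simp add: prod.remove[of UNIV 0])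
qed

lemma (in minus_type) weight_count_DC:
  assumes "DC_range \<epsilon> i n" and "distinct gs" and "set gs = DC i \<kappa> n"
  shows "real (weight_count gs j) = (\<Sum>\<nu>\<in>families j. \<Prod>\<beta>\<in>UNIV.
    binom (coef_A \<epsilon> i n (real q) * (coef_B \<epsilon> i n (real q) + of_int \<epsilon> * deviation i \<beta>) / real q) (\<nu> \<beta>))"
  using weight_count_eq[OF assms(2), of j] unfolding assms(3) card_trace_DC[OF assms(1)] .

theorem theorem21:
  fixes \<kappa> :: "'a::{field,finite}"
    and r q n i N :: nat
    and \<epsilon> :: int
    and gs :: "'a mat list"
    and A B :: real
  assumes "q = 2 ^ r" and "CARD('a) = q"
    and "irreducible [:\<kappa>, 1, 1:]"
    and "DC_range \<epsilon> i n"
    and "i \<in> {2, 4} \<longrightarrow> q \<ge> 4"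
    and "distinct gs" and "set gs = DC i \<kappa> n"
    and "N = card (DC i \<kappa> n)"
    and "A = coef_A \<epsilon> i n (real q)" and "B = coef_B \<epsilon> i n (real q)"
  shows
    "(i \<in> {1, 3} \<longrightarrow> (\<forall>j\<le>N.
        real (weight_count gs j) =
        (\<Sum>\<nu>\<in>families j.
           binom (A * (B + of_int \<epsilon>) / q) (\<nu> (0::'a)) *
           (\<Prod>\<beta> | \<beta> \<noteq> 0 \<and> field_tr r (inverse \<beta>) = 0.
              binom (A * (B + of_int \<epsilon> * (real q + 1)) / q) (\<nu> \<beta>)) *
           (\<Prod>\<beta> | \<beta> \<noteq> 0 \<and> field_tr r (inverse \<beta>) = 1.
              binom (A * (B + of_int \<epsilon> * (- real q + 1)) / q) (\<nu> \<beta>))))) \<and>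
     (i = 2 \<longrightarrow> (\<forall>j\<le>N.
        real (weight_count gs j) =
        (\<Sum>\<nu>\<in>families j.
           binom (A * (B + of_int \<epsilon> * (real q + 1 - real q ^ 2)) / q) (\<nu> (0::'a)) *
           (\<Prod>\<tau>\<in>tau_range q. \<Prod>\<beta> | \<beta> \<noteq> 0 \<and> kloosterman r (inverse \<beta>) = \<tau>.
              binom (A * (B + of_int \<epsilon> * (real q + 1 - real q * of_int \<tau>)) / q) (\<nu> \<beta>))))) \<and>
     (i = 4 \<longrightarrow> (\<forall>j\<le>N.
        real (weight_count gs j) =
        (\<Sum>\<nu>\<in>families j.
           binom (A * (B + of_int \<epsilon> * (real q ^ 2 + 1 - real q ^ 3)) / q) (\<nu> (0::'a)) *
           (\<Prod>\<tau>\<in>tau_range q. \<Prod>\<beta> | \<beta> \<noteq> 0 \<and> kloosterman r (inverse \<beta>) = \<tau>.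
              binom (A * (B + of_int \<epsilon> * (real q ^ 2 + 1 - real q * of_int \<tau>)) / q) (\<nu> \<beta>)))))"
proof -
  interpret minus_type r q "TYPE('a)" \<kappa>
    by unfold_locales (use assms in auto)
  note w = weight_count_DC[OF assms(4,6,7), folded assms(9,10)]
  have 1: "i \<in> {1, 3} \<longrightarrow> (\<forall>j\<le>N.
        real (weight_count gs j) =
        (\<Sum>\<nu>\<in>families j.
           binom (A * (B + of_int \<epsilon>) / q) (\<nu> (0::'a)) *
           (\<Prod>\<beta> | \<beta> \<noteq> 0 \<and> field_tr r (inverse \<beta>) = 0.
              binom (A * (B + of_int \<epsilon> * (real q + 1)) / q) (\<nu> \<beta>)) *
           (\<Prod>\<beta> | \<beta> \<noteq> 0 \<and> field_tr r (inverse \<beta>) = 1.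
              binom (A * (B + of_int \<epsilon> * (- real q + 1)) / q) (\<nu> \<beta>))))"
  proof (intro impI allI, unfold w, rule sum.cong[OF refl])
    fix \<nu> :: "'a \<Rightarrow> nat" assume i: "i \<in> {1, 3}"
    show "(\<Prod>\<beta>\<in>UNIV. binom (A * (B + of_int \<epsilon> * deviation i \<beta>) / real q) (\<nu> \<beta>)) =
       binom (A * (B + of_int \<epsilon>) / q) (\<nu> (0::'a)) *
           (\<Prod>\<beta> | \<beta> \<noteq> 0 \<and> field_tr r (inverse \<beta>) = 0.
              binom (A * (B + of_int \<epsilon> * (real q + 1)) / q) (\<nu> \<beta>)) *
           (\<Prod>\<beta> | \<beta> \<noteq> 0 \<and> field_tr r (inverse \<beta>) = 1.
              binom (A * (B + of_int \<epsilon> * (- real q + 1)) / q) (\<nu> \<beta>))"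
      unfolding prod_split_tr using i
      by (intro arg_cong2[where f = "(*)"] prod.cong refl) (auto simp: deviation_def trace_val_def add_char_def add.commute)
  qed
  have 2: "i = 2 \<longrightarrow> (\<forall>j\<le>N.
        real (weight_count gs j) =
        (\<Sum>\<nu>\<in>families j.
           binom (A * (B + of_int \<epsilon> * (real q + 1 - real q ^ 2)) / q) (\<nu> (0::'a)) *
           (\<Prod>\<tau>\<in>tau_range q. \<Prod>\<beta> | \<beta> \<noteq> 0 \<and> kloosterman r (inverse \<beta>) = \<tau>.
              binom (A * (B + of_int \<epsilon> * (real q + 1 - real q * of_int \<tau>)) / q) (\<nu> \<beta>))))"
  proof (intro impI allI, unfold w, rule sum.cong[OF refl])
    fix \<nu> :: "'a \<Rightarrow> nat" assume i: "i = 2"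
    have q: "4 \<le> q" using i assms(5) by blast
    show "(\<Prod>\<beta>\<in>UNIV. binom (A * (B + of_int \<epsilon> * deviation i \<beta>) / real q) (\<nu> \<beta>)) =
           binom (A * (B + of_int \<epsilon> * (real q + 1 - real q ^ 2)) / q) (\<nu> (0::'a)) *
           (\<Prod>\<tau>\<in>tau_range q. \<Prod>\<beta> | \<beta> \<noteq> 0 \<and> kloosterman r (inverse \<beta>) = \<tau>.
              binom (A * (B + of_int \<epsilon> * (real q + 1 - real q * of_int \<tau>)) / q) (\<nu> \<beta>))"
      unfolding prod_split_kloosterman[OF q]
      by (intro arg_cong2[where f = "(*)"] prod.cong refl) (auto simp: i deviation_def kl_val_def power2_eq_square)
  qed
  have 4: "i = 4 \<longrightarrow> (\<forall>j\<le>N.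
        real (weight_count gs j) =
        (\<Sum>\<nu>\<in>families j.
           binom (A * (B + of_int \<epsilon> * (real q ^ 2 + 1 - real q ^ 3)) / q) (\<nu> (0::'a)) *
           (\<Prod>\<tau>\<in>tau_range q. \<Prod>\<beta> | \<beta> \<noteq> 0 \<and> kloosterman r (inverse \<beta>) = \<tau>.
              binom (A * (B + of_int \<epsilon> * (real q ^ 2 + 1 - real q * of_int \<tau>)) / q) (\<nu> \<beta>))))"
  proof (intro impI allI, unfold w, rule sum.cong[OF refl])
    fix \<nu> :: "'a \<Rightarrow> nat" assume i: "i = 4"
    have q: "4 \<le> q" using i assms(5) by blast
    show "(\<Prod>\<beta>\<in>UNIV. binom (A * (B + of_int \<epsilon> * deviation i \<beta>) / real q) (\<nu> \<beta>)) =
           binom (A * (B + of_int \<epsilon> * (real q ^ 2 + 1 - real q ^ 3)) / q) (\<nu> (0::'a)) *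
           (\<Prod>\<tau>\<in>tau_range q. \<Prod>\<beta> | \<beta> \<noteq> 0 \<and> kloosterman r (inverse \<beta>) = \<tau>.
              binom (A * (B + of_int \<epsilon> * (real q ^ 2 + 1 - real q * of_int \<tau>)) / q) (\<nu> \<beta>))"
      unfolding prod_split_kloosterman[OF q]
      by (intro arg_cong2[where f = "(*)"] prod.cong refl) (auto simp: i deviation_def kl_val_def power2_eq_square power3_eq_cube)
  qed
  from 1 2 4 show ?thesis by blast
qed

end
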